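(* Let $n\ge0$, let $G$ be a group acting by isometries on a proper non-compact $CAT(0)$ space $M$, and let $A$ be a $\mathbb{Z}G$-module of type $FP_n$. Then $${}^{\circ}\Sigma^{n}(M;A)=\{e\in\partial M\mid \mathrm{Tor}^{\mathbb{Z}G}_{k}(\widehat{\mathbb{Z}G}^{e'},A)=0\ \text{ for all } e'\in\mathrm{cl}(Ge)\text{ and all } k\le n\},$$ where $\mathrm{cl}(Ge)$ is the closure of the orbit $Ge$ in $\partial M$ (cone topology) and $\widehat{\mathbb{Z}G}^{e'}$ is the Novikov module at $e'$.
   Context: Setting. $\partial M$ is the set of asymptoty classes of geodesic rays in $(M,d)$, with the cone topology; $G$ acts on it. For a geodesic ray $\gamma$ with endpoint $\gamma(\infty)=e\in\partial M$, the Busemann function is $\beta_\gamma(x)=\lim_{t\to\infty}(t-d(x,\gamma(t)))$ (so it tends to $+\infty$ towards $e$); the horoballs at $e$ are the sets $\{x\in M\mid\beta_\gamma(x)\ge t\}$, $t\in\mathbb{R}$. Novikov module. Fix a base point $b\in M$. $\widehat{\mathbb{Z}G}^{e}$ is the set of all (possibly infinite) formal sums $\sigma=\sum_{g\in G}a_g g$, $a_g\in\mathbb{Z}$, such that for each horoball $HB$ at $e$ all but finitely many of the elements $g$ of $\mathrm{supp}(\sigma)=\{g\mid a_g\neq0\}$ satisfy $gb\in HB$. It is a right $\mathbb{Z}G$-module under termwise addition and termwise right multiplication, and is independent of $b$. Resolutions and control. $fS$ is the set of finite subsets of a set $S$. A based free resolution $\mathbf F\twoheadrightarrow A$ is a resolution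 by free (left) $\mathbb{Z}G$-modules $F_k$, $k\ge0$, with chosen $\mathbb{Z}G$-bases $X_k$ and augmentation $\epsilon:F_0\to A$; $Y_k=GX_k$ is the induced $\mathbb{Z}$-basis, $X=\bigcup X_k$, $Y=\bigcup Y_k$. It is always assumed admissible: $\partial x\ne0$ for $x\in X_k$, $k\ge1$, and $\epsilon(x)\neq0$ for $x\in X_0$. $\mathbf F^{(n)}$ is the $n$-skeleton ($F_k$ replaced by $0$ for $k>n$). $A$ has type $FP_n$ if such a resolution exists with $\mathbf F^{(n)}$ finitely generated. For $c\in\mathbf F$, $\mathrm{supp}(c)\subseteq Y$ is the set of $y$ occurring in the expansion of $c$. A control map is a $G$-map $h:\mathbf F\to fM$ with $h(c)=\bigcup_{y\in\mathrm{supp}(c)}h(y)$ (so $h(0)=\emptyset$) and $h(x)\neq\emptyset$ for $x\in X$. Put $v_\gamma(c)=\min\beta_\gamma(h(c))$ for $c\ne0$, $v_\gamma(0)=\infty$. Finitary maps and the dynamical invariant. An additive homomorphism $\varphi:B\to C$ of $G$-modules is $G$-finitary if there is a $G$-map $\Phi:B\to fC$ with $\varphi(b)\in\Phi(b)$ for all $b\in B$. For $\varphi:\mathbf F^{(n)}\to\mathbf F^{(n)}$ additive and $\gamma(\infty)=e$, $\mathrm{gsh}_e(\varphi)=\inf\{v_\gamma(\varphi(c))-v_\gamma(c)\mid 0\ne c\in \mathbf F^{(n)}\}$ (independent of the ray $\gamma$ with endpoint $e$); $\varphi$ pushes $\mathbf F^{(n)}$ towards $e$ if $\mathrm{gsh}_e(\varphi)>0$.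 A chain map $\varphi$ induces $\mathrm{id}_A$ if $\epsilon\varphi=\epsilon$ on $F_0$. Choose $\mathbf F\twoheadrightarrow A$ with $\mathbf F^{(n)}$ finitely generated and a control map $h$; ${}^{\circ}\Sigma^n(M;A)$ is the set of $e\in\partial M$ for which there is a $G$-finitary chain map $\mathbf F^{(n)}\to\mathbf F^{(n)}$ inducing $\mathrm{id}_A$ and pushing $\mathbf F^{(n)}$ towards $e$ (independent of the choices). *)

theory Defs
  imports
    "HOL-Analysis.Analysis"
    "HOL-Algebra.Group_Action"
    "HOL-Algebra.Module"
    "HOL-Algebra.Elementary_Groups"
    "HOL-Algebra.Free_Abelian_Groups"
begin

section \<open>CAT(0) spaces and their boundary\<close>

definition geodesic_on :: "real set \<Rightarrow> (real \<Rightarrow> 'm::metric_space) \<Rightarrow> bool" where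
  "geodesic_on I c \<longleftrightarrow> (\<forall>s\<in>I. \<forall>t\<in>I. dist (c s) (c t) = \<bar>s - t\<bar>)"

definition geodesic_segment :: "(real \<Rightarrow> 'm::metric_space) \<Rightarrow> 'm \<Rightarrow> 'm \<Rightarrow> bool" where
  "geodesic_segment c x y \<longleftrightarrow> geodesic_on {0..dist x y} c \<and> c 0 = x \<and> c (dist x y) = y"

text \<open>
  Every geodesic triangle is at least as thin as its comparison triangle in the Euclidean plane.
  Two points on different sides of a triangle lie on two sides issuing from a common vertex,
  which is called \<open>x\<close> below (for points on one and the same side the inequality is an equality);
  \<open>x', y', z'\<close> is a comparison triangle, and \<open>p', q'\<close> are the comparison points of \<open>c s, c' t\<close>.
\<close>

definition CAT0 :: "'m::metric_space itself \<Rightarrow> bool" where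
  "CAT0 _ \<longleftrightarrow>
     (\<forall>x y :: 'm. \<exists>c. geodesic_segment c x y) \<and>
     (\<forall>(x::'m) y z c c'. geodesic_segment c x y \<longrightarrow> geodesic_segment c' x z \<longrightarrow>
        (\<forall>(x'::real^2) y' z'.
           dist x' y' = dist x y \<longrightarrow> dist x' z' = dist x z \<longrightarrow> dist y' z' = dist y z \<longrightarrow>
           (\<forall>s\<in>{0..dist x y}. \<forall>t\<in>{0..dist x z}.
              \<forall>p'\<in>closed_segment x' y'. \<forall>q'\<in>closed_segment x' z'.
                dist x' p' = s \<longrightarrow> dist x' q' = t \<longrightarrow> dist (c s) (c' t) \<le> dist p' q')))"

definition proper_space :: "'m::metric_space itself \<Rightarrow> bool" where
  "proper_space _ \<longleftrightarrow> (\<forall>(x::'m) r. compact (cball x r))"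

definition isometric_action ::
    "('g, 'b) monoid_scheme \<Rightarrow> ('g \<Rightarrow> 'm::metric_space \<Rightarrow> 'm) \<Rightarrow> bool" where
  "isometric_action G \<phi> \<longleftrightarrow>
     group_action G UNIV \<phi> \<and> (\<forall>g\<in>carrier G. \<forall>x y. dist (\<phi> g x) (\<phi> g y) = dist x y)"

text \<open>
  A ray is only constrained on \<open>{0..}\<close>. Its values at negative arguments are irrelevant to all
  notions below; rays which differ only there are asymptotic, hence get identified.
\<close>

definition rays :: "(real \<Rightarrow> 'm::metric_space) set" where
  "rays = {\<gamma>. geodesic_on {0..} \<gamma>}"

definition asymptotic :: "((real \<Rightarrow> 'm::metric_space) \<times> (real \<Rightarrow> 'm)) set" where
  "asymptotic = {(\<gamma>, \<gamma>'). \<gamma> \<in> rays \<and> \<gamma>' \<in> rays \<and> (\<exists>K. \<forall>t\<ge>0. dist (\<gamma> t) (\<gamma>' t) \<le> K)}"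

definition boundary :: "(real \<Rightarrow> 'm::metric_space) set set" where
  "boundary = rays // asymptotic"

definition boundary_action ::
    "('g \<Rightarrow> 'm::metric_space \<Rightarrow> 'm) \<Rightarrow> 'g \<Rightarrow> (real \<Rightarrow> 'm) set \<Rightarrow> (real \<Rightarrow> 'm) set" where
  "boundary_action \<phi> g e = (\<lambda>\<gamma>. \<phi> g \<circ> \<gamma>) ` e"

text \<open>
  \<open>cone_nbhd \<gamma> r \<epsilon>\<close> consists of the boundary points whose representing ray from \<open>\<gamma> 0\<close> is
  \<open>\<epsilon>\<close>-close to \<open>\<gamma>\<close> at time \<open>r\<close>. For fixed \<open>\<gamma> 0 = b\<close> these sets form a basis of the cone topology
  on the boundary, which does not depend on \<open>b\<close>.
\<close>

definition cone_nbhd :: "(real \<Rightarrow> 'm::metric_space) \<Rightarrow> real \<Rightarrow> real \<Rightarrow> (real \<Rightarrow> 'm) set set" where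
  "cone_nbhd \<gamma> r \<epsilon> = {e \<in> boundary. \<exists>\<gamma>'\<in>e. \<gamma>' 0 = \<gamma> 0 \<and> dist (\<gamma>' r) (\<gamma> r) < \<epsilon>}"

definition cone_topology :: "'m::metric_space \<Rightarrow> (real \<Rightarrow> 'm) set topology" where
  "cone_topology b =
     topology_generated_by {cone_nbhd \<gamma> r \<epsilon> | \<gamma> r \<epsilon>. \<gamma> \<in> rays \<and> \<gamma> 0 = b \<and> 0 < r \<and> 0 < \<epsilon>}"

definition busemann :: "(real \<Rightarrow> 'm::metric_space) \<Rightarrow> 'm \<Rightarrow> real" where
  "busemann \<gamma> x = Lim at_top (\<lambda>t. t - dist x (\<gamma> t))"

definition horoballs :: "(real \<Rightarrow> 'm::metric_space) set \<Rightarrow> 'm set set" where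
  "horoballs e = {{x. busemann \<gamma> x \<ge> t} | \<gamma> t. \<gamma> \<in> e}"


section \<open>Modules over a possibly non-commutative ring\<close>

locale left_module = R?: ring R + M?: abelian_group M
  for R :: "('r, 'i) ring_scheme" (structure) and M :: "('r, 'a, 'j) module_scheme" (structure) +
  assumes lsmult_closed:
      "\<lbrakk>r \<in> carrier R; x \<in> carrier M\<rbrakk> \<Longrightarrow> r \<odot>\<^bsub>M\<^esub> x \<in> carrier M"
    and lsmult_l_distr:
      "\<lbrakk>r \<in> carrier R; s \<in> carrier R; x \<in> carrier M\<rbrakk>
        \<Longrightarrow> (r \<oplus>\<^bsub>R\<^esub> s) \<odot>\<^bsub>M\<^esub> x = (r \<odot>\<^bsub>M\<^esub> x) \<oplus>\<^bsub>M\<^esub> (s \<odot>\<^bsub>M\<^esub> x)"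
    and lsmult_r_distr:
      "\<lbrakk>r \<in> carrier R; x \<in> carrier M; y \<in> carrier M\<rbrakk>
        \<Longrightarrow> r \<odot>\<^bsub>M\<^esub> (x \<oplus>\<^bsub>M\<^esub> y) = (r \<odot>\<^bsub>M\<^esub> x) \<oplus>\<^bsub>M\<^esub> (r \<odot>\<^bsub>M\<^esub> y)"
    and lsmult_assoc:
      "\<lbrakk>r \<in> carrier R; s \<in> carrier R; x \<in> carrier M\<rbrakk>
        \<Longrightarrow> (r \<otimes>\<^bsub>R\<^esub> s) \<odot>\<^bsub>M\<^esub> x = r \<odot>\<^bsub>M\<^esub> (s \<odot>\<^bsub>M\<^esub> x)"
    and lsmult_one:
      "x \<in> carrier M \<Longrightarrow> \<one>\<^bsub>R\<^esub> \<odot>\<^bsub>M\<^esub> x = x"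

text \<open>Right modules use the same record type; \<open>r \<odot> x\<close> then stands for \<open>x\<close> times \<open>r\<close>.\<close>

locale right_module = R?: ring R + M?: abelian_group M
  for R :: "('r, 'i) ring_scheme" (structure) and M :: "('r, 'a, 'j) module_scheme" (structure) +
  assumes rsmult_closed:
      "\<lbrakk>r \<in> carrier R; x \<in> carrier M\<rbrakk> \<Longrightarrow> r \<odot>\<^bsub>M\<^esub> x \<in> carrier M"
    and rsmult_l_distr:
      "\<lbrakk>r \<in> carrier R; s \<in> carrier R; x \<in> carrier M\<rbrakk>
        \<Longrightarrow> (r \<oplus>\<^bsub>R\<^esub> s) \<odot>\<^bsub>M\<^esub> x = (r \<odot>\<^bsub>M\<^esub> x) \<oplus>\<^bsub>M\<^esub> (s \<odot>\<^bsub>M\<^esub> x)"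
    and rsmult_r_distr:
      "\<lbrakk>r \<in> carrier R; x \<in> carrier M; y \<in> carrier M\<rbrakk>
        \<Longrightarrow> r \<odot>\<^bsub>M\<^esub> (x \<oplus>\<^bsub>M\<^esub> y) = (r \<odot>\<^bsub>M\<^esub> x) \<oplus>\<^bsub>M\<^esub> (r \<odot>\<^bsub>M\<^esub> y)"
    and rsmult_assoc:
      "\<lbrakk>r \<in> carrier R; s \<in> carrier R; x \<in> carrier M\<rbrakk>
        \<Longrightarrow> (r \<otimes>\<^bsub>R\<^esub> s) \<odot>\<^bsub>M\<^esub> x = s \<odot>\<^bsub>M\<^esub> (r \<odot>\<^bsub>M\<^esub> x)"
    and rsmult_one:
      "x \<in> carrier M \<Longrightarrow> \<one>\<^bsub>R\<^esub> \<odot>\<^bsub>M\<^esub> x = x"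

definition additive_maps ::
    "('r, 'a, 'i) module_scheme \<Rightarrow> ('r, 'b, 'j) module_scheme \<Rightarrow> ('a \<Rightarrow> 'b) set" where
  "additive_maps M N = {f. f \<in> carrier M \<rightarrow> carrier N \<and>
     (\<forall>x\<in>carrier M. \<forall>y\<in>carrier M. f (x \<oplus>\<^bsub>M\<^esub> y) = f x \<oplus>\<^bsub>N\<^esub> f y)}"

definition linear_maps ::
    "('r, 'k) ring_scheme \<Rightarrow> ('r, 'a, 'i) module_scheme \<Rightarrow> ('r, 'b, 'j) module_scheme
      \<Rightarrow> ('a \<Rightarrow> 'b) set" where
  "linear_maps R M N = {f \<in> additive_maps M N.
     \<forall>r\<in>carrier R. \<forall>x\<in>carrier M. f (r \<odot>\<^bsub>M\<^esub> x) = r \<odot>\<^bsub>N\<^esub> f x}"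

definition finitely_generated ::
    "('r, 'k) ring_scheme \<Rightarrow> ('r, 'a, 'i) module_scheme \<Rightarrow> bool" where
  "finitely_generated R M \<longleftrightarrow> (\<exists>S. finite S \<and> S \<subseteq> carrier M \<and>
     (\<forall>x\<in>carrier M. \<exists>r\<in>S \<rightarrow> carrier R. x = (\<Oplus>\<^bsub>M\<^esub>s\<in>S. r s \<odot>\<^bsub>M\<^esub> s)))"


subsection \<open>Tensor product and Tor\<close>

text \<open>
  \<open>N\<close> is a right and \<open>L\<close> a left \<open>R\<close>-module. Their tensor product is the free abelian group on the
  pairs \<open>(a, x)\<close> modulo the usual bilinear, balanced relations.
\<close>

definition tensor_relations ::
    "('r, 'k) ring_scheme \<Rightarrow> ('r, 'n, 'i) module_scheme \<Rightarrow> ('r, 'a, 'j) module_scheme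
      \<Rightarrow> (('n \<times> 'a) \<Rightarrow>\<^sub>0 int) set" where
  "tensor_relations R N L = generate (free_Abelian_group (carrier N \<times> carrier L))
     ({frag_of (a \<oplus>\<^bsub>N\<^esub> b, x) - frag_of (a, x) - frag_of (b, x) | a b x.
         a \<in> carrier N \<and> b \<in> carrier N \<and> x \<in> carrier L} \<union>
      {frag_of (a, x \<oplus>\<^bsub>L\<^esub> y) - frag_of (a, x) - frag_of (a, y) | a x y.
         a \<in> carrier N \<and> x \<in> carrier L \<and> y \<in> carrier L} \<union>
      {frag_of (r \<odot>\<^bsub>N\<^esub> a, x) - frag_of (a, r \<odot>\<^bsub>L\<^esub> x) | r a x.
         r \<in> carrier R \<and> a \<in> carrier N \<and> x \<in> carrier L})"

definition tensor_product ::
    "('r, 'k) ring_scheme \<Rightarrow> ('r, 'n, 'i) module_scheme \<Rightarrow> ('r, 'a, 'j) module_scheme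
      \<Rightarrow> (('n \<times> 'a) \<Rightarrow>\<^sub>0 int) set monoid" where
  "tensor_product R N L =
     free_Abelian_group (carrier N \<times> carrier L) Mod tensor_relations R N L"

text \<open>The map from \<open>N \<otimes> L\<close> to \<open>N \<otimes> L'\<close> induced by \<open>f : L \<rightarrow> L'\<close>, on cosets.\<close>

definition tensor_map ::
    "('r, 'k) ring_scheme \<Rightarrow> ('r, 'n, 'i) module_scheme \<Rightarrow> ('r, 'b, 'j) module_scheme
      \<Rightarrow> ('a \<Rightarrow> 'b) \<Rightarrow> (('n \<times> 'a) \<Rightarrow>\<^sub>0 int) set \<Rightarrow> (('n \<times> 'b) \<Rightarrow>\<^sub>0 int) set" where
  "tensor_map R N L' f C = tensor_relations R N L'
     <#>\<^bsub>free_Abelian_group (carrier N \<times> carrier L')\<^esub>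
     frag_extend (\<lambda>(a, x). frag_of (a, f x)) ` C"

text \<open>
  The homology in degree \<open>k\<close> of \<open>N \<otimes> L\<^sub>*\<close>, where \<open>L\<^sub>*\<close> is a chain complex (a projective resolution
  in the applications) with boundary maps \<open>d : L\<^bsub>k+1\<^esub> \<rightarrow> L\<^sub>k\<close> for \<open>k \<ge> 0\<close>.
\<close>

definition Tor ::
    "('r, 'k) ring_scheme \<Rightarrow> ('r, 'n, 'i) module_scheme \<Rightarrow> (nat \<Rightarrow> ('r, 'a) module)
      \<Rightarrow> ('a \<Rightarrow> 'a) \<Rightarrow> nat \<Rightarrow> (('n \<times> 'a) \<Rightarrow>\<^sub>0 int) set set monoid" where
  "Tor R N L d k =
     (let T = (\<lambda>i. tensor_product R N (L i));
          \<Delta> = (\<lambda>i. tensor_map R N (L i) d);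
          Z = (case k of 0 \<Rightarrow> carrier (T 0) | Suc i \<Rightarrow> kernel (T k) (T i) (\<Delta> i))
      in (T k)\<lparr>carrier := Z\<rparr> Mod (\<Delta> k ` carrier (T (Suc k))))"


section \<open>Group rings, free modules and Novikov modules\<close>

definition group_ring :: "('g, 'b) monoid_scheme \<Rightarrow> ('g \<Rightarrow>\<^sub>0 int) ring" where
  "group_ring G = \<lparr>carrier = {a. Poly_Mapping.keys a \<subseteq> carrier G},
     monoid.mult = (\<lambda>a b. frag_extend (\<lambda>g. frag_extend (\<lambda>h. frag_of (g \<otimes>\<^bsub>G\<^esub> h)) b) a),
     monoid.one = frag_of \<one>\<^bsub>G\<^esub>, ring.zero = 0, ring.add = (+)\<rparr>"

text \<open>
  The free left module over the group ring with basis \<open>X\<close>; the pair \<open>(g, x)\<close> stands for the element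
  \<open>gx\<close> of the induced basis \<open>GX\<close> over the integers, so \<open>keys c\<close> is the support of \<open>c\<close>.
  The multiplicative part of the record is meaningless.
\<close>

definition free_module ::
    "('g, 'b) monoid_scheme \<Rightarrow> 'x set \<Rightarrow> ('g \<Rightarrow>\<^sub>0 int, ('g \<times> 'x) \<Rightarrow>\<^sub>0 int) module" where
  "free_module G X = \<lparr>carrier = {c. Poly_Mapping.keys c \<subseteq> carrier G \<times> X},
     monoid.mult = undefined, monoid.one = undefined, ring.zero = 0, ring.add = (+),
     module.smult = (\<lambda>a c. frag_extend (\<lambda>g. frag_extend (\<lambda>(h, x). frag_of (g \<otimes>\<^bsub>G\<^esub> h, x)) c) a)\<rparr>"

abbreviation basis_elem :: "('g, 'b) monoid_scheme \<Rightarrow> 'x \<Rightarrow> ('g \<times> 'x) \<Rightarrow>\<^sub>0 int" where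
  "basis_elem G x \<equiv> frag_of (\<one>\<^bsub>G\<^esub>, x)"

text \<open>
  A formal sum over \<open>G\<close> is its coefficient function, extended by \<open>0\<close> outside \<open>carrier G\<close>.
  Termwise right multiplication by \<open>h\<close> turns the coefficient at \<open>g h\<^sup>-\<^sup>1\<close> into the one at \<open>g\<close>.
\<close>

definition novikov_module ::
    "('g, 'b) monoid_scheme \<Rightarrow> ('g \<Rightarrow> 'm::metric_space \<Rightarrow> 'm) \<Rightarrow> 'm \<Rightarrow> (real \<Rightarrow> 'm) set
      \<Rightarrow> ('g \<Rightarrow>\<^sub>0 int, 'g \<Rightarrow> int) module" where
  "novikov_module G \<phi> b e =
     \<lparr>carrier = {\<sigma>. (\<forall>g. g \<notin> carrier G \<longrightarrow> \<sigma> g = 0) \<and>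
        (\<forall>HB\<in>horoballs e. finite {g \<in> carrier G. \<sigma> g \<noteq> 0 \<and> \<phi> g b \<notin> HB})},
      monoid.mult = undefined, monoid.one = undefined, ring.zero = (\<lambda>_. 0), ring.add = (\<lambda>\<sigma> \<tau> g. \<sigma> g + \<tau> g),
      module.smult = (\<lambda>a \<sigma> g. if g \<in> carrier G
        then \<Sum>h\<in>Poly_Mapping.keys a. \<sigma> (g \<otimes>\<^bsub>G\<^esub> inv\<^bsub>G\<^esub> h) * Poly_Mapping.lookup a h else 0)\<rparr>"


subsection \<open>Well-formedness\<close>

lemma frag_ind [consumes 1, case_names zero of diff]:
  assumes "Poly_Mapping.keys c \<subseteq> S" "P 0" "\<And>x. x \<in> S \<Longrightarrow> P (frag_of x)" 
    "\<And>a b. P a \<Longrightarrow> P b \<Longrightarrow> P (a - b)" shows "P c"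
  using assms by (metis frag_induction)

lemma keys_frag_extend_subset:
  assumes "\<And>x. x \<in> S \<Longrightarrow> Poly_Mapping.keys (f x) \<subseteq> T" "Poly_Mapping.keys c \<subseteq> S"
  shows "Poly_Mapping.keys (frag_extend f c) \<subseteq> T"
  using keys_frag_extend[of f c] assms by blast

lemma frag_extend_fun_diff:
  "frag_extend (\<lambda>g. f g - k g) c = frag_extend f c - frag_extend k c"
  by (simp add: frag_extend_def sum_subtractf[symmetric] frag_cmul_def[symmetric])
     (metis (no_types, lifting) frag_cmul_distrib2 diff_conv_add_uminus minus_frag_cmul sum.cong sum_subtractf frag_cmul_minus_one frag_cmul_cmul mult.commute)

lemma frag_extend_fun_add:
  "frag_extend (\<lambda>g. f g + k g) c = frag_extend f c + frag_extend k c"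
  by (simp add: frag_extend_def frag_cmul_distrib2 sum.distrib)

lemma frag_extend_frag_extend:
  "frag_extend f (frag_extend k c) = frag_extend (\<lambda>x. frag_extend f (k x)) c"
  by (rule frag_induction[where S=UNIV and c=c]) (simp_all add: frag_extend_diff)

lemma ring_group_ring:
  assumes "group G" shows "ring (group_ring G)"
proof -
  interpret group G by fact
  have keys_mult: "Poly_Mapping.keys (frag_extend (\<lambda>g. frag_extend (\<lambda>h. frag_of (g \<otimes>\<^bsub>G\<^esub> h)) b) a) \<subseteq> carrier G"
    if "Poly_Mapping.keys a \<subseteq> carrier G" "Poly_Mapping.keys b \<subseteq> carrier G" for a b
    using that by (intro keys_frag_extend_subset[of "carrier G"]) auto
  have assoc: "frag_extend (\<lambda>g. frag_extend (\<lambda>h. frag_of (g \<otimes>\<^bsub>G\<^esub> h)) c)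
        (frag_extend (\<lambda>g. frag_extend (\<lambda>h. frag_of (g \<otimes>\<^bsub>G\<^esub> h)) b) a) =
       frag_extend (\<lambda>g. frag_extend (\<lambda>h. frag_of (g \<otimes>\<^bsub>G\<^esub> h)) (frag_extend (\<lambda>g. frag_extend (\<lambda>h. frag_of (g \<otimes>\<^bsub>G\<^esub> h)) c) b)) a"
    if "Poly_Mapping.keys a \<subseteq> carrier G" "Poly_Mapping.keys b \<subseteq> carrier G" "Poly_Mapping.keys c \<subseteq> carrier G" for a b c
    unfolding frag_extend_frag_extend using that
    by (intro frag_extend_eq) (auto simp: frag_extend_frag_extend m_assoc subset_iff intro!: frag_extend_eq)
  show ?thesis
  proof (rule ringI)
    show "abelian_group (group_ring G)"
    proof (rule abelian_groupI)
      fix x assume "x \<in> carrier (group_ring G)"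
      then show "\<exists>y\<in>carrier (group_ring G). y \<oplus>\<^bsub>group_ring G\<^esub> x = \<zero>\<^bsub>group_ring G\<^esub>"
        by (intro bexI[of _ "-x"]) (auto simp: group_ring_def)
    qed (use keys_add in \<open>fastforce simp: group_ring_def ac_simps\<close>)+
    show "Group.monoid (group_ring G)"
    proof (rule monoidI)
      fix x y z assume "x \<in> carrier (group_ring G)" "y \<in> carrier (group_ring G)" "z \<in> carrier (group_ring G)"
      then show "(x \<otimes>\<^bsub>group_ring G\<^esub> y) \<otimes>\<^bsub>group_ring G\<^esub> z = x \<otimes>\<^bsub>group_ring G\<^esub> (y \<otimes>\<^bsub>group_ring G\<^esub> z)"
        by (simp add: group_ring_def assoc)
    next
      fix x assume "x \<in> carrier (group_ring G)"
      then have k: "Poly_Mapping.keys x \<subseteq> carrier G" by (simp add: group_ring_def)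
      then show "\<one>\<^bsub>group_ring G\<^esub> \<otimes>\<^bsub>group_ring G\<^esub> x = x" "x \<otimes>\<^bsub>group_ring G\<^esub> \<one>\<^bsub>group_ring G\<^esub> = x"
        by (induction rule: frag_ind) (simp_all add: group_ring_def frag_extend_diff frag_extend_fun_diff)
    qed (use keys_mult in \<open>auto simp: group_ring_def\<close>)
  qed (auto simp: group_ring_def frag_extend_add frag_extend_fun_add)
qed

lemma left_module_free_module:
  assumes "group G" shows "left_module (group_ring G) (free_module G X)"
proof -
  interpret group G by fact
  interpret R: ring "group_ring G" by (rule ring_group_ring) fact
  have ab: "abelian_group (free_module G X)"
  proof (rule abelian_groupI)
    fix x assume "x \<in> carrier (free_module G X)"
    then show "\<exists>y\<in>carrier (free_module G X). y \<oplus>\<^bsub>free_module G X\<^esub> x = \<zero>\<^bsub>free_module G X\<^esub>"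
      by (intro bexI[of _ "-x"]) (auto simp: free_module_def)
  qed (use keys_add in \<open>fastforce simp: free_module_def ac_simps\<close>)+
  show ?thesis
  proof (intro left_module.intro ab R.ring_axioms left_module_axioms.intro)
    fix r x assume "r \<in> carrier (group_ring G)" "x \<in> carrier (free_module G X)"
    then have k: "Poly_Mapping.keys r \<subseteq> carrier G" "Poly_Mapping.keys x \<subseteq> carrier G \<times> X"
      by (simp_all add: free_module_def group_ring_def)
    have "Poly_Mapping.keys (frag_extend (\<lambda>(h, x). frag_of (g \<otimes>\<^bsub>G\<^esub> h, x)) x) \<subseteq> carrier G \<times> X"
      if "g \<in> carrier G" for g
      using k(2) that by (intro keys_frag_extend_subset[of "carrier G \<times> X"]) auto
    then show "r \<odot>\<^bsub>free_module G X\<^esub> x \<in> carrier (free_module G X)"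
      by (simp add: free_module_def, intro keys_frag_extend_subset[OF _ k(1)])
  next
    fix r s x assume "r \<in> carrier (group_ring G)" "s \<in> carrier (group_ring G)" "x \<in> carrier (free_module G X)"
    then have k: "Poly_Mapping.keys r \<subseteq> carrier G" "Poly_Mapping.keys s \<subseteq> carrier G"
        "Poly_Mapping.keys x \<subseteq> carrier G \<times> X"
      by (simp_all add: free_module_def group_ring_def)
    have *: "(g \<otimes>\<^bsub>G\<^esub> h) \<otimes>\<^bsub>G\<^esub> h' = g \<otimes>\<^bsub>G\<^esub> (h \<otimes>\<^bsub>G\<^esub> h')" if "g \<in> carrier G" "h \<in> carrier G" "h' \<in> carrier G" for g h h'
      using that by (rule m_assoc)
    show "(r \<otimes>\<^bsub>group_ring G\<^esub> s) \<odot>\<^bsub>free_module G X\<^esub> x = r \<odot>\<^bsub>free_module G X\<^esub> (s \<odot>\<^bsub>free_module G X\<^esub> x)"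
      using k
      by (auto simp: free_module_def group_ring_def frag_extend_frag_extend subset_iff m_assoc intro!: frag_extend_eq)
  next
    fix x assume "x \<in> carrier (free_module G X)"
    then show "\<one>\<^bsub>group_ring G\<^esub> \<odot>\<^bsub>free_module G X\<^esub> x = x"
      unfolding free_module_def group_ring_def
      by simp (induction rule: frag_ind, auto simp: frag_extend_diff)
  qed (auto simp: free_module_def group_ring_def frag_extend_add frag_extend_fun_add)
qed

lemma busemann_Lipschitz:
  fixes x y :: "'m::metric_space"
  assumes "\<gamma> \<in> rays" shows "\<bar>busemann \<gamma> x - busemann \<gamma> y\<bar> \<le> dist x y"
proof -
  have lim: "((\<lambda>t. t - dist x (\<gamma> t)) \<longlongrightarrow> busemann \<gamma> x) at_top" for x :: 'm
  proof -
    let ?f = "\<lambda>t. max 0 t - dist x (\<gamma> (max 0 t))"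
    have r: "dist (\<gamma> s) (\<gamma> t) = \<bar>s - t\<bar>" if "s \<ge> 0" "t \<ge> 0" for s t
      using assms that by (auto simp: rays_def geodesic_on_def)
    have m: "mono ?f"
    proof (rule monoI)
      fix s t :: real assume "s \<le> t"
      then show "?f s \<le> ?f t"
        using r[of "max 0 s" "max 0 t"] dist_triangle[of x "\<gamma> (max 0 t)" "\<gamma> (max 0 s)"] by auto
    qed
    have b: "?f t \<le> dist x (\<gamma> 0)" for t
      using r[of 0 "max 0 t"] dist_triangle3[of "\<gamma> 0" "\<gamma> (max 0 t)" x] by linarith
    have inc: "incseq (\<lambda>n. ?f (real n))"
      unfolding incseq_def using monoD[OF m] by (metis of_nat_le_iff)
    obtain L where L: "(\<lambda>n. ?f (real n)) \<longlonglongrightarrow> L"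
      using incseq_convergent[OF inc, of "dist x (\<gamma> 0)"] b by blast
    have "(?f \<longlongrightarrow> L) at_top"
      by (rule tendsto_at_topI_sequentially_real[OF m]) (use L in simp)
    moreover have "\<forall>\<^sub>F t in at_top. ?f t = t - dist x (\<gamma> t)"
      using eventually_ge_at_top[of 0] by eventually_elim simp
    ultimately have "((\<lambda>t. t - dist x (\<gamma> t)) \<longlongrightarrow> L) at_top"
      by (rule Lim_transform_eventually)
    moreover from this have "busemann \<gamma> x = L"
      unfolding busemann_def by (intro tendsto_Lim) auto
    ultimately show ?thesis by simp
  qed
  have "busemann \<gamma> x - busemann \<gamma> y \<le> dist x y" for x y :: 'm
  proof (rule tendsto_upperbound[OF tendsto_diff[OF lim lim]])
    have "t - dist x (\<gamma> t) - (t - dist y (\<gamma> t)) \<le> dist x y" for t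
      using dist_triangle[of y "\<gamma> t" x] by (simp add: dist_commute)
    then show "\<forall>\<^sub>F t in at_top. t - dist x (\<gamma> t) - (t - dist y (\<gamma> t)) \<le> dist x y"
      by (intro always_eventually allI)
  qed auto
  from this[of x y] this[of y x] show ?thesis by (simp add: dist_commute abs_le_iff)
qed

lemma right_module_novikov:
  fixes \<phi> :: "'g \<Rightarrow> 'm::metric_space \<Rightarrow> 'm" and G :: "('g, 'b) monoid_scheme"
  assumes "group G" and act: "isometric_action G \<phi>" and e: "e \<in> boundary"
  shows "right_module (group_ring G) (novikov_module G \<phi> b e)" (is "right_module _ ?N")
proof -
  interpret group G by fact
  interpret R: ring "group_ring G" by (rule ring_group_ring) fact
  interpret A: group_action G UNIV \<phi> using act by (simp add: isometric_action_def)
  have iso: "dist (\<phi> g x) (\<phi> g y) = dist x y" if "g \<in> carrier G" for g x y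
    using act that by (simp add: isometric_action_def)
  have rays: "\<gamma> \<in> rays" if "\<gamma> \<in> e" for \<gamma>
    using e that by (auto simp: boundary_def quotient_def asymptotic_def)
  have smult_sum: "(a \<odot>\<^bsub>?N\<^esub> \<sigma>) g = (\<Sum>h\<in>S. \<sigma> (g \<otimes>\<^bsub>G\<^esub> inv\<^bsub>G\<^esub> h) * Poly_Mapping.lookup a h)"
    if "finite S" "Poly_Mapping.keys a \<subseteq> S" "g \<in> carrier G" for a S \<sigma> g
    using that by (simp add: novikov_module_def) (intro sum.mono_neutral_left, auto simp: in_keys_iff)
  have smult_out: "(a \<odot>\<^bsub>?N\<^esub> \<sigma>) g = 0" if "g \<notin> carrier G" for a \<sigma> g
    using that by (simp add: novikov_module_def)
  have smult_add: "(a + c) \<odot>\<^bsub>?N\<^esub> \<sigma> = (\<lambda>g. (a \<odot>\<^bsub>?N\<^esub> \<sigma>) g + (c \<odot>\<^bsub>?N\<^esub> \<sigma>) g)" for a c \<sigma>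
  proof
    fix g
    let ?S = "Poly_Mapping.keys a \<union> Poly_Mapping.keys c"
    show "((a + c) \<odot>\<^bsub>?N\<^esub> \<sigma>) g = (a \<odot>\<^bsub>?N\<^esub> \<sigma>) g + (c \<odot>\<^bsub>?N\<^esub> \<sigma>) g"
      by (cases "g \<in> carrier G")
         (simp_all add: smult_out smult_sum[of ?S] keys_add lookup_add ring_distribs sum.distrib)
  qed
  have smult_diff: "(a - c) \<odot>\<^bsub>?N\<^esub> \<sigma> = (\<lambda>g. (a \<odot>\<^bsub>?N\<^esub> \<sigma>) g - (c \<odot>\<^bsub>?N\<^esub> \<sigma>) g)" for a c \<sigma>
    using smult_add[of "a - c" c \<sigma>] by simp
  have smult_0: "0 \<odot>\<^bsub>?N\<^esub> \<sigma> = (\<lambda>g. 0)" for \<sigma>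
    by (auto simp: novikov_module_def)
  have smult_of: "frag_of h \<odot>\<^bsub>?N\<^esub> \<sigma> = (\<lambda>g. if g \<in> carrier G then \<sigma> (g \<otimes>\<^bsub>G\<^esub> inv\<^bsub>G\<^esub> h) else 0)" for h \<sigma>
    by (auto simp: novikov_module_def)
  have smult_fdiff: "a \<odot>\<^bsub>?N\<^esub> (\<lambda>g. \<sigma> g - \<tau> g) = (\<lambda>g. (a \<odot>\<^bsub>?N\<^esub> \<sigma>) g - (a \<odot>\<^bsub>?N\<^esub> \<tau>) g)" for a \<sigma> \<tau>
    by (auto simp: novikov_module_def ring_distribs sum_subtractf)
  have smult_fadd: "a \<odot>\<^bsub>?N\<^esub> (\<lambda>g. \<sigma> g + \<tau> g) = (\<lambda>g. (a \<odot>\<^bsub>?N\<^esub> \<sigma>) g + (a \<odot>\<^bsub>?N\<^esub> \<tau>) g)" for a \<sigma> \<tau>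
    by (auto simp: novikov_module_def ring_distribs sum.distrib)
  have smult_f0: "a \<odot>\<^bsub>?N\<^esub> (\<lambda>g. 0) = (\<lambda>g. 0)" for a
    by (auto simp: novikov_module_def)
  have carr: "\<sigma> \<in> carrier ?N \<longleftrightarrow> (\<forall>g. g \<notin> carrier G \<longrightarrow> \<sigma> g = 0) \<and>
     (\<forall>\<gamma>\<in>e. \<forall>t. finite {g \<in> carrier G. \<sigma> g \<noteq> 0 \<and> \<not> busemann \<gamma> (\<phi> g b) \<ge> t})" for \<sigma>
  proof -
    have "(\<forall>HB\<in>horoballs e. P HB) \<longleftrightarrow> (\<forall>\<gamma>\<in>e. \<forall>t. P {x. busemann \<gamma> x \<ge> t})" for P
      unfolding horoballs_def by blast
    then show ?thesis by (simp add: novikov_module_def)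
  qed
  have diff_closed: "(\<lambda>g. \<sigma> g - \<tau> g) \<in> carrier ?N" if "\<sigma> \<in> carrier ?N" "\<tau> \<in> carrier ?N" for \<sigma> \<tau>
  proof -
    have "finite {g \<in> carrier G. \<sigma> g - \<tau> g \<noteq> 0 \<and> \<not> busemann \<gamma> (\<phi> g b) \<ge> t}" if "\<gamma> \<in> e" for \<gamma> t
      by (rule finite_subset[of _ "{g \<in> carrier G. \<sigma> g \<noteq> 0 \<and> \<not> busemann \<gamma> (\<phi> g b) \<ge> t} \<union>
            {g \<in> carrier G. \<tau> g \<noteq> 0 \<and> \<not> busemann \<gamma> (\<phi> g b) \<ge> t}"])
         (use that \<open>\<sigma> \<in> _\<close> \<open>\<tau> \<in> _\<close> in \<open>auto simp: carr\<close>)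
    with that show ?thesis by (auto simp: carr)
  qed
  have zero_closed: "(\<lambda>g. 0) \<in> carrier ?N" by (simp add: carr)
  have add_closed: "(\<lambda>g. \<sigma> g + \<tau> g) \<in> carrier ?N" if "\<sigma> \<in> carrier ?N" "\<tau> \<in> carrier ?N" for \<sigma> \<tau>
    using diff_closed[OF that(1) diff_closed[OF zero_closed that(2)]] by simp
  have of_closed: "frag_of h \<odot>\<^bsub>?N\<^esub> \<sigma> \<in> carrier ?N" if h: "h \<in> carrier G" and \<sigma>: "\<sigma> \<in> carrier ?N" for h \<sigma>
  proof -
    have "finite {g \<in> carrier G. \<sigma> (g \<otimes>\<^bsub>G\<^esub> inv\<^bsub>G\<^esub> h) \<noteq> 0 \<and> \<not> busemann \<gamma> (\<phi> g b) \<ge> t}" if "\<gamma> \<in> e" for \<gamma> t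
    proof (rule finite_subset)
      show "finite ((\<lambda>g. g \<otimes>\<^bsub>G\<^esub> h) ` {g \<in> carrier G. \<sigma> g \<noteq> 0 \<and> \<not> busemann \<gamma> (\<phi> g b) \<ge> t + dist (\<phi> h b) b})"
        using \<sigma> that by (auto simp: carr)
      show "{g \<in> carrier G. \<sigma> (g \<otimes>\<^bsub>G\<^esub> inv\<^bsub>G\<^esub> h) \<noteq> 0 \<and> \<not> busemann \<gamma> (\<phi> g b) \<ge> t} \<subseteq>
        (\<lambda>g. g \<otimes>\<^bsub>G\<^esub> h) ` {g \<in> carrier G. \<sigma> g \<noteq> 0 \<and> \<not> busemann \<gamma> (\<phi> g b) \<ge> t + dist (\<phi> h b) b}"
      proof
        fix g assume g: "g \<in> {g \<in> carrier G. \<sigma> (g \<otimes>\<^bsub>G\<^esub> inv\<^bsub>G\<^esub> h) \<noteq> 0 \<and> \<not> busemann \<gamma> (\<phi> g b) \<ge> t}"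
        define g' where "g' = g \<otimes>\<^bsub>G\<^esub> inv\<^bsub>G\<^esub> h"
        have g': "g' \<in> carrier G" "g = g' \<otimes>\<^bsub>G\<^esub> h"
          using g h by (auto simp: g'_def m_assoc)
        then have "\<phi> g b = \<phi> g' (\<phi> h b)"
          using A.composition_rule[of b g' h] h by simp
        then have "dist (\<phi> g b) (\<phi> g' b) = dist (\<phi> h b) b"
          using iso g' by simp
        with busemann_Lipschitz[OF rays[OF that], of "\<phi> g b" "\<phi> g' b"]
        have "\<not> busemann \<gamma> (\<phi> g' b) \<ge> t + dist (\<phi> h b) b"
          using g by auto
        moreover have "\<sigma> g' \<noteq> 0" using g by (simp add: g'_def)
        ultimately show "g \<in> (\<lambda>g. g \<otimes>\<^bsub>G\<^esub> h) ` {g \<in> carrier G. \<sigma> g \<noteq> 0 \<and> \<not> busemann \<gamma> (\<phi> g b) \<ge> t + dist (\<phi> h b) b}"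
          using g' by blast
      qed
    qed
    then show ?thesis
      unfolding smult_of carr by (simp cong: conj_cong)
  qed
  have R_carr: "a \<in> carrier (group_ring G) \<longleftrightarrow> Poly_Mapping.keys a \<subseteq> carrier G" for a
    by (simp add: group_ring_def)
  have closed: "a \<odot>\<^bsub>?N\<^esub> \<sigma> \<in> carrier ?N" if "a \<in> carrier (group_ring G)" "\<sigma> \<in> carrier ?N" for a \<sigma>
    using that(1) unfolding R_carr
    by (induction rule: frag_ind) (simp_all add: smult_0 smult_diff zero_closed of_closed diff_closed that)
  have mult: "a \<otimes>\<^bsub>group_ring G\<^esub> c = frag_extend (\<lambda>g. frag_extend (\<lambda>h. frag_of (g \<otimes>\<^bsub>G\<^esub> h)) c) a" for a c
    by (simp add: group_ring_def)
  have assoc: "(a \<otimes>\<^bsub>group_ring G\<^esub> c) \<odot>\<^bsub>?N\<^esub> \<sigma> = c \<odot>\<^bsub>?N\<^esub> (a \<odot>\<^bsub>?N\<^esub> \<sigma>)"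
    if "a \<in> carrier (group_ring G)" "c \<in> carrier (group_ring G)" for a c \<sigma>
    using that(1) unfolding R_carr
  proof (induction rule: frag_ind)
    case (of g)
    show ?case using that(2) unfolding R_carr
    proof (induction rule: frag_ind)
      case (of h)
      with \<open>g \<in> carrier G\<close> show ?case
        by (auto simp: mult smult_of inv_mult_group m_assoc fun_eq_iff)
    qed (simp_all add: mult smult_0 smult_diff frag_extend_diff)
  qed (simp_all add: mult smult_0 smult_f0 smult_diff smult_fdiff frag_extend_diff)
  have [simp]: "\<zero>\<^bsub>?N\<^esub> = (\<lambda>_. 0)" "\<sigma> \<oplus>\<^bsub>?N\<^esub> \<tau> = (\<lambda>g. \<sigma> g + \<tau> g)" for \<sigma> \<tau>
    by (simp_all add: novikov_module_def)
  have [simp]: "a \<oplus>\<^bsub>group_ring G\<^esub> c = a + c" "\<one>\<^bsub>group_ring G\<^esub> = frag_of \<one>\<^bsub>G\<^esub>" for a c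
    by (simp_all add: group_ring_def)
  have "abelian_group ?N"
  proof (rule abelian_groupI)
    fix \<sigma> assume "\<sigma> \<in> carrier ?N"
    then show "\<exists>\<tau>\<in>carrier ?N. \<tau> \<oplus>\<^bsub>?N\<^esub> \<sigma> = \<zero>\<^bsub>?N\<^esub>"
      using diff_closed[OF zero_closed] by (intro bexI[of _ "\<lambda>g. 0 - \<sigma> g"]) auto
  qed (simp_all add: add_closed zero_closed ac_simps)
  then show ?thesis
  proof (intro right_module.intro R.ring_axioms right_module_axioms.intro)
    fix \<sigma> assume "\<sigma> \<in> carrier ?N"
    then show "\<one>\<^bsub>group_ring G\<^esub> \<odot>\<^bsub>?N\<^esub> \<sigma> = \<sigma>"
      by (auto simp: smult_of carr)
  qed (simp_all add: closed smult_add smult_fadd assoc)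
qed


section \<open>Based free resolutions and control maps\<close>

text \<open>
  \<open>F\<^sub>k\<close> is \<open>free_module G (X k)\<close>. As the \<open>X k\<close> are disjoint, the direct sum of the \<open>F\<^sub>k\<close> is
  \<open>free_module G (\<Union>k. X k)\<close>, and one function \<open>d\<close> serves as boundary map in all degrees \<open>k \<ge> 1\<close>.
\<close>

definition based_free_resolution ::
    "('g, 'b) monoid_scheme \<Rightarrow> ('g \<Rightarrow>\<^sub>0 int, 'a, 'c) module_scheme \<Rightarrow> (nat \<Rightarrow> 'x set)
      \<Rightarrow> ((('g \<times> 'x) \<Rightarrow>\<^sub>0 int) \<Rightarrow> (('g \<times> 'x) \<Rightarrow>\<^sub>0 int)) \<Rightarrow> ((('g \<times> 'x) \<Rightarrow>\<^sub>0 int) \<Rightarrow> 'a) \<Rightarrow> bool" where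
  "based_free_resolution G A X d \<epsilon> \<longleftrightarrow>
     (let R = group_ring G; F = (\<lambda>k. free_module G (X k)) in
      disjoint_family X \<and>
      (\<forall>k. d \<in> linear_maps R (F (Suc k)) (F k)) \<and>
      \<epsilon> \<in> linear_maps R (F 0) A \<and>
      \<epsilon> ` carrier (F 0) = carrier A \<and>
      {c \<in> carrier (F 0). \<epsilon> c = \<zero>\<^bsub>A\<^esub>} = d ` carrier (F 1) \<and>
      (\<forall>k. {c \<in> carrier (F (Suc k)). d c = 0} = d ` carrier (F (Suc (Suc k)))))"

definition admissible ::
    "('g, 'b) monoid_scheme \<Rightarrow> ('g \<Rightarrow>\<^sub>0 int, 'a, 'c) module_scheme \<Rightarrow> (nat \<Rightarrow> 'x set)
      \<Rightarrow> ((('g \<times> 'x) \<Rightarrow>\<^sub>0 int) \<Rightarrow> (('g \<times> 'x) \<Rightarrow>\<^sub>0 int)) \<Rightarrow> ((('g \<times> 'x) \<Rightarrow>\<^sub>0 int) \<Rightarrow> 'a) \<Rightarrow> bool" where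
  "admissible G A X d \<epsilon> \<longleftrightarrow>
     (\<forall>k. \<forall>x\<in>X (Suc k). d (basis_elem G x) \<noteq> 0) \<and> (\<forall>x\<in>X 0. \<epsilon> (basis_elem G x) \<noteq> \<zero>\<^bsub>A\<^esub>)"

definition skeleton ::
    "('g, 'b) monoid_scheme \<Rightarrow> (nat \<Rightarrow> 'x set) \<Rightarrow> nat
      \<Rightarrow> ('g \<Rightarrow>\<^sub>0 int, ('g \<times> 'x) \<Rightarrow>\<^sub>0 int) module" where
  "skeleton G X n = free_module G (\<Union>k\<le>n. X k)"

text \<open>An \<open>FP\<^sub>n\<close>-module is one that has a resolution as follows.\<close>

definition FP_resolution ::
    "nat \<Rightarrow> ('g, 'b) monoid_scheme \<Rightarrow> ('g \<Rightarrow>\<^sub>0 int, 'a, 'c) module_scheme \<Rightarrow> (nat \<Rightarrow> 'x set)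
      \<Rightarrow> ((('g \<times> 'x) \<Rightarrow>\<^sub>0 int) \<Rightarrow> (('g \<times> 'x) \<Rightarrow>\<^sub>0 int)) \<Rightarrow> ((('g \<times> 'x) \<Rightarrow>\<^sub>0 int) \<Rightarrow> 'a) \<Rightarrow> bool" where
  "FP_resolution n G A X d \<epsilon> \<longleftrightarrow>
     based_free_resolution G A X d \<epsilon> \<and> admissible G A X d \<epsilon> \<and>
     finitely_generated (group_ring G) (skeleton G X n)"

definition control_map ::
    "('g, 'b) monoid_scheme \<Rightarrow> ('g \<Rightarrow> 'm::metric_space \<Rightarrow> 'm) \<Rightarrow> (nat \<Rightarrow> 'x set)
      \<Rightarrow> ((('g \<times> 'x) \<Rightarrow>\<^sub>0 int) \<Rightarrow> 'm set) \<Rightarrow> bool" where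
  "control_map G \<phi> X h \<longleftrightarrow>
     (let F = free_module G (\<Union>k. X k) in
      (\<forall>c\<in>carrier F. finite (h c)) \<and>
      (\<forall>g\<in>carrier G. \<forall>c\<in>carrier F. h (frag_of g \<odot>\<^bsub>F\<^esub> c) = \<phi> g ` h c) \<and>
      (\<forall>c\<in>carrier F. h c = (\<Union>y\<in>Poly_Mapping.keys c. h (frag_of y))) \<and>
      (\<forall>k. \<forall>x\<in>X k. h (basis_elem G x) \<noteq> {}))"

definition valuation ::
    "('c \<Rightarrow> 'm::metric_space set) \<Rightarrow> (real \<Rightarrow> 'm) \<Rightarrow> ('c::zero) \<Rightarrow> ereal" where
  "valuation h \<gamma> c = (if c = 0 then \<infinity> else ereal (Min (busemann \<gamma> ` h c)))"


section \<open>Finitary maps and the dynamical invariant\<close>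

definition finitary ::
    "('g, 'b) monoid_scheme \<Rightarrow> ('g \<Rightarrow>\<^sub>0 int, 'a, 'i) module_scheme
      \<Rightarrow> ('g \<Rightarrow>\<^sub>0 int, 'c, 'j) module_scheme \<Rightarrow> ('a \<Rightarrow> 'c) \<Rightarrow> bool" where
  "finitary G B C f \<longleftrightarrow>
     f \<in> additive_maps B C \<and>
     (\<exists>\<Phi>. \<forall>x\<in>carrier B. finite (\<Phi> x) \<and> \<Phi> x \<subseteq> carrier C \<and> f x \<in> \<Phi> x \<and>
        (\<forall>g\<in>carrier G. \<Phi> (frag_of g \<odot>\<^bsub>B\<^esub> x) = (\<lambda>y. frag_of g \<odot>\<^bsub>C\<^esub> y) ` \<Phi> x))"

text \<open>The guaranteed shift; the set of differences is the same for every ray \<open>\<gamma>\<close> in the class \<open>e\<close>.\<close>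

definition gsh ::
    "('g, 'b) monoid_scheme \<Rightarrow> (nat \<Rightarrow> 'x set) \<Rightarrow> nat
      \<Rightarrow> ((('g \<times> 'x) \<Rightarrow>\<^sub>0 int) \<Rightarrow> 'm::metric_space set) \<Rightarrow> (real \<Rightarrow> 'm) set
      \<Rightarrow> ((('g \<times> 'x) \<Rightarrow>\<^sub>0 int) \<Rightarrow> (('g \<times> 'x) \<Rightarrow>\<^sub>0 int)) \<Rightarrow> ereal" where
  "gsh G X n h e f =
     Inf {valuation h \<gamma> (f c) - valuation h \<gamma> c | \<gamma> c.
       \<gamma> \<in> e \<and> c \<in> carrier (skeleton G X n) \<and> c \<noteq> 0}"

text \<open>Chain endomorphisms of the \<open>n\<close>-skeleton (additive, not necessarily equivariant) over the
  identity of the resolved module.\<close>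

definition chain_map_inducing_id ::
    "('g, 'b) monoid_scheme \<Rightarrow> (nat \<Rightarrow> 'x set) \<Rightarrow> ((('g \<times> 'x) \<Rightarrow>\<^sub>0 int) \<Rightarrow> (('g \<times> 'x) \<Rightarrow>\<^sub>0 int))
      \<Rightarrow> ((('g \<times> 'x) \<Rightarrow>\<^sub>0 int) \<Rightarrow> 'a) \<Rightarrow> nat
      \<Rightarrow> ((('g \<times> 'x) \<Rightarrow>\<^sub>0 int) \<Rightarrow> (('g \<times> 'x) \<Rightarrow>\<^sub>0 int)) \<Rightarrow> bool" where
  "chain_map_inducing_id G X d \<epsilon> n f \<longleftrightarrow>
     f \<in> additive_maps (skeleton G X n) (skeleton G X n) \<and>
     (\<forall>k\<le>n. f ` carrier (free_module G (X k)) \<subseteq> carrier (free_module G (X k))) \<and>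
     (\<forall>k<n. \<forall>c\<in>carrier (free_module G (X (Suc k))). f (d c) = d (f c)) \<and>
     (\<forall>c\<in>carrier (free_module G (X 0)). \<epsilon> (f c) = \<epsilon> c)"

definition dynamical_Sigma ::
    "nat \<Rightarrow> ('g, 'b) monoid_scheme \<Rightarrow> (nat \<Rightarrow> 'x set)
      \<Rightarrow> ((('g \<times> 'x) \<Rightarrow>\<^sub>0 int) \<Rightarrow> (('g \<times> 'x) \<Rightarrow>\<^sub>0 int)) \<Rightarrow> ((('g \<times> 'x) \<Rightarrow>\<^sub>0 int) \<Rightarrow> 'a)
      \<Rightarrow> ((('g \<times> 'x) \<Rightarrow>\<^sub>0 int) \<Rightarrow> 'm::metric_space set) \<Rightarrow> (real \<Rightarrow> 'm) set set" where
  "dynamical_Sigma n G X d \<epsilon> h =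
     {e \<in> boundary. \<exists>f. finitary G (skeleton G X n) (skeleton G X n) f \<and>
        chain_map_inducing_id G X d \<epsilon> n f \<and> gsh G X n h e f > 0}"

end

theory Submission
  imports Defs
begin

text \<open>
  Only the function \<open>\<beta> g = \<beta>\<^sub>\<gamma>(gb)\<close> on \<open>G\<close> matters, not the control map, because a positive shift can be
  enlarged by iteration. Tensoring with a free module over \<open>X\<close> turns the Novikov module into the group
  of infinite chains over \<open>GX\<close>, in finitely many columns, with finitely many terms below each height,
  and finitary maps act on such chains.

  Given a pushing map \<open>\<phi>\<close>, pick a finitary homotopy \<open>s\<close> from the identity to \<open>\<phi>\<close>. A Novikov cycle \<open>z\<close> bounds
  the convergent sum of the \<open>- s \<phi>\<^sup>j z\<close>. The same applies at all \<open>e'\<close> in the closure of \<open>Ge\<close>, as an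
  ultralimit of the conjugates of \<open>\<phi>\<close> pushes towards \<open>e'\<close>: by finitarity they have only finitely many
  values on each basis element up to translation, and Busemann functions of rays from \<open>b\<close> converge with the rays.

  Conversely, a pushing map is built degree by degree. If \<open>\<phi>\<close> is known below degree \<open>k\<close> and \<open>s\<close> is the
  homotopy, then \<open>x + \<Sum>\<^sub>j s \<phi>\<^sup>j \<partial>x\<close> over all \<open>j\<close> is a Novikov cycle, which bounds an infinite chain;
  subtracting the boundary of a finite part of that chain from \<open>x + \<Sum>\<^sub>j s \<phi>\<^sup>j \<partial>x\<close> over \<open>j < m\<close> gives a
  value of the new map on \<open>x\<close>. Vanishing at all points of the closure makes finitely many such values
  suffice for all translates of \<open>x\<close>, by compactness.
\<close>

section \<open>Finitary maps between free modules\<close>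

text \<open>A finitary map is not equivariant, so it induces nothing on a tensor product over the
  group ring. It still acts on infinite chains, because a target basis element receives
  contributions from only finitely many source elements in finitely many columns. Type FP_n bounds
  the bases only up to degree n, whereas the homotopies lead into degree n + 1, and the resolution
  that computes Tor may have infinite bases everywhere. Therefore each Novikov chain carries its own
  finite set of columns, and finitarity has to show that images stay in finitely many.

  Ultrafilters on G replace sequences because neither G nor a neighbourhood basis is assumed
  countable and one limit must serve all basis elements, all stages of an infinite sum and all
  heights at once. The notion is used in two opposite ways: a limit carries a pushing map from e to
  the closure of its orbit, while the lack of a finite supply of values would itself produce a
  limit, at which exactness then supplies the missing value. Points of the closure and ultrafilters
  on G give the same functions on G; this is the only place where the geometry of M meets the
  algebra.\<close>

definition translate :: "('g, 'b) monoid_scheme \<Rightarrow> 'g \<Rightarrow> (('g \<times> 'x) \<Rightarrow>\<^sub>0 int) \<Rightarrow> (('g \<times> 'x) \<Rightarrow>\<^sub>0 int)" where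
  "translate G g c = frag_extend (\<lambda>(h, x). frag_of (g \<otimes>\<^bsub>G\<^esub> h, x)) c"

definition fchains :: "('g, 'b) monoid_scheme \<Rightarrow> 'x set \<Rightarrow> (('g \<times> 'x) \<Rightarrow>\<^sub>0 int) set" where
  "fchains G X = {c. Poly_Mapping.keys c \<subseteq> carrier G \<times> X}"

definition equivariant :: "('g, 'b) monoid_scheme \<Rightarrow> 'x set \<Rightarrow> (('g \<times> 'x) \<Rightarrow> (('g \<times> 'y) \<Rightarrow>\<^sub>0 int)) \<Rightarrow> bool" where
  "equivariant G X p \<longleftrightarrow>
     (\<forall>g\<in>carrier G. \<forall>h\<in>carrier G. \<forall>x\<in>X. p (g \<otimes>\<^bsub>G\<^esub> h, x) = translate G g (p (h, x)))"

text \<open>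
  \<open>p\<close> lists the values on the basis \<open>GX\<close> of the additive map \<open>frag_extend p\<close>. That map is finitary iff,
  for each \<open>x\<close>, only finitely many chains occur among the \<open>g\<^sup>-\<^sup>1 p(gx)\<close>.
\<close>

definition fin_map ::
    "('g, 'b) monoid_scheme \<Rightarrow> 'x set \<Rightarrow> 'y set \<Rightarrow> (('g \<times> 'x) \<Rightarrow> (('g \<times> 'y) \<Rightarrow>\<^sub>0 int)) \<Rightarrow> bool" where
  "fin_map G X Y p \<longleftrightarrow>
     (\<forall>g\<in>carrier G. \<forall>x\<in>X. p (g, x) \<in> fchains G Y) \<and>
     (\<forall>x\<in>X. finite ((\<lambda>g. translate G (inv\<^bsub>G\<^esub> g) (p (g, x))) ` carrier G))"

lemma translate_0 [simp]: "translate G g 0 = 0"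
  and translate_diff: "translate G g (c - c') = translate G g c - translate G g c'"
  and translate_of [simp]: "translate G g (frag_of (h, x)) = frag_of (g \<otimes>\<^bsub>G\<^esub> h, x)"
  by (simp_all add: translate_def frag_extend_diff)

lemma carrier_free_module: "carrier (free_module G X) = fchains G X"
  by (simp add: free_module_def fchains_def)

lemma add_free_module: "x \<oplus>\<^bsub>free_module G X\<^esub> y = x + y"
  by (simp add: free_module_def)

lemma zero_free_module: "\<zero>\<^bsub>free_module G X\<^esub> = 0"
  by (simp add: free_module_def)

lemma smult_free_module: "r \<odot>\<^bsub>free_module G X\<^esub> c = frag_extend (\<lambda>g. translate G g c) r"
  by (simp add: free_module_def translate_def)

lemma chains_zero [simp]: "0 \<in> fchains G X"
  and chains_of [simp]: "frag_of (g, x) \<in> fchains G X \<longleftrightarrow> g \<in> carrier G \<and> x \<in> X"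
  by (simp_all add: fchains_def)

lemma chains_diff: "c \<in> fchains G X \<Longrightarrow> c' \<in> fchains G X \<Longrightarrow> c - c' \<in> fchains G X"
  using keys_diff[of c c'] by (auto simp: fchains_def)

lemma chains_add: "c \<in> fchains G X \<Longrightarrow> c' \<in> fchains G X \<Longrightarrow> c + c' \<in> fchains G X"
  using keys_add[of c c'] by (auto simp: fchains_def)

lemma chains_mono: "X \<subseteq> Y \<Longrightarrow> c \<in> fchains G X \<Longrightarrow> c \<in> fchains G Y"
  by (auto simp: fchains_def)

lemma chains_induct [consumes 1, case_names zero of diff]:
  assumes "c \<in> fchains G X" "P 0" "\<And>g x. g \<in> carrier G \<Longrightarrow> x \<in> X \<Longrightarrow> P (frag_of (g, x))"
    "\<And>a b. a \<in> fchains G X \<Longrightarrow> b \<in> fchains G X \<Longrightarrow> P a \<Longrightarrow> P b \<Longrightarrow> P (a - b)"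
  shows "P c"
proof -
  have "c \<in> fchains G X \<and> P c"
    using assms(1) unfolding fchains_def mem_Collect_eq
  proof (induction rule: frag_ind)
    case (of x)
    then show ?case using assms(3) by (cases x) auto
  next
    case (diff a b)
    then show ?case using assms(4) chains_diff[of a G X b] by (simp add: fchains_def)
  qed (use assms in auto)
  then show ?thesis by simp
qed

lemma frag_extend_chains:
  assumes "\<And>g x. g \<in> carrier G \<Longrightarrow> x \<in> X \<Longrightarrow> p (g, x) \<in> fchains G Y" "c \<in> fchains G X"
  shows "frag_extend p c \<in> fchains G Y"
  using assms(2) by (induction rule: chains_induct) (auto simp: assms(1) frag_extend_diff chains_diff)

lemma frag_extend_cong_chains:
  assumes "c \<in> fchains G X" "\<And>g x. g \<in> carrier G \<Longrightarrow> x \<in> X \<Longrightarrow> p (g, x) = q (g, x)"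
  shows "frag_extend p c = frag_extend q c"
  using assms by (intro frag_extend_eq) (auto simp: fchains_def)

lemma frag_extend_frag_of [simp]: "frag_extend frag_of c = c"
  by (metis frag_expansion)

lemma keys_translate: "Poly_Mapping.keys (translate G g c) \<subseteq> (\<lambda>(h, x). (g \<otimes>\<^bsub>G\<^esub> h, x)) ` Poly_Mapping.keys c"
  unfolding translate_def using keys_frag_extend[of "\<lambda>(h, x). frag_of (g \<otimes>\<^bsub>G\<^esub> h, x)" c] by fastforce

lemma lookup_frag_extend:
  "Poly_Mapping.lookup (frag_extend p c) z =
     (\<Sum>y\<in>Poly_Mapping.keys c. Poly_Mapping.lookup c y * Poly_Mapping.lookup (p y) z)"
  by (simp add: frag_extend_def lookup_sum)

section \<open>Finiteness up to translation\<close>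

context group
begin

lemma translate_closed:
  assumes "g \<in> carrier G" "c \<in> fchains G X" shows "translate G g c \<in> fchains G X"
  unfolding translate_def using assms by (intro frag_extend_chains) auto

lemma translate_translate:
  assumes "g \<in> carrier G" "h \<in> carrier G" "c \<in> fchains G X"
  shows "translate G g (translate G h c) = translate G (g \<otimes> h) c"
  using assms(3) by (induction rule: chains_induct) (auto simp: assms(1,2) translate_diff m_assoc)

lemma translate_one: "c \<in> fchains G X \<Longrightarrow> translate G \<one> c = c"
  by (induction rule: chains_induct) (auto simp: translate_diff)

lemma translate_inv:
  assumes "g \<in> carrier G" "c \<in> fchains G X"
  shows "translate G (inv g) (translate G g c) = c" "translate G g (translate G (inv g) c) = c"
  using assms by (simp_all add: translate_translate translate_one)

lemma equivariant_frag_extend: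
  assumes "equivariant G X p" "g \<in> carrier G" "c \<in> fchains G X"
  shows "frag_extend p (translate G g c) = translate G g (frag_extend p c)"
  using assms(3) by (induction rule: chains_induct)
     (use assms in \<open>auto simp: translate_diff frag_extend_diff equivariant_def\<close>)

lemma equivariant_fin_map:
  assumes "equivariant G X p" "\<And>g x. g \<in> carrier G \<Longrightarrow> x \<in> X \<Longrightarrow> p (g, x) \<in> fchains G Y"
  shows "fin_map G X Y p"
  unfolding fin_map_def
proof safe
  fix x assume x: "x \<in> X"
  have "translate G (inv g) (p (g, x)) = p (\<one>, x)" if "g \<in> carrier G" for g
  proof -
    have "p (g, x) = translate G g (p (\<one>, x))"
      using assms(1) that x unfolding equivariant_def by (metis one_closed r_one)
    then show ?thesis using that x assms(2)[of \<one> x] by (simp add: translate_inv)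
  qed
  then have "(\<lambda>g. translate G (inv g) (p (g, x))) ` carrier G \<subseteq> {p (\<one>, x)}" by auto
  then show "finite ((\<lambda>g. translate G (inv g) (p (g, x))) ` carrier G)"
    by (rule finite_subset) simp
qed (use assms in auto)

lemma fin_map_closed: "fin_map G X Y p \<Longrightarrow> g \<in> carrier G \<Longrightarrow> x \<in> X \<Longrightarrow> p (g, x) \<in> fchains G Y"
  by (simp add: fin_map_def)

lemma fin_map_chains: "fin_map G X Y p \<Longrightarrow> c \<in> fchains G X \<Longrightarrow> frag_extend p c \<in> fchains G Y"
  by (intro frag_extend_chains) (auto simp: fin_map_def)

text \<open>The form in which finitarity is usually established: the value at gx is the g-translate
  of a chain from a finite supply that depends on x only.\<close>

lemma fin_mapI:
  assumes "\<And>g x. g \<in> carrier G \<Longrightarrow> x \<in> X \<Longrightarrow> finite (S x) \<and> (\<exists>c\<in>S x. c \<in> fchains G Y \<and> p (g, x) = translate G g c)"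
  shows "fin_map G X Y p"
  unfolding fin_map_def
proof safe
  fix g x assume "g \<in> carrier G" "x \<in> X"
  then show "p (g, x) \<in> fchains G Y" using assms[of g x] by (auto simp: translate_closed)
next
  fix x assume x: "x \<in> X"
  have "(\<lambda>g. translate G (inv g) (p (g, x))) ` carrier G \<subseteq> S x"
  proof safe
    fix g assume "g \<in> carrier G"
    then show "translate G (inv g) (p (g, x)) \<in> S x" using assms[of g x] x by (auto simp: translate_inv)
  qed
  then show "finite ((\<lambda>g. translate G (inv g) (p (g, x))) ` carrier G)"
    using assms[OF one_closed x] by (auto intro: finite_subset)
qed

text \<open>At hx the conjugate by g is the h-translate of the value at ghx normalised by
  \<open>inv (g \<otimes> h)\<close>, and those values are finite in number; differences of finitely
  many chains are finitely many. This finiteness is what gives conjugates of a finitary map a limit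
  along an ultrafilter.\<close>

lemma fin_map_conj_finite:
  assumes p: "fin_map G X Y p" and c: "c \<in> fchains G X"
  shows "finite ((\<lambda>g. translate G (inv g) (frag_extend p (translate G g c))) ` carrier G)"
  using c
proof (induction rule: chains_induct)
  case zero
  show ?case by (simp add: finite_image_iff image_constant_conv)
next
  case (of h x)
  have "(\<lambda>g. translate G (inv g) (frag_extend p (translate G g (frag_of (h, x))))) ` carrier G
    \<subseteq> translate G h ` (\<lambda>g. translate G (inv g) (p (g, x))) ` carrier G"
  proof safe
    fix g assume g: "g \<in> carrier G"
    have "translate G (inv g) (p (g \<otimes> h, x)) = translate G h (translate G (inv (g \<otimes> h)) (p (g \<otimes> h, x)))"
      using g of fin_map_closed[OF p, of "g \<otimes> h" x]
      by (simp add: translate_translate inv_mult_group m_assoc[symmetric])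
    then show "translate G (inv g) (frag_extend p (translate G g (frag_of (h, x)))) \<in>
        translate G h ` (\<lambda>g. translate G (inv g) (p (g, x))) ` carrier G"
      using g of by auto
  qed
  moreover have "finite ((\<lambda>g. translate G (inv g) (p (g, x))) ` carrier G)"
    using p of by (simp add: fin_map_def)
  ultimately show ?case by (meson finite_imageI finite_subset)
next
  case (diff a b)
  let ?f = "\<lambda>c g. translate G (inv g) (frag_extend p (translate G g c))"
  have "?f (a - b) ` carrier G \<subseteq> (\<lambda>(u, v). u - v) ` (?f a ` carrier G \<times> ?f b ` carrier G)"
    by (auto simp: translate_diff frag_extend_diff)
  then show ?case using diff.IH by (meson finite_SigmaI finite_imageI finite_subset)
qed

text \<open>The inner map has finitely many normalised values c, and by
  \<open>fin_map_conj_finite\<close> the outer one has finitely many conjugates at each such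
  c.\<close>

lemma fin_map_comp:
  assumes p: "fin_map G X Y p" and q: "fin_map G Y Z q"
  shows "fin_map G X Z (\<lambda>y. frag_extend q (p y))"
  unfolding fin_map_def
proof safe
  fix g x assume "g \<in> carrier G" "x \<in> X"
  then show "frag_extend q (p (g, x)) \<in> fchains G Z" using p q by (simp add: fin_map_chains fin_map_closed)
next
  fix x assume x: "x \<in> X"
  let ?S = "(\<lambda>g. translate G (inv g) (p (g, x))) ` carrier G"
  let ?T = "\<lambda>c. (\<lambda>g. translate G (inv g) (frag_extend q (translate G g c))) ` carrier G"
  have "finite ?S" using p x by (simp add: fin_map_def)
  moreover have "finite (?T c)" if "c \<in> ?S" for c
    using that p x by (auto intro!: fin_map_conj_finite[OF q] translate_closed simp: fin_map_def)
  ultimately have "finite (\<Union>c\<in>?S. ?T c)" by blast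
  moreover have "(\<lambda>g. translate G (inv g) (frag_extend q (p (g, x)))) ` carrier G \<subseteq> (\<Union>c\<in>?S. ?T c)"
  proof safe
    fix g assume g: "g \<in> carrier G"
    have "p (g, x) = translate G g (translate G (inv g) (p (g, x)))"
      using g x fin_map_closed[OF p, of g x] by (simp add: translate_inv)
    then have "translate G (inv g) (frag_extend q (p (g, x))) \<in> ?T (translate G (inv g) (p (g, x)))"
      using g by (intro image_eqI[of _ _ g]) simp_all
    then show "translate G (inv g) (frag_extend q (p (g, x))) \<in> (\<Union>c\<in>?S. ?T c)"
      using g by blast
  qed
  ultimately show "finite ((\<lambda>g. translate G (inv g) (frag_extend q (p (g, x)))) ` carrier G)"
    by (rule finite_subset[rotated])
qed

lemma fin_map_diff:
  assumes p: "fin_map G X Y p" and q: "fin_map G X Y q"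
  shows "fin_map G X Y (\<lambda>y. p y - q y)"
  unfolding fin_map_def
proof safe
  fix x assume x: "x \<in> X"
  let ?f = "\<lambda>p g. translate G (inv g) (p (g, x))"
  have "?f (\<lambda>y. p y - q y) ` carrier G \<subseteq> (\<lambda>(u, v). u - v) ` (?f p ` carrier G \<times> ?f q ` carrier G)"
    by (auto simp: translate_diff)
  then show "finite (?f (\<lambda>y. p y - q y) ` carrier G)"
    using assms x unfolding fin_map_def by (meson finite_SigmaI finite_imageI finite_subset)
qed (use assms in \<open>auto simp: fin_map_def intro: chains_diff\<close>)

lemma fin_map_zero: "fin_map G X Y (\<lambda>_. 0)"
  by (intro fin_mapI[of _ "\<lambda>_. {0}"]) auto

lemma fin_map_frag_of: "fin_map G X X frag_of"
  by (intro equivariant_fin_map) (auto simp: equivariant_def)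

lemma fin_map_add:
  assumes p: "fin_map G X Y p" and q: "fin_map G X Y q"
  shows "fin_map G X Y (\<lambda>y. p y + q y)"
  using fin_map_diff[OF p fin_map_diff[OF fin_map_zero q]] by simp

lemma fin_map_cong:
  assumes "fin_map G X Y p" "\<And>g x. g \<in> carrier G \<Longrightarrow> x \<in> X \<Longrightarrow> p (g, x) = q (g, x)"
  shows "fin_map G X Y q"
proof -
  have "(\<lambda>g. translate G (inv g) (q (g, x))) ` carrier G = (\<lambda>g. translate G (inv g) (p (g, x))) ` carrier G"
    if "x \<in> X" for x using assms(2) that by (intro image_cong) auto
  moreover have "q (g, x) \<in> fchains G Y" if "g \<in> carrier G" "x \<in> X" for g x
    using fin_map_closed[OF assms(1) that] assms(2)[OF that] by simp
  ultimately show ?thesis using assms(1) unfolding fin_map_def by simp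
qed

text \<open>\<open>K\<close> collects the supports of the finitely many normalised values, so one
  finite set serves for all g. The bounded loss of height, the finiteness of columns and the
  convergence of infinite sums are all drawn from it.\<close>

lemma fin_map_support:
  assumes p: "fin_map G X Y p" and X0: "finite X0" "X0 \<subseteq> X"
  obtains K where "finite K" "K \<subseteq> carrier G \<times> Y"
    "\<forall>g\<in>carrier G. \<forall>x\<in>X0. \<forall>g' y. (g', y) \<in> Poly_Mapping.keys (p (g, x)) \<longrightarrow>
       (\<exists>h. (h, y) \<in> K \<and> g' = g \<otimes> h)"
proof
  let ?K = "\<Union>x\<in>X0. \<Union>g\<in>carrier G. Poly_Mapping.keys (translate G (inv g) (p (g, x)))"
  have *: "finite (\<Union>g\<in>carrier G. Poly_Mapping.keys (translate G (inv g) (p (g, x))))" if "x \<in> X0" for x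
  proof -
    have "finite ((\<lambda>g. translate G (inv g) (p (g, x))) ` carrier G)"
      using p X0 that by (auto simp: fin_map_def)
    then have "finite (\<Union>c\<in>(\<lambda>g. translate G (inv g) (p (g, x))) ` carrier G. Poly_Mapping.keys c)"
      by (rule finite_UN_I) simp
    then show ?thesis by simp
  qed
  show "finite ?K" by (rule finite_UN_I[OF X0(1)]) (erule *)
  have "Poly_Mapping.keys (translate G (inv g) (p (g, x))) \<subseteq> carrier G \<times> Y"
    if "g \<in> carrier G" "x \<in> X0" for g x
    using translate_closed[OF inv_closed[OF that(1)] fin_map_closed[OF p that(1)]] that X0
    by (auto simp: fchains_def)
  then show "?K \<subseteq> carrier G \<times> Y" by (intro UN_least)
  show "\<forall>g\<in>carrier G. \<forall>x\<in>X0. \<forall>g' y. (g', y) \<in> Poly_Mapping.keys (p (g, x)) \<longrightarrow>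
       (\<exists>h. (h, y) \<in> ?K \<and> g' = g \<otimes> h)"
  proof (intro ballI allI impI)
    fix g x g' y assume g: "g \<in> carrier G" "x \<in> X0" "(g', y) \<in> Poly_Mapping.keys (p (g, x))"
    have "p (g, x) = translate G g (translate G (inv g) (p (g, x)))"
      using g X0 fin_map_closed[OF p, of g x] by (auto simp: translate_inv)
    with g(3) have "(g', y) \<in> (\<lambda>(h, x). (g \<otimes> h, x)) ` Poly_Mapping.keys (translate G (inv g) (p (g, x)))"
      using keys_translate[of G g "translate G (inv g) (p (g, x))"] by auto
    then obtain h where "(h, y) \<in> Poly_Mapping.keys (translate G (inv g) (p (g, x)))" "g' = g \<otimes> h"
      by auto
    then show "\<exists>h. (h, y) \<in> ?K \<and> g' = g \<otimes> h" using g(1,2) by (intro exI[of _ h] conjI UN_I)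
  qed
qed

end

subsection \<open>Lifting finitary maps\<close>

text \<open>The preimage is chosen for the normalised value and translated back afterwards. Equal
  normalised values thereby get equal preimages, so the lift stays finitary; independent choices at
  the various gx would not guarantee this.\<close>

definition lift ::
    "('g, 'b) monoid_scheme \<Rightarrow> 'v set \<Rightarrow> (('g \<times> 'v) \<Rightarrow> (('g \<times> 'z) \<Rightarrow>\<^sub>0 int)) \<Rightarrow>
      (('g \<times> 'x) \<Rightarrow> (('g \<times> 'z) \<Rightarrow>\<^sub>0 int)) \<Rightarrow> (('g \<times> 'x) \<Rightarrow> (('g \<times> 'v) \<Rightarrow>\<^sub>0 int))" where
  "lift G V E q = (\<lambda>(g, x). translate G g
     (SOME c. c \<in> fchains G V \<and> frag_extend E c = translate G (inv\<^bsub>G\<^esub> g) (q (g, x))))"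

context group
begin

lemma lift:
  assumes q: "fin_map G X Z q" and E: "equivariant G V E" "fin_map G V Z E"
    and ex: "\<And>g x. g \<in> carrier G \<Longrightarrow> x \<in> X \<Longrightarrow> \<exists>c\<in>fchains G V. frag_extend E c = q (g, x)"
  shows "fin_map G X V (lift G V E q)"
    and "\<And>g x. g \<in> carrier G \<Longrightarrow> x \<in> X \<Longrightarrow> frag_extend E (lift G V E q (g, x)) = q (g, x)"
proof -
  define P where "P u = (SOME c. c \<in> fchains G V \<and> frag_extend E c = u)" for u
  have P: "P (translate G (inv g) (q (g, x))) \<in> fchains G V \<and>
      frag_extend E (P (translate G (inv g) (q (g, x)))) = translate G (inv g) (q (g, x))"
    if gx: "g \<in> carrier G" "x \<in> X" for g x
  proof -
    obtain c where "c \<in> fchains G V" "frag_extend E c = q (g, x)" using ex gx by blast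
    then have "\<exists>c. c \<in> fchains G V \<and> frag_extend E c = translate G (inv g) (q (g, x))"
      using gx E by (intro exI[of _ "translate G (inv g) c"]) (simp add: equivariant_frag_extend translate_closed)
    then show ?thesis unfolding P_def by (rule someI_ex)
  qed
  have l: "lift G V E q (g, x) = translate G g (P (translate G (inv g) (q (g, x))))" for g x
    by (simp add: lift_def P_def)
  show "fin_map G X V (lift G V E q)"
  proof (rule fin_mapI)
    fix g x assume "g \<in> carrier G" "x \<in> X"
    then show "finite (P ` (\<lambda>g. translate G (inv g) (q (g, x))) ` carrier G) \<and>
      (\<exists>c\<in>P ` (\<lambda>g. translate G (inv g) (q (g, x))) ` carrier G. c \<in> fchains G V \<and> lift G V E q (g, x) = translate G g c)"
      using q P[of g x] by (auto simp: l fin_map_def)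
  qed
  fix g x assume gx: "g \<in> carrier G" "x \<in> X"
  show "frag_extend E (lift G V E q (g, x)) = q (g, x)"
    using P[OF gx] gx E fin_map_closed[OF q gx]
    by (simp add: l equivariant_frag_extend translate_inv)
qed

end

text \<open>The resolved module enters only through the image of \<open>D\<close> in degree \<open>0\<close>, so it is left out.\<close>

locale free_complex = group G for G (structure) +
  fixes X :: "nat \<Rightarrow> 'x set" and D :: "('g \<times> 'x) \<Rightarrow> (('g \<times> 'x) \<Rightarrow>\<^sub>0 int)"
  assumes D_equivariant: "equivariant G (X (Suc k)) D"
    and D_closed: "g \<in> carrier G \<Longrightarrow> x \<in> X (Suc k) \<Longrightarrow> D (g, x) \<in> fchains G (X k)"
    and D_D: "g \<in> carrier G \<Longrightarrow> x \<in> X (Suc (Suc k)) \<Longrightarrow> frag_extend D (D (g, x)) = 0"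
    and D_exact: "c \<in> fchains G (X (Suc k)) \<Longrightarrow> frag_extend D c = 0 \<Longrightarrow>
       \<exists>c'\<in>fchains G (X (Suc (Suc k))). frag_extend D c' = c"
begin

lemma D_fin_map: "fin_map G (X (Suc k)) (X k) D"
  by (intro equivariant_fin_map D_equivariant D_closed)

lemma D_D_chains: "c \<in> fchains G (X (Suc (Suc k))) \<Longrightarrow> frag_extend D (frag_extend D c) = 0"
  by (induction rule: chains_induct) (auto simp: frag_extend_diff D_D)

lemma lift_D:
  assumes "fin_map G V (X k) q"
    and "\<And>g x. g \<in> carrier G \<Longrightarrow> x \<in> V \<Longrightarrow> \<exists>c\<in>fchains G (X (Suc k)). frag_extend D c = q (g, x)"
  shows "fin_map G V (X (Suc k)) (lift G (X (Suc k)) D q)"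
    and "\<And>g x. g \<in> carrier G \<Longrightarrow> x \<in> V \<Longrightarrow> frag_extend D (lift G (X (Suc k)) D q (g, x)) = q (g, x)"
  using lift[OF assms(1) D_equivariant D_fin_map] assms(2) by blast+

end

section \<open>Chain homotopies and comparison maps made of finitary maps\<close>

primrec homotopy ::
    "('g, 'b) monoid_scheme \<Rightarrow> (nat \<Rightarrow> 'y set) \<Rightarrow> (('g \<times> 'y) \<Rightarrow> (('g \<times> 'y) \<Rightarrow>\<^sub>0 int)) \<Rightarrow> (('g \<times> 'x) \<Rightarrow> (('g \<times> 'x) \<Rightarrow>\<^sub>0 int))
     \<Rightarrow> (nat \<Rightarrow> ('g \<times> 'x) \<Rightarrow> (('g \<times> 'y) \<Rightarrow>\<^sub>0 int)) \<Rightarrow> nat \<Rightarrow> ('g \<times> 'x) \<Rightarrow> (('g \<times> 'y) \<Rightarrow>\<^sub>0 int)" where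
  "homotopy G Y E D f 0 = lift G (Y (Suc 0)) E (f 0)"
| "homotopy G Y E D f (Suc k) =
     lift G (Y (Suc (Suc k))) E (\<lambda>y. f (Suc k) y - frag_extend (homotopy G Y E D f k) (D y))"

primrec lift_chain_map ::
    "('g, 'b) monoid_scheme \<Rightarrow> (nat \<Rightarrow> 'y set) \<Rightarrow> (('g \<times> 'y) \<Rightarrow> (('g \<times> 'y) \<Rightarrow>\<^sub>0 int)) \<Rightarrow> (('g \<times> 'x) \<Rightarrow> (('g \<times> 'x) \<Rightarrow>\<^sub>0 int))
     \<Rightarrow> (('g \<times> 'x) \<Rightarrow> (('g \<times> 'y) \<Rightarrow>\<^sub>0 int)) \<Rightarrow> nat \<Rightarrow> ('g \<times> 'x) \<Rightarrow> (('g \<times> 'y) \<Rightarrow>\<^sub>0 int)" where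
  "lift_chain_map G Y E D u 0 = u"
| "lift_chain_map G Y E D u (Suc k) =
     lift G (Y (Suc k)) E (\<lambda>y. frag_extend (lift_chain_map G Y E D u k) (D y))"

context
  fixes G (structure) and X :: "nat \<Rightarrow> 'x set" and D and Y :: "nat \<Rightarrow> 'y set" and E
  assumes X: "free_complex G X D" and Y: "free_complex G Y E"
begin

interpretation X: free_complex G X D by (rule X)
interpretation Y: free_complex G Y E by (rule Y)

text \<open>The recursion solves \<open>E s + s D = f\<close> for a chain map f that is a boundary
  in degree 0. The chain to be lifted is a cycle, because \<open>E s\<close> at \<open>D y\<close>
  is \<open>f (D y)\<close> up to a term containing \<open>D D\<close>. In the applications f is the
  difference of a chain map and the identity; the bound \<open>N\<close> allows for chain maps known
  only in low degrees.\<close>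

lemma homotopy:
  assumes f: "\<And>k. k < N \<Longrightarrow> fin_map G (X k) (Y k) (f k)"
    and f0: "\<And>g x. g \<in> carrier G \<Longrightarrow> x \<in> X 0 \<Longrightarrow> \<exists>c\<in>fchains G (Y 1). frag_extend E c = f 0 (g, x)"
    and ch: "\<And>k g x. Suc k < N \<Longrightarrow> g \<in> carrier G \<Longrightarrow> x \<in> X (Suc k) \<Longrightarrow>
        frag_extend E (f (Suc k) (g, x)) = frag_extend (f k) (D (g, x))"
    and k: "k < N"
  defines "s \<equiv> homotopy G Y E D f"
  shows "fin_map G (X k) (Y (Suc k)) (s k)"
    and "\<And>g x. g \<in> carrier G \<Longrightarrow> x \<in> X k \<Longrightarrow>
       frag_extend E (s k (g, x)) = (case k of 0 \<Rightarrow> f 0 (g, x) | Suc j \<Rightarrow> f k (g, x) - frag_extend (s j) (D (g, x)))"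
proof -
  have "fin_map G (X k) (Y (Suc k)) (s k) \<and> (\<forall>g\<in>carrier G. \<forall>x\<in>X k.
       frag_extend E (s k (g, x)) = (case k of 0 \<Rightarrow> f 0 (g, x) | Suc j \<Rightarrow> f k (g, x) - frag_extend (s j) (D (g, x))))"
    using k
  proof (induction k)
    case 0
    show ?case using Y.lift_D[OF f[OF 0]] f0 by (simp add: s_def)
  next
    case (Suc k)
    let ?q = "\<lambda>y. f (Suc k) y - frag_extend (s k) (D y)"
    have IH: "fin_map G (X k) (Y (Suc k)) (s k)"
      "\<And>g x. g \<in> carrier G \<Longrightarrow> x \<in> X k \<Longrightarrow> frag_extend E (s k (g, x)) =
        (case k of 0 \<Rightarrow> f 0 (g, x) | Suc j \<Rightarrow> f k (g, x) - frag_extend (s j) (D (g, x)))"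
      using Suc by auto
    have q: "fin_map G (X (Suc k)) (Y (Suc k)) ?q"
      by (intro X.fin_map_diff f Suc X.fin_map_comp[OF X.D_fin_map] IH)
    have "frag_extend E (?q (g, x)) = 0" if gx: "g \<in> carrier G" "x \<in> X (Suc k)" for g x
    proof -
      have "frag_extend E (frag_extend (s k) (D (g, x))) = frag_extend (\<lambda>y. frag_extend E (s k y)) (D (g, x))"
        by (simp add: frag_extend_frag_extend)
      also have "\<dots> = frag_extend (\<lambda>y. case k of 0 \<Rightarrow> f 0 y | Suc j \<Rightarrow> f k y - frag_extend (s j) (D y)) (D (g, x))"
        by (rule frag_extend_cong_chains[OF X.D_closed[OF gx]]) (use IH in auto)
      also have "\<dots> = frag_extend (f k) (D (g, x))"
      proof (cases k)
        case (Suc j)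
        have "frag_extend (\<lambda>y. frag_extend (s j) (D y)) (D (g, x)) = frag_extend (s j) (frag_extend D (D (g, x)))"
          by (simp add: frag_extend_frag_extend)
        then show ?thesis using X.D_D gx Suc by (simp add: frag_extend_fun_diff)
      qed auto
      finally show ?thesis using ch[of k] Suc.prems gx by (simp add: frag_extend_diff)
    qed
    then have "\<exists>c\<in>fchains G (Y (Suc (Suc k))). frag_extend E c = ?q (g, x)" if "g \<in> carrier G" "x \<in> X (Suc k)" for g x
      using that Y.D_exact[OF X.fin_map_closed[OF q that]] by blast
    from Y.lift_D[OF q this] show ?case by (simp add: s_def)
  qed
  then show "fin_map G (X k) (Y (Suc k)) (s k)"
    and "\<And>g x. g \<in> carrier G \<Longrightarrow> x \<in> X k \<Longrightarrow>
       frag_extend E (s k (g, x)) = (case k of 0 \<Rightarrow> f 0 (g, x) | Suc j \<Rightarrow> f k (g, x) - frag_extend (s j) (D (g, x)))"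
    by auto
qed

text \<open>The comparison theorem for resolutions, with finitary maps in place of linear
  ones.\<close>

lemma lift_chain_map:
  assumes u: "fin_map G (X 0) (Y 0) u"
    and u0: "\<And>g x. g \<in> carrier G \<Longrightarrow> x \<in> X 1 \<Longrightarrow> \<exists>c\<in>fchains G (Y 1). frag_extend E c = frag_extend u (D (g, x))"
  defines "U \<equiv> lift_chain_map G Y E D u"
  shows "fin_map G (X k) (Y k) (U k)"
    and "\<And>g x. g \<in> carrier G \<Longrightarrow> x \<in> X (Suc k) \<Longrightarrow> frag_extend E (U (Suc k) (g, x)) = frag_extend (U k) (D (g, x))"
proof -
  have step: "fin_map G (X (Suc k)) (Y (Suc k)) (U (Suc k)) \<and>
      (\<forall>g\<in>carrier G. \<forall>x\<in>X (Suc k). frag_extend E (U (Suc k) (g, x)) = frag_extend (U k) (D (g, x)))"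
    if k: "fin_map G (X k) (Y k) (U k)"
      and ex: "\<And>g x. g \<in> carrier G \<Longrightarrow> x \<in> X (Suc k) \<Longrightarrow>
        \<exists>c\<in>fchains G (Y (Suc k)). frag_extend E c = frag_extend (U k) (D (g, x))" for k
    using Y.lift_D[OF X.fin_map_comp[OF X.D_fin_map k] ex] by (simp add: U_def)
  \<comment> \<open>Two consecutive degrees are carried along: that the next chain to be lifted is a
    cycle follows from the commutation one degree below.\<close>
  have "fin_map G (X k) (Y k) (U k) \<and> fin_map G (X (Suc k)) (Y (Suc k)) (U (Suc k)) \<and>
      (\<forall>g\<in>carrier G. \<forall>x\<in>X (Suc k). frag_extend E (U (Suc k) (g, x)) = frag_extend (U k) (D (g, x)))"
    for k
  proof (induction k)
    case 0
    show ?case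
      using u step[of 0] u0 by (simp add: U_def)
  next
    case (Suc k)
    have "frag_extend E (frag_extend (U (Suc k)) (D (g, x))) = 0"
      if gx: "g \<in> carrier G" "x \<in> X (Suc (Suc k))" for g x
    proof -
      have "frag_extend E (frag_extend (U (Suc k)) (D (g, x))) = frag_extend (\<lambda>y. frag_extend E (U (Suc k) y)) (D (g, x))"
        by (simp add: frag_extend_frag_extend)
      also have "\<dots> = frag_extend (\<lambda>y. frag_extend (U k) (D y)) (D (g, x))"
        by (rule frag_extend_cong_chains[OF X.D_closed[OF gx]]) (use Suc in auto)
      also have "\<dots> = frag_extend (U k) (frag_extend D (D (g, x)))"
        by (simp add: frag_extend_frag_extend)
      finally show ?thesis using X.D_D[OF gx] by simp
    qed
    then have "\<exists>c\<in>fchains G (Y (Suc (Suc k))). frag_extend E c = frag_extend (U (Suc k)) (D (g, x))"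
      if "g \<in> carrier G" "x \<in> X (Suc (Suc k))" for g x
      using that Suc X.D_closed[OF that] by (intro Y.D_exact X.fin_map_chains) auto
    then show ?case using Suc step[of "Suc k"] by blast
  qed
  then show "fin_map G (X k) (Y k) (U k)"
    and "\<And>g x. g \<in> carrier G \<Longrightarrow> x \<in> X (Suc k) \<Longrightarrow> frag_extend E (U (Suc k) (g, x)) = frag_extend (U k) (D (g, x))"
    by blast+
qed

end

section \<open>Ultrafilters\<close>

definition ultrafilter :: "'i filter \<Rightarrow> bool" where
  "ultrafilter U \<longleftrightarrow> U \<noteq> bot \<and> (\<forall>P. eventually P U \<or> eventually (\<lambda>x. \<not> P x) U)"

text \<open>Zorn's lemma among the proper filters below F. The infimum of a chain is proper, since
  falsehood would hold eventually in one of its members already. A minimal proper filter that does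
  not exclude P is not changed by adding P, hence contains it.\<close>

lemma ultrafilter_le_exists:
  assumes "F \<noteq> bot" shows "\<exists>U. ultrafilter U \<and> U \<le> F"
proof -
  let ?A = "{F'. F' \<noteq> bot \<and> F' \<le> F}"
  let ?R = "relation_of (\<lambda>a b. b \<le> a) ?A"
  have "\<exists>m\<in>?A. \<forall>a\<in>?A. a \<le> m \<longrightarrow> a = m"
  proof (rule predicate_Zorn)
    show "partial_order_on ?A ?R"
      by (intro partial_order_on_relation_ofI) auto
    fix C assume C: "C \<in> Chains ?R"
    then have CA: "C \<subseteq> ?A" and lin: "a \<le> b \<or> b \<le> a" if "a \<in> C" "b \<in> C" for a b
      using that by (auto simp: Chains_def relation_of_def)
    show "\<exists>u\<in>?A. \<forall>a\<in>C. u \<le> a"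
    proof (cases "C = {}")
      case True
      then show ?thesis using assms by auto
    next
      case False
      have CA: "C \<subseteq> ?A" using C by (auto simp: Chains_def relation_of_def)
      have "eventually (\<lambda>_. False) (Inf C) \<longleftrightarrow> (\<exists>b\<in>C. eventually (\<lambda>_. False) b)"
      proof (rule eventually_Inf_base[OF False])
        fix a b assume ab: "a \<in> C" "b \<in> C"
        then have "a \<le> b \<or> b \<le> a" by (rule lin)
        then show "\<exists>x\<in>C. x \<le> inf a b"
        proof
          assume "a \<le> b" then show ?thesis using ab by (intro bexI[of _ a]) auto
        next
          assume "b \<le> a" then show ?thesis using ab by (intro bexI[of _ b]) auto
        qed
      qed
      then have "Inf C \<noteq> bot" using CA by (auto simp: trivial_limit_def)
      moreover obtain c where "c \<in> C" using False by blast
      then have "Inf C \<le> F" using CA by (intro order_trans[OF Inf_lower]) auto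
      ultimately show ?thesis by (intro bexI[of _ "Inf C"]) (auto intro: Inf_lower)
    qed
  qed
  then obtain U where U: "U \<noteq> bot" "U \<le> F" and min: "\<forall>a\<in>?A. a \<le> U \<longrightarrow> a = U" by blast
  have "eventually P U \<or> eventually (\<lambda>x. \<not> P x) U" for P
  proof (rule disjCI)
    assume "\<not> eventually (\<lambda>x. \<not> P x) U"
    then have "inf U (principal {x. P x}) \<noteq> bot"
      by (simp add: trivial_limit_def eventually_inf_principal)
    then have "inf U (principal {x. P x}) = U"
      using min U(2) by (simp add: le_infI1)
    moreover have "eventually P (inf U (principal {x. P x}))"
      by (simp add: eventually_inf_principal)
    ultimately show "eventually P U" by simp
  qed
  then show ?thesis using U by (auto simp: ultrafilter_def)
qed

text \<open>The finite intersection property. It is applied to the complements of the sets of g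
  served by a given correction, and to the traces of the neighbourhoods of a boundary point.\<close>

lemma ultrafilter_exists:
  assumes "\<And>C. finite C \<Longrightarrow> C \<subseteq> I \<Longrightarrow> \<exists>a. \<forall>c\<in>C. a \<in> S c"
  obtains U where "ultrafilter U" "\<forall>c\<in>I. eventually (\<lambda>a. a \<in> S c) U"
proof -
  have "(INF c\<in>I. principal (S c)) \<noteq> bot"
  proof (rule INF_filter_not_bot)
    fix C assume C: "C \<subseteq> I" "finite C"
    have "(INF c\<in>C. principal (S c)) = principal (\<Inter>c\<in>C. S c)"
      by (rule INF_principal_finite[OF C(2)])
    then show "(INF c\<in>C. principal (S c)) \<noteq> bot" using assms[OF C(2,1)] by (auto simp: principal_eq_bot_iff)
  qed
  then obtain U where U: "ultrafilter U" "U \<le> (INF c\<in>I. principal (S c))"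
    using ultrafilter_le_exists by blast
  have "eventually (\<lambda>a. a \<in> S c) U" if "c \<in> I" for c
  proof -
    have "U \<le> principal (S c)" using U(2) INF_lower[OF that, of "\<lambda>c. principal (S c)"] by (rule order_trans)
    then show ?thesis by (simp add: le_principal)
  qed
  then show thesis using U(1) that by blast
qed

lemma ultrafilter_not_bot: "ultrafilter U \<Longrightarrow> U \<noteq> bot"
  by (simp add: ultrafilter_def)

text \<open>This makes finitary data eventually constant, so that their limit is one of the values
  actually taken and every identity among finitely many of them survives.\<close>

lemma ultrafilter_finite_range:
  assumes U: "ultrafilter U" and S: "finite S" "eventually (\<lambda>i. f i \<in> S) U"
  obtains v where "v \<in> S" "eventually (\<lambda>i. f i = v) U"
proof -
  have "\<exists>v\<in>S. eventually (\<lambda>i. f i = v) U"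
  proof (rule ccontr)
    assume "\<not> ?thesis"
    then have "\<forall>v\<in>S. eventually (\<lambda>i. f i \<noteq> v) U" using U by (auto simp: ultrafilter_def)
    then have "eventually (\<lambda>i. \<forall>v\<in>S. f i \<noteq> v) U" using S(1) by (simp add: eventually_ball_finite)
    with S(2) have "eventually (\<lambda>i. False) U" by eventually_elim auto
    then show False using U by (simp add: ultrafilter_def trivial_limit_def)
  qed
  then show thesis using that by blast
qed

lemma ultrafilter_tendsto_compact:
  fixes f :: "'i \<Rightarrow> 'm::topological_space"
  assumes U: "ultrafilter U" and S: "compact S" "eventually (\<lambda>i. f i \<in> S) U"
  obtains l where "l \<in> S" "(f \<longlongrightarrow> l) U"
proof -
  have "\<exists>l\<in>S. (f \<longlongrightarrow> l) U"
  proof (rule ccontr)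
    assume "\<not> ?thesis"
    then have *: "\<forall>l\<in>S. \<exists>N. open N \<and> l \<in> N \<and> \<not> eventually (\<lambda>i. f i \<in> N) U"
      unfolding tendsto_def by auto
    define \<N> where "\<N> = {N. open N \<and> \<not> eventually (\<lambda>i. f i \<in> N) U}"
    have sub: "S \<subseteq> \<Union>\<N>" using * by (auto simp: \<N>_def)
    have op: "open N" if "N \<in> \<N>" for N using that by (simp add: \<N>_def)
    obtain \<C> where \<C>: "\<C> \<subseteq> \<N>" "finite \<C>" "S \<subseteq> \<Union>\<C>"
      by (rule compactE[OF S(1) sub op])
    have "\<forall>N\<in>\<C>. eventually (\<lambda>i. f i \<notin> N) U" using U \<C>(1) by (auto simp: ultrafilter_def \<N>_def)
    then have "eventually (\<lambda>i. \<forall>N\<in>\<C>. f i \<notin> N) U" using \<C>(2) by (simp add: eventually_ball_finite)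
    with S(2) have "eventually (\<lambda>i. False) U"
      by eventually_elim (use \<C>(3) in blast)
    then show False using U by (simp add: ultrafilter_def trivial_limit_def)
  qed
  then show thesis using that by blast
qed

section \<open>Novikov chains\<close>

text \<open>In the application \<open>\<beta> g\<close> is the value of a Busemann function at the translate \<open>gb\<close> of the base point.\<close>

definition height :: "('g, 'b) monoid_scheme \<Rightarrow> ('g \<Rightarrow> real) \<Rightarrow> bool" where
  "height G \<beta> \<longleftrightarrow> (\<forall>h\<in>carrier G. \<exists>L. \<forall>g\<in>carrier G. \<beta> (g \<otimes>\<^bsub>G\<^esub> h) \<ge> \<beta> g - L)"

text \<open>The finite set of columns is imposed because tensoring with a free module of infinite
  rank gives a direct sum of copies of the Novikov module, not a product.\<close>

definition novikov_chains ::
    "('g, 'b) monoid_scheme \<Rightarrow> ('g \<Rightarrow> real) \<Rightarrow> 'x set \<Rightarrow> (('g \<times> 'x) \<Rightarrow> int) set" where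
  "novikov_chains G \<beta> X = {\<sigma>. (\<exists>X0\<subseteq>X. finite X0 \<and> {y. \<sigma> y \<noteq> 0} \<subseteq> carrier G \<times> X0) \<and>
     (\<forall>t. finite {y. \<sigma> y \<noteq> 0 \<and> \<beta> (fst y) < t})}"

text \<open>The index set is finite, so that this is not the junk value \<open>0\<close> of an infinite sum, if \<open>p\<close> is
  finitary and \<open>\<sigma>\<close> lives on finitely many columns \<open>Gx\<close>.\<close>

definition novikov_ext ::
    "(('g \<times> 'x) \<Rightarrow> (('g \<times> 'y) \<Rightarrow>\<^sub>0 int)) \<Rightarrow> (('g \<times> 'x) \<Rightarrow> int) \<Rightarrow> (('g \<times> 'y) \<Rightarrow> int)" where
  "novikov_ext p \<sigma> z =
     (\<Sum>y | \<sigma> y \<noteq> 0 \<and> Poly_Mapping.lookup (p y) z \<noteq> 0. \<sigma> y * Poly_Mapping.lookup (p y) z)"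

text \<open>The zero chain lies above every t, in accordance with the convention that its valuation
  is \<infinity>.\<close>

definition above :: "('g \<Rightarrow> real) \<Rightarrow> real \<Rightarrow> (('g \<times> 'x) \<Rightarrow> int) \<Rightarrow> bool" where
  "above \<beta> t \<sigma> \<longleftrightarrow> (\<forall>y. \<sigma> y \<noteq> 0 \<longrightarrow> t \<le> \<beta> (fst y))"

definition raises ::
    "('g, 'b) monoid_scheme \<Rightarrow> ('g \<Rightarrow> real) \<Rightarrow> 'x set \<Rightarrow> (('g \<times> 'x) \<Rightarrow> (('g \<times> 'y) \<Rightarrow>\<^sub>0 int)) \<Rightarrow> real \<Rightarrow> bool" where
  "raises G \<beta> X p t \<longleftrightarrow>
     (\<forall>g\<in>carrier G. \<forall>x\<in>X. above \<beta> (\<beta> g + t) (Poly_Mapping.lookup (p (g, x))))"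

text \<open>Vanishing of the homology in degree k after tensoring. In degree 0 every chain counts as
  a cycle, as in \<open>Tor\<close>; the augmentation takes no part.\<close>

definition novikov_exact ::
    "('g, 'b) monoid_scheme \<Rightarrow> ('g \<Rightarrow> real) \<Rightarrow> (nat \<Rightarrow> 'x set) \<Rightarrow> (('g \<times> 'x) \<Rightarrow> (('g \<times> 'x) \<Rightarrow>\<^sub>0 int)) \<Rightarrow> nat \<Rightarrow> bool" where
  "novikov_exact G \<beta> X D k \<longleftrightarrow>
     (\<forall>\<sigma>\<in>novikov_chains G \<beta> (X k). (k \<noteq> 0 \<longrightarrow> novikov_ext D \<sigma> = (\<lambda>_. 0)) \<longrightarrow>
        (\<exists>\<tau>\<in>novikov_chains G \<beta> (X (Suc k)). novikov_ext D \<tau> = \<sigma>))"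

lemma above_mono: "above \<beta> t \<sigma> \<Longrightarrow> s \<le> t \<Longrightarrow> above \<beta> s \<sigma>"
  by (force simp: above_def)

lemma above_diff: "above \<beta> t \<sigma> \<Longrightarrow> above \<beta> t \<tau> \<Longrightarrow> above \<beta> t (\<lambda>y. \<sigma> y - \<tau> y)"
  unfolding above_def by (metis diff_zero)

lemma above_add: "above \<beta> t \<sigma> \<Longrightarrow> above \<beta> t \<tau> \<Longrightarrow> above \<beta> t (\<lambda>y. \<sigma> y + \<tau> y)"
  unfolding above_def by (metis add_0)

lemma above_lookup_of: "above \<beta> (\<beta> g) (Poly_Mapping.lookup (frag_of (g, x)))"
  by (auto simp: above_def lookup_frag_of split: if_splits)

lemma above_lookup_extend:
  assumes "raises G \<beta> X p t" "c \<in> fchains G X" "above \<beta> s (Poly_Mapping.lookup c)"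
  shows "above \<beta> (s + t) (Poly_Mapping.lookup (frag_extend p c))"
  unfolding above_def
proof safe
  fix g y assume "Poly_Mapping.lookup (frag_extend p c) (g, y) \<noteq> 0"
  then have "(g, y) \<in> Poly_Mapping.keys (frag_extend p c)" by (simp add: in_keys_iff)
  then obtain h x where hx: "(h, x) \<in> Poly_Mapping.keys c" "(g, y) \<in> Poly_Mapping.keys (p (h, x))"
    using keys_frag_extend[of p c] by fastforce
  then have "s \<le> \<beta> h" "\<beta> h + t \<le> \<beta> g"
    using assms by (auto simp: above_def raises_def fchains_def in_keys_iff subset_iff)
  then show "s + t \<le> \<beta> (fst (g, y))" by simp
qed

lemma raises_comp:
  assumes "raises G \<beta> X p s" "raises G \<beta> Y q t"
    "\<And>g x. g \<in> carrier G \<Longrightarrow> x \<in> X \<Longrightarrow> p (g, x) \<in> fchains G Y"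
  shows "raises G \<beta> X (\<lambda>y. frag_extend q (p y)) (s + t)"
  unfolding raises_def
proof safe
  fix g x assume gx: "g \<in> carrier G" "x \<in> X"
  show "above \<beta> (\<beta> g + (s + t)) (Poly_Mapping.lookup (frag_extend q (p (g, x))))"
    using above_lookup_extend[OF assms(2) assms(3)[OF gx], of "\<beta> g + s"] assms(1) gx
    by (simp add: raises_def add.assoc)
qed

lemma raises_mono: "raises G \<beta> X p t \<Longrightarrow> s \<le> t \<Longrightarrow> raises G \<beta> X p s"
  unfolding raises_def using above_mono by fastforce

lemma raises_subset: "raises G \<beta> X p t \<Longrightarrow> X' \<subseteq> X \<Longrightarrow> raises G \<beta> X' p t"
  unfolding raises_def by blast

lemma novikov_ext_eq_sum:
  assumes "finite R" "\<And>y. y \<notin> R \<Longrightarrow> \<sigma> y \<noteq> 0 \<Longrightarrow> Poly_Mapping.lookup (p y) z = 0"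
  shows "novikov_ext p \<sigma> z = (\<Sum>y\<in>R. \<sigma> y * Poly_Mapping.lookup (p y) z)"
  unfolding novikov_ext_def using assms by (intro sum.mono_neutral_left) auto

lemma novikov_ext_nonzeroE:
  assumes "novikov_ext p \<sigma> z \<noteq> 0"
  obtains y where "\<sigma> y \<noteq> 0" "Poly_Mapping.lookup (p y) z \<noteq> 0"
proof -
  have "{y. \<sigma> y \<noteq> 0 \<and> Poly_Mapping.lookup (p y) z \<noteq> 0} \<noteq> {}"
    using assms unfolding novikov_ext_def by (metis sum.empty)
  then show thesis using that by blast
qed

lemma novikov_ext_lookup: "novikov_ext p (Poly_Mapping.lookup c) = Poly_Mapping.lookup (frag_extend p c)"
proof
  fix z
  show "novikov_ext p (Poly_Mapping.lookup c) z = Poly_Mapping.lookup (frag_extend p c) z"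
    unfolding lookup_frag_extend by (rule novikov_ext_eq_sum) (auto simp: in_keys_iff)
qed

lemma novikov_ext_above:
  assumes "raises G \<beta> X0 p t" "{y. \<sigma> y \<noteq> 0} \<subseteq> carrier G \<times> X0" "above \<beta> s \<sigma>"
  shows "above \<beta> (s + t) (novikov_ext p \<sigma>)"
  unfolding above_def
proof safe
  fix g y assume "novikov_ext p \<sigma> (g, y) \<noteq> 0"
  then obtain w where w: "\<sigma> w \<noteq> 0" "Poly_Mapping.lookup (p w) (g, y) \<noteq> 0"
    by (rule novikov_ext_nonzeroE)
  moreover obtain h x where "w = (h, x)" by fastforce
  ultimately have "s \<le> \<beta> h" "\<beta> h + t \<le> \<beta> g"
    using assms by (auto simp: above_def raises_def subset_iff)
  then show "s + t \<le> \<beta> (fst (g, y))" by simp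
qed

lemma novikov_ext_cong:
  assumes "\<And>y. \<sigma> y \<noteq> 0 \<Longrightarrow> p y = q y" shows "novikov_ext p \<sigma> = novikov_ext q \<sigma>"
  unfolding novikov_ext_def fun_eq_iff using assms by (auto intro!: sum.cong)

lemma novikov_ext_zero [simp]: "novikov_ext p (\<lambda>_. 0) = (\<lambda>_. 0)"
  by (simp add: novikov_ext_def fun_eq_iff)

lemma novikov_chainsE:
  assumes "\<sigma> \<in> novikov_chains G \<beta> X"
  obtains X0 where "X0 \<subseteq> X" "finite X0" "{y. \<sigma> y \<noteq> 0} \<subseteq> carrier G \<times> X0"
  using assms unfolding novikov_chains_def by auto

lemma novikov_ext_cong_on:
  assumes "\<sigma> \<in> novikov_chains G \<beta> X" "\<And>g x. g \<in> carrier G \<Longrightarrow> x \<in> X \<Longrightarrow> p (g, x) = q (g, x)"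
  shows "novikov_ext p \<sigma> = novikov_ext q \<sigma>"
proof (rule novikov_ext_cong)
  fix y assume "\<sigma> y \<noteq> 0"
  moreover obtain X0 where "X0 \<subseteq> X" "{y. \<sigma> y \<noteq> 0} \<subseteq> carrier G \<times> X0" by (rule novikov_chainsE[OF assms(1)])
  ultimately have "y \<in> carrier G \<times> X" by auto
  then have "fst y \<in> carrier G" "snd y \<in> X" by auto
  from assms(2)[OF this] show "p y = q y" by simp
qed

lemma novikov_chainsI:
  assumes "X0 \<subseteq> X" "finite X0" "{y. \<sigma> y \<noteq> 0} \<subseteq> carrier G \<times> X0"
    "\<And>t. finite {y. \<sigma> y \<noteq> 0 \<and> \<beta> (fst y) < t}"
  shows "\<sigma> \<in> novikov_chains G \<beta> X"
  using assms unfolding novikov_chains_def by auto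

lemma novikov_chains_finite:
  "\<sigma> \<in> novikov_chains G \<beta> X \<Longrightarrow> finite {y. \<sigma> y \<noteq> 0 \<and> \<beta> (fst y) < t}"
  by (simp add: novikov_chains_def)

lemma novikov_chains_lookup:
  assumes c: "c \<in> fchains G X" shows "Poly_Mapping.lookup c \<in> novikov_chains G \<beta> X"
proof (rule novikov_chainsI)
  show "finite {y. Poly_Mapping.lookup c y \<noteq> 0 \<and> \<beta> (fst y) < t}" for t
    by (rule finite_subset[of _ "Poly_Mapping.keys c"]) (auto simp: in_keys_iff)
  show "snd ` Poly_Mapping.keys c \<subseteq> X" using c by (auto simp: fchains_def)
  show "{y. Poly_Mapping.lookup c y \<noteq> 0} \<subseteq> carrier G \<times> snd ` Poly_Mapping.keys c"
    using c by (force simp: fchains_def in_keys_iff)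
qed simp

lemma novikov_chains_diff:
  assumes "\<sigma> \<in> novikov_chains G \<beta> X" "\<tau> \<in> novikov_chains G \<beta> X"
  shows "(\<lambda>y. \<sigma> y - \<tau> y) \<in> novikov_chains G \<beta> X"
proof -
  obtain X0 where X0: "X0 \<subseteq> X" "finite X0" "{y. \<sigma> y \<noteq> 0} \<subseteq> carrier G \<times> X0"
    by (rule novikov_chainsE[OF assms(1)])
  obtain X1 where X1: "X1 \<subseteq> X" "finite X1" "{y. \<tau> y \<noteq> 0} \<subseteq> carrier G \<times> X1"
    by (rule novikov_chainsE[OF assms(2)])
  show ?thesis
  proof (rule novikov_chainsI)
    have "{y. \<sigma> y - \<tau> y \<noteq> 0} \<subseteq> {y. \<sigma> y \<noteq> 0} \<union> {y. \<tau> y \<noteq> 0}" by auto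
    also have "\<dots> \<subseteq> carrier G \<times> (X0 \<union> X1)" using X0(3) X1(3) by auto
    finally show "{y. \<sigma> y - \<tau> y \<noteq> 0} \<subseteq> carrier G \<times> (X0 \<union> X1)" .
    show "finite {y. \<sigma> y - \<tau> y \<noteq> 0 \<and> \<beta> (fst y) < t}" for t
      by (rule finite_subset[of _ "{y. \<sigma> y \<noteq> 0 \<and> \<beta> (fst y) < t} \<union> {y. \<tau> y \<noteq> 0 \<and> \<beta> (fst y) < t}"])
        (use assms in \<open>auto simp: novikov_chains_finite\<close>)
  qed (use X0 X1 in auto)
qed

lemma novikov_chains_zero: "(\<lambda>_. 0) \<in> novikov_chains G \<beta> X"
  by (rule novikov_chainsI[of "{}"]) auto

lemma novikov_chains_uminus: "\<sigma> \<in> novikov_chains G \<beta> X \<Longrightarrow> (\<lambda>y. - \<sigma> y) \<in> novikov_chains G \<beta> X"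
  using novikov_chains_diff[OF novikov_chains_zero, of \<sigma>] by simp

lemma novikov_chains_add:
  assumes "\<sigma> \<in> novikov_chains G \<beta> X" "\<tau> \<in> novikov_chains G \<beta> X"
  shows "(\<lambda>y. \<sigma> y + \<tau> y) \<in> novikov_chains G \<beta> X"
  using novikov_chains_diff[OF assms(1) novikov_chains_uminus[OF assms(2)]] by simp

text \<open>Serves to replace an infinite bounding chain by a finite one, with an error that starts
  only at height t.\<close>

lemma novikov_chains_truncate:
  assumes "\<sigma> \<in> novikov_chains G \<beta> X"
  obtains c where "Poly_Mapping.keys c \<subseteq> {y. \<sigma> y \<noteq> 0}" "above \<beta> t (\<lambda>y. \<sigma> y - Poly_Mapping.lookup c y)"
proof
  define c where "c = Abs_poly_mapping (\<lambda>y. if \<beta> (fst y) < t then \<sigma> y else 0)"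
  have "{y. (if \<beta> (fst y) < t then \<sigma> y else 0) \<noteq> 0} \<subseteq> {y. \<sigma> y \<noteq> 0 \<and> \<beta> (fst y) < t}" by auto
  then have "finite {y. (if \<beta> (fst y) < t then \<sigma> y else 0) \<noteq> 0}"
    by (rule finite_subset) (rule novikov_chains_finite[OF assms])
  then have c: "Poly_Mapping.lookup c = (\<lambda>y. if \<beta> (fst y) < t then \<sigma> y else 0)"
    unfolding c_def by (rule lookup_Abs_poly_mapping)
  show "Poly_Mapping.keys c \<subseteq> {y. \<sigma> y \<noteq> 0}"
    by (auto simp: in_keys_iff c split: if_splits)
  show "above \<beta> t (\<lambda>y. \<sigma> y - Poly_Mapping.lookup c y)"
    by (auto simp: above_def c split: if_splits)
qed

lemma novikov_chains_bounded_below: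
  assumes "\<sigma> \<in> novikov_chains G \<beta> X" obtains m where "above \<beta> m \<sigma>"
proof
  let ?S = "{y. \<sigma> y \<noteq> 0 \<and> \<beta> (fst y) < 0}"
  have fin: "finite (insert 0 ((\<lambda>y. \<beta> (fst y)) ` ?S))" using novikov_chains_finite[OF assms] by simp
  show "above \<beta> (Min (insert 0 ((\<lambda>y. \<beta> (fst y)) ` ?S))) \<sigma>"
    unfolding above_def
  proof safe
    fix g x assume "\<sigma> (g, x) \<noteq> 0"
    then show "Min (insert 0 ((\<lambda>y. \<beta> (fst y)) ` ?S)) \<le> \<beta> (fst (g, x))"
      using Min_le[OF fin, of "\<beta> g"] Min_le[OF fin, of 0] by (cases "\<beta> g < 0") force+
  qed
qed

section \<open>The action of finitary maps on Novikov chains\<close>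

context group
begin

text \<open>The supports lie in gK for one finite \<open>K\<close>, and right multiplication by each
  element of \<open>K\<close> costs a bounded amount of height. The bound is uniform in g but may
  depend on the column, hence the finite \<open>X0\<close>.\<close>

lemma raises_bounded:
  assumes \<beta>: "height G \<beta>" and p: "fin_map G X Y p" and X0: "finite X0" "X0 \<subseteq> X"
  obtains L where "raises G \<beta> X0 p (- L)"
proof -
  obtain K where K: "finite K" "K \<subseteq> carrier G \<times> Y"
    "\<forall>g\<in>carrier G. \<forall>x\<in>X0. \<forall>g' y. (g', y) \<in> Poly_Mapping.keys (p (g, x)) \<longrightarrow>
       (\<exists>h. (h, y) \<in> K \<and> g' = g \<otimes> h)"
    by (rule fin_map_support[OF p X0])
  have "\<forall>k\<in>K. \<exists>L. \<forall>g\<in>carrier G. \<beta> (g \<otimes> fst k) \<ge> \<beta> g - L"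
    using \<beta> K(2) by (auto simp: height_def)
  then have "\<exists>L. \<forall>k\<in>K. \<forall>g\<in>carrier G. \<beta> (g \<otimes> fst k) \<ge> \<beta> g - L k" by (rule bchoice)
  then obtain L where L: "\<forall>k\<in>K. \<forall>g\<in>carrier G. \<beta> (g \<otimes> fst k) \<ge> \<beta> g - L k" by (rule exE)
  \<comment> \<open>A sum rather than a maximum, since \<open>K\<close> may be empty and the
    \<open>L k\<close> negative.\<close>
  define B where "B = (\<Sum>k\<in>K. \<bar>L k\<bar>)"
  have B: "\<beta> (g \<otimes> h) \<ge> \<beta> g - B" if k: "(h, y) \<in> K" and g: "g \<in> carrier G" for g h y
  proof -
    have "\<bar>L (h, y)\<bar> \<le> B" unfolding B_def by (rule member_le_sum[OF k]) (use K(1) in auto)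
    then show ?thesis using L[rule_format, OF k g] by simp
  qed
  have "raises G \<beta> X0 p (- B)"
    unfolding raises_def above_def
  proof safe
    fix g x h y assume "g \<in> carrier G" "x \<in> X0" "Poly_Mapping.lookup (p (g, x)) (h, y) \<noteq> 0"
    then show "\<beta> g + - B \<le> \<beta> (fst (h, y))"
      using K(3)[rule_format, of g x h y] B by (auto simp: in_keys_iff)
  qed
  then show thesis by (rule that)
qed

text \<open>If z occurs in the value at gx, then its group component is gh with h from a finite set,
  so only the finitely many quotients by such h are possible for g.\<close>

lemma novikov_ext_finite_support:
  assumes p: "fin_map G X Y p" and X0: "finite X0" "X0 \<subseteq> X"
  shows "finite {y \<in> carrier G \<times> X0. Poly_Mapping.lookup (p y) z \<noteq> 0}"
proof -
  obtain K where K: "finite K" "K \<subseteq> carrier G \<times> Y"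
    "\<forall>g\<in>carrier G. \<forall>x\<in>X0. \<forall>g' y. (g', y) \<in> Poly_Mapping.keys (p (g, x)) \<longrightarrow>
       (\<exists>h. (h, y) \<in> K \<and> g' = g \<otimes> h)"
    by (rule fin_map_support[OF p X0])
  have "{y \<in> carrier G \<times> X0. Poly_Mapping.lookup (p y) z \<noteq> 0} \<subseteq> (\<lambda>k. fst z \<otimes> inv (fst k)) ` K \<times> X0"
  proof clarify
    fix g x assume gx: "g \<in> carrier G" "x \<in> X0" "Poly_Mapping.lookup (p (g, x)) z \<noteq> 0"
    then obtain h where h: "(h, snd z) \<in> K" "fst z = g \<otimes> h"
      using K(3)[rule_format, of g x "fst z" "snd z"] by (auto simp: in_keys_iff)
    then have "g = fst z \<otimes> inv h" using gx K(2) by (auto simp: m_assoc)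
    then show "g \<in> (\<lambda>k. fst z \<otimes> inv (fst k)) ` K" using h by force
  qed
  then show ?thesis by (rule finite_subset) (use K(1) X0(1) in simp)
qed

text \<open>Finitely many columns go to finitely many columns even if \<open>Y\<close> is infinite,
  which is the situation of a homotopy leading into degree n + 1.\<close>

lemma novikov_ext_columns:
  assumes p: "fin_map G X Y p" and X0: "finite X0" "X0 \<subseteq> X"
  obtains Y0 where "finite Y0" "Y0 \<subseteq> Y" "\<forall>g\<in>carrier G. \<forall>x\<in>X0. p (g, x) \<in> fchains G Y0"
    "\<forall>\<sigma>. {y. \<sigma> y \<noteq> 0} \<subseteq> carrier G \<times> X0 \<longrightarrow> {z. novikov_ext p \<sigma> z \<noteq> 0} \<subseteq> carrier G \<times> Y0"
proof -
  obtain K where K: "finite K" "K \<subseteq> carrier G \<times> Y"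
    "\<forall>g\<in>carrier G. \<forall>x\<in>X0. \<forall>g' y. (g', y) \<in> Poly_Mapping.keys (p (g, x)) \<longrightarrow>
       (\<exists>h. (h, y) \<in> K \<and> g' = g \<otimes> h)"
    by (rule fin_map_support[OF p X0])
  have sub: "Poly_Mapping.keys (p (g, x)) \<subseteq> carrier G \<times> snd ` K" if gx: "g \<in> carrier G" "x \<in> X0" for g x
  proof clarify
    fix g' y assume *: "(g', y) \<in> Poly_Mapping.keys (p (g, x))"
    obtain h where "(h, y) \<in> K" "g' = g \<otimes> h" using K(3)[rule_format, OF gx *] by auto
    then show "g' \<in> carrier G \<and> y \<in> snd ` K" using K(2) gx by force
  qed
  show thesis
  proof (rule that[of "snd ` K"], goal_cases)
    case 4
    show ?case
    proof (intro allI impI)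
      fix \<sigma> :: "'a \<times> 'c \<Rightarrow> int" assume \<sigma>: "{y. \<sigma> y \<noteq> 0} \<subseteq> carrier G \<times> X0"
      show "{z. novikov_ext p \<sigma> z \<noteq> 0} \<subseteq> carrier G \<times> snd ` K"
      proof clarify
        fix g' y assume "novikov_ext p \<sigma> (g', y) \<noteq> 0"
        then obtain w where w: "\<sigma> w \<noteq> 0" "Poly_Mapping.lookup (p w) (g', y) \<noteq> 0"
          by (rule novikov_ext_nonzeroE)
        then have "fst w \<in> carrier G" "snd w \<in> X0" using \<sigma> by auto
        from sub[OF this] w(2) show "g' \<in> carrier G \<and> y \<in> snd ` K" by (auto simp: in_keys_iff)
      qed
    qed
  qed (use K sub in \<open>auto simp: fchains_def\<close>)
qed

text \<open>If \<open>p\<close> loses at most \<open>L\<close>, a term of the image below t comes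
  from a term of \<sigma> below \<open>t + L\<close>. There are finitely many of these, each with a
  finite image.\<close>

lemma novikov_ext_closed:
  assumes \<beta>: "height G \<beta>" and p: "fin_map G X Y p" and \<sigma>: "\<sigma> \<in> novikov_chains G \<beta> X"
  shows "novikov_ext p \<sigma> \<in> novikov_chains G \<beta> Y"
proof -
  obtain X0 where X0: "X0 \<subseteq> X" "finite X0" "{y. \<sigma> y \<noteq> 0} \<subseteq> carrier G \<times> X0"
    by (rule novikov_chainsE[OF \<sigma>])
  obtain Y0 where Y0: "finite Y0" "Y0 \<subseteq> Y" "\<forall>g\<in>carrier G. \<forall>x\<in>X0. p (g, x) \<in> fchains G Y0"
    "\<forall>\<sigma>. {y. \<sigma> y \<noteq> 0} \<subseteq> carrier G \<times> X0 \<longrightarrow> {z. novikov_ext p \<sigma> z \<noteq> 0} \<subseteq> carrier G \<times> Y0"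
    by (rule novikov_ext_columns[OF p X0(2,1)])
  note cols = Y0(4)[rule_format, OF X0(3)]
  obtain L where L: "raises G \<beta> X0 p (- L)" by (rule raises_bounded[OF \<beta> p X0(2,1)])
  have "finite {z. novikov_ext p \<sigma> z \<noteq> 0 \<and> \<beta> (fst z) < t}" for t
  proof (rule finite_subset)
    let ?S = "{y. \<sigma> y \<noteq> 0 \<and> \<beta> (fst y) < t + L}"
    show "finite (\<Union>y\<in>?S. Poly_Mapping.keys (p y))"
      by (rule finite_UN_I[OF novikov_chains_finite[OF \<sigma>]]) simp
    show "{z. novikov_ext p \<sigma> z \<noteq> 0 \<and> \<beta> (fst z) < t} \<subseteq> (\<Union>y\<in>?S. Poly_Mapping.keys (p y))"
    proof clarify
      fix g y assume z: "novikov_ext p \<sigma> (g, y) \<noteq> 0" "\<beta> (fst (g, y)) < t"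
      obtain w where w: "\<sigma> w \<noteq> 0" "Poly_Mapping.lookup (p w) (g, y) \<noteq> 0"
        using z(1) by (rule novikov_ext_nonzeroE)
      moreover obtain h x where hx: "w = (h, x)" by fastforce
      ultimately have "\<beta> h + - L \<le> \<beta> g" using L X0(3) by (auto simp: raises_def above_def)
      then show "(g, y) \<in> (\<Union>y\<in>?S. Poly_Mapping.keys (p y))"
        using w hx z by (intro UN_I[of "(h, x)"]) (auto simp: in_keys_iff)
    qed
  qed
  then show ?thesis by (rule novikov_chainsI[OF Y0(2,1) cols])
qed

lemma novikov_ext_sum:
  assumes p: "fin_map G X Y p" and \<sigma>: "\<sigma> \<in> novikov_chains G \<beta> X" and \<tau>: "\<tau> \<in> novikov_chains G \<beta> X"
  shows "novikov_ext p (\<lambda>y. a * \<sigma> y + b * \<tau> y) = (\<lambda>z. a * novikov_ext p \<sigma> z + b * novikov_ext p \<tau> z)"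
proof
  fix z
  obtain X0 where X0: "X0 \<subseteq> X" "finite X0" "{y. \<sigma> y \<noteq> 0} \<subseteq> carrier G \<times> X0" by (rule novikov_chainsE[OF \<sigma>])
  obtain X1 where X1: "X1 \<subseteq> X" "finite X1" "{y. \<tau> y \<noteq> 0} \<subseteq> carrier G \<times> X1" by (rule novikov_chainsE[OF \<tau>])
  define R where "R = {y \<in> carrier G \<times> (X0 \<union> X1). Poly_Mapping.lookup (p y) z \<noteq> 0}"
  have R: "finite R" unfolding R_def using X0 X1 by (intro novikov_ext_finite_support[OF p]) auto
  have *: "Poly_Mapping.lookup (p y) z = 0" if "y \<notin> R" "\<sigma> y \<noteq> 0 \<or> \<tau> y \<noteq> 0" for y
    using that X0(3) X1(3) by (auto simp: R_def)
  have "novikov_ext p (\<lambda>y. a * \<sigma> y + b * \<tau> y) z = (\<Sum>y\<in>R. (a * \<sigma> y + b * \<tau> y) * Poly_Mapping.lookup (p y) z)"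
  proof (rule novikov_ext_eq_sum[OF R])
    fix y assume "y \<notin> R" "a * \<sigma> y + b * \<tau> y \<noteq> 0"
    then show "Poly_Mapping.lookup (p y) z = 0" by (intro *) auto
  qed
  also have "\<dots> = a * (\<Sum>y\<in>R. \<sigma> y * Poly_Mapping.lookup (p y) z) + b * (\<Sum>y\<in>R. \<tau> y * Poly_Mapping.lookup (p y) z)"
    by (simp add: sum.distrib sum_distrib_left distrib_right mult.assoc)
  also have "\<dots> = a * novikov_ext p \<sigma> z + b * novikov_ext p \<tau> z"
    using * by (simp add: novikov_ext_eq_sum[OF R])
  finally show "novikov_ext p (\<lambda>y. a * \<sigma> y + b * \<tau> y) z = a * novikov_ext p \<sigma> z + b * novikov_ext p \<tau> z" .
qed

lemma novikov_ext_diff: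
  assumes "fin_map G X Y p" "\<sigma> \<in> novikov_chains G \<beta> X" "\<tau> \<in> novikov_chains G \<beta> X"
  shows "novikov_ext p (\<lambda>y. \<sigma> y - \<tau> y) = (\<lambda>z. novikov_ext p \<sigma> z - novikov_ext p \<tau> z)"
  using novikov_ext_sum[OF assms, of 1 "-1"] by simp

lemma novikov_ext_add:
  assumes "fin_map G X Y p" "\<sigma> \<in> novikov_chains G \<beta> X" "\<tau> \<in> novikov_chains G \<beta> X"
  shows "novikov_ext p (\<lambda>y. \<sigma> y + \<tau> y) = (\<lambda>z. novikov_ext p \<sigma> z + novikov_ext p \<tau> z)"
  using novikov_ext_sum[OF assms, of 1 1] by simp

lemma novikov_ext_uminus:
  assumes "fin_map G X Y p" "\<sigma> \<in> novikov_chains G \<beta> X"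
  shows "novikov_ext p (\<lambda>y. - \<sigma> y) = (\<lambda>z. - novikov_ext p \<sigma> z)"
  using novikov_ext_sum[OF assms assms(2), of "-1" 0] by simp

lemma novikov_ext_fun_diff:
  assumes p: "fin_map G X Y p" and q: "fin_map G X Y q" and \<sigma>: "\<sigma> \<in> novikov_chains G \<beta> X"
  shows "novikov_ext (\<lambda>y. p y - q y) \<sigma> = (\<lambda>z. novikov_ext p \<sigma> z - novikov_ext q \<sigma> z)"
proof
  fix z
  obtain X0 where X0: "X0 \<subseteq> X" "finite X0" "{y. \<sigma> y \<noteq> 0} \<subseteq> carrier G \<times> X0" by (rule novikov_chainsE[OF \<sigma>])
  define R where "R = {y \<in> carrier G \<times> X0. Poly_Mapping.lookup (p y) z \<noteq> 0} \<union>
    {y \<in> carrier G \<times> X0. Poly_Mapping.lookup (q y) z \<noteq> 0}"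
  have R: "finite R" unfolding R_def by (intro finite_UnI novikov_ext_finite_support[OF p X0(2,1)]
      novikov_ext_finite_support[OF q X0(2,1)])
  have *: "Poly_Mapping.lookup (p y) z = 0" "Poly_Mapping.lookup (q y) z = 0" if "y \<notin> R" "\<sigma> y \<noteq> 0" for y
    using that X0(3) by (auto simp: R_def)
  show "novikov_ext (\<lambda>y. p y - q y) \<sigma> z = novikov_ext p \<sigma> z - novikov_ext q \<sigma> z"
    using * by (simp add: novikov_ext_eq_sum[OF R] lookup_minus sum_subtractf right_diff_distrib)
qed

lemma novikov_ext_frag_of: "novikov_ext frag_of \<sigma> = \<sigma>"
proof
  fix z
  show "novikov_ext frag_of \<sigma> z = \<sigma> z"
    by (subst novikov_ext_eq_sum[of "{z}"]) (auto simp: lookup_frag_of)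
qed

text \<open>At a fixed z this is an exchange of two finite sums: \<open>W\<close> is the finite set
  of intermediate basis elements that contribute to z, and \<open>V\<close> the finite set of those
  contributing to \<open>W\<close>.\<close>

lemma novikov_ext_comp:
  assumes p: "fin_map G X Y p" and q: "fin_map G Y Z q" and \<sigma>: "\<sigma> \<in> novikov_chains G \<beta> X"
  shows "novikov_ext q (novikov_ext p \<sigma>) = novikov_ext (\<lambda>y. frag_extend q (p y)) \<sigma>"
proof
  fix z
  obtain X0 where X0: "X0 \<subseteq> X" "finite X0" "{y. \<sigma> y \<noteq> 0} \<subseteq> carrier G \<times> X0" by (rule novikov_chainsE[OF \<sigma>])
  obtain Y0 where Y0: "finite Y0" "Y0 \<subseteq> Y" "\<forall>g\<in>carrier G. \<forall>x\<in>X0. p (g, x) \<in> fchains G Y0"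
    "\<forall>\<sigma>. {y. \<sigma> y \<noteq> 0} \<subseteq> carrier G \<times> X0 \<longrightarrow> {z. novikov_ext p \<sigma> z \<noteq> 0} \<subseteq> carrier G \<times> Y0"
    by (rule novikov_ext_columns[OF p X0(2,1)])
  note cols = Y0(4)[rule_format, OF X0(3)]
  define W where "W = {w \<in> carrier G \<times> Y0. Poly_Mapping.lookup (q w) z \<noteq> 0}"
  define V where "V = (\<Union>w\<in>W. {y \<in> carrier G \<times> X0. Poly_Mapping.lookup (p y) w \<noteq> 0})"
  have W: "finite W" unfolding W_def by (rule novikov_ext_finite_support[OF q Y0(1,2)])
  then have V: "finite V" unfolding V_def by (intro finite_UN_I novikov_ext_finite_support[OF p X0(2,1)])
  have pw: "Poly_Mapping.keys (p y) \<subseteq> carrier G \<times> Y0" if "\<sigma> y \<noteq> 0" for y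
  proof -
    have "fst y \<in> carrier G" "snd y \<in> X0" using that X0(3) by auto
    from Y0(3)[rule_format, OF this] show ?thesis by (simp add: fchains_def)
  qed
  have qp: "Poly_Mapping.lookup (frag_extend q (p y)) z = (\<Sum>w\<in>W. Poly_Mapping.lookup (p y) w * Poly_Mapping.lookup (q w) z)"
    if "\<sigma> y \<noteq> 0" for y
    unfolding lookup_frag_extend
    by (rule sum.mono_neutral_cong[OF W]) (use pw[OF that] in \<open>auto simp: W_def in_keys_iff\<close>)
  have "novikov_ext q (novikov_ext p \<sigma>) z = (\<Sum>w\<in>W. novikov_ext p \<sigma> w * Poly_Mapping.lookup (q w) z)"
    by (rule novikov_ext_eq_sum[OF W]) (use cols in \<open>auto simp: W_def\<close>)
  also have "\<dots> = (\<Sum>w\<in>W. (\<Sum>y\<in>V. \<sigma> y * Poly_Mapping.lookup (p y) w) * Poly_Mapping.lookup (q w) z)"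
  proof (rule sum.cong[OF refl])
    fix w assume "w \<in> W"
    then have "novikov_ext p \<sigma> w = (\<Sum>y\<in>V. \<sigma> y * Poly_Mapping.lookup (p y) w)"
      using X0(3) by (intro novikov_ext_eq_sum[OF V]) (auto simp: V_def)
    then show "novikov_ext p \<sigma> w * Poly_Mapping.lookup (q w) z =
      (\<Sum>y\<in>V. \<sigma> y * Poly_Mapping.lookup (p y) w) * Poly_Mapping.lookup (q w) z" by simp
  qed
  also have "\<dots> = (\<Sum>y\<in>V. \<sigma> y * (\<Sum>w\<in>W. Poly_Mapping.lookup (p y) w * Poly_Mapping.lookup (q w) z))"
    unfolding sum_distrib_right sum_distrib_left by (subst sum.swap) (simp add: mult.assoc)
  also have "\<dots> = (\<Sum>y\<in>V. \<sigma> y * Poly_Mapping.lookup (frag_extend q (p y)) z)"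
  proof (intro sum.cong refl)
    fix y
    show "\<sigma> y * (\<Sum>w\<in>W. Poly_Mapping.lookup (p y) w * Poly_Mapping.lookup (q w) z) =
        \<sigma> y * Poly_Mapping.lookup (frag_extend q (p y)) z"
      by (cases "\<sigma> y = 0") (simp_all add: qp)
  qed
  also have "\<dots> = novikov_ext (\<lambda>y. frag_extend q (p y)) \<sigma> z"
  proof (rule novikov_ext_eq_sum[OF V, symmetric])
    fix y assume y: "y \<notin> V" "\<sigma> y \<noteq> 0"
    then have "Poly_Mapping.lookup (p y) w = 0" if "w \<in> W" for w
      using that X0(3) by (auto simp: V_def)
    then show "Poly_Mapping.lookup (frag_extend q (p y)) z = 0"
      using qp[OF y(2)] by simp
  qed
  finally show "novikov_ext q (novikov_ext p \<sigma>) z = novikov_ext (\<lambda>y. frag_extend q (p y)) \<sigma> z" .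
qed

text \<open>Below any given height the sequence becomes constant, so it converges coefficientwise.
  The common finite set \<open>X0\<close> is what keeps the limit within finitely many
  columns.\<close>

lemma novikov_chains_limit:
  assumes X0: "finite X0" "X0 \<subseteq> X"
    and \<sigma>: "\<And>j. \<sigma> j \<in> novikov_chains G \<beta> X" "\<And>j. {y. \<sigma> j y \<noteq> 0} \<subseteq> carrier G \<times> X0"
    and step: "\<And>j. above \<beta> (real j - L) (\<lambda>y. \<sigma> (Suc j) y - \<sigma> j y)"
  obtains \<tau> where "\<tau> \<in> novikov_chains G \<beta> X" "{y. \<tau> y \<noteq> 0} \<subseteq> carrier G \<times> X0"
    "\<forall>j. above \<beta> (real j - L) (\<lambda>y. \<tau> y - \<sigma> j y)"
proof -
  have eq: "\<sigma> (j + i) y = \<sigma> j y" if "\<beta> (fst y) < real j - L" for i j y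
  proof (induction i)
    case (Suc i)
    have "\<beta> (fst y) < real (j + i) - L" using that by simp
    then have "\<sigma> (Suc (j + i)) y = \<sigma> (j + i) y" using step[of "j + i"] unfolding above_def
      by (metis eq_iff_diff_eq_0 linorder_not_less)
    then show ?case using Suc by simp
  qed simp
  \<comment> \<open>From stage \<open>N y\<close> on, all increments lie strictly above the height
    of y; the \<open>+ 1\<close> makes this strict.\<close>
  define N where "N y = nat \<lceil>\<beta> (fst y) + L + 1\<rceil>" for y :: "'a \<times> 'c"
  define \<tau> where "\<tau> y = \<sigma> (N y) y" for y
  have \<tau>: "\<tau> y = \<sigma> j y" if y: "\<beta> (fst y) < real j - L" for y j
  proof -
    have "\<beta> (fst y) < real (N y) - L" unfolding N_def by linarith
    from eq[OF this, of "j - N y"] eq[OF y, of "N y - j"] show ?thesis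
      by (cases "j \<le> N y") (simp_all add: \<tau>_def)
  qed
  have cols: "{y. \<tau> y \<noteq> 0} \<subseteq> carrier G \<times> X0" using \<sigma>(2) unfolding \<tau>_def by blast
  have "finite {y. \<tau> y \<noteq> 0 \<and> \<beta> (fst y) < t}" for t
  proof -
    define j where "j = nat \<lceil>t + L\<rceil>"
    have "t \<le> real j - L" unfolding j_def by linarith
    then have "{y. \<tau> y \<noteq> 0 \<and> \<beta> (fst y) < t} \<subseteq> {y. \<sigma> j y \<noteq> 0 \<and> \<beta> (fst y) < t}"
      using \<tau>[of _ j] by auto
    then show ?thesis by (rule finite_subset) (rule novikov_chains_finite[OF \<sigma>(1)])
  qed
  then have "\<tau> \<in> novikov_chains G \<beta> X" by (rule novikov_chainsI[OF X0(2,1) cols])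
  moreover have "above \<beta> (real j - L) (\<lambda>y. \<tau> y - \<sigma> j y)" for j
    using \<tau>[of _ j] unfolding above_def by (metis diff_self linorder_not_less)
  ultimately show thesis using cols that by blast
qed

end

text \<open>Identities between infinite chains are proved in this way: finite stages show that the
  difference lies above every height.\<close>

lemma above_all_imp_zero:
  assumes "\<And>j::nat. above \<beta> (real j - L) \<sigma>" shows "\<sigma> = (\<lambda>_. 0)"
proof (rule ccontr)
  assume "\<sigma> \<noteq> (\<lambda>_. 0)"
  then obtain y where y: "\<sigma> y \<noteq> 0" by (auto simp: fun_eq_iff)
  have "real (nat \<lceil>\<beta> (fst y) + L + 1\<rceil>) - L \<le> \<beta> (fst y)" using assms y unfolding above_def by blast
  then show False by linarith
qed

section \<open>Independence of the resolution\<close>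

lemma (in free_complex) D_novikov:
  assumes \<beta>: "height G \<beta>" and p: "fin_map G V (X (Suc k)) p" and \<sigma>: "\<sigma> \<in> novikov_chains G \<beta> V"
  shows "novikov_ext D (novikov_ext p \<sigma>) = novikov_ext (\<lambda>y. frag_extend D (p y)) \<sigma>"
  by (rule novikov_ext_comp[OF p D_fin_map \<sigma>])

text \<open>Let \<open>U\<close> and \<open>W\<close> be comparison maps and s a homotopy from the
  identity to \<open>U W\<close>. If \<sigma> is a cycle and \<tau> bounds
  \<open>W \<sigma>\<close>, then \<open>U \<tau> - s \<sigma>\<close> bounds \<sigma>. One
  composite suffices because exactness is carried in one direction only.\<close>

lemma novikov_exact_transfer:
  fixes G (structure)
  assumes X: "free_complex G X D" and Y: "free_complex G Y E" and \<beta>: "height G \<beta>"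
    and u: "fin_map G (X 0) (Y 0) u" and w: "fin_map G (Y 0) (X 0) w"
    and uD: "\<And>g x. g \<in> carrier G \<Longrightarrow> x \<in> X 1 \<Longrightarrow> \<exists>c\<in>fchains G (Y 1). frag_extend E c = frag_extend u (D (g, x))"
    and wE: "\<And>g y. g \<in> carrier G \<Longrightarrow> y \<in> Y 1 \<Longrightarrow> \<exists>c\<in>fchains G (X 1). frag_extend D c = frag_extend w (E (g, y))"
    and uw: "\<And>g y. g \<in> carrier G \<Longrightarrow> y \<in> Y 0 \<Longrightarrow>
        \<exists>c\<in>fchains G (Y 1). frag_extend E c = frag_extend u (w (g, y)) - frag_of (g, y)"
    and ex: "novikov_exact G \<beta> X D k"
  shows "novikov_exact G \<beta> Y E k"
proof -
  interpret X: free_complex G X D by (rule X)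
  interpret Y: free_complex G Y E by (rule Y)
  define U where "U = lift_chain_map G Y E D u"
  define W where "W = lift_chain_map G X D E w"
  have U: "fin_map G (X k) (Y k) (U k)"
    "\<And>g x. g \<in> carrier G \<Longrightarrow> x \<in> X (Suc k) \<Longrightarrow> frag_extend E (U (Suc k) (g, x)) = frag_extend (U k) (D (g, x))" for k
    using lift_chain_map[OF X Y u uD] by (simp_all add: U_def)
  have W: "fin_map G (Y k) (X k) (W k)"
    "\<And>g x. g \<in> carrier G \<Longrightarrow> x \<in> Y (Suc k) \<Longrightarrow> frag_extend D (W (Suc k) (g, x)) = frag_extend (W k) (E (g, x))" for k
    using lift_chain_map[OF Y X w wE] by (simp_all add: W_def)
  define f where "f k y = frag_extend (U k) (W k y) - frag_of y" for k y
  define s where "s = homotopy G Y E E f"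
  have f: "fin_map G (Y k) (Y k) (f k)" for k
    unfolding f_def by (intro X.fin_map_diff X.fin_map_comp[OF W(1) U(1)] X.fin_map_frag_of)
  have f0: "\<exists>c\<in>fchains G (Y 1). frag_extend E c = f 0 (g, x)" if "g \<in> carrier G" "x \<in> Y 0" for g x
    using uw[OF that] by (simp add: f_def U_def W_def)
  have fE: "frag_extend E (f (Suc k) (g, x)) = frag_extend (f k) (E (g, x))"
    if gx: "g \<in> carrier G" "x \<in> Y (Suc k)" for k g x
  proof -
    have "frag_extend E (frag_extend (U (Suc k)) (W (Suc k) (g, x))) =
        frag_extend (\<lambda>y. frag_extend E (U (Suc k) y)) (W (Suc k) (g, x))"
      by (simp add: frag_extend_frag_extend)
    also have "\<dots> = frag_extend (\<lambda>y. frag_extend (U k) (D y)) (W (Suc k) (g, x))"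
      by (rule frag_extend_cong_chains[OF X.fin_map_closed[OF W(1) gx]]) (rule U(2))
    also have "\<dots> = frag_extend (U k) (frag_extend D (W (Suc k) (g, x)))"
      by (simp add: frag_extend_frag_extend)
    also have "\<dots> = frag_extend (\<lambda>y. frag_extend (U k) (W k y)) (E (g, x))"
      by (simp add: W(2)[OF gx] frag_extend_frag_extend)
    finally show ?thesis unfolding f_def by (simp add: frag_extend_diff frag_extend_fun_diff)
  qed
  have s: "fin_map G (Y k) (Y (Suc k)) (s k)"
    "\<And>g x. g \<in> carrier G \<Longrightarrow> x \<in> Y k \<Longrightarrow>
       frag_extend E (s k (g, x)) = (case k of 0 \<Rightarrow> f 0 (g, x) | Suc j \<Rightarrow> f k (g, x) - frag_extend (s j) (E (g, x)))" for k
    unfolding s_def by (rule homotopy(1)[OF Y Y f f0 fE lessI], assumption+)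
      (rule homotopy(2)[OF Y Y f f0 fE lessI], assumption+)
  show ?thesis
    unfolding novikov_exact_def
  proof (intro ballI impI)
    fix \<sigma> assume \<sigma>: "\<sigma> \<in> novikov_chains G \<beta> (Y k)" and cyc: "k \<noteq> 0 \<longrightarrow> novikov_ext E \<sigma> = (\<lambda>_. 0)"
    define \<rho> where "\<rho> = novikov_ext (W k) \<sigma>"
    have \<rho>: "\<rho> \<in> novikov_chains G \<beta> (X k)" unfolding \<rho>_def by (rule X.novikov_ext_closed[OF \<beta> W(1) \<sigma>])
    have "k \<noteq> 0 \<longrightarrow> novikov_ext D \<rho> = (\<lambda>_. 0)"
    proof
      assume "k \<noteq> 0"
      then obtain j where j: "k = Suc j" by (cases k) auto
      have \<sigma>j: "\<sigma> \<in> novikov_chains G \<beta> (Y (Suc j))" using \<sigma> j by simp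
      have "novikov_ext D \<rho> = novikov_ext (\<lambda>y. frag_extend D (W (Suc j) y)) \<sigma>"
        unfolding \<rho>_def j by (rule X.D_novikov[OF \<beta> W(1) \<sigma>j])
      also have "\<dots> = novikov_ext (\<lambda>y. frag_extend (W j) (E y)) \<sigma>"
        by (rule novikov_ext_cong_on[OF \<sigma>j]) (rule W(2))
      also have "\<dots> = novikov_ext (W j) (novikov_ext E \<sigma>)"
        by (rule X.novikov_ext_comp[OF Y.D_fin_map W(1) \<sigma>j, symmetric])
      also have "\<dots> = (\<lambda>_. 0)" using cyc j by simp
      finally show "novikov_ext D \<rho> = (\<lambda>_. 0)" .
    qed
    then obtain \<tau> where \<tau>: "\<tau> \<in> novikov_chains G \<beta> (X (Suc k))" "novikov_ext D \<tau> = \<rho>"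
      using ex \<rho> unfolding novikov_exact_def by blast
    define \<upsilon> where "\<upsilon> = novikov_ext (U (Suc k)) \<tau>"
    define \<omega> where "\<omega> = novikov_ext (s k) \<sigma>"
    have \<upsilon>: "\<upsilon> \<in> novikov_chains G \<beta> (Y (Suc k))" unfolding \<upsilon>_def by (rule X.novikov_ext_closed[OF \<beta> U(1) \<tau>(1)])
    have \<omega>: "\<omega> \<in> novikov_chains G \<beta> (Y (Suc k))" unfolding \<omega>_def by (rule X.novikov_ext_closed[OF \<beta> s(1) \<sigma>])
    have "novikov_ext E \<upsilon> = novikov_ext (\<lambda>y. frag_extend E (U (Suc k) y)) \<tau>"
      unfolding \<upsilon>_def by (rule Y.D_novikov[OF \<beta> U(1) \<tau>(1)])
    also have "\<dots> = novikov_ext (\<lambda>y. frag_extend (U k) (D y)) \<tau>"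
      by (rule novikov_ext_cong_on[OF \<tau>(1)]) (rule U(2))
    also have "\<dots> = novikov_ext (U k) (novikov_ext D \<tau>)"
      by (rule X.novikov_ext_comp[OF X.D_fin_map U(1) \<tau>(1), symmetric])
    also have "\<dots> = novikov_ext (\<lambda>y. frag_extend (U k) (W k y)) \<sigma>"
      unfolding \<tau>(2) \<rho>_def by (rule X.novikov_ext_comp[OF W(1) U(1) \<sigma>])
    finally have Eu: "novikov_ext E \<upsilon> = novikov_ext (\<lambda>y. frag_extend (U k) (W k y)) \<sigma>" .
    have "novikov_ext E \<omega> = novikov_ext (\<lambda>y. frag_extend E (s k y)) \<sigma>"
      unfolding \<omega>_def by (rule Y.D_novikov[OF \<beta> s(1) \<sigma>])
    also have "\<dots> = novikov_ext (f k) \<sigma>"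
    proof (cases k)
      case 0
      show ?thesis by (rule novikov_ext_cong_on[OF \<sigma>]) (use s(2) 0 in auto)
    next
      case (Suc j)
      have \<sigma>j: "\<sigma> \<in> novikov_chains G \<beta> (Y (Suc j))" using \<sigma> Suc by simp
      have "novikov_ext (\<lambda>y. frag_extend E (s k y)) \<sigma> = novikov_ext (\<lambda>y. f k y - frag_extend (s j) (E y)) \<sigma>"
        by (rule novikov_ext_cong_on[OF \<sigma>]) (use s(2) Suc in auto)
      also have "\<dots> = (\<lambda>z. novikov_ext (f k) \<sigma> z - novikov_ext (\<lambda>y. frag_extend (s j) (E y)) \<sigma> z)"
        unfolding Suc by (rule X.novikov_ext_fun_diff[OF f X.fin_map_comp[OF Y.D_fin_map s(1)] \<sigma>j])
      also have "novikov_ext (\<lambda>y. frag_extend (s j) (E y)) \<sigma> = novikov_ext (s j) (novikov_ext E \<sigma>)"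
        by (rule X.novikov_ext_comp[OF Y.D_fin_map s(1) \<sigma>j, symmetric])
      finally show ?thesis using cyc Suc by simp
    qed
    also have "\<dots> = (\<lambda>z. novikov_ext (\<lambda>y. frag_extend (U k) (W k y)) \<sigma> z - novikov_ext frag_of \<sigma> z)"
      unfolding f_def by (rule X.novikov_ext_fun_diff[OF X.fin_map_comp[OF W(1) U(1)] X.fin_map_frag_of \<sigma>])
    finally have Ew: "novikov_ext E \<omega> = (\<lambda>z. novikov_ext E \<upsilon> z - \<sigma> z)"
      by (simp add: Eu X.novikov_ext_frag_of)
    have "novikov_ext E (\<lambda>y. \<upsilon> y - \<omega> y) = \<sigma>"
      by (simp add: X.novikov_ext_diff[OF Y.D_fin_map \<upsilon> \<omega>] Ew)
    then show "\<exists>\<tau>\<in>novikov_chains G \<beta> (Y (Suc k)). novikov_ext E \<tau> = \<sigma>"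
      using novikov_chains_diff[OF \<upsilon> \<omega>] by blast
  qed
qed


section \<open>Pushing maps\<close>

text \<open>The condition in degree 0 says that p induces the identity on the cokernel of
  \<open>D\<close>, that is, on the resolved module. The bound \<open>N\<close> permits a
  construction degree by degree, and the shift t may have any sign. One function p serves all
  degrees, as the bases are disjoint in a based resolution.\<close>

definition pushes ::
    "('g, 'b) monoid_scheme \<Rightarrow> ('g \<Rightarrow> real) \<Rightarrow> (nat \<Rightarrow> 'x set) \<Rightarrow> (('g \<times> 'x) \<Rightarrow> (('g \<times> 'x) \<Rightarrow>\<^sub>0 int)) \<Rightarrow> nat
      \<Rightarrow> (('g \<times> 'x) \<Rightarrow> (('g \<times> 'x) \<Rightarrow>\<^sub>0 int)) \<Rightarrow> real \<Rightarrow> bool" where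
  "pushes G \<beta> X D N p t \<longleftrightarrow>
     (\<forall>k<N. fin_map G (X k) (X k) p \<and> raises G \<beta> (X k) p t) \<and>
     (\<forall>k. Suc k < N \<longrightarrow> (\<forall>g\<in>carrier G. \<forall>x\<in>X (Suc k). frag_extend D (p (g, x)) = frag_extend p (D (g, x)))) \<and>
     (0 < N \<longrightarrow> (\<forall>g\<in>carrier G. \<forall>x\<in>X 0. \<exists>c\<in>fchains G (X 1). frag_extend D c = p (g, x) - frag_of (g, x)))"

context free_complex
begin

context
  fixes \<beta> N p t
  assumes p: "pushes G \<beta> X D N p t"
begin

lemma pushes_fin_map: "k < N \<Longrightarrow> fin_map G (X k) (X k) p"
  and pushes_raises: "k < N \<Longrightarrow> raises G \<beta> (X k) p t"
  and pushes_D: "Suc k < N \<Longrightarrow> g \<in> carrier G \<Longrightarrow> x \<in> X (Suc k) \<Longrightarrow>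
       frag_extend D (p (g, x)) = frag_extend p (D (g, x))"
  and pushes_id: "0 < N \<Longrightarrow> g \<in> carrier G \<Longrightarrow> x \<in> X 0 \<Longrightarrow>
       \<exists>c\<in>fchains G (X 1). frag_extend D c = p (g, x) - frag_of (g, x)"
  using p by (auto simp: pushes_def)

lemma pushes_D_chains:
  assumes "Suc k < N" "c \<in> fchains G (X (Suc k))"
  shows "frag_extend D (frag_extend p c) = frag_extend p (frag_extend D c)"
  using assms(2) by (induction rule: chains_induct) (auto simp: frag_extend_diff pushes_D[OF assms(1)])

lemma pushes_id_chains:
  assumes "0 < N" "c \<in> fchains G (X 0)"
  shows "\<exists>c'\<in>fchains G (X 1). frag_extend D c' = frag_extend p c - c"
  using assms(2)
proof (induction rule: chains_induct)
  case zero
  then show ?case by (intro bexI[of _ 0]) auto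
next
  case (of g x)
  then show ?case using pushes_id[OF assms(1)] by simp
next
  case (diff a b)
  then obtain a' b' where "a' \<in> fchains G (X 1)" "frag_extend D a' = frag_extend p a - a"
     "b' \<in> fchains G (X 1)" "frag_extend D b' = frag_extend p b - b" by blast
  then show ?case by (intro bexI[of _ "a' - b'"]) (auto simp: frag_extend_diff chains_diff)
qed

lemma pushes_homotopy:
  obtains s where "\<forall>k<N. fin_map G (X k) (X (Suc k)) (s k)"
    "\<forall>k<N. \<forall>g\<in>carrier G. \<forall>x\<in>X k. frag_extend D (s k (g, x)) =
       p (g, x) - frag_of (g, x) - (case k of 0 \<Rightarrow> 0 | Suc j \<Rightarrow> frag_extend (s j) (D (g, x)))"
proof -
  define f where "f = (\<lambda>(k::nat) y. p y - frag_of y)"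
  define s where "s = homotopy G X D D f"
  have ax: "free_complex G X D" by (rule free_complex_axioms)
  have f: "fin_map G (X k) (X k) (f k)" if "k < N" for k
    unfolding f_def by (intro fin_map_diff pushes_fin_map that fin_map_frag_of)
  have fD: "frag_extend D (f (Suc k) (g, x)) = frag_extend (f k) (D (g, x))"
    if "Suc k < N" "g \<in> carrier G" "x \<in> X (Suc k)" for k g x
    by (simp add: f_def frag_extend_diff frag_extend_fun_diff pushes_D[OF that])
  have s: "fin_map G (X k) (X (Suc k)) (s k) \<and> (\<forall>g\<in>carrier G. \<forall>x\<in>X k. frag_extend D (s k (g, x)) =
       p (g, x) - frag_of (g, x) - (case k of 0 \<Rightarrow> 0 | Suc j \<Rightarrow> frag_extend (s j) (D (g, x))))" if k: "k < N" for k
  proof -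
    have f0: "\<exists>c\<in>fchains G (X 1). frag_extend D c = f 0 (g, x)" if "g \<in> carrier G" "x \<in> X 0" for g x
      using pushes_id[OF _ that] k by (auto simp: f_def)
    have "fin_map G (X k) (X (Suc k)) (s k)"
      unfolding s_def by (rule homotopy(1)[OF ax ax f f0 fD k])
    moreover have "frag_extend D (s k (g, x)) =
        (case k of 0 \<Rightarrow> f 0 (g, x) | Suc j \<Rightarrow> f k (g, x) - frag_extend (s j) (D (g, x)))"
      if "g \<in> carrier G" "x \<in> X k" for g x
      unfolding s_def by (rule homotopy(2)[OF ax ax f f0 fD k that])
    ultimately show ?thesis by (auto simp: f_def split: nat.split)
  qed
  show thesis by (rule that[of s]) (use s in auto)
qed

text \<open>The iterates of \<open>p\<close> move a Novikov cycle off to infinity, so the homotopies between them add up.\<close>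

lemma pushes_imp_novikov_exact:
  assumes \<beta>: "height G \<beta>" and t: "1 \<le> t" and k: "k < N" and fin: "finite (X k)"
  shows "novikov_exact G \<beta> X D k"
  unfolding novikov_exact_def
proof (intro ballI impI)
  fix \<sigma> assume \<sigma>: "\<sigma> \<in> novikov_chains G \<beta> (X k)" and cyc: "k \<noteq> 0 \<longrightarrow> novikov_ext D \<sigma> = (\<lambda>_. 0)"
  obtain s where s: "\<forall>k<N. fin_map G (X k) (X (Suc k)) (s k)"
    "\<forall>k<N. \<forall>g\<in>carrier G. \<forall>x\<in>X k. frag_extend D (s k (g, x)) =
       p (g, x) - frag_of (g, x) - (case k of 0 \<Rightarrow> 0 | Suc j \<Rightarrow> frag_extend (s j) (D (g, x)))"
    by (rule pushes_homotopy)
  have sk: "fin_map G (X k) (X (Suc k)) (s k)" using s(1) k by simp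
  have pk: "fin_map G (X k) (X k) p" by (rule pushes_fin_map[OF k])
  have Ds: "novikov_ext D (novikov_ext (s k) \<tau>) = (\<lambda>z. novikov_ext p \<tau> z - \<tau> z)"
    if \<tau>: "\<tau> \<in> novikov_chains G \<beta> (X k)" "k \<noteq> 0 \<longrightarrow> novikov_ext D \<tau> = (\<lambda>_. 0)" for \<tau>
  proof -
    have "novikov_ext D (novikov_ext (s k) \<tau>) = novikov_ext (\<lambda>y. frag_extend D (s k y)) \<tau>"
      by (rule D_novikov[OF \<beta> sk \<tau>(1)])
    also have "\<dots> = novikov_ext (\<lambda>y. p y - frag_of y) \<tau>"
    proof (cases k)
      case 0
      then show ?thesis using s(2) k by (intro novikov_ext_cong_on[OF \<tau>(1)]) auto
    next
      case (Suc j)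
      have \<tau>j: "\<tau> \<in> novikov_chains G \<beta> (X (Suc j))" using \<tau> Suc by simp
      have sj: "fin_map G (X j) (X (Suc j)) (s j)" using s(1) k Suc by simp
      have pj: "fin_map G (X (Suc j)) (X (Suc j)) p" using pk Suc by simp
      have "novikov_ext (\<lambda>y. frag_extend D (s k y)) \<tau> = novikov_ext (\<lambda>y. (p y - frag_of y) - frag_extend (s j) (D y)) \<tau>"
        by (rule novikov_ext_cong_on[OF \<tau>(1)]) (use s(2) k Suc in auto)
      also have "\<dots> = (\<lambda>z. novikov_ext (\<lambda>y. p y - frag_of y) \<tau> z - novikov_ext (\<lambda>y. frag_extend (s j) (D y)) \<tau> z)"
        by (rule novikov_ext_fun_diff[OF fin_map_diff[OF pj fin_map_frag_of] fin_map_comp[OF D_fin_map sj] \<tau>j])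
      also have "novikov_ext (\<lambda>y. frag_extend (s j) (D y)) \<tau> = novikov_ext (s j) (novikov_ext D \<tau>)"
        by (rule novikov_ext_comp[OF D_fin_map sj \<tau>j, symmetric])
      finally show ?thesis using \<tau>(2) Suc by simp
    qed
    also have "\<dots> = (\<lambda>z. novikov_ext p \<tau> z - novikov_ext frag_of \<tau> z)"
      by (rule novikov_ext_fun_diff[OF pk fin_map_frag_of \<tau>(1)])
    finally show ?thesis by (simp add: novikov_ext_frag_of)
  qed
  obtain m where m: "above \<beta> m \<sigma>" by (rule novikov_chains_bounded_below[OF \<sigma>])
  define P where "P j = (novikov_ext p ^^ j) \<sigma>" for j
  have P: "P j \<in> novikov_chains G \<beta> (X k) \<and> (k \<noteq> 0 \<longrightarrow> novikov_ext D (P j) = (\<lambda>_. 0)) \<and> above \<beta> (m + real j) (P j)" for j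
  proof (induction j)
    case 0
    then show ?case using \<sigma> cyc m by (simp add: P_def)
  next
    case (Suc j)
    have Pj: "P j \<in> novikov_chains G \<beta> (X k)" using Suc by simp
    have PS: "P (Suc j) = novikov_ext p (P j)" by (simp add: P_def)
    obtain X0 where X0: "X0 \<subseteq> X k" "finite X0" "{y. P j y \<noteq> 0} \<subseteq> carrier G \<times> X0" by (rule novikov_chainsE[OF Pj])
    have "above \<beta> (m + real j + 1) (P (Suc j))"
      unfolding PS
      by (rule novikov_ext_above[OF raises_subset[OF raises_mono[OF pushes_raises[OF k] t] X0(1)] X0(3)]) (use Suc in simp)
    moreover have "novikov_ext D (P (Suc j)) = (\<lambda>_. 0)" if k0: "k \<noteq> 0"
    proof -
      obtain i where i: "k = Suc i" using k0 by (cases k) auto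
      have pi: "fin_map G (X i) (X i) p" "fin_map G (X (Suc i)) (X (Suc i)) p"
        using pushes_fin_map[of i] pk k i by auto
      have Pi: "P j \<in> novikov_chains G \<beta> (X (Suc i))" using Pj i by simp
      have "novikov_ext D (P (Suc j)) = novikov_ext (\<lambda>y. frag_extend D (p y)) (P j)"
        unfolding PS by (rule D_novikov[OF \<beta> pi(2) Pi])
      also have "\<dots> = novikov_ext (\<lambda>y. frag_extend p (D y)) (P j)"
        by (rule novikov_ext_cong_on[OF Pi]) (rule pushes_D, use k i in auto)
      also have "\<dots> = novikov_ext p (novikov_ext D (P j))"
        by (rule novikov_ext_comp[OF D_fin_map pi(1) Pi, symmetric])
      finally show ?thesis using Suc k0 by simp
    qed
    ultimately show ?case using novikov_ext_closed[OF \<beta> pk Pj] by (simp add: PS ac_simps)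
  qed
  \<comment> \<open>All partial sums have to stay in common finitely many columns for their limit to
    be a Novikov chain, and the basis in degree k + 1 may be infinite.\<close>
  obtain Y0 where Y0: "finite Y0" "Y0 \<subseteq> X (Suc k)" "\<forall>g\<in>carrier G. \<forall>x\<in>X k. s k (g, x) \<in> fchains G Y0"
    "\<forall>\<sigma>. {y. \<sigma> y \<noteq> 0} \<subseteq> carrier G \<times> X k \<longrightarrow> {z. novikov_ext (s k) \<sigma> z \<noteq> 0} \<subseteq> carrier G \<times> Y0"
    by (rule novikov_ext_columns[OF sk fin subset_refl])
  obtain L where L: "raises G \<beta> (X k) (s k) (- L)" by (rule raises_bounded[OF \<beta> sk fin subset_refl])
  obtain L' where L': "raises G \<beta> Y0 D (- L')" by (rule raises_bounded[OF \<beta> D_fin_map Y0(1,2)])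
  have supp: "{y. \<tau> y \<noteq> 0} \<subseteq> carrier G \<times> X k" if \<tau>: "\<tau> \<in> novikov_chains G \<beta> (X k)" for \<tau>
  proof -
    obtain X0 where "X0 \<subseteq> X k" "{y. \<tau> y \<noteq> 0} \<subseteq> carrier G \<times> X0" by (rule novikov_chainsE[OF \<tau>])
    then show ?thesis by blast
  qed
  \<comment> \<open>Partial sums of the \<open>s p^i \<sigma>\<close>. On cycles \<open>D s\<close>
    is p minus the identity, so their boundaries telescope to \<open>P j - \<sigma>\<close>.\<close>
  define W where "W = rec_nat (\<lambda>_. 0 :: int) (\<lambda>j w z. w z + novikov_ext (s k) (P j) z)"
  have W_simps: "W 0 = (\<lambda>_. 0)" "W (Suc j) = (\<lambda>z. W j z + novikov_ext (s k) (P j) z)" for j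
    by (simp_all add: W_def)
  have sP: "novikov_ext (s k) (P j) \<in> novikov_chains G \<beta> (X (Suc k))" for j
    using P[of j] novikov_ext_closed[OF \<beta> sk] by blast
  have W: "W j \<in> novikov_chains G \<beta> (X (Suc k))" for j
    by (induction j) (simp_all add: W_simps novikov_chains_zero novikov_chains_add sP)
  have sPcol: "{z. novikov_ext (s k) (P j) z \<noteq> 0} \<subseteq> carrier G \<times> Y0" for j
    using Y0(4) supp P[of j] by blast
  have Wcol: "{y. W j y \<noteq> 0} \<subseteq> carrier G \<times> Y0" for j
  proof (induction j)
    case (Suc j)
    have "{y. W (Suc j) y \<noteq> 0} \<subseteq> {y. W j y \<noteq> 0} \<union> {z. novikov_ext (s k) (P j) z \<noteq> 0}"
      by (auto simp: W_simps)
    then show ?case using Suc sPcol[of j] by blast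
  qed (simp add: W_simps)
  have step: "above \<beta> (real j - (L - m)) (\<lambda>y. W (Suc j) y - W j y)" for j
  proof -
    have "above \<beta> (m + real j + - L) (novikov_ext (s k) (P j))"
      using P[of j] supp by (intro novikov_ext_above[OF L]) auto
    moreover have "(\<lambda>y. W (Suc j) y - W j y) = novikov_ext (s k) (P j)" by (simp add: W_simps)
    ultimately show ?thesis by (simp add: algebra_simps)
  qed
  have DW: "novikov_ext D (W j) = (\<lambda>z. P j z - \<sigma> z)" for j
  proof (induction j)
    case 0
    then show ?case by (simp add: W_simps P_def)
  next
    case (Suc j)
    have "novikov_ext D (W (Suc j)) = (\<lambda>z. novikov_ext D (W j) z + novikov_ext D (novikov_ext (s k) (P j)) z)"
      unfolding W_simps by (rule novikov_ext_add[OF D_fin_map W sP])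
    also have "novikov_ext D (novikov_ext (s k) (P j)) = (\<lambda>z. P (Suc j) z - P j z)"
      using Ds[of "P j"] P[of j] by (simp add: P_def)
    finally show ?case using Suc by simp
  qed
  obtain \<tau> where \<tau>: "\<tau> \<in> novikov_chains G \<beta> (X (Suc k))" "{y. \<tau> y \<noteq> 0} \<subseteq> carrier G \<times> Y0"
    and lim: "\<forall>j. above \<beta> (real j - (L - m)) (\<lambda>y. \<tau> y - W j y)"
    by (rule novikov_chains_limit[OF Y0(1,2) W Wcol step])
  have "(\<lambda>z. novikov_ext D \<tau> z + \<sigma> z) = (\<lambda>_. 0)"
  proof (rule above_all_imp_zero)
    fix j
    \<comment> \<open>One constant for two terms: \<open>L - m + L'\<close> accounts for the losses
      of s and \<open>D\<close> and for the bottom m of \<sigma> in the boundary of the tail, and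
      \<open>- m\<close> for the iterate \<open>P j\<close>.\<close>
    let ?M = "max (L - m + L') (- m)"
    have "{y. \<tau> y - W j y \<noteq> 0} \<subseteq> {y. \<tau> y \<noteq> 0} \<union> {y. W j y \<noteq> 0}" by auto
    then have "{y. \<tau> y - W j y \<noteq> 0} \<subseteq> carrier G \<times> Y0" using \<tau>(2) Wcol[of j] by blast
    then have "above \<beta> (real j - (L - m) + - L') (novikov_ext D (\<lambda>y. \<tau> y - W j y))"
      by (rule novikov_ext_above[OF L' _ lim[rule_format]])
    moreover have "above \<beta> (m + real j) (P j)" using P by blast
    ultimately have "above \<beta> (real j - ?M) (\<lambda>z. novikov_ext D (\<lambda>y. \<tau> y - W j y) z + P j z)"
      by (intro above_add) (erule above_mono, simp)+
    then show "above \<beta> (real j - ?M) (\<lambda>z. novikov_ext D \<tau> z + \<sigma> z)"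
      by (simp add: novikov_ext_diff[OF D_fin_map \<tau>(1) W] DW)
  qed
  then have "novikov_ext D \<tau> z + \<sigma> z = 0" for z by (rule fun_cong)
  then have "- novikov_ext D \<tau> z = \<sigma> z" for z by (metis add.inverse_unique)
  then have "novikov_ext D (\<lambda>y. - \<tau> y) = \<sigma>"
    unfolding novikov_ext_uminus[OF D_fin_map \<tau>(1)] by (rule ext)
  then show "\<exists>\<tau>\<in>novikov_chains G \<beta> (X (Suc k)). novikov_ext D \<tau> = \<sigma>"
    using novikov_chains_uminus[OF \<tau>(1)] by blast
qed

end

end

text \<open>
  The function \<open>h \<mapsto> \<beta> (ah) - \<beta> a\<close> belongs to the boundary point \<open>a\<^sup>-\<^sup>1 e\<close> if \<open>\<beta>\<close> belongs to \<open>e\<close>, so the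
  limit heights of \<open>\<beta>\<close> describe the closure of the orbit of \<open>e\<close>.
\<close>

definition limit_height ::
    "('g, 'b) monoid_scheme \<Rightarrow> ('g \<Rightarrow> real) \<Rightarrow> 'g filter \<Rightarrow> ('g \<Rightarrow> real) \<Rightarrow> bool" where
  "limit_height G \<beta> U \<beta>' \<longleftrightarrow> ultrafilter U \<and> eventually (\<lambda>a. a \<in> carrier G) U \<and>
     (\<forall>h\<in>carrier G. ((\<lambda>a. \<beta> (a \<otimes>\<^bsub>G\<^esub> h) - \<beta> a) \<longlongrightarrow> \<beta>' h) U)"

section \<open>Limits of heights and of pushing maps along an ultrafilter\<close>

context group
begin

lemma lookup_translate:
  assumes "a \<in> carrier G" "h \<in> carrier G" "c \<in> fchains G X"
  shows "Poly_Mapping.lookup (translate G a c) (a \<otimes> h, x) = Poly_Mapping.lookup c (h, x)"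
  using assms(3) by (induction rule: chains_induct)
    (use assms(1,2) in \<open>auto simp: translate_diff lookup_minus lookup_frag_of\<close>)

text \<open>Turns conditions on a translated chain into inequalities for the numbers
  \<open>\<beta> (a \<otimes> h)\<close>, which are the ones that converge after subtraction of
  \<open>\<beta> a\<close>.\<close>

lemma above_translate_iff:
  assumes a: "a \<in> carrier G" and c: "c \<in> fchains G X"
  shows "above \<beta> s (Poly_Mapping.lookup (translate G a c)) \<longleftrightarrow>
    (\<forall>y\<in>Poly_Mapping.keys c. s \<le> \<beta> (a \<otimes> fst y))" (is "?l \<longleftrightarrow> ?r")
proof
  assume l: ?l
  show ?r
  proof
    fix y assume y: "y \<in> Poly_Mapping.keys c"
    then have h: "fst y \<in> carrier G" using c by (auto simp: fchains_def)
    have "Poly_Mapping.lookup (translate G a c) (a \<otimes> fst y, snd y) \<noteq> 0"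
      unfolding lookup_translate[OF a h c] using y by (simp add: in_keys_iff)
    then have "s \<le> \<beta> (fst (a \<otimes> fst y, snd y))" using l unfolding above_def by blast
    then show "s \<le> \<beta> (a \<otimes> fst y)" by simp
  qed
next
  assume r: ?r
  show ?l
    unfolding above_def
  proof (intro allI impI)
    fix z assume "Poly_Mapping.lookup (translate G a c) z \<noteq> 0"
    then have "z \<in> (\<lambda>(h, x). (a \<otimes> h, x)) ` Poly_Mapping.keys c"
      using keys_translate[of G a c] by (auto simp: in_keys_iff)
    then show "s \<le> \<beta> (fst z)" using r by auto
  qed
qed

text \<open>The height condition for h bounds \<open>\<beta> (a \<otimes> h) - \<beta> a\<close>
  from below and the one for \<open>inv h\<close> bounds it from above, so that the difference stays
  in a compact interval.\<close>

lemma limit_height_exists: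
  assumes \<beta>: "height G \<beta>" and U: "ultrafilter U" "eventually (\<lambda>a. a \<in> carrier G) U"
  obtains \<beta>' where "limit_height G \<beta> U \<beta>'"
proof -
  have "\<forall>h\<in>carrier G. \<exists>l. ((\<lambda>a. \<beta> (a \<otimes> h) - \<beta> a) \<longlongrightarrow> l) U"
  proof
    fix h assume h: "h \<in> carrier G"
    obtain L1 where L1: "\<forall>g\<in>carrier G. \<beta> (g \<otimes> h) \<ge> \<beta> g - L1" using \<beta> h by (auto simp: height_def)
    obtain L2 where L2: "\<forall>g\<in>carrier G. \<beta> (g \<otimes> inv h) \<ge> \<beta> g - L2"
      using \<beta> inv_closed[OF h] unfolding height_def by blast
    have "\<beta> (a \<otimes> h) - \<beta> a \<in> {- L1..L2}" if a: "a \<in> carrier G" for a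
      using L1[rule_format, OF a] L2[rule_format, of "a \<otimes> h"] a h by (simp add: m_assoc)
    then have "eventually (\<lambda>a. \<beta> (a \<otimes> h) - \<beta> a \<in> {- L1..L2}) U"
      using U(2) by (rule eventually_mono[rotated])
    then obtain l where "((\<lambda>a. \<beta> (a \<otimes> h) - \<beta> a) \<longlongrightarrow> l) U"
      by (rule ultrafilter_tendsto_compact[OF U(1) compact_Icc])
    then show "\<exists>l. ((\<lambda>a. \<beta> (a \<otimes> h) - \<beta> a) \<longlongrightarrow> l) U" by blast
  qed
  then have "\<exists>\<beta>'. \<forall>h\<in>carrier G. ((\<lambda>a. \<beta> (a \<otimes> h) - \<beta> a) \<longlongrightarrow> \<beta>' h) U" by (rule bchoice)
  then show thesis using U that by (auto simp: limit_height_def)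
qed

context
  fixes \<beta> \<beta>' :: "'a \<Rightarrow> real" and U
  assumes lim: "limit_height G \<beta> U \<beta>'"
begin

lemma limit_ultrafilter: "ultrafilter U"
  and limit_not_bot: "U \<noteq> bot"
  and limit_carrier: "eventually (\<lambda>a. a \<in> carrier G) U"
  and limit_tendsto: "h \<in> carrier G \<Longrightarrow> ((\<lambda>a. \<beta> (a \<otimes> h) - \<beta> a) \<longlongrightarrow> \<beta>' h) U"
  using lim by (auto simp: limit_height_def ultrafilter_def)

lemma limit_height_mono:
  assumes "h \<in> carrier G" "h' \<in> carrier G"
    "eventually (\<lambda>a. \<beta> (a \<otimes> h) + t \<le> \<beta> (a \<otimes> h')) U"
  shows "\<beta>' h + t \<le> \<beta>' h'"
proof (rule tendsto_le[OF limit_not_bot limit_tendsto[OF assms(2)]])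
  show "((\<lambda>a. (\<beta> (a \<otimes> h) - \<beta> a) + t) \<longlongrightarrow> \<beta>' h + t) U"
    by (intro tendsto_add limit_tendsto assms(1) tendsto_const)
  show "eventually (\<lambda>a. (\<beta> (a \<otimes> h) - \<beta> a) + t \<le> \<beta> (a \<otimes> h') - \<beta> a) U"
    using assms(3) by eventually_elim simp
qed

lemma limit_height_one: "\<beta>' \<one> = 0"
proof -
  have "((\<lambda>a. 0) \<longlongrightarrow> \<beta>' \<one>) U"
  proof (rule Lim_transform_eventually[OF limit_tendsto[OF one_closed]])
    show "eventually (\<lambda>a. \<beta> (a \<otimes> \<one>) - \<beta> a = 0) U"
      using limit_carrier by eventually_elim simp
  qed
  then show ?thesis using tendsto_unique[OF limit_not_bot _ tendsto_const] by blast
qed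

lemma height_limit_height: "height G \<beta> \<Longrightarrow> height G \<beta>'"
  unfolding height_def
proof
  fix h assume \<beta>: "\<forall>h\<in>carrier G. \<exists>L. \<forall>g\<in>carrier G. \<beta> (g \<otimes> h) \<ge> \<beta> g - L" and h: "h \<in> carrier G"
  then obtain L where L: "\<forall>g\<in>carrier G. \<beta> (g \<otimes> h) \<ge> \<beta> g - L" by blast
  have "\<beta>' g + - L \<le> \<beta>' (g \<otimes> h)" if g: "g \<in> carrier G" for g
  proof (rule limit_height_mono[OF g m_closed[OF g h]])
    show "eventually (\<lambda>a. \<beta> (a \<otimes> g) + - L \<le> \<beta> (a \<otimes> (g \<otimes> h))) U"
      using limit_carrier
    proof eventually_elim
      case (elim a)
      then show ?case using L[rule_format, of "a \<otimes> g"] g h by (simp add: m_assoc)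
    qed
  qed
  then show "\<exists>L. \<forall>g\<in>carrier G. \<beta>' g - L \<le> \<beta>' (g \<otimes> h)" by (intro exI[of _ L]) simp
qed

lemma limit_above:
  assumes c: "c \<in> fchains G X"
    and ev: "eventually (\<lambda>a. above \<beta> (\<beta> a + t) (Poly_Mapping.lookup (translate G a c))) U"
  shows "above \<beta>' t (Poly_Mapping.lookup c)"
  unfolding above_def
proof (intro allI impI)
  fix y assume "Poly_Mapping.lookup c y \<noteq> 0"
  then have y: "y \<in> Poly_Mapping.keys c" by (simp add: in_keys_iff)
  then have h: "fst y \<in> carrier G" using c by (auto simp: fchains_def)
  have "eventually (\<lambda>a. \<beta> (a \<otimes> \<one>) + t \<le> \<beta> (a \<otimes> fst y)) U"
    using ev limit_carrier
  proof eventually_elim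
    case (elim a)
    then show ?case using above_translate_iff[OF elim(2) c] y by simp
  qed
  from limit_height_mono[OF one_closed h this] show "t \<le> \<beta>' (fst y)" by (simp add: limit_height_one)
qed

text \<open>The way back from the limit to almost all a. A limit inequality is inherited only with a
  strict loss; the finite support of c makes finitely many such inequalities enough.\<close>

lemma eventually_above:
  assumes c: "c \<in> fchains G X" and t: "above \<beta>' t' (Poly_Mapping.lookup c)" "t < t'"
  shows "eventually (\<lambda>a. above \<beta> (\<beta> a + t) (Poly_Mapping.lookup (translate G a c))) U"
proof -
  have "\<forall>y\<in>Poly_Mapping.keys c. eventually (\<lambda>a. t < \<beta> (a \<otimes> fst y) - \<beta> a) U"
  proof
    fix y assume y: "y \<in> Poly_Mapping.keys c"
    then have h: "fst y \<in> carrier G" using c by (auto simp: fchains_def)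
    have "t' \<le> \<beta>' (fst y)" using t(1) y unfolding above_def in_keys_iff by blast
    then have "t < \<beta>' (fst y)" using t(2) by simp
    then show "eventually (\<lambda>a. t < \<beta> (a \<otimes> fst y) - \<beta> a) U"
      by (rule order_tendstoD(1)[OF limit_tendsto[OF h]])
  qed
  then have "eventually (\<lambda>a. \<forall>y\<in>Poly_Mapping.keys c. t < \<beta> (a \<otimes> fst y) - \<beta> a) U"
    by (simp add: eventually_ball_finite)
  then show ?thesis using limit_carrier
  proof eventually_elim
    case (elim a)
    have "\<beta> a + t \<le> \<beta> (a \<otimes> fst y)" if "y \<in> Poly_Mapping.keys c" for y
      using elim(1)[rule_format, OF that] by simp
    then show ?case unfolding above_translate_iff[OF elim(2) c] by blast
  qed
qed

end

end

context free_complex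
begin

text \<open>On a basis element the conjugates of p by a take finitely many values and hence are
  constant along U. Each defining property of a pushing map concerns finitely many basis elements at
  a time, so it is read off at a single suitable a, or, for the shift, in the limit over a.\<close>

lemma pushes_limit:
  assumes p: "pushes G \<beta> X D N p t" and lim: "limit_height G \<beta> U \<beta>'"
  obtains p' where "pushes G \<beta>' X D N p' t"
proof -
  note U = limit_not_bot[OF lim]
  define conj where "conj a c = translate G (inv a) (frag_extend p (translate G a c))" for a and c :: "('g \<times> 'x) \<Rightarrow>\<^sub>0 int"
  \<comment> \<open>The value is unique, as U is proper.\<close>
  define p' where "p' y = (SOME v. eventually (\<lambda>a. conj a (frag_of y) = v) U)" for y
  have p'_ev: "eventually (\<lambda>a. conj a (frag_of (g, x)) = p' (g, x)) U"
    if k: "k < N" and gx: "g \<in> carrier G" "x \<in> X k" for k g x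
  proof -
    have fin: "finite ((\<lambda>a. conj a (frag_of (g, x))) ` carrier G)"
      unfolding conj_def by (rule fin_map_conj_finite[OF pushes_fin_map[OF p k]]) (use gx in simp)
    have "eventually (\<lambda>a. conj a (frag_of (g, x)) \<in> (\<lambda>a. conj a (frag_of (g, x))) ` carrier G) U"
      using limit_carrier[OF lim] by eventually_elim simp
    then obtain v where "eventually (\<lambda>a. conj a (frag_of (g, x)) = v) U"
      by (rule ultrafilter_finite_range[OF limit_ultrafilter[OF lim] fin])
    then show ?thesis unfolding p'_def by (rule someI)
  qed
  have conj_diff: "conj a (c - c') = conj a c - conj a c'" for a c c'
    by (simp add: conj_def translate_diff frag_extend_diff)
  have ev: "eventually (\<lambda>a. conj a c = frag_extend p' c) U" if k: "k < N" and c: "c \<in> fchains G (X k)" for k c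
    using c
  proof (induction rule: chains_induct)
    case zero
    show ?case by (simp add: conj_def)
  next
    case (of g x)
    then show ?case using p'_ev[OF k] by simp
  next
    case (diff a b)
    from diff.IH show ?case by eventually_elim (simp add: conj_diff frag_extend_diff)
  qed
  have fm: "fin_map G (X k) (X k) p'" if k: "k < N" for k
  proof (rule fin_mapI)
    fix g x assume gx: "g \<in> carrier G" "x \<in> X k"
    have "eventually (\<lambda>a. a \<in> carrier G \<and> conj a (frag_of (g, x)) = p' (g, x)) U"
      using p'_ev[OF k gx] limit_carrier[OF lim] by eventually_elim simp
    then obtain a where a: "a \<in> carrier G" "conj a (frag_of (g, x)) = p' (g, x)"
      using eventually_happens'[OF U] by blast
    have pag: "p (a \<otimes> g, x) \<in> fchains G (X k)" using fin_map_closed[OF pushes_fin_map[OF p k]] a gx by simp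
    \<comment> \<open>The normalised values of the limit are among those of p itself, so the finite
      supply of p also serves for \<open>p'\<close>.\<close>
    have "p' (g, x) = translate G g (translate G (inv (a \<otimes> g)) (p (a \<otimes> g, x)))"
      using a gx pag unfolding a(2)[symmetric] conj_def
      by (simp add: translate_translate inv_mult_group m_assoc[symmetric])
    moreover have "translate G (inv (a \<otimes> g)) (p (a \<otimes> g, x)) \<in> fchains G (X k)"
      using a gx pag by (intro translate_closed) auto
    ultimately show "finite ((\<lambda>g. translate G (inv g) (p (g, x))) ` carrier G) \<and>
       (\<exists>c\<in>(\<lambda>g. translate G (inv g) (p (g, x))) ` carrier G. c \<in> fchains G (X k) \<and> p' (g, x) = translate G g c)"
      using pushes_fin_map[OF p k] gx a by (auto simp: fin_map_def)
  qed
  have rs: "raises G \<beta>' (X k) p' t" if k: "k < N" for k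
    unfolding raises_def above_def
  proof (intro ballI allI impI)
    fix g x z assume gx: "g \<in> carrier G" "x \<in> X k" and z: "Poly_Mapping.lookup (p' (g, x)) z \<noteq> 0"
    have p': "p' (g, x) \<in> fchains G (X k)" by (rule fin_map_closed[OF fm[OF k] gx])
    have zk: "z \<in> Poly_Mapping.keys (p' (g, x))" using z by (simp add: in_keys_iff)
    then have zG: "fst z \<in> carrier G" using p' by (auto simp: fchains_def)
    have "eventually (\<lambda>a. \<beta> (a \<otimes> g) + t \<le> \<beta> (a \<otimes> fst z)) U"
      using p'_ev[OF k gx] limit_carrier[OF lim]
    proof eventually_elim
      case (elim a)
      have pag: "p (a \<otimes> g, x) \<in> fchains G (X k)" using fin_map_closed[OF pushes_fin_map[OF p k]] elim gx by simp
      have "translate G a (p' (g, x)) = p (a \<otimes> g, x)"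
        unfolding elim(1)[symmetric] conj_def using elim(2) pag by (simp add: translate_inv)
      moreover have "above \<beta> (\<beta> (a \<otimes> g) + t) (Poly_Mapping.lookup (p (a \<otimes> g, x)))"
        using pushes_raises[OF p k] elim(2) gx by (simp add: raises_def)
      ultimately show ?case using above_translate_iff[OF elim(2) p'] zk by simp
    qed
    then show "\<beta>' g + t \<le> \<beta>' (fst z)" by (rule limit_height_mono[OF lim gx(1) zG])
  qed
  have chain: "frag_extend D (p' (g, x)) = frag_extend p' (D (g, x))"
    if k: "Suc k < N" and gx: "g \<in> carrier G" "x \<in> X (Suc k)" for k g x
  proof -
    have k': "k < N" using k by simp
    have "eventually (\<lambda>a. a \<in> carrier G \<and> conj a (frag_of (g, x)) = p' (g, x) \<and>
        conj a (D (g, x)) = frag_extend p' (D (g, x))) U"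
      using p'_ev[OF k gx] limit_carrier[OF lim] ev[OF k' D_closed[OF gx]] by eventually_elim simp
    then obtain a where a: "a \<in> carrier G" "conj a (frag_of (g, x)) = p' (g, x)"
        "conj a (D (g, x)) = frag_extend p' (D (g, x))"
      using eventually_happens'[OF U] by blast
    have pag: "p (a \<otimes> g, x) \<in> fchains G (X (Suc k))" using fin_map_closed[OF pushes_fin_map[OF p k]] a gx by simp
    have "frag_extend D (p' (g, x)) = translate G (inv a) (frag_extend D (p (a \<otimes> g, x)))"
      unfolding a(2)[symmetric] conj_def using a(1) pag by (simp add: equivariant_frag_extend[OF D_equivariant])
    also have "frag_extend D (p (a \<otimes> g, x)) = frag_extend p (D (a \<otimes> g, x))"
      using pushes_D[OF p k] a gx by simp
    also have "D (a \<otimes> g, x) = translate G a (D (g, x))"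
      using D_equivariant a gx by (simp add: equivariant_def)
    also have "translate G (inv a) (frag_extend p (translate G a (D (g, x)))) = frag_extend p' (D (g, x))"
      using a(3) by (simp add: conj_def)
    finally show ?thesis .
  qed
  have ident: "\<exists>c\<in>fchains G (X 1). frag_extend D c = p' (g, x) - frag_of (g, x)"
    if N: "0 < N" and gx: "g \<in> carrier G" "x \<in> X 0" for g x
  proof -
    have "eventually (\<lambda>a. a \<in> carrier G \<and> conj a (frag_of (g, x)) = p' (g, x)) U"
      using p'_ev[OF N gx] limit_carrier[OF lim] by eventually_elim simp
    then obtain a where a: "a \<in> carrier G" "conj a (frag_of (g, x)) = p' (g, x)"
      using eventually_happens'[OF U] by blast
    have "a \<otimes> g \<in> carrier G" using a gx by simp
    from pushes_id[OF p N this gx(2)] obtain c where c: "c \<in> fchains G (X (Suc 0))"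
       "frag_extend D c = p (a \<otimes> g, x) - frag_of (a \<otimes> g, x)" by auto
    have "frag_extend D (translate G (inv a) c) = p' (g, x) - frag_of (g, x)"
      using a gx c unfolding a(2)[symmetric] conj_def
      by (simp add: equivariant_frag_extend[OF D_equivariant] translate_diff m_assoc[symmetric])
    then show ?thesis using a c by (intro bexI[of _ "translate G (inv a) c"]) (simp_all add: translate_closed)
  qed
  show thesis by (rule that[of p']) (use fm rs chain ident in \<open>auto simp: pushes_def\<close>)
qed

text \<open>
  If no finite set of corrections \<open>c\<close> of the \<open>g\<^sup>-\<^sup>1 T\<^sub>m(gx)\<close> is high enough for all \<open>g\<close>, some ultrafilter on \<open>G\<close>
  avoids every correction. Along it, all \<open>g\<^sup>-\<^sup>1 T\<^sub>j(gx)\<close> and the translates of \<open>\<beta>\<close> converge; the limit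
  over \<open>j\<close> is then a Novikov cycle for the limit height, and cutting off a chain which it bounds yields
  a correction that works for almost all \<open>g\<close>.
\<close>

lemma compact_choice:
  assumes \<beta>: "height G \<beta>" and fin: "finite (X k)"
    and T: "\<And>m. fin_map G (X k) (X k) (T m)"
    and step: "\<And>m. raises G \<beta> (X k) (\<lambda>y. T (Suc m) y - T m y) (real m - L)"
    and cyc: "\<And>m. k \<noteq> 0 \<Longrightarrow> raises G \<beta> (X k) (\<lambda>y. frag_extend D (T m y)) (real m - L)"
    and ex: "\<And>U \<beta>'. limit_height G \<beta> U \<beta>' \<Longrightarrow> novikov_exact G \<beta>' X D k"
    and m: "real m \<ge> L + 2" and x: "x \<in> X k"
  shows "\<exists>C. finite C \<and> (\<forall>g\<in>carrier G. \<exists>c\<in>C. c \<in> fchains G (X k) \<and>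
     above \<beta> (\<beta> g + 1) (Poly_Mapping.lookup (translate G g c)) \<and>
     (\<exists>w\<in>fchains G (X (Suc k)). frag_extend D w = translate G (inv g) (T m (g, x)) - c))"
proof (rule ccontr)
  define good where "good g c \<longleftrightarrow> c \<in> fchains G (X k) \<and>
     above \<beta> (\<beta> g + 1) (Poly_Mapping.lookup (translate G g c)) \<and>
     (\<exists>w\<in>fchains G (X (Suc k)). frag_extend D w = translate G (inv g) (T m (g, x)) - c)" for g c
  assume "\<not> ?thesis"
  then have bad: "\<exists>g\<in>carrier G. \<forall>c\<in>C. \<not> good g c" if "finite C" for C
    using that unfolding good_def[symmetric] by blast
  have fip: "\<exists>g. \<forall>c\<in>C. g \<in> {g \<in> carrier G. \<not> good g c}" if "finite C" "C \<subseteq> UNIV" for C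
    using bad[OF that(1)] by auto
  obtain U where U: "ultrafilter U" "\<forall>c\<in>UNIV. eventually (\<lambda>g. g \<in> {g \<in> carrier G. \<not> good g c}) U"
    by (rule ultrafilter_exists[OF fip])
  have UG: "eventually (\<lambda>g. g \<in> carrier G) U"
    using U(2)[rule_format, of 0] by (rule eventually_mono) auto
  obtain \<beta>' where lim: "limit_height G \<beta> U \<beta>'" by (rule limit_height_exists[OF \<beta> U(1) UG])
  note not_bot = limit_not_bot[OF lim]
  have \<beta>': "height G \<beta>'" by (rule height_limit_height[OF lim \<beta>])
  define Tg where "Tg j a = translate G (inv a) (T j (a, x))" for j a
  have Tg: "Tg j a \<in> fchains G (X k)" "translate G a (Tg j a) = T j (a, x)" if "a \<in> carrier G" for j a
    using translate_closed[OF inv_closed[OF that] fin_map_closed[OF T that x]]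
      translate_inv(2)[OF that fin_map_closed[OF T that x]] by (simp_all add: Tg_def)
  have "\<forall>j. \<exists>v. v \<in> fchains G (X k) \<and> eventually (\<lambda>a. Tg j a = v) U"
  proof
    fix j
    have fin: "finite (Tg j ` carrier G)" using T[of j] x by (simp add: fin_map_def Tg_def)
    have "eventually (\<lambda>a. Tg j a \<in> Tg j ` carrier G) U" using UG by eventually_elim simp
    then obtain v where "v \<in> Tg j ` carrier G" "eventually (\<lambda>a. Tg j a = v) U"
      by (rule ultrafilter_finite_range[OF U(1) fin])
    then show "\<exists>v. v \<in> fchains G (X k) \<and> eventually (\<lambda>a. Tg j a = v) U" using Tg(1) by auto
  qed
  then have "\<exists>v. \<forall>j. v j \<in> fchains G (X k) \<and> eventually (\<lambda>a. Tg j a = v j) U" by (rule choice)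
  then obtain v where v: "\<forall>j. v j \<in> fchains G (X k) \<and> eventually (\<lambda>a. Tg j a = v j) U" by (rule exE)
  have vk: "v j \<in> fchains G (X k)" and vev: "eventually (\<lambda>a. Tg j a = v j) U" for j using v by auto
  define \<sigma> where "\<sigma> j = Poly_Mapping.lookup (v j)" for j
  have \<sigma>: "\<sigma> j \<in> novikov_chains G \<beta>' (X k)" for j unfolding \<sigma>_def by (rule novikov_chains_lookup[OF vk])
  have \<sigma>col: "{y. \<sigma> j y \<noteq> 0} \<subseteq> carrier G \<times> X k" for j
    using vk[of j] by (auto simp: \<sigma>_def fchains_def in_keys_iff)
  have \<sigma>step: "above \<beta>' (real j - L) (\<lambda>y. \<sigma> (Suc j) y - \<sigma> j y)" for j
  proof -
    have "eventually (\<lambda>a. above \<beta> (\<beta> a + (real j - L)) (Poly_Mapping.lookup (translate G a (v (Suc j) - v j)))) U"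
      using vev[of j] vev[of "Suc j"] UG
    proof eventually_elim
      case (elim a)
      then have "translate G a (v (Suc j) - v j) = T (Suc j) (a, x) - T j (a, x)"
        using Tg(2)[OF elim(3), of j] Tg(2)[OF elim(3), of "Suc j"] by (simp add: translate_diff)
      then show ?case using step[of j] elim(3) x by (simp add: raises_def)
    qed
    then have "above \<beta>' (real j - L) (Poly_Mapping.lookup (v (Suc j) - v j))"
      by (rule limit_above[OF lim chains_diff[OF vk vk]])
    moreover have "(\<lambda>y. \<sigma> (Suc j) y - \<sigma> j y) = Poly_Mapping.lookup (v (Suc j) - v j)"
      by (simp add: \<sigma>_def lookup_minus fun_eq_iff)
    ultimately show ?thesis by simp
  qed
  obtain \<tau> where \<tau>: "\<tau> \<in> novikov_chains G \<beta>' (X k)" "{y. \<tau> y \<noteq> 0} \<subseteq> carrier G \<times> X k"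
      "\<forall>j. above \<beta>' (real j - L) (\<lambda>y. \<tau> y - \<sigma> j y)"
    by (rule novikov_chains_limit[OF fin subset_refl \<sigma> \<sigma>col \<sigma>step])
  \<comment> \<open>The \<open>\<sigma> j\<close> need not be cycles. Their boundaries rise with j,
    and so do those of the differences \<open>\<tau> - \<sigma> j\<close>; hence the boundary of
    \<tau> lies above every height.\<close>
  have "k \<noteq> 0 \<longrightarrow> novikov_ext D \<tau> = (\<lambda>_. 0)"
  proof
    assume k0: "k \<noteq> 0"
    then obtain i where i: "k = Suc i" by (cases k) auto
    have Df: "fin_map G (X k) (X i) D" unfolding i by (rule D_fin_map)
    obtain L' where L': "raises G \<beta>' (X k) D (- L')" by (rule raises_bounded[OF \<beta>' Df fin subset_refl])
    show "novikov_ext D \<tau> = (\<lambda>_. 0)"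
    proof (rule above_all_imp_zero)
      fix j
      have "eventually (\<lambda>a. above \<beta> (\<beta> a + (real j - L)) (Poly_Mapping.lookup (translate G a (frag_extend D (v j))))) U"
        using vev[of j] UG
      proof eventually_elim
        case (elim a)
        have "translate G a (frag_extend D (v j)) = frag_extend D (translate G a (v j))"
          using equivariant_frag_extend[OF D_equivariant elim(2)] vk[of j] i by simp
        also have "translate G a (v j) = T j (a, x)" using Tg(2)[OF elim(2), of j] elim(1) by simp
        finally show ?case using cyc[OF k0, of j] elim(2) x by (simp add: raises_def)
      qed
      then have "above \<beta>' (real j - L) (Poly_Mapping.lookup (frag_extend D (v j)))"
        by (rule limit_above[OF lim fin_map_chains[OF Df vk]])
      then have "above \<beta>' (real j - L) (novikov_ext D (\<sigma> j))"
        by (simp add: \<sigma>_def novikov_ext_lookup)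
      moreover have "above \<beta>' (real j - L + - L') (novikov_ext D (\<lambda>y. \<tau> y - \<sigma> j y))"
      proof (rule novikov_ext_above[OF L'])
        have "{y. \<tau> y - \<sigma> j y \<noteq> 0} \<subseteq> {y. \<tau> y \<noteq> 0} \<union> {y. \<sigma> j y \<noteq> 0}" by auto
        then show "{y. \<tau> y - \<sigma> j y \<noteq> 0} \<subseteq> carrier G \<times> X k" using \<tau>(2) \<sigma>col[of j] by blast
      qed (use \<tau>(3) in blast)
      ultimately have "above \<beta>' (real j - (L + \<bar>L'\<bar>))
          (\<lambda>z. novikov_ext D (\<sigma> j) z + novikov_ext D (\<lambda>y. \<tau> y - \<sigma> j y) z)"
        by (intro above_add) (erule above_mono, simp)+
      then show "above \<beta>' (real j - (L + \<bar>L'\<bar>)) (novikov_ext D \<tau>)"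
        by (simp add: novikov_ext_diff[OF Df \<tau>(1) \<sigma>])
    qed
  qed
  then obtain \<omega> where \<omega>: "\<omega> \<in> novikov_chains G \<beta>' (X (Suc k))" "novikov_ext D \<omega> = \<tau>"
    using ex[OF lim] \<tau>(1) unfolding novikov_exact_def by blast
  obtain X1 where X1: "X1 \<subseteq> X (Suc k)" "finite X1" "{y. \<omega> y \<noteq> 0} \<subseteq> carrier G \<times> X1"
    by (rule novikov_chainsE[OF \<omega>(1)])
  obtain L1 where L1: "raises G \<beta>' X1 D (- L1)" by (rule raises_bounded[OF \<beta>' D_fin_map X1(2,1)])
  \<comment> \<open>\<open>D\<close> loses at most \<open>L1\<close>, so the boundary of the part
    cut off above \<open>2 + L1\<close> still lies above 2.\<close>
  obtain w where w: "Poly_Mapping.keys w \<subseteq> {y. \<omega> y \<noteq> 0}"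
      "above \<beta>' (2 + L1) (\<lambda>y. \<omega> y - Poly_Mapping.lookup w y)"
    by (rule novikov_chains_truncate[OF \<omega>(1)])
  have wX: "w \<in> fchains G (X (Suc k))"
    unfolding fchains_def using w(1) X1(1,3) by auto
  \<comment> \<open>Relative to \<tau>, this is the boundary of the part cut off minus the tail
    \<open>\<tau> - \<sigma> m\<close>. The tail is above 2 because m is at least
    \<open>L + 2\<close>.\<close>
  define c where "c = v m - frag_extend D w"
  have c: "c \<in> fchains G (X k)"
    unfolding c_def by (rule chains_diff[OF vk fin_map_chains[OF D_fin_map wX]])
  have "above \<beta>' 2 (Poly_Mapping.lookup c)"
  proof -
    have "{y. \<omega> y - Poly_Mapping.lookup w y \<noteq> 0} \<subseteq> {y. \<omega> y \<noteq> 0} \<union> Poly_Mapping.keys w"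
      by (auto simp: in_keys_iff)
    then have "{y. \<omega> y - Poly_Mapping.lookup w y \<noteq> 0} \<subseteq> carrier G \<times> X1" using X1(3) w(1) by blast
    then have "above \<beta>' (2 + L1 + - L1) (novikov_ext D (\<lambda>y. \<omega> y - Poly_Mapping.lookup w y))"
      by (rule novikov_ext_above[OF L1 _ w(2)])
    then have "above \<beta>' 2 (\<lambda>z. \<tau> z - Poly_Mapping.lookup (frag_extend D w) z)"
      by (simp add: novikov_ext_diff[OF D_fin_map \<omega>(1) novikov_chains_lookup[OF wX]] \<omega>(2) novikov_ext_lookup)
    moreover have "above \<beta>' 2 (\<lambda>y. \<tau> y - \<sigma> m y)"
      using \<tau>(3) m above_mono[of \<beta>' "real m - L" _ 2] by auto
    ultimately have "above \<beta>' 2 (\<lambda>z. (\<tau> z - Poly_Mapping.lookup (frag_extend D w) z) - (\<tau> z - \<sigma> m z))"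
      by (rule above_diff)
    moreover have "(\<lambda>z. (\<tau> z - Poly_Mapping.lookup (frag_extend D w) z) - (\<tau> z - \<sigma> m z)) = Poly_Mapping.lookup c"
      by (simp add: c_def \<sigma>_def lookup_minus fun_eq_iff)
    ultimately show ?thesis by simp
  qed
  \<comment> \<open>Height 2 in the limit leaves the slack needed to have height 1 for almost all
    a.\<close>
  then have "eventually (\<lambda>a. above \<beta> (\<beta> a + 1) (Poly_Mapping.lookup (translate G a c))) U"
    by (rule eventually_above[OF lim c]) simp
  then have "eventually (\<lambda>a. good a c) U"
    using vev[of m]
  proof eventually_elim
    case (elim a)
    have "frag_extend D w = translate G (inv a) (T m (a, x)) - c" using elim(2) by (simp add: c_def Tg_def)
    then show ?case using elim c wX unfolding good_def by blast
  qed
  moreover have "eventually (\<lambda>g. g \<in> {g \<in> carrier G. \<not> good g c}) U" using U(2) by blast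
  ultimately have "eventually (\<lambda>_. False) U" by eventually_elim simp
  then show False using not_bot by (simp add: trivial_limit_def)
qed

end

section \<open>Iterates, and the construction of pushing maps degree by degree\<close>

primrec iter_map :: "(('g \<times> 'x) \<Rightarrow> (('g \<times> 'x) \<Rightarrow>\<^sub>0 int)) \<Rightarrow> nat \<Rightarrow> ('g \<times> 'x) \<Rightarrow> (('g \<times> 'x) \<Rightarrow>\<^sub>0 int)" where
  "iter_map p 0 = frag_of"
| "iter_map p (Suc m) = (\<lambda>y. frag_extend p (iter_map p m y))"

lemma frag_extend_iter_map_Suc:
  "frag_extend (iter_map p (Suc m)) c = frag_extend p (frag_extend (iter_map p m) c)"
  by (simp add: frag_extend_frag_extend)

lemma (in group) fin_map_iter_map: "fin_map G X X p \<Longrightarrow> fin_map G X X (iter_map p m)"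
proof (induction m)
  case 0
  then show ?case by (simp add: fin_map_frag_of)
next
  case (Suc m)
  show ?case
    unfolding iter_map.simps by (rule fin_map_comp[OF Suc.IH[OF Suc.prems] Suc.prems])
qed

lemma (in group) raises_iter_map:
  assumes "fin_map G X X p" "raises G \<beta> X p t"
  shows "raises G \<beta> X (iter_map p m) (real m * t)"
proof (induction m)
  case 0
  show ?case by (auto simp: raises_def above_def split: if_splits)
next
  case (Suc m)
  have "raises G \<beta> X (iter_map p (Suc m)) (real m * t + t)"
    unfolding iter_map.simps
    by (rule raises_comp[OF Suc assms(2)]) (rule fin_map_closed[OF fin_map_iter_map[OF assms(1)]])
  then show ?case by (simp add: algebra_simps)
qed

context free_complex
begin

lemma iter_map_D:
  assumes p: "pushes G \<beta> X D N p t" and k: "Suc k < N" and gx: "g \<in> carrier G" "x \<in> X (Suc k)"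
  shows "frag_extend D (iter_map p m (g, x)) = frag_extend (iter_map p m) (D (g, x))"
proof (induction m)
  case (Suc m)
  have "iter_map p m (g, x) \<in> fchains G (X (Suc k))"
    by (rule fin_map_closed[OF fin_map_iter_map[OF pushes_fin_map[OF p k]] gx])
  then have "frag_extend D (iter_map p (Suc m) (g, x)) = frag_extend p (frag_extend D (iter_map p m (g, x)))"
    by (simp add: pushes_D_chains[OF p k])
  then show ?case by (simp only: Suc frag_extend_iter_map_Suc)
qed simp

lemma pushes_iter_map:
  assumes p: "pushes G \<beta> X D N p t"
  shows "pushes G \<beta> X D N (iter_map p m) (real m * t)"
proof -
  have "\<exists>c\<in>fchains G (X 1). frag_extend D c = iter_map p m (g, x) - frag_of (g, x)"
    if N: "0 < N" and gx: "g \<in> carrier G" "x \<in> X 0" for g x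
  proof (induction m)
    case 0
    then show ?case by (intro bexI[of _ 0]) auto
  next
    case (Suc m)
    then obtain c where c: "c \<in> fchains G (X 1)" "frag_extend D c = iter_map p m (g, x) - frag_of (g, x)" by blast
    have "iter_map p m (g, x) \<in> fchains G (X 0)"
      by (rule fin_map_closed[OF fin_map_iter_map[OF pushes_fin_map[OF p N]] gx])
    from pushes_id_chains[OF p N this] obtain c' where
      c': "c' \<in> fchains G (X 1)" "frag_extend D c' = iter_map p (Suc m) (g, x) - iter_map p m (g, x)" by auto
    show ?case
      using c c' by (intro bexI[of _ "c + c'"]) (auto simp: frag_extend_add chains_add)
  qed
  then show ?thesis
    unfolding pushes_def
    using fin_map_iter_map[OF pushes_fin_map[OF p]] raises_iter_map[OF pushes_fin_map[OF p] pushes_raises[OF p]]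
      iter_map_D[OF p] by auto
qed

text \<open>For each gx one of the finitely many corrections provided by
  \<open>compact_choice\<close> is selected. Their finite number makes r finitary, and since r
  differs from \<open>T m\<close> by boundaries, the two have the same image under
  \<open>D\<close>.\<close>

lemma push_choice:
  assumes \<beta>: "height G \<beta>" and fin: "finite (X k)"
    and T: "\<And>m. fin_map G (X k) (X k) (T m)"
    and step: "\<And>m. raises G \<beta> (X k) (\<lambda>y. T (Suc m) y - T m y) (real m - L)"
    and cyc: "\<And>m. k \<noteq> 0 \<Longrightarrow> raises G \<beta> (X k) (\<lambda>y. frag_extend D (T m y)) (real m - L)"
    and ex: "\<And>U \<beta>'. limit_height G \<beta> U \<beta>' \<Longrightarrow> novikov_exact G \<beta>' X D k"
    and m: "real m \<ge> L + 2"
  obtains r where "fin_map G (X k) (X k) r" "raises G \<beta> (X k) r 1"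
    "\<forall>g\<in>carrier G. \<forall>x\<in>X k. \<exists>w\<in>fchains G (X (Suc k)). frag_extend D w = T m (g, x) - r (g, x)"
proof -
  define good where "good x g c \<longleftrightarrow> c \<in> fchains G (X k) \<and>
     above \<beta> (\<beta> g + 1) (Poly_Mapping.lookup (translate G g c)) \<and>
     (\<exists>w\<in>fchains G (X (Suc k)). frag_extend D w = translate G (inv g) (T m (g, x)) - c)" for x g c
  have "\<forall>x\<in>X k. \<exists>C. finite C \<and> (\<forall>g\<in>carrier G. \<exists>c\<in>C. good x g c)"
    unfolding good_def by (intro ballI compact_choice[OF \<beta> fin T step cyc ex m])
  then have "\<exists>C. \<forall>x\<in>X k. finite (C x) \<and> (\<forall>g\<in>carrier G. \<exists>c\<in>C x. good x g c)" by (rule bchoice)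
  then obtain C where C: "\<forall>x\<in>X k. finite (C x) \<and> (\<forall>g\<in>carrier G. \<exists>c\<in>C x. good x g c)" by (rule exE)
  define c where "c g x = (SOME c. c \<in> C x \<and> good x g c)" for g x
  have c: "c g x \<in> C x \<and> good x g (c g x)" if "g \<in> carrier G" "x \<in> X k" for g x
    unfolding c_def by (rule someI_ex) (use C that in blast)
  define r where "r = (\<lambda>(g, x). translate G g (c g x))"
  have ck: "c g x \<in> fchains G (X k)" if "g \<in> carrier G" "x \<in> X k" for g x
    using c[OF that] by (simp add: good_def)
  show thesis
  proof (rule that[of r])
    show "fin_map G (X k) (X k) r"
    proof (rule fin_mapI[of _ C])
      fix g x assume gx: "g \<in> carrier G" "x \<in> X k"
      show "finite (C x) \<and> (\<exists>c\<in>C x. c \<in> fchains G (X k) \<and> r (g, x) = translate G g c)"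
        using C c[OF gx] ck[OF gx] gx by (auto simp: r_def intro!: bexI[of _ "c g x"])
    qed
    show "raises G \<beta> (X k) r 1"
      using c by (auto simp: raises_def r_def good_def)
    show "\<forall>g\<in>carrier G. \<forall>x\<in>X k. \<exists>w\<in>fchains G (X (Suc k)). frag_extend D w = T m (g, x) - r (g, x)"
    proof (intro ballI)
      fix g x assume gx: "g \<in> carrier G" "x \<in> X k"
      obtain w where w: "w \<in> fchains G (X (Suc k))" "frag_extend D w = translate G (inv g) (T m (g, x)) - c g x"
        using c[OF gx] by (auto simp: good_def)
      have "frag_extend D (translate G g w) = translate G g (translate G (inv g) (T m (g, x)) - c g x)"
        using equivariant_frag_extend[OF D_equivariant gx(1) w(1)] w(2) by simp
      also have "\<dots> = T m (g, x) - r (g, x)"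
        using translate_inv(2)[OF gx(1) fin_map_closed[OF T gx]] by (simp add: translate_diff r_def)
      finally show "\<exists>w\<in>fchains G (X (Suc k)). frag_extend D w = T m (g, x) - r (g, x)"
        using translate_closed[OF gx(1) w(1)] by blast
    qed
  qed
qed

lemma pushes_extend_0:
  assumes \<beta>: "height G \<beta>" and fin: "finite (X 0)"
    and ex: "\<And>U \<beta>'. limit_height G \<beta> U \<beta>' \<Longrightarrow> novikov_exact G \<beta>' X D 0"
  obtains p where "pushes G \<beta> X D 1 p 1"
proof -
  \<comment> \<open>In degree 0 there is nothing to lift and the sequence is constantly the
    identity, so \<open>L = 0\<close> is possible and \<open>m = 2\<close> is the least value
    allowed.\<close>
  obtain r where r: "fin_map G (X 0) (X 0) r" "raises G \<beta> (X 0) r 1"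
    "\<forall>g\<in>carrier G. \<forall>x\<in>X 0. \<exists>w\<in>fchains G (X (Suc 0)). frag_extend D w = frag_of (g, x) - r (g, x)"
    by (rule push_choice[OF \<beta> fin fin_map_frag_of _ _ ex, where m = 2 and L = 0])
      (auto simp: raises_def above_def)
  have "\<exists>c\<in>fchains G (X 1). frag_extend D c = r (g, x) - frag_of (g, x)"
    if gx: "g \<in> carrier G" "x \<in> X 0" for g x
  proof -
    obtain w where "w \<in> fchains G (X (Suc 0))" "frag_extend D w = frag_of (g, x) - r (g, x)" using r(3) gx by blast
    then show ?thesis
      using chains_diff[OF chains_zero, of w] by (intro bexI[of _ "0 - w"]) (simp_all add: frag_extend_diff del: diff_0)
  qed
  then show thesis using r by (intro that[of r]) (simp add: pushes_def)
qed

text \<open>The new value at x has to lift \<open>p^m D x\<close> for some m and to lie above x. The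
  sum \<open>T m\<close> is such a lift but contains x itself; subtracting boundaries does not
  affect the lifting property and, by \<open>push_choice\<close>, can raise the sum by 1. The losses
  of \<open>D\<close> and s dictate m, so in the lower degrees p must give way to its m-th
  iterate.\<close>

lemma pushes_extend_Suc:
  assumes \<beta>: "height G \<beta>" and fin: "\<And>i. i \<le> Suc j \<Longrightarrow> finite (X i)"
    and disj: "\<And>i. i \<le> j \<Longrightarrow> X i \<inter> X (Suc j) = {}"
    and ex: "\<And>U \<beta>'. limit_height G \<beta> U \<beta>' \<Longrightarrow> novikov_exact G \<beta>' X D (Suc j)"
    and p: "pushes G \<beta> X D (Suc j) p 1"
  obtains p' where "pushes G \<beta> X D (Suc (Suc j)) p' 1"
proof -
  let ?P = "\<lambda>i c. frag_extend (iter_map p i) c"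
  obtain s where s: "\<forall>k<Suc j. fin_map G (X k) (X (Suc k)) (s k)"
    "\<forall>k<Suc j. \<forall>g\<in>carrier G. \<forall>x\<in>X k. frag_extend D (s k (g, x)) =
       p (g, x) - frag_of (g, x) - (case k of 0 \<Rightarrow> 0 | Suc j \<Rightarrow> frag_extend (s j) (D (g, x)))"
    by (rule pushes_homotopy[OF p])
  have sj: "fin_map G (X j) (X (Suc j)) (s j)" using s(1) by simp
  have pj: "fin_map G (X j) (X j) (iter_map p i)" for i
    by (rule fin_map_iter_map[OF pushes_fin_map[OF p lessI]])
  \<comment> \<open>On cycles the term of the homotopy formula that contains \<open>D\<close> drops
    out.\<close>
  have Ds: "frag_extend D (frag_extend (s j) c) = frag_extend p c - c"
    if c: "c \<in> fchains G (X j)" "j \<noteq> 0 \<Longrightarrow> frag_extend D c = 0" for c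
  proof (cases j)
    case 0
    have "frag_extend D (frag_extend (s j) c) = frag_extend (\<lambda>y. frag_extend D (s j y)) c"
      by (simp add: frag_extend_frag_extend)
    also have "\<dots> = frag_extend (\<lambda>y. p y - frag_of y) c"
      by (rule frag_extend_cong_chains[OF c(1)]) (use s(2) 0 in auto)
    finally show ?thesis by (simp add: frag_extend_fun_diff)
  next
    case (Suc i)
    have "frag_extend D (frag_extend (s j) c) = frag_extend (\<lambda>y. frag_extend D (s j y)) c"
      by (simp add: frag_extend_frag_extend)
    also have "\<dots> = frag_extend (\<lambda>y. p y - frag_of y - frag_extend (s i) (D y)) c"
      by (rule frag_extend_cong_chains[OF c(1)]) (use s(2) Suc in auto)
    also have "\<dots> = frag_extend p c - c - frag_extend (s i) (frag_extend D c)"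
      by (simp add: frag_extend_fun_diff frag_extend_frag_extend)
    finally show ?thesis using c(2) Suc by simp
  qed
  define q where "q i y = frag_extend (s j) (?P i (D y))" for i y
  have q: "fin_map G (X (Suc j)) (X (Suc j)) (q i)" for i
    unfolding q_def by (intro fin_map_comp[OF fin_map_comp[OF D_fin_map pj] sj])
  have PD: "?P i (D (g, x)) \<in> fchains G (X j)" "j \<noteq> 0 \<Longrightarrow> frag_extend D (?P i (D (g, x))) = 0"
    if gx: "g \<in> carrier G" "x \<in> X (Suc j)" for i g x
  proof -
    show "?P i (D (g, x)) \<in> fchains G (X j)" by (rule fin_map_chains[OF pj D_closed[OF gx]])
    assume "j \<noteq> 0"
    then obtain l where l: "j = Suc l" by (cases j) auto
    have "D (g, x) \<in> fchains G (X (Suc l))" using D_closed[OF gx] l by simp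
    then show "frag_extend D (?P i (D (g, x))) = 0"
      using pushes_D_chains[OF pushes_iter_map[OF p, of i], of l] l D_D[of g x l] gx by simp
  qed
  \<comment> \<open>\<open>T\<^sub>i = id + \<Sum>\<^sub>j s p\<^sup>j D\<close> over \<open>j < i\<close> lifts \<open>p\<^sup>i D\<close>, and its terms tend to infinity\<close>
  define T where "T = rec_nat frag_of (\<lambda>i T y. T y + q i y)"
  have T_simps: "T 0 = frag_of" "T (Suc i) = (\<lambda>y. T i y + q i y)" for i
    by (simp_all add: T_def)
  have T: "fin_map G (X (Suc j)) (X (Suc j)) (T i)" for i
    by (induction i) (simp_all add: T_simps fin_map_frag_of fin_map_add q)
  have DT: "frag_extend D (T i (g, x)) = ?P i (D (g, x))" if gx: "g \<in> carrier G" "x \<in> X (Suc j)" for i g x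
  proof (induction i)
    case 0
    then show ?case by (simp add: T_simps)
  next
    case (Suc i)
    have "frag_extend D (q i (g, x)) = frag_extend p (?P i (D (g, x))) - ?P i (D (g, x))"
      unfolding q_def by (rule Ds[OF PD[OF gx]])
    then show ?case using Suc by (simp add: T_simps frag_extend_add frag_extend_frag_extend)
  qed
  obtain L1 where L1: "raises G \<beta> (X (Suc j)) D (- L1)"
    by (rule raises_bounded[OF \<beta> D_fin_map fin[OF order_refl] subset_refl])
  obtain L2 where L2: "raises G \<beta> (X j) (s j) (- L2)"
    by (rule raises_bounded[OF \<beta> sj fin[of j] subset_refl]) simp_all
  \<comment> \<open>Absolute values, because the losses may be negative: \<open>L\<close> has to
    bound \<open>L1 + L2\<close> for the terms \<open>q i\<close> and \<open>L1\<close> alone for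
    the boundaries of \<open>T i\<close>, and being nonnegative it makes m at least 2.\<close>
  define L where "L = \<bar>L1\<bar> + \<bar>L2\<bar>"
  have rP: "raises G \<beta> (X (Suc j)) (\<lambda>y. ?P i (D y)) (- L1 + real i * 1)" for i
    by (rule raises_comp[OF L1 pushes_raises[OF pushes_iter_map[OF p] lessI] D_closed])
  have rq: "raises G \<beta> (X (Suc j)) (q i) (real i - L)" for i
  proof -
    have "raises G \<beta> (X (Suc j)) (q i) (- L1 + real i * 1 + - L2)"
      unfolding q_def by (rule raises_comp[OF rP L2 PD(1)])
    then show ?thesis by (rule raises_mono) (simp add: L_def)
  qed
  have step: "raises G \<beta> (X (Suc j)) (\<lambda>y. T (Suc i) y - T i y) (real i - L)" for i
    using rq[of i] by (simp add: T_simps)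
  have cyc: "raises G \<beta> (X (Suc j)) (\<lambda>y. frag_extend D (T i y)) (real i - L)" for i
  proof -
    have "raises G \<beta> (X (Suc j)) (\<lambda>y. ?P i (D y)) (real i - L)"
      by (rule raises_mono[OF rP]) (simp add: L_def)
    then show ?thesis using DT by (simp add: raises_def)
  qed
  define m where "m = nat \<lceil>L + 2\<rceil>"
  have m: "real m \<ge> L + 2" unfolding m_def by linarith
  obtain r where r: "fin_map G (X (Suc j)) (X (Suc j)) r" "raises G \<beta> (X (Suc j)) r 1"
    "\<forall>g\<in>carrier G. \<forall>x\<in>X (Suc j). \<exists>w\<in>fchains G (X (Suc (Suc j))). frag_extend D w = T m (g, x) - r (g, x)"
    by (rule push_choice[OF \<beta> fin[OF order_refl] T step cyc ex m])
  define p' where "p' = (\<lambda>(g, x). if x \<in> X (Suc j) then r (g, x) else iter_map p m (g, x))"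
  have p'_top: "p' (g, x) = r (g, x)" if "x \<in> X (Suc j)" for g x using that by (simp add: p'_def)
  have p'_low: "p' (g, x) = iter_map p m (g, x)" if "x \<in> X i" "i \<le> j" for g x i
    using that disj[of i] by (auto simp: p'_def)
  have pm: "pushes G \<beta> X D (Suc j) (iter_map p m) (real m * 1)" by (rule pushes_iter_map[OF p])
  have p'_low_chains: "frag_extend p' c = frag_extend (iter_map p m) c" if "c \<in> fchains G (X i)" "i \<le> j" for c i
    by (rule frag_extend_cong_chains[OF that(1)]) (rule p'_low[OF _ that(2)])
  have Dr: "frag_extend D (r (g, x)) = frag_extend (iter_map p m) (D (g, x))"
    if gx: "g \<in> carrier G" "x \<in> X (Suc j)" for g x
  proof -
    obtain w where w: "w \<in> fchains G (X (Suc (Suc j)))" "frag_extend D w = T m (g, x) - r (g, x)" using r(3) gx by blast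
    have "frag_extend D (T m (g, x) - r (g, x)) = 0" using D_D_chains[OF w(1)] w(2) by simp
    then show ?thesis using DT[OF gx] by (simp add: frag_extend_diff)
  qed
  have "pushes G \<beta> X D (Suc (Suc j)) p' 1"
    unfolding pushes_def
  proof (intro conjI allI impI ballI)
    fix k assume k: "k < Suc (Suc j)"
    show "fin_map G (X k) (X k) p'"
    proof (cases "k = Suc j")
      case True
      then show ?thesis using fin_map_cong[OF r(1)] p'_top by simp
    next
      case False
      then have kj: "k \<le> j" using k by simp
      show ?thesis
        by (rule fin_map_cong[OF pushes_fin_map[OF pm, of k]]) (use kj p'_low[OF _ kj] in auto)
    qed
    show "raises G \<beta> (X k) p' 1"
    proof (cases "k = Suc j")
      case True
      then show ?thesis using r(2) p'_top by (simp add: raises_def)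
    next
      case False
      then have kj: "k \<le> j" using k by simp
      have "1 \<le> real m * 1" using m by (simp add: L_def)
      then have "raises G \<beta> (X k) (iter_map p m) 1" using pushes_raises[OF pm, of k] kj raises_mono by fastforce
      then show ?thesis using p'_low[OF _ kj] by (simp add: raises_def)
    qed
  next
    fix k g x assume k: "Suc k < Suc (Suc j)" and gx: "g \<in> carrier G" "x \<in> X (Suc k)"
    have k': "k \<le> j" using k by simp
    have *: "frag_extend p' (D (g, x)) = frag_extend (iter_map p m) (D (g, x))"
      by (rule p'_low_chains[OF D_closed[OF gx] k'])
    show "frag_extend D (p' (g, x)) = frag_extend p' (D (g, x))"
    proof (cases "k = j")
      case True
      then show ?thesis using Dr[of g x] gx by (simp add: * p'_top)
    next
      case False
      then have kj: "Suc k < Suc j" using k by simp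
      show ?thesis unfolding * using p'_low[OF gx(2)] pushes_D[OF pm kj gx] kj by simp
    qed
  next
    fix g x assume "g \<in> carrier G" "x \<in> X 0"
    then show "\<exists>c\<in>fchains G (X 1). frag_extend D c = p' (g, x) - frag_of (g, x)"
      using pushes_id[OF pm] p'_low[of x 0] by simp
  qed
  then show thesis by (rule that)
qed

lemma pushes_exists:
  assumes \<beta>: "height G \<beta>" and fin: "\<And>i. i \<le> n \<Longrightarrow> finite (X i)" and disj: "disjoint_family X"
    and ex: "\<And>U \<beta>' k. limit_height G \<beta> U \<beta>' \<Longrightarrow> k \<le> n \<Longrightarrow> novikov_exact G \<beta>' X D k"
  shows "\<exists>p. pushes G \<beta> X D (Suc n) p 1"
proof -
  have "k \<le> n \<Longrightarrow> \<exists>p. pushes G \<beta> X D (Suc k) p 1" for k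
  proof (induction k)
    case 0
    obtain p where "pushes G \<beta> X D 1 p 1"
      by (rule pushes_extend_0[OF \<beta> fin ex]) simp_all
    then show ?case by auto
  next
    case (Suc k)
    then obtain p where p: "pushes G \<beta> X D (Suc k) p 1" by auto
    have "X i \<inter> X (Suc k) = {}" if "i \<le> k" for i
      using disj that by (auto simp: disjoint_family_on_def)
    then obtain p' where "pushes G \<beta> X D (Suc (Suc k)) p' 1"
      using Suc.prems by (rule_tac pushes_extend_Suc[OF \<beta> _ _ ex p]) (use fin in auto)
    then show ?case by blast
  qed
  then show ?thesis by simp
qed

lemma pushes_iff_novikov_exact:
  assumes \<beta>: "height G \<beta>" and fin: "\<And>i. i \<le> n \<Longrightarrow> finite (X i)" and disj: "disjoint_family X"
  shows "(\<exists>p. pushes G \<beta> X D (Suc n) p 1) \<longleftrightarrow>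
    (\<forall>U \<beta>'. limit_height G \<beta> U \<beta>' \<longrightarrow> (\<forall>k\<le>n. novikov_exact G \<beta>' X D k))" (is "?l \<longleftrightarrow> ?r")
proof
  assume ?l
  then obtain p where p: "pushes G \<beta> X D (Suc n) p 1" ..
  show ?r
  proof (intro allI impI)
    fix U \<beta>' k assume lim: "limit_height G \<beta> U \<beta>'" and k: "k \<le> n"
    obtain p' where p': "pushes G \<beta>' X D (Suc n) p' 1" by (rule pushes_limit[OF p lim])
    show "novikov_exact G \<beta>' X D k"
      by (rule pushes_imp_novikov_exact[OF p' height_limit_height[OF lim \<beta>] order_refl]) (use k fin in auto)
  qed
next
  assume ?r
  then show ?l using pushes_exists[OF \<beta> fin disj] by blast
qed

end

section \<open>Tensor products with Novikov modules\<close>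

text \<open>The Novikov module with an arbitrary function on G in place of a Busemann function;
  \<open>novikov_module_eq\<close> is the link between the two.\<close>

definition height_module ::
    "('g, 'b) monoid_scheme \<Rightarrow> ('g \<Rightarrow> real) \<Rightarrow> ('g \<Rightarrow>\<^sub>0 int, 'g \<Rightarrow> int) module" where
  "height_module G \<beta> =
     \<lparr>carrier = {\<sigma>. (\<forall>g. g \<notin> carrier G \<longrightarrow> \<sigma> g = 0) \<and> (\<forall>t. finite {g. \<sigma> g \<noteq> 0 \<and> \<beta> g < t})},
      monoid.mult = undefined, monoid.one = undefined, ring.zero = (\<lambda>_. 0), ring.add = (\<lambda>\<sigma> \<tau> g. \<sigma> g + \<tau> g),
      module.smult = (\<lambda>a \<sigma> g. if g \<in> carrier G
        then \<Sum>h\<in>Poly_Mapping.keys a. \<sigma> (g \<otimes>\<^bsub>G\<^esub> inv\<^bsub>G\<^esub> h) * Poly_Mapping.lookup a h else 0)\<rparr>"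

text \<open>Elements of the Novikov module become infinite chains over a basis with one element, so
  that the rules for \<open>novikov_ext\<close> apply to them.\<close>

definition scalar_chain :: "('g \<Rightarrow> int) \<Rightarrow> ('g \<times> unit) \<Rightarrow> int" where
  "scalar_chain a = (\<lambda>(g, _). a g)"

text \<open>The Novikov chain represented by \<open>a \<otimes> c\<close>.\<close>

definition tensor_eval :: "('g, 'b) monoid_scheme \<Rightarrow> ('g \<Rightarrow> int) \<Rightarrow> (('g \<times> 'x) \<Rightarrow>\<^sub>0 int) \<Rightarrow> ('g \<times> 'x) \<Rightarrow> int" where
  "tensor_eval G a c = novikov_ext (\<lambda>(g, _). translate G g c) (scalar_chain a)"

definition tensor_lin :: "('g, 'b) monoid_scheme \<Rightarrow> ((('g \<Rightarrow> int) \<times> (('g \<times> 'x) \<Rightarrow>\<^sub>0 int)) \<Rightarrow>\<^sub>0 int) \<Rightarrow> ('g \<times> 'x) \<Rightarrow> int" where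
  "tensor_lin G w = (\<lambda>y. \<Sum>k\<in>Poly_Mapping.keys w. Poly_Mapping.lookup w k * tensor_eval G (fst k) (snd k) y)"

lemma tensor_lin_0 [simp]: "tensor_lin G 0 = (\<lambda>_. 0)"
  by (simp add: tensor_lin_def)

lemma tensor_lin_of [simp]: "tensor_lin G (frag_of (a, c)) = tensor_eval G a c"
  by (simp add: tensor_lin_def)

lemma tensor_lin_sum:
  assumes "finite S" "Poly_Mapping.keys w \<subseteq> S"
  shows "tensor_lin G w y = (\<Sum>k\<in>S. Poly_Mapping.lookup w k * tensor_eval G (fst k) (snd k) y)"
  unfolding tensor_lin_def using assms by (intro sum.mono_neutral_left) (auto simp: in_keys_iff)

lemma tensor_lin_diff: "tensor_lin G (w - w') = (\<lambda>y. tensor_lin G w y - tensor_lin G w' y)"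
proof
  fix y
  let ?S = "Poly_Mapping.keys w \<union> Poly_Mapping.keys w'"
  have "Poly_Mapping.keys (w - w') \<subseteq> ?S" by (rule keys_diff)
  then show "tensor_lin G (w - w') y = tensor_lin G w y - tensor_lin G w' y"
    by (simp add: tensor_lin_sum[of ?S] lookup_minus left_diff_distrib sum_subtractf)
qed

lemma tensor_lin_uminus: "tensor_lin G (- w) = (\<lambda>y. - tensor_lin G w y)"
  using tensor_lin_diff[of G 0 w] by simp

lemma tensor_lin_add: "tensor_lin G (w + w') = (\<lambda>y. tensor_lin G w y + tensor_lin G w' y)"
  using tensor_lin_diff[of G w "- w'"] by (simp add: tensor_lin_uminus)

lemma comm_group_subgroup:
  assumes "comm_group T" "subgroup Z T" shows "comm_group (T\<lparr>carrier := Z\<rparr>)"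
proof -
  interpret T: comm_group T by fact
  show ?thesis
  proof (rule group.group_comm_groupI)
    show "group (T\<lparr>carrier := Z\<rparr>)" by (rule T.subgroup_imp_group[OF assms(2)])
  qed (use subgroup.mem_carrier[OF assms(2)] T.m_comm in simp)
qed

lemma trivial_quotient_iff:
  assumes T: "comm_group T" and Z: "subgroup Z T" and B: "subgroup B T" "B \<subseteq> Z"
  shows "trivial_group (T\<lparr>carrier := Z\<rparr> Mod B) \<longleftrightarrow> Z \<subseteq> B"
proof -
  interpret T: comm_group T by fact
  interpret H: comm_group "T\<lparr>carrier := Z\<rparr>" by (rule comm_group_subgroup[OF T Z])
  have BH: "subgroup B (T\<lparr>carrier := Z\<rparr>)" by (rule T.subgroup_incl[OF B(1) Z B(2)])
  have grp: "group (T\<lparr>carrier := Z\<rparr> Mod B)"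
    by (rule normal.factorgroup_is_group[OF H.subgroup_imp_normal[OF BH]])
  have one: "\<one>\<^bsub>T\<lparr>carrier := Z\<rparr> Mod B\<^esub> = B" by (simp add: FactGroup_def)
  have "carrier (T\<lparr>carrier := Z\<rparr> Mod B) = {B} \<longleftrightarrow> Z \<subseteq> B"
  proof
    assume l: "carrier (T\<lparr>carrier := Z\<rparr> Mod B) = {B}"
    show "Z \<subseteq> B"
    proof
      fix z assume z: "z \<in> Z"
      then have "B #>\<^bsub>T\<lparr>carrier := Z\<rparr>\<^esub> z \<in> carrier (T\<lparr>carrier := Z\<rparr> Mod B)"
        by (auto simp: carrier_FactGroup)
      then have "B #>\<^bsub>T\<lparr>carrier := Z\<rparr>\<^esub> z = B" using l by simp
      then show "z \<in> B" by (rule H.coset_join1) (use z BH in auto)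
    qed
  next
    assume "Z \<subseteq> B"
    then have "B #>\<^bsub>T\<lparr>carrier := Z\<rparr>\<^esub> z = B" if "z \<in> Z" for z
      using that by (intro H.coset_join2[OF _ BH]) auto
    then show "carrier (T\<lparr>carrier := Z\<rparr> Mod B) = {B}"
      using subgroup.one_closed[OF Z] by (auto simp: carrier_FactGroup)
  qed
  then show ?thesis using grp one by (simp add: trivial_group_def)
qed

locale height_tensor = group G for G (structure) +
  fixes \<beta> :: "'a \<Rightarrow> real"
  assumes height: "height G \<beta>"
begin

abbreviation N where "N \<equiv> height_module G \<beta>"

lemma N_simps [simp]:
  "\<zero>\<^bsub>N\<^esub> = (\<lambda>_. 0)" "\<sigma> \<oplus>\<^bsub>N\<^esub> \<tau> = (\<lambda>g. \<sigma> g + \<tau> g)"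
  by (simp_all add: height_module_def)

lemmas free_module_simps [simp] = carrier_free_module add_free_module

lemma scalar_chain_closed:
  assumes "a \<in> carrier N" shows "scalar_chain a \<in> novikov_chains G \<beta> (UNIV :: unit set)"
proof (rule novikov_chainsI)
  show "{y. scalar_chain a y \<noteq> 0} \<subseteq> carrier G \<times> UNIV"
    using assms by (auto simp: scalar_chain_def height_module_def)
  fix t
  have "{y. scalar_chain a y \<noteq> 0 \<and> \<beta> (fst y) < t} \<subseteq> (\<lambda>g. (g, ())) ` {g. a g \<noteq> 0 \<and> \<beta> g < t}"
    by (auto simp: scalar_chain_def)
  then show "finite {y. scalar_chain a y \<noteq> 0 \<and> \<beta> (fst y) < t}"
    by (rule finite_subset) (use assms in \<open>simp add: height_module_def\<close>)
qed simp_all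

lemma column_closed:
  assumes "\<sigma> \<in> novikov_chains G \<beta> X" shows "(\<lambda>g. \<sigma> (g, x)) \<in> carrier N"
proof -
  have "\<sigma> (g, x) = 0" if "g \<notin> carrier G" for g
    using assms that by (auto simp: novikov_chains_def)
  moreover have "finite {g. \<sigma> (g, x) \<noteq> 0 \<and> \<beta> g < t}" for t
  proof (rule finite_subset)
    show "finite (fst ` {y. \<sigma> y \<noteq> 0 \<and> \<beta> (fst y) < t})"
      by (rule finite_imageI[OF novikov_chains_finite[OF assms]])
    show "{g. \<sigma> (g, x) \<noteq> 0 \<and> \<beta> g < t} \<subseteq> fst ` {y. \<sigma> y \<noteq> 0 \<and> \<beta> (fst y) < t}" by force
  qed
  ultimately show ?thesis by (simp add: height_module_def)
qed

lemma zero_N: "(\<lambda>_. 0) \<in> carrier N" by (simp add: height_module_def)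

lemma diff_N:
  assumes "a \<in> carrier N" "b \<in> carrier N" shows "(\<lambda>g. a g - b g) \<in> carrier N"
  using column_closed[OF novikov_chains_diff[OF scalar_chain_closed[OF assms(1)] scalar_chain_closed[OF assms(2)]]]
  by (simp add: scalar_chain_def)

text \<open>This is the equivariant map on the free module with one generator that sends the
  generator to c. Its extension to the infinite chain a is \<open>tensor_eval G a c\<close>.\<close>

lemma fin_map_translate:
  assumes "c \<in> fchains G X" shows "fin_map G (UNIV :: unit set) X (\<lambda>(g, _). translate G g c)"
  using assms by (intro equivariant_fin_map) (auto simp: equivariant_def translate_translate translate_closed)

lemma tensor_eval_closed:
  "a \<in> carrier N \<Longrightarrow> c \<in> fchains G X \<Longrightarrow> tensor_eval G a c \<in> novikov_chains G \<beta> X"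
  unfolding tensor_eval_def
  by (rule novikov_ext_closed[OF height fin_map_translate scalar_chain_closed])

lemma tensor_eval_diff_left:
  assumes "a \<in> carrier N" "b \<in> carrier N" "c \<in> fchains G X"
  shows "tensor_eval G (\<lambda>g. a g - b g) c = (\<lambda>y. tensor_eval G a c y - tensor_eval G b c y)"
proof -
  have "scalar_chain (\<lambda>g. a g - b g) = (\<lambda>y. scalar_chain a y - scalar_chain b y)"
    by (auto simp: scalar_chain_def)
  then show ?thesis
    unfolding tensor_eval_def
    using novikov_ext_diff[OF fin_map_translate[OF assms(3)] scalar_chain_closed[OF assms(1)] scalar_chain_closed[OF assms(2)]]
    by simp
qed

lemma tensor_eval_diff_right:
  assumes "a \<in> carrier N" "c \<in> fchains G X" "c' \<in> fchains G X"
  shows "tensor_eval G a (c - c') = (\<lambda>y. tensor_eval G a c y - tensor_eval G a c' y)"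
proof -
  have "(\<lambda>(g, _::unit). translate G g (c - c')) =
      (\<lambda>y. (case y of (g, _) \<Rightarrow> translate G g c) - (case y of (g, _) \<Rightarrow> translate G g c'))"
    by (auto simp: translate_diff)
  then show ?thesis
    unfolding tensor_eval_def
    using novikov_ext_fun_diff[OF fin_map_translate[OF assms(2)] fin_map_translate[OF assms(3)] scalar_chain_closed[OF assms(1)]]
    by simp
qed

lemma tensor_eval_zero_right: "tensor_eval G a 0 = (\<lambda>_. 0)"
  by (simp add: tensor_eval_def novikov_ext_def fun_eq_iff case_prod_unfold)

lemma tensor_eval_of:
  assumes "a \<in> carrier N" "h \<in> carrier G"
  shows "tensor_eval G a (frag_of (h, x)) (g, x') = (if x' = x \<and> g \<in> carrier G then a (g \<otimes> inv h) else 0)"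
proof -
  have a: "a g' = 0" if "g' \<notin> carrier G" for g' using assms that by (simp add: height_module_def)
  have "tensor_eval G a (frag_of (h, x)) (g, x') =
    (\<Sum>y\<in>(if g \<in> carrier G then {(g \<otimes> inv h, ())} else {}).
       scalar_chain a y * Poly_Mapping.lookup (case y of (g, _) \<Rightarrow> translate G g (frag_of (h, x))) (g, x'))"
    unfolding tensor_eval_def
  proof (rule novikov_ext_eq_sum)
    fix y assume y: "y \<notin> (if g \<in> carrier G then {(g \<otimes> inv h, ())} else {})" "scalar_chain a y \<noteq> 0"
    obtain g' where g': "y = (g', ())" by (cases y) auto
    have "g' \<in> carrier G" using y(2) a g' by (auto simp: scalar_chain_def)
    then have "(g' \<otimes> h, x) \<noteq> (g, x')" using y(1) g' assms(2) by (auto simp: m_assoc)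
    then show "Poly_Mapping.lookup (case y of (g, _) \<Rightarrow> translate G g (frag_of (h, x))) (g, x') = 0"
      by (auto simp: g')
  qed simp
  also have "\<dots> = (if x' = x \<and> g \<in> carrier G then a (g \<otimes> inv h) else 0)"
    using assms(2) by (auto simp: scalar_chain_def m_assoc)
  finally show ?thesis .
qed

text \<open>The ring element r is a finite chain s over a one-element basis, and a times r is the
  image of a under the map that sends the generator to s. Both sides of the equation are then the
  image of a under a composite of two equivariant maps, which is
  \<open>novikov_ext_comp\<close>.\<close>

lemma tensor_eval_balanced:
  assumes a: "a \<in> carrier N" and r: "r \<in> carrier (group_ring G)" and c: "c \<in> fchains G X"
  shows "tensor_eval G (r \<odot>\<^bsub>N\<^esub> a) c = tensor_eval G a (r \<odot>\<^bsub>free_module G X\<^esub> c)"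
    and "r \<odot>\<^bsub>N\<^esub> a \<in> carrier N"
proof -
  define s where "s = frag_extend (\<lambda>g. frag_of (g, ())) r"
  have kr: "Poly_Mapping.keys r \<subseteq> carrier G" using r by (simp add: group_ring_def)
  have s: "s \<in> fchains G UNIV"
    unfolding s_def fchains_def using keys_frag_extend_subset[OF _ kr, of "\<lambda>g. frag_of (g, ())" "carrier G \<times> UNIV"] by simp
  have "tensor_eval G a s (g, ()) = (r \<odot>\<^bsub>N\<^esub> a) g" for g
  proof (cases "g \<in> carrier G")
    case False
    have "tensor_eval G a s \<in> novikov_chains G \<beta> UNIV" by (rule tensor_eval_closed[OF a s])
    then have "tensor_eval G a s (g, ()) = 0" using False by (auto simp: novikov_chains_def)
    then show ?thesis using False by (simp add: height_module_def)
  next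
    case True
    have "tensor_eval G a (frag_extend (\<lambda>g. frag_of (g, ())) q) (g, ()) =
        (\<Sum>h\<in>Poly_Mapping.keys r. a (g \<otimes> inv h) * Poly_Mapping.lookup q h) \<and>
        frag_extend (\<lambda>g. frag_of (g, ())) q \<in> fchains G UNIV"
      if "Poly_Mapping.keys q \<subseteq> Poly_Mapping.keys r" for q
      using that
    proof (induction rule: frag_ind)
      case zero
      then show ?case by (simp add: tensor_eval_zero_right)
    next
      case (of h)
      have "(\<Sum>i\<in>Poly_Mapping.keys r. a (g \<otimes> inv i) * Poly_Mapping.lookup (frag_of h) i) =
          (\<Sum>i\<in>{h}. a (g \<otimes> inv i) * Poly_Mapping.lookup (frag_of h) i)"
        by (rule sum.mono_neutral_right) (use of in auto)
      then show ?case using tensor_eval_of[OF a, of h "()" g "()"] of kr True by auto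
    next
      case (diff q q')
      then show ?case
        using tensor_eval_diff_right[OF a, of "frag_extend (\<lambda>g. frag_of (g, ())) q" UNIV "frag_extend (\<lambda>g. frag_of (g, ())) q'"]
        by (simp add: frag_extend_diff lookup_minus right_diff_distrib sum_subtractf chains_diff)
    qed
    from this[of r] show ?thesis using True by (simp add: s_def height_module_def)
  qed
  then have ra: "scalar_chain (r \<odot>\<^bsub>N\<^esub> a) = tensor_eval G a s"
    by (auto simp: scalar_chain_def)
  have "r \<odot>\<^bsub>N\<^esub> a = (\<lambda>g. tensor_eval G a s (g, ()))"
    unfolding ra[symmetric] by (simp add: scalar_chain_def)
  then show "r \<odot>\<^bsub>N\<^esub> a \<in> carrier N" using column_closed[OF tensor_eval_closed[OF a s]] by simp
  have rc: "r \<odot>\<^bsub>free_module G X\<^esub> c = frag_extend (\<lambda>(g, _). translate G g c) s"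
    by (simp add: s_def free_module_def frag_extend_frag_extend translate_def)
  have "tensor_eval G (r \<odot>\<^bsub>N\<^esub> a) c = novikov_ext (\<lambda>(g, _). translate G g c) (tensor_eval G a s)"
    by (simp add: tensor_eval_def[of G "r \<odot>\<^bsub>N\<^esub> a"] ra)
  also have "\<dots> = novikov_ext (\<lambda>y. frag_extend (\<lambda>(g, _). translate G g c) (case y of (g, _) \<Rightarrow> translate G g s)) (scalar_chain a)"
    unfolding tensor_eval_def
    by (rule novikov_ext_comp[OF fin_map_translate[OF s] fin_map_translate[OF c] scalar_chain_closed[OF a]])
  also have "\<dots> = novikov_ext (\<lambda>(g, _). translate G g (r \<odot>\<^bsub>free_module G X\<^esub> c)) (scalar_chain a)"
  proof (rule novikov_ext_cong_on[OF scalar_chain_closed[OF a]])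
    fix g and u :: unit assume g: "g \<in> carrier G"
    have "equivariant G UNIV (\<lambda>(g, _::unit). translate G g c)"
      using c by (auto simp: equivariant_def translate_translate)
    from equivariant_frag_extend[OF this g s]
    show "frag_extend (\<lambda>(g, _). translate G g c) (case (g, u) of (g, _) \<Rightarrow> translate G g s) =
        (case (g, u) of (g, _) \<Rightarrow> translate G g (r \<odot>\<^bsub>free_module G X\<^esub> c))"
      by (simp add: rc)
  qed
  finally show "tensor_eval G (r \<odot>\<^bsub>N\<^esub> a) c = tensor_eval G a (r \<odot>\<^bsub>free_module G X\<^esub> c)"
    by (simp add: tensor_eval_def)
qed

section \<open>Tensors modulo the bilinear and balanced relations\<close>

definition pairs :: "'x set \<Rightarrow> (('a \<Rightarrow> int) \<times> (('a \<times> 'x) \<Rightarrow>\<^sub>0 int)) set" where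
  "pairs X = carrier N \<times> fchains G X"

definition rels :: "'x set \<Rightarrow> ((('a \<Rightarrow> int) \<times> (('a \<times> 'x) \<Rightarrow>\<^sub>0 int)) \<Rightarrow>\<^sub>0 int) set" where
  "rels X = tensor_relations (group_ring G) N (free_module G X)"

definition rel_gens :: "'x set \<Rightarrow> ((('a \<Rightarrow> int) \<times> (('a \<times> 'x) \<Rightarrow>\<^sub>0 int)) \<Rightarrow>\<^sub>0 int) set" where
  "rel_gens X = {frag_of (\<lambda>g. a g + b g, x) - frag_of (a, x) - frag_of (b, x) | a b x.
         a \<in> carrier N \<and> b \<in> carrier N \<and> x \<in> fchains G X} \<union>
      {frag_of (a, x + y) - frag_of (a, x) - frag_of (a, y) | a x y.
         a \<in> carrier N \<and> x \<in> fchains G X \<and> y \<in> fchains G X} \<union>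
      {frag_of (r \<odot>\<^bsub>N\<^esub> a, x) - frag_of (a, r \<odot>\<^bsub>free_module G X\<^esub> x) | r a x.
         r \<in> carrier (group_ring G) \<and> a \<in> carrier N \<and> x \<in> fchains G X}"

lemma rels_eq: "rels X = generate (free_Abelian_group (pairs X)) (rel_gens X)"
  by (simp add: rels_def tensor_relations_def rel_gens_def pairs_def)

lemma smult_chains:
  assumes "r \<in> carrier (group_ring G)" "c \<in> fchains G X"
  shows "r \<odot>\<^bsub>free_module G X\<^esub> c \<in> fchains G X"
  using left_module.lsmult_closed[OF left_module_free_module[OF is_group, of X] assms(1)] assms(2) by simp

lemma add_N: "a \<in> carrier N \<Longrightarrow> b \<in> carrier N \<Longrightarrow> (\<lambda>g. a g + b g) \<in> carrier N"
  using diff_N[of a "\<lambda>g. 0 - b g"] diff_N[OF zero_N, of b] by simp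

lemma keys_diff_subset: "Poly_Mapping.keys a \<subseteq> S \<Longrightarrow> Poly_Mapping.keys b \<subseteq> S \<Longrightarrow> Poly_Mapping.keys (a - b) \<subseteq> S"
  for a b :: "'z \<Rightarrow>\<^sub>0 int"
  using keys_diff[of a b] by blast

lemma rel_gens_carrier: "rel_gens X \<subseteq> carrier (free_Abelian_group (pairs X))"
proof
  have *: "Poly_Mapping.keys (frag_of k :: _ \<Rightarrow>\<^sub>0 int) \<subseteq> pairs X" if "k \<in> pairs X" for k using that by simp
  fix w assume "w \<in> rel_gens X"
  then consider a b c where "w = frag_of (\<lambda>g. a g + b g, c) - frag_of (a, c) - frag_of (b, c)"
      "a \<in> carrier N" "b \<in> carrier N" "c \<in> fchains G X"
    | a c c' where "w = frag_of (a, c + c') - frag_of (a, c) - frag_of (a, c')"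
      "a \<in> carrier N" "c \<in> fchains G X" "c' \<in> fchains G X"
    | r a c where "w = frag_of (r \<odot>\<^bsub>N\<^esub> a, c) - frag_of (a, r \<odot>\<^bsub>free_module G X\<^esub> c)"
      "r \<in> carrier (group_ring G)" "a \<in> carrier N" "c \<in> fchains G X"
    unfolding rel_gens_def by blast
  then have "Poly_Mapping.keys w \<subseteq> pairs X"
  proof cases
    case 1
    show ?thesis unfolding 1(1)
      by (intro keys_diff_subset *) (use 1 add_N in \<open>simp_all add: pairs_def\<close>)
  next
    case 2
    show ?thesis unfolding 2(1)
      by (intro keys_diff_subset *) (use 2 chains_add in \<open>simp_all add: pairs_def\<close>)
  next
    case 3
    have "r \<odot>\<^bsub>N\<^esub> a \<in> carrier N" "r \<odot>\<^bsub>free_module G X\<^esub> c \<in> fchains G X"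
      using tensor_eval_balanced(2)[OF 3(3,2,4)] smult_chains[OF 3(2,4)] by simp_all
    then show ?thesis unfolding 3(1)
      by (intro keys_diff_subset *) (use 3 in \<open>simp_all add: pairs_def\<close>)
  qed
  then show "w \<in> carrier (free_Abelian_group (pairs X))" by simp
qed

lemma rels_subgroup: "subgroup (rels X) (free_Abelian_group (pairs X))"
  unfolding rels_eq by (rule group.generate_is_subgroup[OF group_free_Abelian_group rel_gens_carrier])

lemma rels_0: "0 \<in> rels X"
  using subgroup.one_closed[OF rels_subgroup] by simp

lemma rels_carrier: "w \<in> rels X \<Longrightarrow> Poly_Mapping.keys w \<subseteq> pairs X"
  using subgroup.mem_carrier[OF rels_subgroup] by simp

lemma rels_diff: "w \<in> rels X \<Longrightarrow> w' \<in> rels X \<Longrightarrow> w - w' \<in> rels X"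
proof -
  assume w: "w \<in> rels X" "w' \<in> rels X"
  have "- w' \<in> rels X" using subgroup.m_inv_closed[OF rels_subgroup w(2)] rels_carrier[OF w(2)] by simp
  from subgroup.m_closed[OF rels_subgroup w(1) this] show ?thesis by simp
qed

lemma rels_uminus: "w \<in> rels X \<Longrightarrow> - w \<in> rels X"
  using rels_diff[OF rels_0, of w X] by simp

lemma rels_add: "w \<in> rels X \<Longrightarrow> w' \<in> rels X \<Longrightarrow> w + w' \<in> rels X"
  using rels_diff[OF _ rels_uminus, of w X w'] by simp

lemma rels_sum: "(\<And>i. i \<in> I \<Longrightarrow> f i \<in> rels X) \<Longrightarrow> sum f I \<in> rels X"
  by (induction I rule: infinite_finite_induct) (auto simp: rels_0 rels_add)

lemma rels_gen: "w \<in> rel_gens X \<Longrightarrow> w \<in> rels X"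
  unfolding rels_eq by (rule generate.incl)

lemma rel_gens_left:
  assumes "a \<in> carrier N" "b \<in> carrier N" "c \<in> fchains G X"
  shows "frag_of (\<lambda>g. a g + b g, c) - frag_of (a, c) - frag_of (b, c) \<in> rel_gens X"
  unfolding rel_gens_def
  by (rule UnI1, rule UnI1, rule CollectI, rule exI[of _ a], rule exI[of _ b], rule exI[of _ c]) (use assms in simp)

lemma rel_gens_right:
  assumes "a \<in> carrier N" "c \<in> fchains G X" "c' \<in> fchains G X"
  shows "frag_of (a, c + c') - frag_of (a, c) - frag_of (a, c') \<in> rel_gens X"
  unfolding rel_gens_def
  by (rule UnI1, rule UnI2, rule CollectI, rule exI[of _ a], rule exI[of _ c], rule exI[of _ c']) (use assms in simp)

lemma rel_gens_balanced:
  assumes "r \<in> carrier (group_ring G)" "a \<in> carrier N" "c \<in> fchains G X"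
  shows "frag_of (r \<odot>\<^bsub>N\<^esub> a, c) - frag_of (a, r \<odot>\<^bsub>free_module G X\<^esub> c) \<in> rel_gens X"
  unfolding rel_gens_def
  by (rule UnI2, rule CollectI, rule exI[of _ r], rule exI[of _ a], rule exI[of _ c]) (use assms in simp)

text \<open>Additivity is recast in terms of differences to suit the induction over integral
  combinations, whose steps are differences.\<close>

lemma rels_left:
  assumes "a \<in> carrier N" "b \<in> carrier N" "c \<in> fchains G X"
  shows "frag_of (\<lambda>g. a g - b g, c) - (frag_of (a, c) - frag_of (b, c)) \<in> rels X"
proof -
  have "frag_of (\<lambda>g. (a g - b g) + b g, c) - frag_of (\<lambda>g. a g - b g, c) - frag_of (b, c) \<in> rel_gens X"
    by (rule rel_gens_left[OF diff_N[OF assms(1,2)] assms(2,3)])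
  from rels_uminus[OF rels_gen[OF this]] show ?thesis by (simp add: algebra_simps)
qed

lemma rels_right:
  assumes "a \<in> carrier N" "c \<in> fchains G X" "c' \<in> fchains G X"
  shows "frag_of (a, c - c') - (frag_of (a, c) - frag_of (a, c')) \<in> rels X"
proof -
  have "frag_of (a, (c - c') + c') - frag_of (a, c - c') - frag_of (a, c') \<in> rel_gens X"
    by (rule rel_gens_right[OF assms(1) chains_diff[OF assms(2,3)] assms(3)])
  from rels_uminus[OF rels_gen[OF this]] show ?thesis by (simp add: algebra_simps)
qed

lemma rels_balanced:
  assumes "r \<in> carrier (group_ring G)" "a \<in> carrier N" "c \<in> fchains G X"
  shows "frag_of (r \<odot>\<^bsub>N\<^esub> a, c) - frag_of (a, r \<odot>\<^bsub>free_module G X\<^esub> c) \<in> rels X"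
  by (rule rels_gen[OF rel_gens_balanced[OF assms]])

lemma rels_zero_left: "c \<in> fchains G X \<Longrightarrow> frag_of (\<lambda>_. 0, c) \<in> rels X"
  using rels_left[OF zero_N zero_N, of c X] by simp

lemma rels_zero_right: "a \<in> carrier N \<Longrightarrow> frag_of (a, 0) \<in> rels X"
  using rels_right[of a 0 X 0] by simp

lemma tensor_lin_closed:
  assumes "Poly_Mapping.keys w \<subseteq> pairs X" shows "tensor_lin G w \<in> novikov_chains G \<beta> X"
  using assms
proof (induction rule: frag_ind)
  case (of k)
  then show ?case by (cases k) (simp add: pairs_def tensor_eval_closed)
qed (simp_all add: novikov_chains_zero tensor_lin_diff novikov_chains_diff)

lemma tensor_lin_rel_gens:
  fixes X :: "'x set"
  assumes "w \<in> rel_gens X" shows "tensor_lin G w = (\<lambda>_. 0)"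
proof -
  have *: "tensor_eval G (\<lambda>g. a g + b g) c y - tensor_eval G a c y - tensor_eval G b c y = 0"
    if "a \<in> carrier N" "b \<in> carrier N" "c \<in> fchains G X" for a b y and c :: "('a \<times> 'x) \<Rightarrow>\<^sub>0 int"
    using fun_cong[OF tensor_eval_diff_left[OF add_N[OF that(1,2)] that(2,3)], of y] by simp
  have **: "tensor_eval G a (c + c') y - tensor_eval G a c y - tensor_eval G a c' y = 0"
    if "a \<in> carrier N" "c \<in> fchains G X" "c' \<in> fchains G X" for a y and c c' :: "('a \<times> 'x) \<Rightarrow>\<^sub>0 int"
    using fun_cong[OF tensor_eval_diff_right[OF that(1) chains_add[OF that(2,3)] that(3)], of y] by simp
  show ?thesis
    using assms unfolding rel_gens_def by (auto simp: tensor_lin_diff * ** tensor_eval_balanced(1))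
qed

lemma tensor_lin_rels:
  assumes "w \<in> rels X" shows "tensor_lin G w = (\<lambda>_. 0)"
  using assms unfolding rels_eq
proof (induction rule: generate.induct)
  case (inv h)
  then have "h \<in> carrier (free_Abelian_group (pairs X))" by (rule subsetD[OF rel_gens_carrier])
  then have "Poly_Mapping.keys h \<subseteq> pairs X" by simp
  then show ?case using tensor_lin_rel_gens[OF inv] by (simp add: tensor_lin_uminus)
qed (simp_all add: tensor_lin_rel_gens tensor_lin_add)

text \<open>Every tensor is congruent to one of the form \<open>\<Sum>\<^sub>x a\<^sub>x \<otimes> x\<close>, with \<open>a\<^sub>x\<close> the column of its Novikov chain at \<open>x\<close>.\<close>

definition standard :: "'x set \<Rightarrow> (('a \<times> 'x) \<Rightarrow> int) \<Rightarrow> (('a \<Rightarrow> int) \<times> (('a \<times> 'x) \<Rightarrow>\<^sub>0 int)) \<Rightarrow>\<^sub>0 int" where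
  "standard S \<sigma> = (\<Sum>x\<in>S. frag_of (\<lambda>g. \<sigma> (g, x), frag_of (\<one>, x)))"

lemma standard_keys:
  assumes "\<sigma> \<in> novikov_chains G \<beta> X" "S \<subseteq> X"
  shows "Poly_Mapping.keys (standard S \<sigma>) \<subseteq> pairs X"
proof -
  have "Poly_Mapping.keys (standard S \<sigma>) \<subseteq> (\<Union>x\<in>S. Poly_Mapping.keys (frag_of (\<lambda>g. \<sigma> (g, x), frag_of (\<one>, x)) :: _ \<Rightarrow>\<^sub>0 int))"
    unfolding standard_def by (rule Poly_Mapping.keys_sum)
  also have "\<dots> \<subseteq> pairs X" using assms column_closed[OF assms(1)] by (auto simp: pairs_def)
  finally show ?thesis .
qed

lemma standard_0: "S \<subseteq> X \<Longrightarrow> standard S (\<lambda>_. 0) \<in> rels X"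
  unfolding standard_def by (intro rels_sum rels_zero_left) auto

lemma standard_diff:
  assumes "\<sigma> \<in> novikov_chains G \<beta> X" "\<tau> \<in> novikov_chains G \<beta> X" "S \<subseteq> X"
  shows "standard S (\<lambda>y. \<sigma> y - \<tau> y) - (standard S \<sigma> - standard S \<tau>) \<in> rels X"
proof -
  have "standard S (\<lambda>y. \<sigma> y - \<tau> y) - (standard S \<sigma> - standard S \<tau>) =
    (\<Sum>x\<in>S. frag_of (\<lambda>g. \<sigma> (g, x) - \<tau> (g, x), frag_of (\<one>, x)) -
       (frag_of (\<lambda>g. \<sigma> (g, x), frag_of (\<one>, x)) - frag_of (\<lambda>g. \<tau> (g, x), frag_of (\<one>, x))))"
    by (simp add: standard_def sum_subtractf)
  also have "\<dots> \<in> rels X"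
    by (intro rels_sum rels_left column_closed[OF assms(1)] column_closed[OF assms(2)]) (use assms(3) in auto)
  finally show ?thesis .
qed

lemma tensor_lin_standard:
  assumes \<sigma>: "\<sigma> \<in> novikov_chains G \<beta> X" and S: "finite S" "S \<subseteq> X" "{y. \<sigma> y \<noteq> 0} \<subseteq> carrier G \<times> S"
  shows "tensor_lin G (standard S \<sigma>) = \<sigma>"
proof
  fix y :: "'a \<times> 'c" obtain g x where y: "y = (g, x)" by (cases y)
  have "tensor_lin G (\<Sum>x\<in>T. frag_of (\<lambda>g. \<sigma> (g, x), frag_of (\<one>, x))) (g, x) =
     (\<Sum>x'\<in>T. if x' = x then \<sigma> (g, x) else 0)" if "finite T" for T
    using that
  proof (induction T rule: finite_induct)
    case (insert z T)
    have "tensor_eval G (\<lambda>g. \<sigma> (g, z)) (frag_of (\<one>, z)) (g, x) = (if z = x then \<sigma> (g, x) else 0)"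
      using tensor_eval_of[OF column_closed[OF \<sigma>], of \<one> z z g x] S(3) by (cases "g \<in> carrier G") auto
    then show ?case using insert by (cases "z = x") (simp_all add: tensor_lin_add)
  qed simp
  from this[OF S(1)] have "tensor_lin G (standard S \<sigma>) (g, x) = (if x \<in> S then \<sigma> (g, x) else 0)"
    using S(1) by (simp add: standard_def)
  then show "tensor_lin G (standard S \<sigma>) y = \<sigma> y" using S(3) y by auto
qed

text \<open>For \<open>c = hx\<close> the factor h is moved across the tensor sign. The claim covers
  all finite sets S beyond some \<open>S0\<close>, so that the sets for two chains can be united;
  surplus columns only add tensors with zero left factor, which are relations.\<close>

lemma frag_of_standard:
  assumes a: "a \<in> carrier N" and c: "c \<in> fchains G X"
  shows "\<exists>S0. finite S0 \<and> S0 \<subseteq> X \<and> (\<forall>S. finite S \<and> S0 \<subseteq> S \<and> S \<subseteq> X \<longrightarrow>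
     frag_of (a, c) - standard S (tensor_eval G a c) \<in> rels X)"
  using c
proof (induction rule: chains_induct)
  case zero
  show ?case
    by (rule exI[of _ "{}"])
      (auto simp: tensor_eval_zero_right intro!: rels_diff rels_zero_right[OF a] standard_0)
next
  case (of h x)
  let ?h = "frag_of h"
  have h: "?h \<in> carrier (group_ring G)" using of by (simp add: group_ring_def)
  have hx: "?h \<odot>\<^bsub>free_module G X\<^esub> frag_of (\<one>, x) = frag_of (h, x)"
    using of by (simp add: free_module_def)
  have ha: "?h \<odot>\<^bsub>N\<^esub> a \<in> carrier N" by (rule tensor_eval_balanced(2)[OF a h chains_zero])
  have ha_eq: "(\<lambda>g. tensor_eval G a (frag_of (h, x)) (g, x)) = ?h \<odot>\<^bsub>N\<^esub> a"
    using tensor_eval_of[OF a of(1), of x] by (auto simp: height_module_def)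
  have other: "(\<lambda>g. tensor_eval G a (frag_of (h, x)) (g, x')) = (\<lambda>_. 0)" if "x' \<noteq> x" for x'
    using tensor_eval_of[OF a of(1), of x] that by auto
  show ?case
  proof (intro exI[of _ "{x}"] conjI allI impI)
    fix S assume S: "finite S \<and> {x} \<subseteq> S \<and> S \<subseteq> X"
    define R where "R = (\<Sum>x'\<in>S - {x}. frag_of (\<lambda>_::'a. 0::int, frag_of (\<one>, x')) :: _ \<Rightarrow>\<^sub>0 int)"
    have eq: "standard S (tensor_eval G a (frag_of (h, x))) = frag_of (?h \<odot>\<^bsub>N\<^esub> a, frag_of (\<one>, x)) +
R"
      unfolding standard_def R_def using S by (subst sum.remove[of _ x]) (auto simp: ha_eq other)
    have R: "R \<in> rels X"
      unfolding R_def using S by (intro rels_sum rels_zero_left) auto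
    have bal: "frag_of (?h \<odot>\<^bsub>N\<^esub> a, frag_of (\<one>, x)) - frag_of (a, frag_of (h, x)) \<in> rels X"
      using rels_balanced[OF h a, of "frag_of (\<one>, x)" X] of by (simp add: hx)
    show "frag_of (a, frag_of (h, x)) - standard S (tensor_eval G a (frag_of (h, x))) \<in> rels X"
      using rels_diff[OF rels_uminus[OF bal] R] by (simp add: eq algebra_simps)
  qed (use of in auto)
next
  case (diff c c')
  obtain S0 where S0: "finite S0" "S0 \<subseteq> X"
    "\<forall>S. finite S \<and> S0 \<subseteq> S \<and> S \<subseteq> X \<longrightarrow> frag_of (a, c) - standard S (tensor_eval G a c) \<in> rels X"
    using diff.IH(1) by auto
  obtain S1 where S1: "finite S1" "S1 \<subseteq> X"
    "\<forall>S. finite S \<and> S1 \<subseteq> S \<and> S \<subseteq> X \<longrightarrow> frag_of (a, c') - standard S (tensor_eval G a c') \<in> rels X"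
    using diff.IH(2) by auto
  show ?case
  proof (intro exI[of _ "S0 \<union> S1"] conjI allI impI)
    fix S assume S: "finite S \<and> S0 \<union> S1 \<subseteq> S \<and> S \<subseteq> X"
    let ?st = "\<lambda>c. standard S (tensor_eval G a c)"
    have 1: "frag_of (a, c) - ?st c \<in> rels X" using S0(3) S by auto
    have 2: "frag_of (a, c') - ?st c' \<in> rels X" using S1(3) S by auto
    have 3: "?st (c - c') - (?st c - ?st c') \<in> rels X"
      unfolding tensor_eval_diff_right[OF a diff.hyps]
      by (rule standard_diff) (use S in \<open>auto intro: tensor_eval_closed a diff.hyps\<close>)
    have 4: "frag_of (a, c - c') - (frag_of (a, c) - frag_of (a, c')) \<in> rels X"
      by (rule rels_right[OF a diff.hyps])
    have "frag_of (a, c - c') - ?st (c - c') =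
      (frag_of (a, c - c') - (frag_of (a, c) - frag_of (a, c'))) + ((frag_of (a, c) - ?st c) - (frag_of (a, c') - ?st c'))
        - (?st (c - c') - (?st c - ?st c'))" by (simp add: algebra_simps)
    then show "frag_of (a, c - c') - ?st (c - c') \<in> rels X"
      using rels_diff[OF rels_add[OF 4 rels_diff[OF 1 2]] 3] by simp
  qed (use S0 S1 in auto)
qed

lemma standard_mod_rels:
  assumes w: "Poly_Mapping.keys w \<subseteq> pairs X"
  shows "\<exists>S0. finite S0 \<and> S0 \<subseteq> X \<and> (\<forall>S. finite S \<and> S0 \<subseteq> S \<and> S \<subseteq> X \<longrightarrow>
     w - standard S (tensor_lin G w) \<in> rels X)"
proof -
  have "Poly_Mapping.keys w \<subseteq> pairs X \<and> (\<exists>S0. finite S0 \<and> S0 \<subseteq> X \<and> (\<forall>S. finite S \<and> S0 \<subseteq> S \<and> S \<subseteq> X \<longrightarrow>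
     w - standard S (tensor_lin G w) \<in> rels X))"
    using w
  proof (induction rule: frag_ind)
    case zero
    show ?case by (auto intro!: exI[of _ "{}"] rels_uminus standard_0)
  next
    case (of k)
    obtain a c where k: "k = (a, c)" by (cases k)
    then have ac: "a \<in> carrier N" "c \<in> fchains G X" using of by (simp_all add: pairs_def)
    show ?case using frag_of_standard[OF ac] of unfolding k tensor_lin_of by simp
  next
    case (diff u v)
    obtain S0 where S0: "finite S0" "S0 \<subseteq> X"
      "\<forall>S. finite S \<and> S0 \<subseteq> S \<and> S \<subseteq> X \<longrightarrow> u - standard S (tensor_lin G u) \<in> rels X"
      using diff.IH(1) by auto
    obtain S1 where S1: "finite S1" "S1 \<subseteq> X"
      "\<forall>S. finite S \<and> S1 \<subseteq> S \<and> S \<subseteq> X \<longrightarrow> v - standard S (tensor_lin G v) \<in> rels X"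
      using diff.IH(2) by auto
    have "(u - v) - standard S (tensor_lin G (u - v)) \<in> rels X" if S: "finite S \<and> S0 \<union> S1 \<subseteq> S \<and> S \<subseteq> X" for S
    proof -
      have 1: "u - standard S (tensor_lin G u) \<in> rels X" using S0(3) S by auto
      have 2: "v - standard S (tensor_lin G v) \<in> rels X" using S1(3) S by auto
      have 3: "standard S (tensor_lin G (u - v)) - (standard S (tensor_lin G u) - standard S (tensor_lin G v)) \<in> rels X"
        unfolding tensor_lin_diff by (rule standard_diff) (use S diff.IH in \<open>auto intro: tensor_lin_closed\<close>)
      show ?thesis using rels_diff[OF rels_diff[OF 1 2] 3] by (simp add: algebra_simps)
    qed
    then have "\<exists>S0. finite S0 \<and> S0 \<subseteq> X \<and> (\<forall>S. finite S \<and> S0 \<subseteq> S \<and> S \<subseteq> X \<longrightarrow>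
        u - v - standard S (tensor_lin G (u - v)) \<in> rels X)"
      using S0(1,2) S1(1,2) by (intro exI[of _ "S0 \<union> S1"]) auto
    moreover have "Poly_Mapping.keys (u - v) \<subseteq> pairs X"
      by (rule keys_diff_subset) (use diff.IH in simp_all)
    ultimately show ?case by (rule conjI[rotated])
  qed
  then show ?thesis by blast
qed

text \<open>Hence \<open>N \<otimes> F(X)\<close> is the group of Novikov chains over \<open>X\<close>.\<close>

lemma rels_iff:
  assumes w: "Poly_Mapping.keys w \<subseteq> pairs X"
  shows "w \<in> rels X \<longleftrightarrow> tensor_lin G w = (\<lambda>_. 0)"
proof
  assume 0: "tensor_lin G w = (\<lambda>_. 0)"
  obtain S0 where "finite S0" "S0 \<subseteq> X" "\<forall>S. finite S \<and> S0 \<subseteq> S \<and> S \<subseteq> X \<longrightarrow> w - standard S (tensor_lin G w) \<in> rels X"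
    using standard_mod_rels[OF w] by auto
  then have "w - standard S0 (\<lambda>_. 0) \<in> rels X" "standard S0 (\<lambda>_. 0) \<in> rels X" using standard_0 0 by auto
  from rels_add[OF this] show "w \<in> rels X" by simp
qed (rule tensor_lin_rels)

lemma tensor_lin_surj:
  assumes \<sigma>: "\<sigma> \<in> novikov_chains G \<beta> X"
  obtains w where "Poly_Mapping.keys w \<subseteq> pairs X" "tensor_lin G w = \<sigma>"
proof -
  obtain S where S: "S \<subseteq> X" "finite S" "{y. \<sigma> y \<noteq> 0} \<subseteq> carrier G \<times> S" by (rule novikov_chainsE[OF \<sigma>])
  show thesis by (rule that[OF standard_keys[OF \<sigma> S(1)] tensor_lin_standard[OF \<sigma> S(2,1,3)]])
qed

end

section \<open>Tor as the homology of Novikov chains\<close>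

context height_tensor
begin

text \<open>By \<open>rels_iff\<close> and \<open>tensor_lin_surj\<close>, the map
  \<open>tensor_lin\<close> identifies each tensor product with a group of Novikov chains, and
  \<open>dd_lin\<close> turns the induced boundary into \<open>novikov_ext D\<close>. Cosets are
  handled through representatives throughout.\<close>

lemma trivial_Tor_iff:
  assumes X: "free_complex G X D"
    and d: "\<And>k c. c \<in> fchains G (X (Suc k)) \<Longrightarrow> d c = frag_extend D c"
  shows "trivial_group (Tor (group_ring G) N (\<lambda>i. free_module G (X i)) d k) \<longleftrightarrow> novikov_exact G \<beta> X D k"
proof -
  interpret X: free_complex G X D by (rule X)
  define FA where "FA k = free_Abelian_group (pairs (X k))" for k
  define T where "T k = FA k Mod rels (X k)" for k
  define q where "q k w = rels (X k) #>\<^bsub>FA k\<^esub> w" for k w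
  define dd where "dd w = frag_extend (\<lambda>(a, x). frag_of (a, d x)) w" for w :: "(('a \<Rightarrow> int) \<times> (('a \<times> 'c) \<Rightarrow>\<^sub>0 int)) \<Rightarrow>\<^sub>0 int"
  have q_eq: "q k w = (\<lambda>r. r + w) ` rels (X k)" for k w
    by (auto simp: q_def r_coset_def FA_def)
  have q_iff: "q k w = q k w' \<longleftrightarrow> w - w' \<in> rels (X k)" for k w w'
  proof
    assume "q k w = q k w'"
    moreover have "w \<in> q k w" unfolding q_eq using rels_0 by force
    ultimately obtain r where "r \<in> rels (X k)" "w = r + w'" unfolding q_eq by auto
    then show "w - w' \<in> rels (X k)" by simp
  next
    assume r: "w - w' \<in> rels (X k)"
    have "r + w \<in> q k w'" if "r \<in> rels (X k)" for r
      unfolding q_eq by (rule image_eqI[OF _ rels_add[OF that r]]) simp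
    moreover have "r + w' \<in> q k w" if "r \<in> rels (X k)" for r
      unfolding q_eq by (rule image_eqI[OF _ rels_diff[OF that r]]) simp
    ultimately show "q k w = q k w'" unfolding q_eq by blast
  qed
  have q_lin: "q k w = q k w' \<longleftrightarrow> tensor_lin G w = tensor_lin G w'"
    if "Poly_Mapping.keys w \<subseteq> pairs (X k)" "Poly_Mapping.keys w' \<subseteq> pairs (X k)" for k w w'
    unfolding q_iff rels_iff[OF keys_diff_subset[OF that]] tensor_lin_diff by (simp add: fun_eq_iff)
  have T_carrier: "carrier (T k) = q k ` {w. Poly_Mapping.keys w \<subseteq> pairs (X k)}" for k
    by (auto simp: T_def carrier_FactGroup q_def FA_def)
  have T_one: "\<one>\<^bsub>T k\<^esub> = q k 0" for k
    by (simp add: T_def FactGroup_def q_eq)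
  have dd_keys: "Poly_Mapping.keys (dd w) \<subseteq> pairs (X k)" if "Poly_Mapping.keys w \<subseteq> pairs (X (Suc k))" for w k
    unfolding dd_def
  proof (rule keys_frag_extend_subset[OF _ that])
    fix z assume "z \<in> pairs (X (Suc k))"
    then show "Poly_Mapping.keys (case z of (a, x) \<Rightarrow> frag_of (a, d x)) \<subseteq> pairs (X k)"
      using fin_map_chains[OF X.D_fin_map] by (auto simp: pairs_def d)
  qed
  have dd_lin: "tensor_lin G (dd w) = novikov_ext D (tensor_lin G w)" if "Poly_Mapping.keys w \<subseteq> pairs (X (Suc k))" for w k
  proof -
    have "Poly_Mapping.keys w \<subseteq> pairs (X (Suc k)) \<and> tensor_lin G (dd w) = novikov_ext D (tensor_lin G w)"
      using that
    proof (induction rule: frag_ind)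
      case zero
      show ?case by (simp add: dd_def)
    next
      case (of z)
      obtain a c where z: "z = (a, c)" by (cases z)
      have ac: "a \<in> carrier N" "c \<in> fchains G (X (Suc k))" using of z by (simp_all add: pairs_def)
      have "novikov_ext D (tensor_eval G a c) =
          novikov_ext (\<lambda>y. frag_extend D (case y of (g, _) \<Rightarrow> translate G g c)) (scalar_chain a)"
        unfolding tensor_eval_def
        by (rule novikov_ext_comp[OF fin_map_translate[OF ac(2)] X.D_fin_map scalar_chain_closed[OF ac(1)]])
      also have "\<dots> = tensor_eval G a (frag_extend D c)"
        unfolding tensor_eval_def
        by (rule novikov_ext_cong_on[OF scalar_chain_closed[OF ac(1)]])
          (simp add: equivariant_frag_extend[OF X.D_equivariant _ ac(2)])
      finally show ?case using of ac by (simp add: dd_def z d)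
    next
      case (diff u v)
      have "dd (u - v) = dd u - dd v" by (simp add: dd_def frag_extend_diff)
      moreover have "novikov_ext D (\<lambda>y. tensor_lin G u y - tensor_lin G v y) =
          (\<lambda>z. novikov_ext D (tensor_lin G u) z - novikov_ext D (tensor_lin G v) z)"
        by (rule novikov_ext_diff[OF X.D_fin_map]) (use diff.IH tensor_lin_closed in auto)
      moreover have "Poly_Mapping.keys (u - v) \<subseteq> pairs (X (Suc k))"
        by (rule keys_diff_subset) (use diff.IH in simp_all)
      ultimately show ?case using diff.IH by (simp add: tensor_lin_diff)
    qed
    then show ?thesis by blast
  qed
  have tp: "tensor_product (group_ring G) N (free_module G (X k)) = T k" for k
    by (simp add: tensor_product_def T_def FA_def pairs_def rels_def)
  have tm: "tensor_map (group_ring G) N (free_module G (X k)) d (q (Suc k) w) = q k (dd w)"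
    if w: "Poly_Mapping.keys w \<subseteq> pairs (X (Suc k))" for k w
  proof -
    have dr: "dd r \<in> rels (X k)" if "r \<in> rels (X (Suc k))" for r
      unfolding rels_iff[OF dd_keys[OF rels_carrier[OF that]]] dd_lin[OF rels_carrier[OF that]]
      by (simp add: tensor_lin_rels[OF that])
    have dd_add: "dd (u + v) = dd u + dd v" for u v by (simp add: dd_def frag_extend_add)
    have "tensor_map (group_ring G) N (free_module G (X k)) d (q (Suc k) w) =
        {r + dd s | r s. r \<in> rels (X k) \<and> s \<in> q (Suc k) w}"
      by (auto simp: tensor_map_def rels_def[symmetric] set_mult_def dd_def)
    also have "\<dots> = q k (dd w)"
    proof
      show "{r + dd s | r s. r \<in> rels (X k) \<and> s \<in> q (Suc k) w} \<subseteq> q k (dd w)"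
      proof
        fix z assume "z \<in> {r + dd s | r s. r \<in> rels (X k) \<and> s \<in> q (Suc k) w}"
        then obtain r r' where "z = r + dd (r' + w)" "r \<in> rels (X k)" "r' \<in> rels (X (Suc k))"
          by (auto simp: q_eq)
        then show "z \<in> q k (dd w)"
          unfolding q_eq by (intro image_eqI[of _ _ "r + dd r'"] rels_add dr) (simp_all add: dd_add add.assoc)
      qed
      show "q k (dd w) \<subseteq> {r + dd s | r s. r \<in> rels (X k) \<and> s \<in> q (Suc k) w}"
      proof
        fix z assume "z \<in> q k (dd w)"
        then obtain r where "z = r + dd w" "r \<in> rels (X k)" by (auto simp: q_eq)
        moreover have "w \<in> q (Suc k) w" unfolding q_eq using rels_0 by force
        ultimately show "z \<in> {r + dd s | r s. r \<in> rels (X k) \<and> s \<in> q (Suc k) w}" by blast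
      qed
    qed
    finally show ?thesis .
  qed
  \<comment> \<open>\<open>K\<close> and the following \<open>L\<close> are the full preimages of
    the cycles and of the boundaries in the free abelian group. \<open>L\<close> is defined by the
    associated Novikov chain and so contains all relations; this allows a comparison of
    \<open>K\<close> with \<open>L\<close> instead of their images.\<close>
  define K where "K = {w. Poly_Mapping.keys w \<subseteq> pairs (X k) \<and> (k \<noteq> 0 \<longrightarrow> novikov_ext D (tensor_lin G w) = (\<lambda>_. 0))}"
  define L where "L = {w. Poly_Mapping.keys w \<subseteq> pairs (X k) \<and>
      (\<exists>\<tau>\<in>novikov_chains G \<beta> (X (Suc k)). novikov_ext D \<tau> = tensor_lin G w)}"
  define Z where "Z = (case k of 0 \<Rightarrow> carrier (T 0)
      | Suc i \<Rightarrow> kernel (T k) (T i) (tensor_map (group_ring G) N (free_module G (X i)) d))"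
  define B where "B = tensor_map (group_ring G) N (free_module G (X k)) d ` carrier (T (Suc k))"
  have Tor_eq: "Tor (group_ring G) N (\<lambda>i. free_module G (X i)) d k = (T k)\<lparr>carrier := Z\<rparr> Mod B"
    by (simp add: Tor_def tp Z_def B_def Let_def)
  have Z: "Z = q k ` K"
  proof (cases k)
    case 0
    then show ?thesis by (simp add: Z_def K_def T_carrier)
  next
    case (Suc i)
    have "tensor_map (group_ring G) N (free_module G (X i)) d (q k w) = \<one>\<^bsub>T i\<^esub> \<longleftrightarrow> w \<in> K"
      if "Poly_Mapping.keys w \<subseteq> pairs (X k)" for w
    proof -
      have w: "Poly_Mapping.keys w \<subseteq> pairs (X (Suc i))" using that Suc by simp
      have "q i (dd w) = q i 0 \<longleftrightarrow> tensor_lin G (dd w) = tensor_lin G 0"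
        by (rule q_lin[OF dd_keys[OF w]]) simp
      then show ?thesis using that Suc by (simp add: tm[OF w] T_one dd_lin[OF w] K_def)
    qed
    then show ?thesis unfolding Z_def Suc by (auto simp: kernel_def T_carrier K_def Suc)
  qed
  have B: "B = q k ` L"
  proof
    show "B \<subseteq> q k ` L"
    proof
      fix z assume "z \<in> B"
      then obtain w where w: "Poly_Mapping.keys w \<subseteq> pairs (X (Suc k))" "z = q k (dd w)"
        unfolding B_def T_carrier using tm by auto
      have "dd w \<in> L" unfolding L_def
        using dd_keys[OF w(1)] dd_lin[OF w(1)] tensor_lin_closed[OF w(1)] by auto
      then show "z \<in> q k ` L" using w(2) by blast
    qed
    show "q k ` L \<subseteq> B"
    proof
      fix z assume "z \<in> q k ` L"
      then obtain w \<tau> where w: "z = q k w" "Poly_Mapping.keys w \<subseteq> pairs (X k)"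
        "\<tau> \<in> novikov_chains G \<beta> (X (Suc k))" "novikov_ext D \<tau> = tensor_lin G w" unfolding L_def by auto
      obtain v where v: "Poly_Mapping.keys v \<subseteq> pairs (X (Suc k))" "tensor_lin G v = \<tau>"
        by (rule tensor_lin_surj[OF w(3)])
      have "q k w = q k (dd v)" unfolding q_lin[OF w(2) dd_keys[OF v(1)]] dd_lin[OF v(1)] by (simp add: v w)
      then show "z \<in> B" unfolding B_def T_carrier using tm[OF v(1)] v(1) w(1) by auto
    qed
  qed
  have FA: "comm_group (FA k)" unfolding FA_def by (rule abelian_free_Abelian_group)
  have T: "comm_group (T k)" unfolding T_def FA_def
    by (rule comm_group.abelian_FactGroup[OF abelian_free_Abelian_group rels_subgroup])
  have rn: "rels (X k) \<lhd> FA k"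
    unfolding FA_def by (rule comm_group.subgroup_imp_normal[OF abelian_free_Abelian_group rels_subgroup])
  have qh: "group_hom (FA k) (T k) (q k)"
    unfolding group_hom_def group_hom_axioms_def T_def q_def
    using normal.r_coset_hom_Mod[OF rn] normal.factorgroup_is_group[OF rn] FA
    by (simp add: comm_group.axioms)
  have LK: "L \<subseteq> K"
  proof
    fix w assume "w \<in> L"
    then obtain \<tau> where w: "Poly_Mapping.keys w \<subseteq> pairs (X k)"
        "\<tau> \<in> novikov_chains G \<beta> (X (Suc k))" "novikov_ext D \<tau> = tensor_lin G w" unfolding L_def by auto
    have "novikov_ext D (tensor_lin G w) = (\<lambda>_. 0)" if k0: "k \<noteq> 0"
    proof -
      obtain i where i: "k = Suc i" using k0 by (cases k) auto
      have \<tau>: "\<tau> \<in> novikov_chains G \<beta> (X (Suc (Suc i)))" using w i by simp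
      have "novikov_ext D (novikov_ext D \<tau>) = novikov_ext (\<lambda>y. frag_extend D (D y)) \<tau>"
        by (rule novikov_ext_comp[OF X.D_fin_map X.D_fin_map \<tau>])
      also have "\<dots> = novikov_ext (\<lambda>y. 0) \<tau>"
        by (rule novikov_ext_cong_on[OF \<tau>]) (rule X.D_D)
      also have "\<dots> = (\<lambda>_. 0)" by (simp add: novikov_ext_def fun_eq_iff)
      finally show ?thesis using w(3) by simp
    qed
    then show "w \<in> K" using w(1) by (simp add: K_def)
  qed
  have lin_k: "tensor_lin G w \<in> novikov_chains G \<beta> (X k)" if "Poly_Mapping.keys w \<subseteq> pairs (X k)" for w
    by (rule tensor_lin_closed[OF that])
  have FA_subgroup: "subgroup S (FA k)" if S: "S \<subseteq> {w. Poly_Mapping.keys w \<subseteq> pairs (X k)}" "0 \<in> S"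
      "\<And>u v. u \<in> S \<Longrightarrow> v \<in> S \<Longrightarrow> u - v \<in> S" for S
  proof -
    have neg: "- v \<in> S" if "v \<in> S" for v using S(3)[OF S(2) that] by simp
    have "u + v \<in> S" if "u \<in> S" "v \<in> S" for u v using S(3)[OF that(1) neg[OF that(2)]] by simp
    then show ?thesis
      using S neg by (intro subgroup.intro) (auto simp: FA_def)
  qed
  have K_sub: "subgroup K (FA k)"
  proof (rule FA_subgroup)
    fix u v assume uv: "u \<in> K" "v \<in> K"
    have "novikov_ext D (tensor_lin G (u - v)) = (\<lambda>_. 0)" if k0: "k \<noteq> 0"
    proof -
      obtain i where i: "k = Suc i" using k0 by (cases k) auto
      have "novikov_ext D (\<lambda>y. tensor_lin G u y - tensor_lin G v y) =
          (\<lambda>z. novikov_ext D (tensor_lin G u) z - novikov_ext D (tensor_lin G v) z)"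
        by (rule novikov_ext_diff[OF X.D_fin_map]) (use uv lin_k i in \<open>auto simp: K_def\<close>)
      then show ?thesis using uv k0 by (simp add: K_def tensor_lin_diff)
    qed
    moreover have "Poly_Mapping.keys (u - v) \<subseteq> pairs (X k)"
      by (rule keys_diff_subset) (use uv in \<open>simp_all add: K_def\<close>)
    ultimately show "u - v \<in> K" by (simp add: K_def)
  qed (auto simp: K_def)
  have L_sub: "subgroup L (FA k)"
  proof (rule FA_subgroup)
    have "\<exists>\<tau>\<in>novikov_chains G \<beta> (X (Suc k)). novikov_ext D \<tau> = (\<lambda>_. 0)"
      by (rule bexI[of _ "\<lambda>_. 0"]) (simp_all add: novikov_chains_zero)
    then show "0 \<in> L" by (simp add: L_def)
    fix u v assume uv: "u \<in> L" "v \<in> L"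
    then obtain \<sigma> \<tau> where \<sigma>: "\<sigma> \<in> novikov_chains G \<beta> (X (Suc k))" "novikov_ext D \<sigma> = tensor_lin G u"
      and \<tau>: "\<tau> \<in> novikov_chains G \<beta> (X (Suc k))" "novikov_ext D \<tau> = tensor_lin G v"
      unfolding L_def by auto
    have "novikov_ext D (\<lambda>y. \<sigma> y - \<tau> y) = tensor_lin G (u - v)"
      unfolding tensor_lin_diff \<sigma>(2)[symmetric] \<tau>(2)[symmetric] by (rule novikov_ext_diff[OF X.D_fin_map \<sigma>(1) \<tau>(1)])
    moreover have "Poly_Mapping.keys (u - v) \<subseteq> pairs (X k)"
      by (rule keys_diff_subset) (use uv in \<open>simp_all add: L_def\<close>)
    ultimately show "u - v \<in> L" using novikov_chains_diff[OF \<sigma>(1) \<tau>(1)] by (auto simp: L_def)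
  qed (auto simp: L_def)
  have Zs: "subgroup Z (T k)" and Bs: "subgroup B (T k)"
    unfolding Z B by (rule group_hom.subgroup_img_is_subgroup[OF qh K_sub], rule group_hom.subgroup_img_is_subgroup[OF qh L_sub])
  have BZ: "B \<subseteq> Z" unfolding Z B using LK by blast
  have "trivial_group (Tor (group_ring G) N (\<lambda>i. free_module G (X i)) d k) \<longleftrightarrow> Z \<subseteq> B"
    unfolding Tor_eq by (rule trivial_quotient_iff[OF T Zs Bs BZ])
  also have "\<dots> \<longleftrightarrow> K \<subseteq> L"
  proof
    assume ZB: "Z \<subseteq> B"
    show "K \<subseteq> L"
    proof
      fix w assume w: "w \<in> K"
      then have "q k w \<in> q k ` L" using ZB unfolding Z B by blast
      then obtain v where v: "q k w = q k v" "v \<in> L" by blast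
      have "tensor_lin G w = tensor_lin G v"
        using v(1) w v(2) q_lin[of w k v] by (simp add: K_def L_def)
      then show "w \<in> L" using v(2) w by (simp add: K_def L_def)
    qed
  qed (auto simp: Z B)
  also have "\<dots> \<longleftrightarrow> novikov_exact G \<beta> X D k"
  proof
    assume KL: "K \<subseteq> L"
    show "novikov_exact G \<beta> X D k"
      unfolding novikov_exact_def
    proof (intro ballI impI)
      fix \<sigma> assume \<sigma>: "\<sigma> \<in> novikov_chains G \<beta> (X k)" "k \<noteq> 0 \<longrightarrow> novikov_ext D \<sigma> = (\<lambda>_. 0)"
      obtain w where w: "Poly_Mapping.keys w \<subseteq> pairs (X k)" "tensor_lin G w = \<sigma>" by (rule tensor_lin_surj[OF \<sigma>(1)])
      then have "w \<in> L" using KL \<sigma>(2) unfolding K_def by blast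
      then show "\<exists>\<tau>\<in>novikov_chains G \<beta> (X (Suc k)). novikov_ext D \<tau> = \<sigma>" using w(2) by (simp add: L_def)
    qed
  next
    assume "novikov_exact G \<beta> X D k"
    then show "K \<subseteq> L" using lin_k by (auto simp: K_def L_def novikov_exact_def)
  qed
  finally show ?thesis .
qed

end

section \<open>Rays in proper CAT(0) spaces\<close>

lemma rays_dist: "\<gamma> \<in> rays \<Longrightarrow> 0 \<le> s \<Longrightarrow> 0 \<le> t \<Longrightarrow> dist (\<gamma> s) (\<gamma> t) = \<bar>s - t\<bar>"
  by (simp add: rays_def geodesic_on_def)

lemma rays_segment:
  assumes "\<gamma> \<in> rays" "0 \<le> T" shows "geodesic_segment \<gamma> (\<gamma> 0) (\<gamma> T)" "dist (\<gamma> 0) (\<gamma> T) = T"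
  using rays_dist[OF assms(1), of 0 T] assms by (auto simp: geodesic_segment_def geodesic_on_def rays_dist)

lemma rays_segment_reverse:
  assumes "\<gamma> \<in> rays" "0 \<le> T" shows "geodesic_segment (\<lambda>s. \<gamma> (T - s)) (\<gamma> T) (\<gamma> 0)" "dist (\<gamma> T) (\<gamma> 0) = T"
  using rays_dist[OF assms(1), of T 0] assms by (auto simp: geodesic_segment_def geodesic_on_def rays_dist)

lemma segment_reverse:
  assumes "geodesic_segment c x y" shows "geodesic_segment (\<lambda>s. c (dist x y - s)) y x"
  using assms by (auto simp: geodesic_segment_def geodesic_on_def dist_commute)

lemma asymptotic_refl: "\<gamma> \<in> rays \<Longrightarrow> (\<gamma>, \<gamma>) \<in> asymptotic"
  by (auto simp: asymptotic_def)

lemma asymptotic_sym: "(\<gamma>, \<gamma>') \<in> asymptotic \<Longrightarrow> (\<gamma>', \<gamma>) \<in> asymptotic"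
  by (auto simp: asymptotic_def dist_commute)

lemma asymptotic_trans:
  assumes "(\<gamma>, \<gamma>') \<in> asymptotic" "(\<gamma>', \<gamma>'') \<in> asymptotic" shows "(\<gamma>, \<gamma>'') \<in> asymptotic"
proof -
  obtain K K' where K: "\<forall>t\<ge>0. dist (\<gamma> t) (\<gamma>' t) \<le> K" "\<forall>t\<ge>0. dist (\<gamma>' t) (\<gamma>'' t) \<le> K'"
    using assms by (auto simp: asymptotic_def)
  have "dist (\<gamma> t) (\<gamma>'' t) \<le> K + K'" if "t \<ge> 0" for t
    using dist_triangle[of "\<gamma> t" "\<gamma>'' t" "\<gamma>' t"] K that by (meson add_mono order_trans)
  then show ?thesis using assms by (auto simp: asymptotic_def)
qed

lemma asymptotic_bound:
  assumes "(\<gamma>, \<gamma>') \<in> asymptotic" obtains K where "0 \<le> K" "\<forall>t\<ge>0. dist (\<gamma> t) (\<gamma>' t) \<le> K"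
proof -
  obtain K where K: "\<forall>t\<ge>0. dist (\<gamma> t) (\<gamma>' t) \<le> K" using assms by (auto simp: asymptotic_def)
  have "dist (\<gamma> 0) (\<gamma>' 0) \<le> K" using K by simp
  then have "0 \<le> K" using zero_le_dist[of "\<gamma> 0" "\<gamma>' 0"] by linarith
  then show thesis using K that by blast
qed

lemma asymptotic_rays: "(\<gamma>, \<gamma>') \<in> asymptotic \<Longrightarrow> \<gamma> \<in> rays \<and> \<gamma>' \<in> rays"
  by (simp add: asymptotic_def)

lemma boundary_class: "\<gamma> \<in> rays \<Longrightarrow> asymptotic `` {\<gamma>} \<in> boundary"
  by (auto simp: boundary_def quotient_def)

lemma boundaryE:
  assumes "e \<in> boundary" obtains \<gamma> where "\<gamma> \<in> rays" "e = asymptotic `` {\<gamma>}"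
  using assms by (auto simp: boundary_def quotient_def)

lemma boundary_asymptotic:
  assumes "e \<in> boundary" "\<gamma> \<in> e" "\<gamma>' \<in> e" shows "(\<gamma>, \<gamma>') \<in> asymptotic"
  using assms by (auto elim!: boundaryE intro: asymptotic_sym asymptotic_trans)

lemma boundary_rays: "e \<in> boundary \<Longrightarrow> \<gamma> \<in> e \<Longrightarrow> \<gamma> \<in> rays"
  by (auto elim!: boundaryE dest: asymptotic_rays)

lemma busemann_mono:
  assumes "\<gamma> \<in> rays" "0 \<le> s" "s \<le> t" shows "s - dist x (\<gamma> s) \<le> t - dist x (\<gamma> t)"
  using rays_dist[OF assms(1,2), of t] dist_triangle[of x "\<gamma> t" "\<gamma> s"] assms by simp

lemma busemann_tendsto:
  assumes \<gamma>: "\<gamma> \<in> rays"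
  shows "((\<lambda>t. t - dist x (\<gamma> t)) \<longlongrightarrow> busemann \<gamma> x) at_top"
proof -
  let ?f = "\<lambda>t. t - dist x (\<gamma> t)"
  have ub: "?f t \<le> dist x (\<gamma> 0)" if "t \<ge> 0" for t
    using rays_dist[OF \<gamma>, of 0 t] dist_triangle3[of "\<gamma> 0" "\<gamma> t" x] that by simp
  have bdd: "bdd_above (?f ` {0..})" using ub by (auto simp: bdd_above_def)
  have "(?f \<longlongrightarrow> Sup (?f ` {0..})) at_top"
  proof (rule order_tendstoI)
    fix a assume "a < Sup (?f ` {0..})"
    then obtain s where s: "s \<ge> 0" "a < ?f s" using bdd by (auto simp: less_cSup_iff)
    have "a < ?f t" if "s \<le> t" for t using busemann_mono[OF \<gamma> s(1) that, of x] s(2) by linarith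
    then show "eventually (\<lambda>t. a < ?f t) at_top" unfolding eventually_at_top_linorder by blast
  next
    fix a assume a: "Sup (?f ` {0..}) < a"
    have "?f t < a" if "0 \<le> t" for t
      using cSup_upper[OF _ bdd, of "?f t"] a that by fastforce
    then show "eventually (\<lambda>t. ?f t < a) at_top" unfolding eventually_at_top_linorder by blast
  qed
  moreover from this have "busemann \<gamma> x = Sup (?f ` {0..})"
    unfolding busemann_def by (intro tendsto_Lim) auto
  ultimately show ?thesis by simp
qed

lemma busemann_ge:
  assumes \<gamma>: "\<gamma> \<in> rays" and T: "0 \<le> T" shows "T - dist x (\<gamma> T) \<le> busemann \<gamma> x"
proof (rule tendsto_lowerbound[OF busemann_tendsto[OF \<gamma>]])
  show "eventually (\<lambda>t. T - dist x (\<gamma> T) \<le> t - dist x (\<gamma> t)) at_top"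
    using eventually_ge_at_top[of T] by eventually_elim (rule busemann_mono[OF \<gamma> T])
qed simp

lemma busemann_start:
  assumes \<gamma>: "\<gamma> \<in> rays" shows "busemann \<gamma> (\<gamma> 0) = 0"
proof -
  have "((\<lambda>t::real. 0) \<longlongrightarrow> busemann \<gamma> (\<gamma> 0)) at_top"
  proof (rule Lim_transform_eventually[OF busemann_tendsto[OF \<gamma>]])
    show "eventually (\<lambda>t. t - dist (\<gamma> 0) (\<gamma> t) = 0) at_top"
      using eventually_ge_at_top[of 0] by eventually_elim (simp add: rays_dist[OF \<gamma>])
  qed
  then show ?thesis using tendsto_unique[OF _ tendsto_const] by force
qed

section \<open>Comparison with the Euclidean plane and its consequences for rays\<close>

lemma dist_vector_2: "dist (vector [p, q] :: real^2) (vector [p', q']) = sqrt ((p - p')\<^sup>2 + (q - q')\<^sup>2)"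
  by (simp add: dist_vec_def L2_set_def sum_2 dist_real_def)

context
  assumes cat0: "CAT0 TYPE('m::metric_space)"
begin

lemma segment_exists:
  fixes x y :: 'm obtains c where "geodesic_segment c x y"
proof -
  have "\<forall>x y :: 'm. \<exists>c. geodesic_segment c x y" using cat0 unfolding CAT0_def by (rule conjunct1)
  then show thesis using that by blast
qed

text \<open>The right-hand side is the squared distance of the comparison points by the law of
  cosines, for a comparison triangle with one vertex at the origin and one on the first axis. With
  this inequality between real numbers, later arguments can do without the plane.\<close>

lemma cat0_comparison:
  fixes x y z :: 'm
  assumes c: "geodesic_segment c x y" and c': "geodesic_segment c' x z"
    and l: "0 \<le> l" "l \<le> 1" and m: "0 \<le> m" "m \<le> 1"
  shows "(dist (c (l * dist x y)) (c' (m * dist x z)))\<^sup>2 \<le>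
    l\<^sup>2 * (dist x y)\<^sup>2 + m\<^sup>2 * (dist x z)\<^sup>2 - l * m * ((dist x y)\<^sup>2 + (dist x z)\<^sup>2 - (dist y z)\<^sup>2)"
proof -
  define A B C where "A = dist x y" and "B = dist x z" and "C = dist y z"
  have nn: "0 \<le> A" "0 \<le> B" "0 \<le> C" by (simp_all add: A_def B_def C_def)
  have tri: "A \<le> B + C" "B \<le> A + C" "C \<le> A + B"
    unfolding A_def B_def C_def by metric+
  \<comment> \<open>The first coordinate of the third vertex, from the law of cosines. For
    \<open>A = 0\<close> the quotient is 0, which is admissible as \<open>B = C\<close>
    then.\<close>
  define u where "u = (A\<^sup>2 + B\<^sup>2 - C\<^sup>2) / (2 * A)"
  define v where "v = sqrt (B\<^sup>2 - u\<^sup>2)"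
  have Au: "2 * A * u = A\<^sup>2 + B\<^sup>2 - C\<^sup>2"
  proof (cases "A = 0")
    case True
    then have "B = C" using tri by simp
    then show ?thesis using True by simp
  qed (simp add: u_def)
  \<comment> \<open>Here the triangle inequalities enter: they guarantee that the comparison
    triangle exists.\<close>
  have uB: "u\<^sup>2 \<le> B\<^sup>2"
  proof (cases "A = 0")
    case False
    then have A: "A > 0" using nn by simp
    have "(A - B)\<^sup>2 \<le> C\<^sup>2" using tri nn by (intro power2_le_iff_abs_le[THEN iffD2]) auto
    then have 1: "2 * A * u \<le> 2 * A * B" unfolding Au by (simp add: power2_eq_square algebra_simps)
    have "C\<^sup>2 \<le> (A + B)\<^sup>2" using tri nn by (intro power_mono) auto
    then have 2: "2 * A * (- B) \<le> 2 * A * u" unfolding Au by (simp add: power2_eq_square algebra_simps)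
    have "u \<le> B" "- B \<le> u" using mult_left_le_imp_le[OF 1] mult_left_le_imp_le[OF 2] A by simp_all
    then show ?thesis by (intro power2_le_iff_abs_le[THEN iffD2]) (use nn in auto)
  qed (simp add: u_def)
  then have v: "v\<^sup>2 = B\<^sup>2 - u\<^sup>2" by (simp add: v_def)
  let ?x = "vector [0, 0] :: real^2" and ?y = "vector [A, 0] :: real^2" and ?z = "vector [u, v] :: real^2"
  let ?p = "vector [l * A, 0] :: real^2" and ?q = "vector [m * u, m * v] :: real^2"
  have d: "dist ?x ?y = A" "dist ?x ?z = B"
    unfolding dist_vector_2 using nn v by (simp_all add: real_sqrt_abs)
  have d3: "dist ?y ?z = C"
  proof -
    have "(A - u)\<^sup>2 + (0 - v)\<^sup>2 = C\<^sup>2" using v Au by (simp add: power2_eq_square algebra_simps)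
    then show ?thesis unfolding dist_vector_2 using nn by simp
  qed
  have pseg: "?p \<in> closed_segment ?x ?y"
    unfolding closed_segment_def using l
    by (auto intro!: exI[of _ l] simp: vec_eq_iff forall_2)
  have qseg: "?q \<in> closed_segment ?x ?z"
    unfolding closed_segment_def using m
    by (auto intro!: exI[of _ m] simp: vec_eq_iff forall_2)
  have dp: "dist ?x ?p = l * A" unfolding dist_vector_2 using nn l by simp
  have dq: "dist ?x ?q = m * B"
  proof -
    have "(0 - m * u)\<^sup>2 + (0 - m * v)\<^sup>2 = m\<^sup>2 * (u\<^sup>2 + v\<^sup>2)"
      by (simp add: power_mult_distrib algebra_simps)
    also have "\<dots> = (m * B)\<^sup>2" by (simp add: v power_mult_distrib)
    finally show ?thesis unfolding dist_vector_2 using nn m by simp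
  qed
  have s: "l * A \<in> {0..dist x y}" "m * B \<in> {0..dist x z}"
    using l m nn mult_left_le_one_le[of A l] mult_left_le_one_le[of B m] by (simp_all add: A_def B_def)
  have "\<forall>x y z :: 'm. \<forall>c c'. geodesic_segment c x y \<longrightarrow> geodesic_segment c' x z \<longrightarrow>
        (\<forall>(x'::real^2) y' z'.
           dist x' y' = dist x y \<longrightarrow> dist x' z' = dist x z \<longrightarrow> dist y' z' = dist y z \<longrightarrow>
           (\<forall>s\<in>{0..dist x y}. \<forall>t\<in>{0..dist x z}.
              \<forall>p'\<in>closed_segment x' y'. \<forall>q'\<in>closed_segment x' z'.
                dist x' p' = s \<longrightarrow> dist x' q' = t \<longrightarrow> dist (c s) (c' t) \<le> dist p' q'))"
    using cat0 unfolding CAT0_def by (rule conjunct2)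
  moreover have "dist ?x ?y = dist x y" "dist ?x ?z = dist x z" "dist ?y ?z = dist y z"
    unfolding A_def[symmetric] B_def[symmetric] C_def[symmetric] by (rule d(1), rule d(2), rule d3)
  ultimately have "dist (c (l * A)) (c' (m * B)) \<le> dist ?p ?q"
    using c c' s pseg qseg dp dq by presburger
  then have "(dist (c (l * A)) (c' (m * B)))\<^sup>2 \<le> (dist ?p ?q)\<^sup>2" by (intro power_mono) auto
  also have "(dist ?p ?q)\<^sup>2 = (l * A - m * u)\<^sup>2 + (m * v)\<^sup>2"
    unfolding dist_vector_2 by simp
  also have "\<dots> = l\<^sup>2 * A\<^sup>2 + m\<^sup>2 * (u\<^sup>2 + v\<^sup>2) - l * m * (2 * A * u)"
    by (simp add: power2_eq_square algebra_simps)
  also have "\<dots> = l\<^sup>2 * A\<^sup>2 + m\<^sup>2 * B\<^sup>2 - l * m * (A\<^sup>2 + B\<^sup>2 - C\<^sup>2)"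
    by (simp add: v Au)
  finally show ?thesis by (simp add: A_def B_def C_def)
qed

text \<open>For equal ratios the terms with the two side lengths cancel in
  \<open>cat0_comparison\<close>.\<close>

lemma segments_diverge:
  fixes x y z :: 'm
  assumes "geodesic_segment c x y" "geodesic_segment c' x z" "0 \<le> l" "l \<le> 1"
  shows "dist (c (l * dist x y)) (c' (l * dist x z)) \<le> l * dist y z"
proof -
  have "(dist (c (l * dist x y)) (c' (l * dist x z)))\<^sup>2 \<le> (l * dist y z)\<^sup>2"
    using cat0_comparison[OF assms assms(3,4)] by (simp add: power2_eq_square algebra_simps)
  then show ?thesis by (rule power2_le_imp_le) (use assms in simp)
qed

text \<open>The initial point \<open>c T\<close> of a long geodesic already determines its Busemann function up to \<open>O(1/T)\<close>.\<close>

lemma segment_busemann: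
  fixes x y z :: 'm
  assumes c: "geodesic_segment c x z" and T: "0 < T" "2 * dist x y \<le> T" "T \<le> dist x z"
  shows "dist y (c T) - T \<le> dist y z - dist x z + (dist x y)\<^sup>2 / T"
proof -
  define r where "r = dist x y"
  define l where "l = dist x z"
  define s where "s = dist y z - l"
  have r: "0 \<le> r" "2 * r \<le> T" using T by (simp_all add: r_def)
  have l: "T \<le> l" "0 < l" using T unfolding l_def by linarith+
  have s: "\<bar>s\<bar> \<le> r" unfolding s_def l_def r_def by metric
  obtain k where k: "geodesic_segment k x y" by (rule segment_exists)
  have ky: "k (1 * dist x y) = y" using k by (simp add: geodesic_segment_def)
  have Tl: "T / l * dist x z = T" using l by (simp add: l_def)
  \<comment> \<open>Ratio 1 selects the endpoint y on the segment from x to y, and ratio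
    \<open>T / l\<close> the point at distance T on c.\<close>
  have "(dist y (c T))\<^sup>2 \<le> 1\<^sup>2 * r\<^sup>2 + (T / l)\<^sup>2 * l\<^sup>2 - 1 * (T / l) * (r\<^sup>2 + l\<^sup>2 - (l + s)\<^sup>2)"
    using cat0_comparison[OF k c, of 1 "T / l"] T(1) l unfolding ky Tl unfolding r_def[symmetric]
    by (simp add: l_def[symmetric] s_def)
  also have "(T / l)\<^sup>2 * l\<^sup>2 = T\<^sup>2" using l by (simp add: power_divide)
  also have "1 * (T / l) * (r\<^sup>2 + l\<^sup>2 - (l + s)\<^sup>2) = (T / l) * (r\<^sup>2 - s\<^sup>2) - 2 * T * s"
    using l by (simp add: power2_eq_square field_simps)
  finally have "(dist y (c T))\<^sup>2 \<le> r\<^sup>2 + T\<^sup>2 + 2 * T * s - (T / l) * (r\<^sup>2 - s\<^sup>2)" by simp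
  moreover have "s\<^sup>2 \<le> r\<^sup>2" using s by (intro power2_le_iff_abs_le[THEN iffD2]) (use r in auto)
  then have "0 \<le> (T / l) * (r\<^sup>2 - s\<^sup>2)" using T l by (intro mult_nonneg_nonneg) auto
  ultimately have "(dist y (c T))\<^sup>2 \<le> r\<^sup>2 + T\<^sup>2 + 2 * T * s" by linarith
  also have "\<dots> \<le> (T + s)\<^sup>2 + r\<^sup>2" by (simp add: power2_eq_square algebra_simps)
  \<comment> \<open>\<open>2 * r \<le> T\<close> gives \<open>T / 2 \<le> T + s\<close>, so the
    mixed term of the new square alone is at least the square of r.\<close>
  also have "\<dots> \<le> (T + s + r\<^sup>2 / T)\<^sup>2"
  proof -
    define Q where "Q = r\<^sup>2 / T * (T + s)"
    have "T / 2 \<le> T + s" using s r by linarith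
    then have "r\<^sup>2 / T * (T / 2) \<le> Q" unfolding Q_def using T by (intro mult_left_mono) auto
    moreover have "r\<^sup>2 / T * (T / 2) = r\<^sup>2 / 2" using T by simp
    ultimately have "r\<^sup>2 \<le> 2 * Q" by simp
    moreover have "(T + s + r\<^sup>2 / T)\<^sup>2 = (T + s)\<^sup>2 + 2 * Q + (r\<^sup>2 / T)\<^sup>2"
      unfolding Q_def power2_sum by (simp add: ac_simps)
    ultimately show ?thesis using zero_le_power2[of "r\<^sup>2 / T"] by linarith
  qed
  finally have "dist y (c T) \<le> T + s + r\<^sup>2 / T"
  proof (rule power2_le_imp_le)
    have "0 \<le> r\<^sup>2 / T" using T by simp
    then show "0 \<le> T + s + r\<^sup>2 / T" using s r by linarith
  qed
  then show ?thesis by (simp add: s_def l_def r_def)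
qed

text \<open>One inequality is the monotonicity of \<open>t - dist y (\<gamma> t)\<close>; the other
  is \<open>segment_busemann\<close> for the segments of the ray up to t, as t tends to
  infinity.\<close>

lemma busemann_approx:
  fixes y :: 'm
  assumes \<gamma>: "\<gamma> \<in> rays" and T: "0 < T" "2 * dist (\<gamma> 0) y \<le> T"
  shows "\<bar>busemann \<gamma> y - (T - dist y (\<gamma> T))\<bar> \<le> (dist (\<gamma> 0) y)\<^sup>2 / T"
proof -
  have "busemann \<gamma> y \<le> T - dist y (\<gamma> T) + (dist (\<gamma> 0) y)\<^sup>2 / T"
  proof (rule tendsto_upperbound[OF busemann_tendsto[OF \<gamma>]])
    show "eventually (\<lambda>t. t - dist y (\<gamma> t) \<le> T - dist y (\<gamma> T) + (dist (\<gamma> 0) y)\<^sup>2 / T) at_top"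
      using eventually_ge_at_top[of T]
    proof eventually_elim
      case (elim t)
      then show ?case
        using segment_busemann[OF rays_segment(1)[OF \<gamma>, of t] T] rays_segment(2)[OF \<gamma>, of t] T(1) by simp
    qed
  qed simp
  then show ?thesis using busemann_ge[OF \<gamma>, of T y] T by (simp add: abs_le_iff)
qed

lemma le_of_le_add_inverse:
  fixes a b r M :: real
  assumes "\<And>T. T > 0 \<Longrightarrow> M \<le> T \<Longrightarrow> a \<le> b + r / T" shows "a \<le> b"
proof -
  have "((\<lambda>T. b + r / T) \<longlongrightarrow> b + 0) at_top"
    by (intro tendsto_add tendsto_const tendsto_divide_0[OF tendsto_const]
        filterlim_at_top_imp_at_infinity filterlim_ident)
  moreover have "eventually (\<lambda>T. a \<le> b + r / T) at_top"
    using eventually_gt_at_top[of 0] eventually_ge_at_top[of M] by eventually_elim (rule assms)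
  ultimately have "a \<le> b + 0" by (rule tendsto_lowerbound) simp
  then show ?thesis by simp
qed

lemma rays_diverge:
  fixes \<gamma> \<gamma>' :: "real \<Rightarrow> 'm"
  assumes \<gamma>: "\<gamma> \<in> rays" "\<gamma>' \<in> rays" "\<gamma> 0 = \<gamma>' 0" and t: "0 \<le> t" "t \<le> T" "0 < T"
  shows "dist (\<gamma> t) (\<gamma>' t) \<le> t / T * dist (\<gamma> T) (\<gamma>' T)"
proof -
  have T: "0 \<le> T" using t by simp
  have c: "geodesic_segment \<gamma> (\<gamma>' 0) (\<gamma> T)" "dist (\<gamma>' 0) (\<gamma> T) = T"
    using rays_segment[OF \<gamma>(1) T] \<gamma>(3) by simp_all
  show ?thesis
    using segments_diverge[OF c(1) rays_segment(1)[OF \<gamma>(2) T], of "t / T"] c(2) rays_segment(2)[OF \<gamma>(2) T] t by simp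
qed

text \<open>By convexity the distance at t is at most \<open>t / T\<close> times the distance at T,
  which is bounded; T tends to infinity.\<close>

lemma asymptotic_unique:
  fixes \<gamma> \<gamma>' :: "real \<Rightarrow> 'm"
  assumes as: "(\<gamma>, \<gamma>') \<in> asymptotic" and 0: "\<gamma> 0 = \<gamma>' 0" and t: "0 \<le> t"
  shows "\<gamma> t = \<gamma>' t"
proof -
  obtain K where K: "0 \<le> K" "\<forall>t\<ge>0. dist (\<gamma> t) (\<gamma>' t) \<le> K" by (rule asymptotic_bound[OF as])
  have "dist (\<gamma> t) (\<gamma>' t) \<le> 0"
  proof (rule le_of_le_add_inverse[where M = t and r = "t * K"])
    fix T :: real assume T: "T > 0" "t \<le> T"
    have "dist (\<gamma> t) (\<gamma>' t) \<le> t / T * dist (\<gamma> T) (\<gamma>' T)"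
      using asymptotic_rays[OF as] by (intro rays_diverge 0 t T) auto
    also have "\<dots> \<le> t / T * K" using K T t by (intro mult_left_mono) auto
    finally show "dist (\<gamma> t) (\<gamma>' t) \<le> 0 + t * K / T" by simp
  qed
  then show ?thesis by simp
qed

text \<open>Two errors of the same size add up: the distance of the points at equal ratio, and the
  change from equal ratio to equal time T on the second segment. For fixed T and bounded
  \<open>dist p q\<close> the result tends to 0 as p recedes.\<close>

lemma segments_asymptotic:
  fixes x p q :: 'm
  assumes c: "geodesic_segment c x p" "geodesic_segment c' x q"
    and T: "0 < T" "T \<le> dist x p" "T \<le> dist x q"
  shows "dist (c T) (c' T) \<le> 2 * T * dist p q / dist x p"
proof -
  define l where "l = dist x p"
  have l: "0 < l" "T \<le> l" using T unfolding l_def by linarith+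
  have "dist (c (T / l * dist x p)) (c' (T / l * dist x q)) \<le> T / l * dist p q"
    using l T by (intro segments_diverge[OF c]) auto
  moreover have "T / l * dist x p = T" using l by (simp add: l_def)
  moreover have "dist (c' (T / l * dist x q)) (c' T) \<le> T / l * dist p q"
  proof -
    have "T / l * dist x q \<le> 1 * dist x q" using l by (intro mult_right_mono) auto
    then have "dist (c' (T / l * dist x q)) (c' T) = \<bar>T / l * dist x q - T\<bar>"
      using c(2) T l by (simp add: geodesic_segment_def geodesic_on_def)
    also have "\<dots> = T / l * \<bar>dist x q - l\<bar>"
    proof -
      have "T / l * dist x q - T = T / l * (dist x q - l)" using l by (simp add: field_simps)
      then show ?thesis using l T by (simp add: abs_mult)
    qed
    also have "\<dots> \<le> T / l * dist p q"
    proof (intro mult_left_mono)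
      show "\<bar>dist x q - l\<bar> \<le> dist p q" unfolding l_def by metric
    qed (use l T in simp)
    finally show ?thesis .
  qed
  ultimately have "dist (c T) (c' T) \<le> T / l * dist p q + T / l * dist p q"
    using dist_triangle[of "c T" "c' T" "c' (T / l * dist x q)"] by simp
  then show ?thesis by (simp add: l_def)
qed

text \<open>Both rays are viewed from x, through segments to their points at time t. The points at
  distance T on the two segments merge as t grows; the triangle inequality relates the first of them
  to \<gamma>, and \<open>segment_busemann\<close> relates the second to \<open>\<gamma>'\<close> up
  to an error of order \<open>1 / T\<close>. Then T tends to infinity.\<close>

lemma busemann_asymptotic_le:
  fixes x y :: 'm
  assumes as: "(\<gamma>, \<gamma>') \<in> asymptotic"
  shows "busemann \<gamma> x - busemann \<gamma> y \<le> busemann \<gamma>' x - busemann \<gamma>' y"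
proof (rule le_of_le_add_inverse[where M = "2 * dist x y" and r = "(dist x y)\<^sup>2"])
  fix T :: real assume T: "T > 0" "2 * dist x y \<le> T"
  have \<gamma>: "\<gamma> \<in> rays" "\<gamma>' \<in> rays" using asymptotic_rays[OF as] by auto
  obtain K where K: "0 \<le> K" "\<forall>t\<ge>0. dist (\<gamma> t) (\<gamma>' t) \<le> K" by (rule asymptotic_bound[OF as])
  \<comment> \<open>The offset between time along the ray and distance from x.\<close>
  define a where "a = dist x (\<gamma> 0)"
  have a: "t - a \<le> dist x (\<gamma> t)" if "t \<ge> 0" for t
    using rays_dist[OF \<gamma>(1), of 0 t] dist_triangle[of "\<gamma> 0" "\<gamma> t" x] that by (simp add: a_def dist_commute)
  have "busemann \<gamma> x - busemann \<gamma> y \<le> busemann \<gamma>' x - busemann \<gamma>' y + (dist x y)\<^sup>2 / T + 0"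
  proof (rule tendsto_le)
    show "((\<lambda>t. (t - dist x (\<gamma> t)) - (t - dist y (\<gamma> t))) \<longlongrightarrow> busemann \<gamma> x - busemann \<gamma> y) at_top"
      by (intro tendsto_diff busemann_tendsto \<gamma>)
    show "((\<lambda>t. (t - dist x (\<gamma>' t)) - (t - dist y (\<gamma>' t)) + (dist x y)\<^sup>2 / T + 2 * T * K / (t - a)) \<longlongrightarrow>
        busemann \<gamma>' x - busemann \<gamma>' y + (dist x y)\<^sup>2 / T + 0) at_top"
    proof (intro tendsto_add tendsto_diff busemann_tendsto \<gamma> tendsto_const)
      have "filterlim (\<lambda>t. - a + t) at_top at_top"
        by (rule filterlim_tendsto_add_at_top[OF tendsto_const filterlim_ident])
      then have "filterlim (\<lambda>t. t - a) at_infinity at_top"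
        by (intro filterlim_at_top_imp_at_infinity) simp
      then show "((\<lambda>t. 2 * T * K / (t - a)) \<longlongrightarrow> 0) at_top"
        by (rule tendsto_divide_0[OF tendsto_const])
    qed
    \<comment> \<open>From time \<open>T + a + K\<close> on, both segments from x have length at
      least T.\<close>
    show "eventually (\<lambda>t. (t - dist x (\<gamma> t)) - (t - dist y (\<gamma> t)) \<le>
        (t - dist x (\<gamma>' t)) - (t - dist y (\<gamma>' t)) + (dist x y)\<^sup>2 / T + 2 * T * K / (t - a)) at_top"
      using eventually_ge_at_top[of "T + a + K"]
    proof eventually_elim
      case (elim t)
      have a0: "0 \<le> a" by (simp add: a_def)
      have t: "0 \<le> t" "0 < t - a" "T + K \<le> t - a" using elim T K a0 by linarith+
      have tK: "dist (\<gamma> t) (\<gamma>' t) \<le> K" using K t by simp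
      have l: "T \<le> dist x (\<gamma> t)" "t - a \<le> dist x (\<gamma> t)" using a[OF t(1)] t K by linarith+
      have l': "T \<le> dist x (\<gamma>' t)" using a[OF t(1)] t tK dist_triangle2[of x "\<gamma> t" "\<gamma>' t"] by linarith
      obtain c where c: "geodesic_segment c x (\<gamma> t)" by (rule segment_exists)
      obtain c' where c': "geodesic_segment c' x (\<gamma>' t)" by (rule segment_exists)
      have "dist (c T) (c' T) \<le> 2 * T * dist (\<gamma> t) (\<gamma>' t) / dist x (\<gamma> t)"
        by (rule segments_asymptotic[OF c c' T(1) l(1) l'])
      also have "\<dots> \<le> 2 * T * K / (t - a)"
        using tK T K t l by (intro frac_le mult_left_mono) auto
      finally have 1: "dist (c T) (c' T) \<le> 2 * T * K / (t - a)" .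
      have 2: "dist y (c' T) - T \<le> dist y (\<gamma>' t) - dist x (\<gamma>' t) + (dist x y)\<^sup>2 / T"
        by (rule segment_busemann[OF c' T l'])
      have ct: "c (dist x (\<gamma> t)) = \<gamma> t" "\<forall>s\<in>{0..dist x (\<gamma> t)}. \<forall>u\<in>{0..dist x (\<gamma> t)}. dist (c s) (c u) = \<bar>s - u\<bar>"
        using c unfolding geodesic_segment_def geodesic_on_def by blast+
      have "dist (c T) (\<gamma> t) = \<bar>T - dist x (\<gamma> t)\<bar>"
        using ct(2)[rule_format, of T "dist x (\<gamma> t)"] l T ct(1) by simp
      then have "dist (c T) (\<gamma> t) = dist x (\<gamma> t) - T" using l by simp
      then have 3: "dist y (\<gamma> t) - dist x (\<gamma> t) \<le> dist y (c T) - T"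
        using dist_triangle[of y "\<gamma> t" "c T"] by simp
      show ?case using 1 2 3 dist_triangle[of y "c T" "c' T"] dist_commute[of "c T" "c' T"] by linarith
    qed
  qed simp
  then show "busemann \<gamma> x - busemann \<gamma> y \<le> busemann \<gamma>' x - busemann \<gamma>' y + (dist x y)\<^sup>2 / T" by simp
qed

lemma busemann_asymptotic:
  fixes x y :: 'm
  assumes "(\<gamma>, \<gamma>') \<in> asymptotic"
  shows "busemann \<gamma> x - busemann \<gamma> y = busemann \<gamma>' x - busemann \<gamma>' y"
  using busemann_asymptotic_le[OF assms] busemann_asymptotic_le[OF asymptotic_sym[OF assms]] by (intro antisym)

text \<open>By \<open>busemann_approx\<close> the value at p depends, up to an error of order
  \<open>1 / T\<close> that is the same for all rays from b, only on the point at time T, and these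
  points converge.\<close>

lemma busemann_continuous:
  fixes p b :: 'm
  assumes \<gamma>: "\<gamma> \<in> rays" "\<gamma> 0 = b" and \<gamma>i: "eventually (\<lambda>i. \<gamma>i i \<in> rays \<and> \<gamma>i i 0 = b) F"
    and conv: "\<And>t. t \<ge> 0 \<Longrightarrow> ((\<lambda>i. \<gamma>i i t) \<longlongrightarrow> \<gamma> t) F"
  shows "((\<lambda>i. busemann (\<gamma>i i) p) \<longlongrightarrow> busemann \<gamma> p) F"
proof (rule tendstoI)
  fix \<epsilon> :: real assume \<epsilon>: "0 < \<epsilon>"
  define r where "r = dist b p"
  \<comment> \<open>The first entry is what \<open>busemann_approx\<close> requires, the second
    brings its error below a third of \<epsilon>; the \<open>+ 1\<close> keeps T positive when p is
    the base point.\<close>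
  define T where "T = max (2 * r) (3 * r\<^sup>2 / \<epsilon> + 1)"
  have T1: "3 * r\<^sup>2 / \<epsilon> + 1 \<le> T" "2 * r \<le> T" by (simp_all add: T_def)
  have "0 \<le> 3 * r\<^sup>2 / \<epsilon>" using \<epsilon> by simp
  then have T0: "0 < T" using T1 by linarith
  have "3 * r\<^sup>2 / \<epsilon> < T" using T1 by simp
  then have rT: "r\<^sup>2 / T < \<epsilon> / 3" using \<epsilon> T0 by (simp add: field_simps)
  have "((\<lambda>i. dist p (\<gamma>i i T)) \<longlongrightarrow> dist p (\<gamma> T)) F"
    using T0 by (intro tendsto_dist tendsto_const conv) simp
  then have "eventually (\<lambda>i. dist (dist p (\<gamma>i i T)) (dist p (\<gamma> T)) < \<epsilon> / 3) F"
    by (rule tendstoD) (use \<epsilon> in simp)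
  then show "eventually (\<lambda>i. dist (busemann (\<gamma>i i) p) (busemann \<gamma> p) < \<epsilon>) F"
    using \<gamma>i
  proof eventually_elim
    case (elim i)
    have 1: "\<bar>busemann (\<gamma>i i) p - (T - dist p (\<gamma>i i T))\<bar> \<le> r\<^sup>2 / T"
      using busemann_approx[of "\<gamma>i i" T p] elim(2) T0 T1 by (simp add: r_def)
    have 2: "\<bar>busemann \<gamma> p - (T - dist p (\<gamma> T))\<bar> \<le> r\<^sup>2 / T"
      using busemann_approx[of \<gamma> T p] \<gamma> T0 T1 by (simp add: r_def)
    show ?case using 1 2 elim(1) rT unfolding dist_real_def by linarith
  qed
qed

end

section \<open>Boundary points seen from the base point\<close>

definition base_ray :: "(real \<Rightarrow> 'm::metric_space) set \<Rightarrow> 'm \<Rightarrow> (real \<Rightarrow> 'm)" where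
  "base_ray e b = (SOME \<gamma>. \<gamma> \<in> e \<and> \<gamma> 0 = b)"

text \<open>The representative that vanishes at b. By \<open>busemann_eq_norm\<close> every other
  ray of the class gives the same function up to a constant.\<close>

definition norm_busemann :: "(real \<Rightarrow> 'm::metric_space) set \<Rightarrow> 'm \<Rightarrow> 'm \<Rightarrow> real" where
  "norm_busemann e b = busemann (base_ray e b)"

context
  assumes cat0: "CAT0 TYPE('m::metric_space)" and proper: "proper_space TYPE('m)"
begin

lemma ultralimit_ray:
  fixes f :: "'i \<Rightarrow> real \<Rightarrow> 'm" and b :: 'm
  assumes U: "ultrafilter U"
    and b: "\<And>t. 0 \<le> t \<Longrightarrow> eventually (\<lambda>i. f i t \<in> cball b t) U"
    and d: "\<And>s t. 0 \<le> s \<Longrightarrow> 0 \<le> t \<Longrightarrow> eventually (\<lambda>i. dist (f i s) (f i t) = \<bar>s - t\<bar>) U"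
  obtains \<gamma> where "\<gamma> \<in> rays" "\<gamma> 0 = b" "\<forall>t\<ge>0. ((\<lambda>i. f i t) \<longlongrightarrow> \<gamma> t) U"
proof -
  have "\<forall>t\<in>{0..}. \<exists>l. ((\<lambda>i. f i t) \<longlongrightarrow> l) U"
  proof
    fix t :: real assume t: "t \<in> {0..}"
    have c: "compact (cball b t)" using proper by (simp add: proper_space_def)
    have "eventually (\<lambda>i. f i t \<in> cball b t) U" using b t by simp
    then obtain l where "((\<lambda>i. f i t) \<longlongrightarrow> l) U" by (rule ultrafilter_tendsto_compact[OF U c])
    then show "\<exists>l. ((\<lambda>i. f i t) \<longlongrightarrow> l) U" by blast
  qed
  then have "\<exists>\<gamma>. \<forall>t\<in>{0..}. ((\<lambda>i. f i t) \<longlongrightarrow> \<gamma> t) U" by (rule bchoice)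
  then obtain \<gamma> where \<gamma>: "\<forall>t\<in>{0..}. ((\<lambda>i. f i t) \<longlongrightarrow> \<gamma> t) U" by (rule exE)
  note nb = ultrafilter_not_bot[OF U]
  have "dist (\<gamma> s) (\<gamma> t) = \<bar>s - t\<bar>" if st: "0 \<le> s" "0 \<le> t" for s t
  proof -
    have "((\<lambda>i. dist (f i s) (f i t)) \<longlongrightarrow> dist (\<gamma> s) (\<gamma> t)) U"
      using \<gamma> st by (intro tendsto_dist) auto
    then have "((\<lambda>i. \<bar>s - t\<bar>) \<longlongrightarrow> dist (\<gamma> s) (\<gamma> t)) U"
      by (rule Lim_transform_eventually) (rule d[OF st])
    then show ?thesis using tendsto_unique[OF nb _ tendsto_const] by blast
  qed
  then have r: "\<gamma> \<in> rays" by (simp add: rays_def geodesic_on_def)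
  have "((\<lambda>i. f i 0) \<longlongrightarrow> \<gamma> 0) U" using \<gamma> by simp
  then have "((\<lambda>i. b) \<longlongrightarrow> \<gamma> 0) U"
    by (rule Lim_transform_eventually) (use b[of 0] in \<open>auto elim: eventually_mono\<close>)
  then have "\<gamma> 0 = b" using tendsto_unique[OF nb _ tendsto_const] by blast
  then show thesis using r \<gamma> by (intro that[of \<gamma>]) auto
qed

text \<open>The ray is a limit of the segments from b to the points of \<gamma> at integer times,
  along an ultrafilter that refines the usual convergence to infinity.\<close>

lemma asymptotic_ray_exists:
  fixes b :: 'm
  assumes \<gamma>: "\<gamma> \<in> rays"
  obtains \<gamma>' where "\<gamma>' \<in> rays" "\<gamma>' 0 = b" "(\<gamma>, \<gamma>') \<in> asymptotic"
proof -
  have "(sequentially :: nat filter) \<noteq> bot" by simp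
  then obtain U :: "nat filter" where U: "ultrafilter U" "U \<le> sequentially"
    using ultrafilter_le_exists by blast
  note nb = ultrafilter_not_bot[OF U(1)]
  define d0 where "d0 = dist b (\<gamma> 0)"
  define L where "L n = dist b (\<gamma> (real n))" for n
  have L: "\<bar>L n - real n\<bar> \<le> d0" for n
    using rays_dist[OF \<gamma>, of 0 "real n"] dist_triangle[of b "\<gamma> (real n)" "\<gamma> 0"]
      dist_triangle3[of "\<gamma> 0" "\<gamma> (real n)" b] unfolding L_def d0_def by simp
  have "\<forall>n. \<exists>c. geodesic_segment c b (\<gamma> (real n))" using segment_exists[OF cat0] by blast
  then have "\<exists>c. \<forall>n. geodesic_segment (c n) b (\<gamma> (real n))" by (rule choice)
  then obtain c where c: "\<forall>n. geodesic_segment (c n) b (\<gamma> (real n))" by (rule exE)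
  have cd: "dist (c n s) (c n t) = \<bar>s - t\<bar>" if "0 \<le> s" "s \<le> L n" "0 \<le> t" "t \<le> L n" for n s t
    using c[rule_format, of n] that by (simp add: geodesic_segment_def geodesic_on_def L_def)
  have c0: "c n 0 = b" for n using c[rule_format, of n] by (simp add: geodesic_segment_def)
  have ev: "eventually (\<lambda>n. t \<le> L n \<and> t \<le> real n \<and> 0 < n) U" for t
  proof -
    have "eventually (\<lambda>n. max 0 t + d0 < real n) sequentially"
      using filterlim_real_sequentially unfolding filterlim_at_top_dense by blast
    then have "eventually (\<lambda>n. max 0 t + d0 < real n) U" using U(2) by (simp add: filter_leD)
    then show ?thesis
    proof eventually_elim
      case (elim n)
      have "0 \<le> d0" by (simp add: d0_def)
      then have "0 < real n" "t \<le> real n" "t \<le> L n" using elim L[of n] by linarith+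
      then show ?case by simp
    qed
  qed
  have "eventually (\<lambda>n. c n t \<in> cball b t) U" if "0 \<le> t" for t
    using ev[of t]
  proof eventually_elim
    case (elim n)
    then show ?case using cd[of 0 n t] that by (simp add: c0 L_def)
  qed
  moreover have "eventually (\<lambda>n. dist (c n s) (c n t) = \<bar>s - t\<bar>) U" if "0 \<le> s" "0 \<le> t" for s t
    using ev[of s] ev[of t] by eventually_elim (use cd that in auto)
  ultimately obtain \<gamma>' where \<gamma>': "\<gamma>' \<in> rays" "\<gamma>' 0 = b" "\<forall>t\<ge>0. ((\<lambda>n. c n t) \<longlongrightarrow> \<gamma>' t) U"
    by (rule ultralimit_ray[OF U(1)])
  have "dist (\<gamma> t) (\<gamma>' t) \<le> 2 * d0" if t: "0 \<le> t" for t
  proof (rule tendsto_upperbound[OF _ _ nb])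
    show "((\<lambda>n. dist (\<gamma> t) (c n t)) \<longlongrightarrow> dist (\<gamma> t) (\<gamma>' t)) U"
      using \<gamma>'(3) t by (intro tendsto_dist tendsto_const) auto
    show "eventually (\<lambda>n. dist (\<gamma> t) (c n t) \<le> 2 * d0) U"
      using ev[of t]
    proof eventually_elim
      case (elim n)
      then have n: "t \<le> L n" "t \<le> real n" "0 < real n" by auto
      \<comment> \<open>The comparison is made from the common endpoint at time n, and ratio l
        corresponds to time t on \<gamma>. On the segment from b it corresponds to time
        \<open>t / real n * L n\<close>, which differs from t by at most \<open>d0\<close>; this
        explains the second \<open>d0\<close> in the bound.\<close>
      define l where "l = 1 - t / real n"
      have l: "0 \<le> l" "l \<le> 1" using n t by (simp_all add: l_def)
      have s1: "geodesic_segment (\<lambda>s. c n (dist b (\<gamma> (real n)) - s)) (\<gamma> (real n)) b"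
        by (rule segment_reverse) (rule c[rule_format])
      note s2 = rays_segment_reverse[OF \<gamma>, of "real n"]
      have "dist (c n (L n - l * L n)) (\<gamma> (real n - l * real n)) \<le> l * dist b (\<gamma> 0)"
        using segments_diverge[OF cat0 s1 s2(1) l] s2(2) by (simp add: L_def dist_commute)
      moreover have "real n - l * real n = t" using n by (simp add: l_def field_simps)
      moreover have "L n - l * L n = t / real n * L n" by (simp add: l_def algebra_simps)
      moreover have "l * dist b (\<gamma> 0) \<le> d0" unfolding d0_def using l by (intro mult_left_le_one_le) auto
      ultimately have 1: "dist (c n (t / real n * L n)) (\<gamma> t) \<le> d0" by simp
      have "0 \<le> L n" by (simp add: L_def)
      then have "0 \<le> t / real n * L n" "t / real n * L n \<le> 1 * L n" using n t by (simp, intro mult_right_mono) auto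
      then have "dist (c n (t / real n * L n)) (c n t) = \<bar>t / real n * L n - t\<bar>" using cd[of "t / real n * L n" n t] n t by simp
      also have "t / real n * L n - t = t / real n * (L n - real n)" using n by (simp add: field_simps)
      also have "\<bar>t / real n * (L n - real n)\<bar> = t / real n * \<bar>L n - real n\<bar>" using n t by (simp add: abs_mult)
      also have "\<dots> \<le> 1 * d0" using L[of n] n t by (intro mult_mono) auto
      finally have 2: "dist (c n (t / real n * L n)) (c n t) \<le> d0" by simp
      show ?case using 1 2 dist_triangle2[of "\<gamma> t" "c n t" "c n (t / real n * L n)"]
        by (simp add: dist_commute)
    qed
  qed
  then have "(\<gamma>, \<gamma>') \<in> asymptotic" using \<gamma> \<gamma>'(1) by (auto simp: asymptotic_def)
  then show thesis using \<gamma>' that by blast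
qed

lemma base_ray:
  fixes b :: 'm
  assumes e: "e \<in> boundary" shows "base_ray e b \<in> e" "base_ray e b 0 = b" "base_ray e b \<in> rays"
proof -
  obtain \<gamma> where \<gamma>: "\<gamma> \<in> rays" "e = asymptotic `` {\<gamma>}" by (rule boundaryE[OF e])
  obtain \<gamma>' where "\<gamma>' \<in> rays" "\<gamma>' 0 = b" "(\<gamma>, \<gamma>') \<in> asymptotic" by (rule asymptotic_ray_exists[OF \<gamma>(1)])
  then have "\<exists>\<gamma>'. \<gamma>' \<in> e \<and> \<gamma>' 0 = b" using \<gamma> by auto
  then have "base_ray e b \<in> e \<and> base_ray e b 0 = b" unfolding base_ray_def by (rule someI_ex)
  then show "base_ray e b \<in> e" "base_ray e b 0 = b" by auto
  then show "base_ray e b \<in> rays" using boundary_rays[OF e] by blast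
qed

lemma busemann_eq_norm:
  fixes b p :: 'm
  assumes e: "e \<in> boundary" and \<gamma>: "\<gamma> \<in> e"
  shows "busemann \<gamma> p = busemann \<gamma> b + norm_busemann e b p"
proof -
  have "busemann \<gamma> p - busemann \<gamma> b = busemann (base_ray e b) p - busemann (base_ray e b) b"
    by (rule busemann_asymptotic[OF cat0 boundary_asymptotic[OF e \<gamma> base_ray(1)[OF e]]])
  moreover have "busemann (base_ray e b) b = 0"
    using busemann_start[OF base_ray(3)[OF e, of b]] base_ray(2)[OF e, of b] by simp
  ultimately show ?thesis by (simp add: norm_busemann_def)
qed

lemma norm_busemann_Lipschitz:
  fixes b p q :: 'm
  assumes "e \<in> boundary" shows "\<bar>norm_busemann e b p - norm_busemann e b q\<bar> \<le> dist p q"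
  unfolding norm_busemann_def by (rule busemann_Lipschitz[OF base_ray(3)[OF assms]])

lemma topspace_cone_topology:
  fixes b :: 'm
  assumes e: "e \<in> boundary" shows "e \<in> topspace (cone_topology b)"
proof -
  have "e \<in> cone_nbhd (base_ray e b) 1 1"
    using base_ray[OF e, of b] e by (auto simp: cone_nbhd_def)
  moreover have "cone_nbhd (base_ray e b) 1 1 \<in> {cone_nbhd \<gamma> r \<epsilon> | \<gamma> r \<epsilon>. \<gamma> \<in> rays \<and> \<gamma> 0 = b \<and> 0 < r \<and> 0 < \<epsilon>}"
    using base_ray[OF e, of b] zero_less_one by blast
  ultimately show ?thesis unfolding cone_topology_def topology_generated_by_topspace by (rule UnionI[rotated])
qed

text \<open>Compactness of the boundary in terms of ultrafilters: the base rays converge to a ray,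
  its class is a limit in the cone topology, and the Busemann functions converge with the
  rays.\<close>

lemma boundary_ultralimit:
  fixes b :: 'm
  assumes U: "ultrafilter U" and f: "eventually (\<lambda>i. f i \<in> boundary) U"
    and S: "eventually (\<lambda>i. f i \<in> S) U"
  obtains e where "e \<in> boundary" "\<forall>p. ((\<lambda>i. norm_busemann (f i) b p) \<longlongrightarrow> norm_busemann e b p) U"
    "e \<in> cone_topology b closure_of S"
proof -
  have b1: "eventually (\<lambda>i. base_ray (f i) b t \<in> cball b t) U" if "0 \<le> t" for t
    using f
  proof eventually_elim
    case (elim i)
    show ?case using rays_dist[OF base_ray(3)[OF elim, of b], of 0 t] base_ray(2)[OF elim, of b] that by simp
  qed
  have b2: "eventually (\<lambda>i. dist (base_ray (f i) b s) (base_ray (f i) b t) = \<bar>s - t\<bar>) U" if "0 \<le> s" "0 \<le> t" for s t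
    using f
  proof eventually_elim
    case (elim i)
    show ?case by (rule rays_dist[OF base_ray(3)[OF elim] that])
  qed
  obtain \<gamma> where \<gamma>: "\<gamma> \<in> rays" "\<gamma> 0 = b" "\<forall>t\<ge>0. ((\<lambda>i. base_ray (f i) b t) \<longlongrightarrow> \<gamma> t) U"
    by (rule ultralimit_ray[OF U b1 b2])
  define e where "e = asymptotic `` {\<gamma>}"
  have e: "e \<in> boundary" "\<gamma> \<in> e" unfolding e_def using boundary_class[OF \<gamma>(1)] asymptotic_refl[OF \<gamma>(1)] by auto
  have ev: "eventually (\<lambda>i. base_ray (f i) b \<in> rays \<and> base_ray (f i) b 0 = b) U"
    using f by eventually_elim (simp add: base_ray)
  have "((\<lambda>i. norm_busemann (f i) b p) \<longlongrightarrow> norm_busemann e b p) U" for p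
  proof -
    have "((\<lambda>i. busemann (base_ray (f i) b) p) \<longlongrightarrow> busemann \<gamma> p) U"
      by (rule busemann_continuous[OF cat0 \<gamma>(1,2) ev]) (use \<gamma>(3) in blast)
    moreover have "busemann \<gamma> p = norm_busemann e b p"
      using busemann_eq_norm[OF e, of p b] busemann_start[OF \<gamma>(1)] \<gamma>(2) by simp
    ultimately show ?thesis by (simp add: norm_busemann_def)
  qed
  moreover have "e \<in> cone_topology b closure_of S"
    unfolding in_closure_of
  proof (intro conjI allI impI)
    show "e \<in> topspace (cone_topology b)" by (rule topspace_cone_topology[OF e(1)])
    fix T assume T: "e \<in> T \<and> openin (cone_topology b) T"
    \<comment> \<open>Induction over the generation of open sets: the property that a set containing
      e contains almost all \<open>f i\<close> passes to finite intersections and to unions, so cone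
      neighbourhoods remain to be checked.\<close>
    have "generate_topology_on {cone_nbhd \<gamma> r \<epsilon> | \<gamma> r \<epsilon>. \<gamma> \<in> rays \<and> \<gamma> 0 = b \<and> 0 < r \<and> 0 < \<epsilon>} T"
      using T by (simp add: cone_topology_def openin_topology_generated_by_iff)
    then have "e \<in> T \<longrightarrow> eventually (\<lambda>i. f i \<in> T) U"
    proof (induction rule: generate_topology_on.induct)
      case (Int a b)
      then show ?case by (auto elim: eventually_elim2)
    next
      case (UN K)
      show ?case
      proof
        assume "e \<in> \<Union>K"
        then obtain k where "k \<in> K" "e \<in> k" by blast
        then have "eventually (\<lambda>i. f i \<in> k) U" using UN by blast
        then show "eventually (\<lambda>i. f i \<in> \<Union>K) U" by eventually_elim (use \<open>k \<in> K\<close> in blast)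
      qed
    next
      case (Basis s)
      then obtain \<delta> r \<epsilon> where s: "s = cone_nbhd \<delta> r \<epsilon>" "\<delta> 0 = b" "0 < r" "0 < \<epsilon>" by blast
      show ?case
      proof
        assume "e \<in> s"
        then obtain \<gamma>'' where g: "\<gamma>'' \<in> e" "\<gamma>'' 0 = b" "dist (\<gamma>'' r) (\<delta> r) < \<epsilon>" using s by (auto simp: cone_nbhd_def)
        have "\<gamma>'' r = \<gamma> r"
          by (rule asymptotic_unique[OF cat0 boundary_asymptotic[OF e(1) g(1) e(2)]]) (use g \<gamma> s in auto)
        then have "dist (\<gamma> r) (\<delta> r) < \<epsilon>" using g by simp
        moreover have "((\<lambda>i. dist (base_ray (f i) b r) (\<delta> r)) \<longlongrightarrow> dist (\<gamma> r) (\<delta> r)) U"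
          using \<gamma>(3) s by (intro tendsto_dist tendsto_const) auto
        ultimately have "eventually (\<lambda>i. dist (base_ray (f i) b r) (\<delta> r) < \<epsilon>) U"
          by (rule order_tendstoD(2)[rotated])
        then show "eventually (\<lambda>i. f i \<in> s) U" using f
        proof eventually_elim
          case (elim i)
          show ?case unfolding s(1) cone_nbhd_def using elim base_ray[OF elim(2), of b] s(2) by auto
        qed
      qed
    qed auto
    then have "eventually (\<lambda>i. f i \<in> T) U" using T by blast
    with S have "eventually (\<lambda>i. f i \<in> S \<and> f i \<in> T) U" by eventually_elim simp
    then obtain i where "f i \<in> S \<and> f i \<in> T" using eventually_happens'[OF ultrafilter_not_bot[OF U]] by blast
    then show "\<exists>y. y \<in> S \<and> y \<in> T" by blast
  qed
  ultimately show thesis using e(1) that by blast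
qed

text \<open>The ultrafilter refines the preimages of the neighbourhoods of e. It lives on the index
  set rather than on the boundary, because limit heights are taken over group elements.\<close>

lemma closure_ultralimit:
  fixes b :: 'm
  assumes f: "\<And>i. i \<in> A \<Longrightarrow> f i \<in> boundary" and cl: "e \<in> cone_topology b closure_of (f ` A)"
    and e: "e \<in> boundary"
  obtains U where "ultrafilter U" "eventually (\<lambda>i. i \<in> A) U"
    "\<forall>p. ((\<lambda>i. norm_busemann (f i) b p) \<longlongrightarrow> norm_busemann e b p) U"
proof -
  define I where "I = {T. openin (cone_topology b) T \<and> e \<in> T}"
  have top: "topspace (cone_topology b) \<in> I" using topspace_cone_topology[OF e] by (simp add: I_def)
  have fip: "\<exists>a. \<forall>T\<in>C. a \<in> {i \<in> A. f i \<in> T}" if C: "finite C" "C \<subseteq> I" for C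
  proof -
    \<comment> \<open>The whole space is added because an intersection of an empty family need not
      be open.\<close>
    let ?C = "insert (topspace (cone_topology b)) C"
    have "openin (cone_topology b) (\<Inter>?C)"
      by (rule openin_Inter) (use C top in \<open>auto simp: I_def\<close>)
    moreover have "e \<in> \<Inter>?C" using C(2) top by (auto simp: I_def)
    ultimately obtain y where "y \<in> f ` A" "y \<in> \<Inter>?C" using cl unfolding in_closure_of by blast
    then show ?thesis by auto
  qed
  obtain U where U: "ultrafilter U" "\<forall>T\<in>I. eventually (\<lambda>a. a \<in> {i \<in> A. f i \<in> T}) U"
    by (rule ultrafilter_exists[OF fip])
  have UA: "eventually (\<lambda>i. i \<in> A) U"
    using U(2)[rule_format, OF top] by (rule eventually_mono) simp
  let ?\<gamma> = "base_ray e b"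
  have conv: "((\<lambda>i. base_ray (f i) b t) \<longlongrightarrow> ?\<gamma> t) U" if t: "0 \<le> t" for t
  proof (rule tendstoI)
    fix \<epsilon> :: real assume \<epsilon>: "0 < \<epsilon>"
    show "eventually (\<lambda>i. dist (base_ray (f i) b t) (?\<gamma> t) < \<epsilon>) U"
    proof (cases "t = 0")
      case True
      show ?thesis using UA
      proof eventually_elim
        case (elim i)
        then show ?case using base_ray(2)[OF f[OF elim], of b] base_ray(2)[OF e, of b] True \<epsilon> by simp
      qed
    next
      case False
      have "cone_nbhd ?\<gamma> t \<epsilon> \<in> I"
        unfolding I_def mem_Collect_eq
      proof
        show "openin (cone_topology b) (cone_nbhd ?\<gamma> t \<epsilon>)"
          unfolding cone_topology_def openin_topology_generated_by_iff
          by (rule generate_topology_on.Basis) (use base_ray[OF e, of b] t False \<epsilon> in force)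
        show "e \<in> cone_nbhd ?\<gamma> t \<epsilon>" using base_ray[OF e, of b] e \<epsilon> by (auto simp: cone_nbhd_def)
      qed
      then have "eventually (\<lambda>a. a \<in> {i \<in> A. f i \<in> cone_nbhd ?\<gamma> t \<epsilon>}) U" using U(2) by blast
      then show ?thesis
      proof eventually_elim
        case (elim i)
        then have iA: "f i \<in> boundary" using f by simp
        obtain \<gamma>' where g: "\<gamma>' \<in> f i" "\<gamma>' 0 = b" "dist (\<gamma>' t) (?\<gamma> t) < \<epsilon>"
          using elim base_ray(2)[OF e, of b] by (auto simp: cone_nbhd_def)
        have "base_ray (f i) b t = \<gamma>' t"
          by (rule asymptotic_unique[OF cat0 boundary_asymptotic[OF iA base_ray(1)[OF iA] g(1)]])
            (use g base_ray(2)[OF iA, of b] t in auto)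
        then show ?case using g by simp
      qed
    qed
  qed
  have ev: "eventually (\<lambda>i. base_ray (f i) b \<in> rays \<and> base_ray (f i) b 0 = b) U"
    using UA by eventually_elim (simp add: base_ray f)
  have "((\<lambda>i. norm_busemann (f i) b p) \<longlongrightarrow> norm_busemann e b p) U" for p
    unfolding norm_busemann_def by (rule busemann_continuous[OF cat0 base_ray(3)[OF e] base_ray(2)[OF e] ev conv])
  then show thesis using U(1) UA that by blast
qed

end

lemma closure_boundary:
  assumes "e \<in> cone_topology b closure_of S" shows "e \<in> boundary"
proof -
  have "e \<in> topspace (cone_topology b)" using assms by (simp add: in_closure_of)
  then show ?thesis by (auto simp: cone_topology_def cone_nbhd_def)
qed

section \<open>Resolutions\<close>

lemma additive_maps_diff:
  assumes f: "f \<in> additive_maps (free_module G X) (free_module G Y)" and ab: "a \<in> fchains G X" "b \<in> fchains G X"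
  shows "f (a - b) = f a - f b"
proof -
  have "f ((a - b) + b) = f (a - b) + f b"
    using f ab chains_diff[OF ab] unfolding additive_maps_def carrier_free_module add_free_module by blast
  then show ?thesis by simp
qed

lemma additive_maps_frag_extend:
  assumes f: "f \<in> additive_maps (free_module G X) (free_module G Y)" and c: "c \<in> fchains G X"
  shows "f c = frag_extend (\<lambda>y. f (frag_of y)) c"
  using c
proof (induction rule: chains_induct)
  case zero
  show ?case using additive_maps_diff[OF f chains_zero chains_zero] by simp
next
  case (diff a b)
  then show ?case using additive_maps_diff[OF f] by (simp add: frag_extend_diff)
qed simp

locale resolution = group G for G :: "('g, 'b) monoid_scheme" (structure) +
  fixes A :: "('g \<Rightarrow>\<^sub>0 int, 'a, 'c) module_scheme" and X :: "nat \<Rightarrow> 'x set" and d \<epsilon>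
  assumes A: "left_module (group_ring G) A" and res: "based_free_resolution G A X d \<epsilon>"
begin

definition D where "D y = d (frag_of y)"

lemma
  shows disj: "disjoint_family X"
    and d_lin: "d \<in> linear_maps (group_ring G) (free_module G (X (Suc k))) (free_module G (X k))"
    and \<epsilon>_lin: "\<epsilon> \<in> linear_maps (group_ring G) (free_module G (X 0)) A"
    and \<epsilon>_surj: "\<epsilon> ` fchains G (X 0) = carrier A"
    and \<epsilon>_ker: "{c \<in> fchains G (X 0). \<epsilon> c = \<zero>\<^bsub>A\<^esub>} = d ` fchains G (X 1)"
    and d_ker: "{c \<in> fchains G (X (Suc k)). d c = 0} = d ` fchains G (X (Suc (Suc k)))"
  using res unfolding based_free_resolution_def Let_def carrier_free_module by auto

lemma d_eq: "c \<in> fchains G (X (Suc k)) \<Longrightarrow> d c = frag_extend D c"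
  using additive_maps_frag_extend[of d G "X (Suc k)" "X k" c] d_lin[of k] by (simp add: linear_maps_def D_def[abs_def])

lemma frag_of_ring: "g \<in> carrier G \<Longrightarrow> frag_of g \<in> carrier (group_ring G)"
  by (simp add: group_ring_def)

lemma D_complex: "free_complex G X D"
proof
  show "equivariant G (X (Suc k)) D" for k
    unfolding equivariant_def
  proof (intro ballI)
    fix g h x assume gh: "g \<in> carrier G" "h \<in> carrier G" "x \<in> X (Suc k)"
    have "d (frag_of g \<odot>\<^bsub>free_module G (X (Suc k))\<^esub> frag_of (h, x)) = frag_of g \<odot>\<^bsub>free_module G (X k)\<^esub> d (frag_of (h, x))"
      using d_lin[of k] frag_of_ring[OF gh(1)] gh unfolding linear_maps_def carrier_free_module by simp
    then show "D (g \<otimes> h, x) = translate G g (D (h, x))" by (simp add: D_def smult_free_module)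
  qed
  show "D (g, x) \<in> fchains G (X k)" if "g \<in> carrier G" "x \<in> X (Suc k)" for g x k
    using d_lin[of k] that unfolding linear_maps_def additive_maps_def carrier_free_module D_def by auto
  then have cl: "frag_extend D c \<in> fchains G (X k)" if "c \<in> fchains G (X (Suc k))" for c k
    using that by (intro frag_extend_chains) auto
  show "frag_extend D (D (g, x)) = 0" if gx: "g \<in> carrier G" "x \<in> X (Suc (Suc k))" for g x k
  proof -
    have "D (g, x) \<in> d ` fchains G (X (Suc (Suc k)))" unfolding D_def using gx by (intro imageI) simp
    then have "D (g, x) \<in> {c \<in> fchains G (X (Suc k)). d c = 0}" unfolding d_ker .
    then have "D (g, x) \<in> fchains G (X (Suc k))" "d (D (g, x)) = 0" by auto
    then show ?thesis using d_eq[of "D (g, x)" k] by simp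
  qed
  show "\<exists>c'\<in>fchains G (X (Suc (Suc k))). frag_extend D c' = c"
    if c: "c \<in> fchains G (X (Suc k))" "frag_extend D c = 0" for c k
  proof -
    have "c \<in> {c \<in> fchains G (X (Suc k)). d c = 0}" using c d_eq[OF c(1)] by simp
    then have "c \<in> d ` fchains G (X (Suc (Suc k)))" unfolding d_ker .
    then obtain c' where "c' \<in> fchains G (X (Suc (Suc k)))" "c = d c'" by auto
    then show ?thesis using d_eq by auto
  qed
qed

lemma A_group: "abelian_group A"
  using A by (simp add: left_module_def)

lemma \<epsilon>_closed: "c \<in> fchains G (X 0) \<Longrightarrow> \<epsilon> c \<in> carrier A"
  using \<epsilon>_surj by blast

lemma \<epsilon>_diff:
  assumes "a \<in> fchains G (X 0)" "b \<in> fchains G (X 0)" shows "\<epsilon> (a - b) \<oplus>\<^bsub>A\<^esub> \<epsilon> b = \<epsilon> a"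
proof -
  have "\<epsilon> ((a - b) + b) = \<epsilon> (a - b) \<oplus>\<^bsub>A\<^esub> \<epsilon> b"
    using \<epsilon>_lin chains_diff[OF assms] assms(2)
    unfolding linear_maps_def additive_maps_def carrier_free_module add_free_module by blast
  then show ?thesis by simp
qed

lemma \<epsilon>_translate:
  assumes "g \<in> carrier G" "c \<in> fchains G (X 0)" shows "\<epsilon> (translate G g c) = frag_of g \<odot>\<^bsub>A\<^esub> \<epsilon> c"
proof -
  have "\<epsilon> (frag_of g \<odot>\<^bsub>free_module G (X 0)\<^esub> c) = frag_of g \<odot>\<^bsub>A\<^esub> \<epsilon> c"
    using \<epsilon>_lin frag_of_ring[OF assms(1)] assms(2) unfolding linear_maps_def carrier_free_module by simp
  then show ?thesis by (simp add: smult_free_module)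
qed

text \<open>Translates equations in the resolved module into boundaries, the language of
  \<open>free_complex\<close>.\<close>

lemma \<epsilon>_eq_iff:
  assumes a: "a \<in> fchains G (X 0)" and b: "b \<in> fchains G (X 0)"
  shows "\<epsilon> a = \<epsilon> b \<longleftrightarrow> (\<exists>c\<in>fchains G (X 1). frag_extend D c = a - b)"
proof -
  interpret A: abelian_group A by (rule A_group)
  have ab: "a - b \<in> fchains G (X 0)" by (rule chains_diff[OF a b])
  have "\<epsilon> a = \<epsilon> b \<longleftrightarrow> \<epsilon> (a - b) \<oplus>\<^bsub>A\<^esub> \<epsilon> b = \<zero>\<^bsub>A\<^esub> \<oplus>\<^bsub>A\<^esub> \<epsilon> b"
    using \<epsilon>_diff[OF a b] \<epsilon>_closed[OF b] by simp
  also have "\<dots> \<longleftrightarrow> \<epsilon> (a - b) = \<zero>\<^bsub>A\<^esub>"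
    by (rule A.add.right_cancel[OF \<epsilon>_closed[OF b] \<epsilon>_closed[OF ab] A.zero_closed])
  also have "\<dots> \<longleftrightarrow> a - b \<in> d ` fchains G (X 1)" using ab \<epsilon>_ker by blast
  also have "\<dots> \<longleftrightarrow> (\<exists>c\<in>fchains G (X 1). frag_extend D c = a - b)"
  proof -
    have "d ` fchains G (X 1) = frag_extend D ` fchains G (X 1)"
      by (rule image_cong[OF refl]) (use d_eq[of _ 0] in simp)
    then show ?thesis by (auto simp: image_iff eq_commute[of "a - b"])
  qed
  finally show ?thesis .
qed

lemma \<epsilon>_D:
  assumes "g \<in> carrier G" "x \<in> X 1" shows "\<epsilon> (D (g, x)) = \<zero>\<^bsub>A\<^esub>"
proof -
  have "D (g, x) \<in> d ` fchains G (X 1)" unfolding D_def using assms by (intro imageI) simp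
  then show ?thesis unfolding \<epsilon>_ker[symmetric] by simp
qed

end

lemma \<epsilon>_frag_extend:
  fixes G (structure)
  assumes X: "resolution G A X d \<epsilon>" and Y: "resolution G A Y d' \<epsilon>'"
    and u: "\<And>g x. g \<in> carrier G \<Longrightarrow> x \<in> X 0 \<Longrightarrow> u (g, x) \<in> fchains G (Y 0) \<and> \<epsilon>' (u (g, x)) = \<epsilon> (frag_of (g, x))"
    and c: "c \<in> fchains G (X 0)"
  shows "\<epsilon>' (frag_extend u c) = \<epsilon> c"
proof -
  interpret X: resolution G A X d \<epsilon> by (rule X)
  interpret Y: resolution G A Y d' \<epsilon>' by (rule Y)
  interpret A: abelian_group A by (rule X.A_group)
  have cl: "frag_extend u c \<in> fchains G (Y 0)" if "c \<in> fchains G (X 0)" for c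
    using u that by (intro frag_extend_chains) auto
  show ?thesis
    using c
  proof (induction rule: chains_induct)
    case zero
    have "\<epsilon>' 0 \<oplus>\<^bsub>A\<^esub> \<epsilon>' 0 = \<epsilon>' 0" "\<epsilon> 0 \<oplus>\<^bsub>A\<^esub> \<epsilon> 0 = \<epsilon> 0"
      using X.\<epsilon>_diff[of 0 0] Y.\<epsilon>_diff[of 0 0] by simp_all
    then have "\<epsilon>' 0 = \<zero>\<^bsub>A\<^esub>" "\<epsilon> 0 = \<zero>\<^bsub>A\<^esub>"
      using A.add.r_cancel_one[of "\<epsilon>' 0" "\<epsilon>' 0"] A.add.r_cancel_one[of "\<epsilon> 0" "\<epsilon> 0"] X.\<epsilon>_closed[of 0] Y.\<epsilon>_closed[of 0]
      by auto
    then show ?case by simp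
  next
    case (of g x)
    then show ?case using u by simp
  next
    case (diff a b)
    have "\<epsilon>' (frag_extend u a - frag_extend u b) \<oplus>\<^bsub>A\<^esub> \<epsilon>' (frag_extend u b) = \<epsilon>' (frag_extend u a)"
      by (rule Y.\<epsilon>_diff[OF cl[OF diff.hyps(1)] cl[OF diff.hyps(2)]])
    then have "\<epsilon>' (frag_extend u a - frag_extend u b) \<oplus>\<^bsub>A\<^esub> \<epsilon> b = \<epsilon> (a - b) \<oplus>\<^bsub>A\<^esub> \<epsilon> b"
      unfolding diff.IH X.\<epsilon>_diff[OF diff.hyps] .
    then have "\<epsilon>' (frag_extend u a - frag_extend u b) = \<epsilon> (a - b)"
      using A.add.right_cancel[OF X.\<epsilon>_closed[OF diff.hyps(2)] Y.\<epsilon>_closed[OF chains_diff[OF cl[OF diff.hyps(1)] cl[OF diff.hyps(2)]]]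
          X.\<epsilon>_closed[OF chains_diff[OF diff.hyps]]] by simp
    then show ?case by (simp add: frag_extend_diff)
  qed
qed

lemma resolution_lift:
  fixes G (structure)
  assumes X: "resolution G A X d \<epsilon>" and Y: "resolution G A Y d' \<epsilon>'"
  obtains u where "fin_map G (X 0) (Y 0) u" "\<forall>c\<in>fchains G (X 0). \<epsilon>' (frag_extend u c) = \<epsilon> c"
proof -
  interpret X: resolution G A X d \<epsilon> by (rule X)
  interpret Y: resolution G A Y d' \<epsilon>' by (rule Y)
  define v where "v x = (SOME c. c \<in> fchains G (Y 0) \<and> \<epsilon>' c = \<epsilon> (frag_of (\<one>, x)))" for x
  have v: "v x \<in> fchains G (Y 0) \<and> \<epsilon>' (v x) = \<epsilon> (frag_of (\<one>, x))" if "x \<in> X 0" for x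
  proof -
    have "frag_of (\<one>, x) \<in> fchains G (X 0)" using that by simp
    then have "\<epsilon> (frag_of (\<one>, x)) \<in> \<epsilon>' ` fchains G (Y 0)" unfolding Y.\<epsilon>_surj by (rule X.\<epsilon>_closed)
    then have "\<exists>c. c \<in> fchains G (Y 0) \<and> \<epsilon>' c = \<epsilon> (frag_of (\<one>, x))" by auto
    then show ?thesis unfolding v_def by (rule someI_ex)
  qed
  define u where "u = (\<lambda>(g, x). translate G g (v x))"
  have u: "u (g, x) \<in> fchains G (Y 0) \<and> \<epsilon>' (u (g, x)) = \<epsilon> (frag_of (g, x))" if gx: "g \<in> carrier G" "x \<in> X 0" for g x
  proof -
    have "\<epsilon>' (u (g, x)) = frag_of g \<odot>\<^bsub>A\<^esub> \<epsilon> (frag_of (\<one>, x))"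
      using Y.\<epsilon>_translate[OF gx(1)] v[OF gx(2)] by (simp add: u_def)
    also have "\<dots> = \<epsilon> (frag_of (g, x))" using X.\<epsilon>_translate[OF gx(1), of "frag_of (\<one>, x)"] gx by simp
    finally show ?thesis using v[OF gx(2)] gx by (simp add: u_def X.translate_closed)
  qed
  have "equivariant G (X 0) u"
    unfolding equivariant_def
  proof (intro ballI)
    fix g h x assume "g \<in> carrier G" "h \<in> carrier G" "x \<in> X 0"
    then show "u (g \<otimes> h, x) = translate G g (u (h, x))"
      using X.translate_translate[of g h "v x" "Y 0"] v[of x] by (simp add: u_def)
  qed
  then have "fin_map G (X 0) (Y 0) u" by (rule X.equivariant_fin_map) (use u in blast)
  then show thesis using that[of u] \<epsilon>_frag_extend[OF X Y u] by blast
qed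

text \<open>Independence of Tor of the resolution. Maps in degree 0 that respect the augmentations
  satisfy the three conditions of \<open>novikov_exact_transfer\<close>, because chains with equal
  augmentation differ by a boundary.\<close>

lemma resolution_novikov_exact:
  fixes G (structure)
  assumes X: "resolution G A X d \<epsilon>" and Y: "resolution G A Y d' \<epsilon>'" and \<beta>: "height G \<beta>"
    and ex: "novikov_exact G \<beta> X (resolution.D d) k"
  shows "novikov_exact G \<beta> Y (resolution.D d') k"
proof -
  interpret X: resolution G A X d \<epsilon> by (rule X)
  interpret Y: resolution G A Y d' \<epsilon>' by (rule Y)
  interpret XC: free_complex G X X.D by (rule X.D_complex)
  interpret YC: free_complex G Y Y.D by (rule Y.D_complex)
  interpret A: abelian_group A by (rule X.A_group)
  obtain u where u: "fin_map G (X 0) (Y 0) u" "\<forall>c\<in>fchains G (X 0). \<epsilon>' (frag_extend u c) = \<epsilon> c"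
    by (rule resolution_lift[OF X Y])
  obtain w where w: "fin_map G (Y 0) (X 0) w" "\<forall>c\<in>fchains G (Y 0). \<epsilon> (frag_extend w c) = \<epsilon>' c"
    by (rule resolution_lift[OF Y X])
  have zX: "\<epsilon> 0 = \<zero>\<^bsub>A\<^esub>" and zY: "\<epsilon>' 0 = \<zero>\<^bsub>A\<^esub>"
    using A.add.r_cancel_one[of "\<epsilon> 0" "\<epsilon> 0"] X.\<epsilon>_diff[of 0 0] X.\<epsilon>_closed[of 0]
      A.add.r_cancel_one[of "\<epsilon>' 0" "\<epsilon>' 0"] Y.\<epsilon>_diff[of 0 0] Y.\<epsilon>_closed[of 0] by auto
  show ?thesis
  proof (rule novikov_exact_transfer[OF X.D_complex Y.D_complex \<beta> u(1) w(1) _ _ _ ex])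
    fix g x assume gx: "g \<in> carrier G" "x \<in> X 1"
    have Dx: "X.D (g, x) \<in> fchains G (X 0)" using XC.D_closed gx by simp
    then have "\<epsilon>' (frag_extend u (X.D (g, x))) = \<epsilon>' 0" using u(2) X.\<epsilon>_D[OF gx] zY by simp
    then show "\<exists>c\<in>fchains G (Y 1). frag_extend Y.D c = frag_extend u (X.D (g, x))"
      using Y.\<epsilon>_eq_iff[OF X.fin_map_chains[OF u(1) Dx] chains_zero] by simp
  next
    fix g x assume gx: "g \<in> carrier G" "x \<in> Y 1"
    have Dx: "Y.D (g, x) \<in> fchains G (Y 0)" using YC.D_closed gx by simp
    then have "\<epsilon> (frag_extend w (Y.D (g, x))) = \<epsilon> 0" using w(2) Y.\<epsilon>_D[OF gx] zX by simp
    then show "\<exists>c\<in>fchains G (X 1). frag_extend X.D c = frag_extend w (Y.D (g, x))"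
      using X.\<epsilon>_eq_iff[OF X.fin_map_chains[OF w(1) Dx] chains_zero] by simp
  next
    fix g x assume gx: "g \<in> carrier G" "x \<in> Y 0"
    have wx: "w (g, x) \<in> fchains G (X 0)" by (rule X.fin_map_closed[OF w(1) gx])
    have "\<epsilon>' (frag_extend u (w (g, x))) = \<epsilon> (w (g, x))" using u(2) wx by blast
    also have "\<dots> = \<epsilon>' (frag_of (g, x))" using w(2)[rule_format, of "frag_of (g, x)"] gx by simp
    finally show "\<exists>c\<in>fchains G (Y 1). frag_extend Y.D c = frag_extend u (w (g, x)) - frag_of (g, x)"
      using Y.\<epsilon>_eq_iff[OF X.fin_map_chains[OF u(1) wx], of "frag_of (g, x)"] gx by simp
  qed
qed

text \<open>The finitely many generators involve only finitely many basis elements, and each basis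
  element must occur among these, since multiplication by ring elements creates no new
  columns.\<close>

lemma finite_basis:
  assumes G: "group G" and fg: "finitely_generated (group_ring G) (free_module G X)"
  shows "finite X"
proof -
  interpret group G by (rule G)
  interpret M: left_module "group_ring G" "free_module G X" by (rule left_module_free_module[OF G])
  obtain S where S: "finite S" "S \<subseteq> fchains G X"
    "\<forall>x\<in>fchains G X. \<exists>r\<in>S \<rightarrow> carrier (group_ring G). x = (\<Oplus>\<^bsub>free_module G X\<^esub>s\<in>S. r s \<odot>\<^bsub>free_module G X\<^esub> s)"
    using fg unfolding finitely_generated_def carrier_free_module by auto
  define Y where "Y = snd ` (\<Union>s\<in>S. Poly_Mapping.keys s)"
  have Y: "finite Y" unfolding Y_def using S(1) by simp
  have SY: "s \<in> fchains G Y" if "s \<in> S" for s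
    using S(2) that unfolding Y_def fchains_def by force
  have "X \<subseteq> Y"
  proof
    fix x assume x: "x \<in> X"
    then obtain r where r: "r \<in> S \<rightarrow> carrier (group_ring G)"
      "frag_of (\<one>\<^bsub>G\<^esub>, x) = (\<Oplus>\<^bsub>free_module G X\<^esub>s\<in>S. r s \<odot>\<^bsub>free_module G X\<^esub> s)"
      using S(3)[rule_format, of "frag_of (\<one>\<^bsub>G\<^esub>, x)"] by auto
    have sm: "r s \<odot>\<^bsub>free_module G X\<^esub> s \<in> fchains G X" "r s \<odot>\<^bsub>free_module G X\<^esub> s \<in> fchains G Y" if "s \<in> S" for s
    proof -
      have rs: "r s \<in> carrier (group_ring G)" using r(1) that by auto
      show "r s \<odot>\<^bsub>free_module G X\<^esub> s \<in> fchains G X"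
        using M.lsmult_closed[OF rs, of s] S(2) that by (auto simp: carrier_free_module)
      show "r s \<odot>\<^bsub>free_module G X\<^esub> s \<in> fchains G Y"
        using left_module.lsmult_closed[OF left_module_free_module[OF G, of Y] rs, of s] SY[OF that]
        by (simp add: carrier_free_module smult_free_module)
    qed
    have "(\<Oplus>\<^bsub>free_module G X\<^esub>s\<in>T. r s \<odot>\<^bsub>free_module G X\<^esub> s) \<in> fchains G Y" if "finite T" "T \<subseteq> S" for T
      using that
    proof (induction T rule: finite_induct)
      case empty
      then show ?case by (simp add: M.M.finsum_empty zero_free_module)
    next
      case (insert s T)
      have "(\<Oplus>\<^bsub>free_module G X\<^esub>s\<in>insert s T. r s \<odot>\<^bsub>free_module G X\<^esub> s) =
          r s \<odot>\<^bsub>free_module G X\<^esub> s + (\<Oplus>\<^bsub>free_module G X\<^esub>s\<in>T. r s \<odot>\<^bsub>free_module G X\<^esub> s)"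
        using insert sm(1) by (subst M.M.finsum_insert) (auto simp: carrier_free_module add_free_module)
      then show ?case using insert sm(2) by (simp add: chains_add)
    qed
    from this[OF S(1) subset_refl] have "frag_of (\<one>\<^bsub>G\<^esub>, x) \<in> fchains G Y" using r(2) by simp
    then show "x \<in> Y" by simp
  qed
  then show ?thesis using Y finite_subset by blast
qed


section \<open>Heights from Busemann functions\<close>

lemma novikov_exact_cong:
  fixes X :: "nat \<Rightarrow> 'x set"
  assumes "\<And>g. g \<in> carrier G \<Longrightarrow> \<beta> g = \<beta>' g"
  shows "novikov_exact G \<beta> X D k \<longleftrightarrow> novikov_exact G \<beta>' X D k"
proof -
  have *: "novikov_chains G \<beta> (Y :: 'x set) \<subseteq> novikov_chains G \<beta>' Y" if eq: "\<And>g. g \<in> carrier G \<Longrightarrow> \<beta> g = \<beta>' g" for \<beta> \<beta>' and Y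
  proof
    fix \<sigma> assume \<sigma>: "\<sigma> \<in> novikov_chains G \<beta> Y"
    obtain Y0 where Y0: "Y0 \<subseteq> Y" "finite Y0" "{y. \<sigma> y \<noteq> 0} \<subseteq> carrier G \<times> Y0" by (rule novikov_chainsE[OF \<sigma>])
    have "{y. \<sigma> y \<noteq> 0 \<and> \<beta>' (fst y) < t} = {y. \<sigma> y \<noteq> 0 \<and> \<beta> (fst y) < t}" for t
      using Y0(3) eq by auto
    then show "\<sigma> \<in> novikov_chains G \<beta>' Y"
      using novikov_chains_finite[OF \<sigma>] by (intro novikov_chainsI[OF Y0]) simp
  qed
  have "novikov_chains G \<beta> Y = novikov_chains G \<beta>' Y" for Y :: "'x set"
  proof (rule antisym)
    show "novikov_chains G \<beta> Y \<subseteq> novikov_chains G \<beta>' Y" by (rule *) (rule assms)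
    show "novikov_chains G \<beta>' Y \<subseteq> novikov_chains G \<beta> Y" by (rule *) (rule assms[symmetric])
  qed
  then show ?thesis by (simp add: novikov_exact_def)
qed

section \<open>Heights of boundary points and the closure of an orbit\<close>

locale cat0_action = group G for G :: "('g, 'b) monoid_scheme" (structure) +
  fixes \<phi> :: "'g \<Rightarrow> 'm::metric_space \<Rightarrow> 'm" and b :: 'm
  assumes cat0: "CAT0 TYPE('m)" and proper: "proper_space TYPE('m)" and act: "isometric_action G \<phi>"
begin

definition orbit_height :: "(real \<Rightarrow> 'm) set \<Rightarrow> 'g \<Rightarrow> real" where
  "orbit_height e g = norm_busemann e b (\<phi> g b)"

lemma action: "group_action G UNIV \<phi>"
  and iso: "g \<in> carrier G \<Longrightarrow> dist (\<phi> g x) (\<phi> g y) = dist x y"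
  using act by (simp_all add: isometric_action_def)

lemma act_mult: "g \<in> carrier G \<Longrightarrow> h \<in> carrier G \<Longrightarrow> \<phi> (g \<otimes> h) x = \<phi> g (\<phi> h x)"
  using group_action.composition_rule[OF action, of x g h] by simp

lemma act_inv: "g \<in> carrier G \<Longrightarrow> \<phi> g (\<phi> (inv g) x) = x" "g \<in> carrier G \<Longrightarrow> \<phi> (inv g) (\<phi> g x) = x"
  using act_mult[of g "inv g" x] act_mult[of "inv g" g x] group_action.id_eq_one[OF action] by (simp_all add: fun_eq_iff)

lemma busemann_act: "g \<in> carrier G \<Longrightarrow> busemann (\<phi> g \<circ> \<gamma>) (\<phi> g p) = busemann \<gamma> p"
  by (simp add: busemann_def iso)

lemma act_asymptotic:
  "g \<in> carrier G \<Longrightarrow> (\<gamma>, \<gamma>') \<in> asymptotic \<Longrightarrow> (\<phi> g \<circ> \<gamma>, \<phi> g \<circ> \<gamma>') \<in> asymptotic"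
  by (simp add: asymptotic_def rays_def geodesic_on_def iso)

lemma boundary_act:
  assumes g: "g \<in> carrier G" and e: "e \<in> boundary"
  shows "boundary_action \<phi> g e \<in> boundary"
proof -
  obtain \<gamma> where \<gamma>: "\<gamma> \<in> rays" "e = asymptotic `` {\<gamma>}" by (rule boundaryE[OF e])
  have "\<phi> g \<circ> \<gamma> \<in> rays" using asymptotic_rays[OF act_asymptotic[OF g asymptotic_refl[OF \<gamma>(1)]]] by blast
  moreover have "boundary_action \<phi> g e = asymptotic `` {\<phi> g \<circ> \<gamma>}"
  proof
    show "boundary_action \<phi> g e \<subseteq> asymptotic `` {\<phi> g \<circ> \<gamma>}"
      using act_asymptotic[OF g] by (auto simp: boundary_action_def \<gamma>(2))
    show "asymptotic `` {\<phi> g \<circ> \<gamma>} \<subseteq> boundary_action \<phi> g e"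
    proof
      fix \<delta> assume "\<delta> \<in> asymptotic `` {\<phi> g \<circ> \<gamma>}"
      then have "(\<phi> (inv g) \<circ> (\<phi> g \<circ> \<gamma>), \<phi> (inv g) \<circ> \<delta>) \<in> asymptotic" using g by (intro act_asymptotic) auto
      moreover have "\<phi> (inv g) \<circ> (\<phi> g \<circ> \<gamma>) = \<gamma>" using act_inv(2)[OF g] by (simp add: fun_eq_iff)
      ultimately have "\<phi> (inv g) \<circ> \<delta> \<in> e" by (simp add: \<gamma>(2))
      moreover have "\<phi> g \<circ> (\<phi> (inv g) \<circ> \<delta>) = \<delta>" using act_inv(1)[OF g] by (simp add: fun_eq_iff)
      ultimately show "\<delta> \<in> boundary_action \<phi> g e" 
        unfolding boundary_action_def by (intro image_eqI[of _ _ "\<phi> (inv g) \<circ> \<delta>"]) simp_all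
    qed
  qed
  ultimately show ?thesis by (simp add: boundary_class)
qed

text \<open>Moving the ray and the argument by the same isometry leaves the Busemann function
  unchanged. The subtracted term restores the normalisation at b, whose preimage is the translate of
  b by \<open>inv g\<close>.\<close>

lemma norm_busemann_act:
  assumes g: "g \<in> carrier G" and e: "e \<in> boundary"
  shows "norm_busemann (boundary_action \<phi> g e) b (\<phi> g p) = norm_busemann e b p - norm_busemann e b (\<phi> (inv g) b)"
proof -
  let ?\<gamma> = "base_ray e b"
  have "\<phi> g \<circ> ?\<gamma> \<in> boundary_action \<phi> g e"
    unfolding boundary_action_def by (rule imageI) (rule base_ray(1)[OF cat0 proper e])
  from busemann_eq_norm[OF cat0 proper boundary_act[OF g e] this, of "\<phi> g p" b]
  have "busemann ?\<gamma> p = busemann (\<phi> g \<circ> ?\<gamma>) b + norm_busemann (boundary_action \<phi> g e) b (\<phi> g p)"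
    by (simp add: busemann_act[OF g])
  moreover have "busemann (\<phi> g \<circ> ?\<gamma>) b = busemann ?\<gamma> (\<phi> (inv g) b)"
    using busemann_act[OF g, of ?\<gamma> "\<phi> (inv g) b"] by (simp add: act_inv(1)[OF g])
  ultimately show ?thesis by (simp add: norm_busemann_def)
qed

lemma orbit_height_act:
  assumes a: "a \<in> carrier G" and h: "h \<in> carrier G" and e: "e \<in> boundary"
  shows "orbit_height (boundary_action \<phi> (inv a) e) h = orbit_height e (a \<otimes> h) - orbit_height e a"
proof -
  have "\<phi> (inv a) (\<phi> (a \<otimes> h) b) = \<phi> h b" using act_mult[OF a h] act_inv(2)[OF a] by simp
  then show ?thesis
    using norm_busemann_act[OF inv_closed[OF a] e, of "\<phi> (a \<otimes> h) b"] a by (simp add: orbit_height_def)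
qed

lemma height_orbit_height:
  assumes e: "e \<in> boundary" shows "height G (orbit_height e)"
  unfolding height_def
proof
  fix h assume h: "h \<in> carrier G"
  have "orbit_height e (g \<otimes> h) \<ge> orbit_height e g - dist (\<phi> h b) b" if g: "g \<in> carrier G" for g
    using norm_busemann_Lipschitz[OF cat0 proper e, of b "\<phi> g (\<phi> h b)" "\<phi> g b"]
    by (simp add: orbit_height_def act_mult[OF g h] iso[OF g])
  then show "\<exists>L. \<forall>g\<in>carrier G. orbit_height e (g \<otimes> h) \<ge> orbit_height e g - L" by blast
qed

lemma orbit_inv: "orbit G (boundary_action \<phi>) e = (\<lambda>a. boundary_action \<phi> (inv a) e) ` carrier G"
proof -
  have "boundary_action \<phi> g e = boundary_action \<phi> (inv (inv g)) e" if "g \<in> carrier G" for g using that by simp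
  then show ?thesis unfolding orbit_def by (auto intro!: image_eqI[of _ _ "inv _"])
qed

text \<open>Limit heights and heights of points of the closure are the same functions on G: an
  ultrafilter of translates has a limit point with the limit height, and a point of the closure is
  reached by an ultrafilter. The orbit is run through by inverses in order to match
  \<open>orbit_height_act\<close>.\<close>

lemma limit_heights_iff_closure:
  assumes e: "e \<in> boundary"
  shows "(\<forall>U \<beta>'. limit_height G (orbit_height e) U \<beta>' \<longrightarrow> (\<forall>k\<le>n. novikov_exact G \<beta>' X D k)) \<longleftrightarrow>
    (\<forall>e'\<in>cone_topology b closure_of orbit G (boundary_action \<phi>) e. \<forall>k\<le>n. novikov_exact G (orbit_height e') X D k)"
    (is "?l \<longleftrightarrow> ?r")
proof
  assume l: ?l
  show ?r
  proof (intro ballI)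
    fix e' assume e': "e' \<in> cone_topology b closure_of orbit G (boundary_action \<phi>) e"
    have e'b: "e' \<in> boundary" by (rule closure_boundary[OF e'])
    have fb: "boundary_action \<phi> (inv a) e \<in> boundary" if "a \<in> carrier G" for a
      using boundary_act[OF inv_closed[OF that] e] .
    obtain U where U: "ultrafilter U" "eventually (\<lambda>i. i \<in> carrier G) U"
      "\<forall>p. ((\<lambda>a. norm_busemann (boundary_action \<phi> (inv a) e) b p) \<longlongrightarrow> norm_busemann e' b p) U"
      by (rule closure_ultralimit[OF cat0 proper fb e'[unfolded orbit_inv] e'b])
    have "((\<lambda>a. orbit_height e (a \<otimes> h) - orbit_height e a) \<longlongrightarrow> orbit_height e' h) U" if h: "h \<in> carrier G" for h
    proof (rule Lim_transform_eventually)
      show "((\<lambda>a. orbit_height (boundary_action \<phi> (inv a) e) h) \<longlongrightarrow> orbit_height e' h) U"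
        unfolding orbit_height_def using U(3) by blast
      show "eventually (\<lambda>a. orbit_height (boundary_action \<phi> (inv a) e) h = orbit_height e (a \<otimes> h) - orbit_height e a) U"
        using U(2) by eventually_elim (rule orbit_height_act[OF _ h e])
    qed
    then have "limit_height G (orbit_height e) U (orbit_height e')" using U by (simp add: limit_height_def)
    then show "\<forall>k\<le>n. novikov_exact G (orbit_height e') X D k" using l by blast
  qed
next
  assume r: ?r
  show ?l
  proof (intro allI impI)
    fix U \<beta>' k assume lim: "limit_height G (orbit_height e) U \<beta>'" and k: "k \<le> n"
    let ?f = "\<lambda>a. boundary_action \<phi> (inv a) e"
    have f: "eventually (\<lambda>a. ?f a \<in> boundary) U"
      using limit_carrier[OF lim] by eventually_elim (rule boundary_act[OF inv_closed e])
    have S: "eventually (\<lambda>a. ?f a \<in> orbit G (boundary_action \<phi>) e) U"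
      unfolding orbit_inv using limit_carrier[OF lim] by eventually_elim (rule imageI)
    obtain e' where e': "e' \<in> boundary" "\<forall>p. ((\<lambda>a. norm_busemann (?f a) b p) \<longlongrightarrow> norm_busemann e' b p) U"
      "e' \<in> cone_topology b closure_of orbit G (boundary_action \<phi>) e"
      by (rule boundary_ultralimit[OF cat0 proper limit_ultrafilter[OF lim] f S])
    have "orbit_height e' h = \<beta>' h" if h: "h \<in> carrier G" for h
    proof (rule tendsto_unique[OF limit_not_bot[OF lim]])
      show "((\<lambda>a. orbit_height e (a \<otimes> h) - orbit_height e a) \<longlongrightarrow> \<beta>' h) U" by (rule limit_tendsto[OF lim h])
      show "((\<lambda>a. orbit_height e (a \<otimes> h) - orbit_height e a) \<longlongrightarrow> orbit_height e' h) U"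
      proof (rule Lim_transform_eventually)
        show "((\<lambda>a. orbit_height (?f a) h) \<longlongrightarrow> orbit_height e' h) U"
          unfolding orbit_height_def using e'(2) by blast
        show "eventually (\<lambda>a. orbit_height (?f a) h = orbit_height e (a \<otimes> h) - orbit_height e a) U"
          using limit_carrier[OF lim] by eventually_elim (rule orbit_height_act[OF _ h e])
      qed
    qed
    then show "novikov_exact G \<beta>' X D k" using r e'(3) k novikov_exact_cong[of G "orbit_height e'" \<beta>'] by blast
  qed
qed

text \<open>All Busemann functions at e are \<open>norm_busemann e b\<close> plus a constant, so the
  horoballs at e cut out exactly the superlevel sets of \<open>orbit_height e\<close> on G.\<close>

lemma novikov_module_eq:
  assumes e: "e \<in> boundary" shows "novikov_module G \<phi> b e = height_module G (orbit_height e)"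
proof -
  have "(\<forall>HB\<in>horoballs e. finite {g \<in> carrier G. \<sigma> g \<noteq> 0 \<and> \<phi> g b \<notin> HB}) \<longleftrightarrow>
      (\<forall>t. finite {g. \<sigma> g \<noteq> 0 \<and> orbit_height e g < t})"
    if \<sigma>: "\<forall>g. g \<notin> carrier G \<longrightarrow> \<sigma> g = 0" for \<sigma> :: "'g \<Rightarrow> int"
  proof -
    have eq: "{g \<in> carrier G. \<sigma> g \<noteq> 0 \<and> \<phi> g b \<notin> {x. busemann \<gamma> x \<ge> t}} =
        {g. \<sigma> g \<noteq> 0 \<and> orbit_height e g < t - busemann \<gamma> b}" if "\<gamma> \<in> e" for \<gamma> t
    proof -
      have "busemann \<gamma> (\<phi> g b) = busemann \<gamma> b + orbit_height e g" for g
        unfolding orbit_height_def by (rule busemann_eq_norm[OF cat0 proper e that])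
      then show ?thesis using \<sigma> by auto
    qed
    show ?thesis
    proof
      assume H: "\<forall>HB\<in>horoballs e. finite {g \<in> carrier G. \<sigma> g \<noteq> 0 \<and> \<phi> g b \<notin> HB}"
      let ?\<gamma> = "base_ray e b"
      have \<gamma>: "?\<gamma> \<in> e" by (rule base_ray(1)[OF cat0 proper e])
      show "\<forall>t. finite {g. \<sigma> g \<noteq> 0 \<and> orbit_height e g < t}"
      proof
        fix t
        have "{x. busemann ?\<gamma> x \<ge> t + busemann ?\<gamma> b} \<in> horoballs e" using \<gamma> unfolding horoballs_def by blast
        from H[rule_format, OF this] show "finite {g. \<sigma> g \<noteq> 0 \<and> orbit_height e g < t}" unfolding eq[OF \<gamma>] by simp
      qed
    next
      assume "\<forall>t. finite {g. \<sigma> g \<noteq> 0 \<and> orbit_height e g < t}"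
      then show "\<forall>HB\<in>horoballs e. finite {g \<in> carrier G. \<sigma> g \<noteq> 0 \<and> \<phi> g b \<notin> HB}"
        unfolding horoballs_def using eq by auto
    qed
  qed
  then show ?thesis unfolding novikov_module_def height_module_def by (auto cong: conj_cong)
qed

end

section \<open>The dynamical invariant\<close>

locale controlled = resolution G A X d \<epsilon> + cat0_action G \<phi> b
  for G :: "('g, 'b) monoid_scheme" (structure) and A :: "('g \<Rightarrow>\<^sub>0 int, 'a, 'c) module_scheme"
    and X :: "nat \<Rightarrow> 'x set" and d \<epsilon> and \<phi> :: "'g \<Rightarrow> 'm::metric_space \<Rightarrow> 'm" and b +
  fixes n :: nat and h :: "(('g \<times> 'x) \<Rightarrow>\<^sub>0 int) \<Rightarrow> 'm set"
  assumes fg: "finitely_generated (group_ring G) (skeleton G X n)" and control: "control_map G \<phi> X h"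
begin

sublocale C: free_complex G X D by (rule D_complex)

definition skel where "skel = (\<Union>k\<le>n. X k)"

lemma skeleton_eq: "skeleton G X n = free_module G skel"
  by (simp add: skeleton_def skel_def)

lemma finite_skel: "finite skel"
  using finite_basis[OF group_axioms] fg by (simp add: skeleton_eq)

lemma X_skel: "k \<le> n \<Longrightarrow> X k \<subseteq> skel"
  by (auto simp: skel_def)

lemma finite_X: "k \<le> n \<Longrightarrow> finite (X k)"
  by (rule finite_subset[OF X_skel finite_skel])

lemma skel_all: "c \<in> fchains G skel \<Longrightarrow> c \<in> fchains G (\<Union>k. X k)"
  by (rule chains_mono) (auto simp: skel_def)

lemma
  shows h_finite: "c \<in> fchains G (\<Union>k. X k) \<Longrightarrow> finite (h c)"
    and h_translate: "g \<in> carrier G \<Longrightarrow> c \<in> fchains G (\<Union>k. X k) \<Longrightarrow> h (translate G g c) = \<phi> g ` h c"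
    and h_union: "c \<in> fchains G (\<Union>k. X k) \<Longrightarrow> h c = (\<Union>y\<in>Poly_Mapping.keys c. h (frag_of y))"
    and h_nonempty: "x \<in> X k \<Longrightarrow> h (frag_of (\<one>, x)) \<noteq> {}"
proof -
  note cm = control[unfolded control_map_def Let_def carrier_free_module smult_free_module frag_extend_of]
  show "c \<in> fchains G (\<Union>k. X k) \<Longrightarrow> finite (h c)" by (rule bspec[OF conjunct1[OF cm]])
  show "g \<in> carrier G \<Longrightarrow> c \<in> fchains G (\<Union>k. X k) \<Longrightarrow> h (translate G g c) = \<phi> g ` h c"
    by (rule bspec[OF bspec[OF conjunct1[OF conjunct2[OF cm]]]])
  show "c \<in> fchains G (\<Union>k. X k) \<Longrightarrow> h c = (\<Union>y\<in>Poly_Mapping.keys c. h (frag_of y))"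
    by (rule bspec[OF conjunct1[OF conjunct2[OF conjunct2[OF cm]]]])
  show "x \<in> X k \<Longrightarrow> h (frag_of (\<one>, x)) \<noteq> {}"
    by (rule bspec[OF spec[OF conjunct2[OF conjunct2[OF conjunct2[OF cm]]]]])
qed

lemma h_of:
  assumes "g \<in> carrier G" "x \<in> X k" shows "h (frag_of (g, x)) = \<phi> g ` h (frag_of (\<one>, x))"
  using h_translate[OF assms(1), of "frag_of (\<one>, x)"] assms by auto

text \<open>By equivariance the distances of the points of \<open>h (frag_of (g, x))\<close> from
  the translate of b by g do not depend on g, and only finitely many x remain.\<close>

lemma control_bound:
  obtains M where "0 \<le> M" "\<forall>g\<in>carrier G. \<forall>x\<in>skel. \<forall>q\<in>h (frag_of (g, x)). dist q (\<phi> g b) \<le> M"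
proof -
  define W where "W = insert 0 (\<Union>x\<in>skel. (\<lambda>q. dist q b) ` h (frag_of (\<one>, x)))"
  have fin: "finite (h (frag_of (\<one>, x)))" if "x \<in> skel" for x
    by (rule h_finite, rule skel_all) (use that in simp)
  have W: "finite W" unfolding W_def
    by (intro finite.insertI finite_UN_I[OF finite_skel] finite_imageI fin)
  have "dist q (\<phi> g b) \<le> Max W" if g: "g \<in> carrier G" and x: "x \<in> skel" and q: "q \<in> h (frag_of (g, x))" for g x q
  proof -
    obtain k where k: "x \<in> X k" using x by (auto simp: skel_def)
    obtain q' where q': "q' \<in> h (frag_of (\<one>, x))" "q = \<phi> g q'" using q unfolding h_of[OF g k] by blast
    have "dist q' b \<in> W" using q'(1) x unfolding W_def by blast
    then show ?thesis unfolding q'(2) iso[OF g] by (rule Max_ge[OF W])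
  qed
  moreover have "0 \<le> Max W" by (rule Max_ge[OF W]) (simp add: W_def)
  ultimately show thesis using that by blast
qed

context
  fixes e and \<gamma> :: "real \<Rightarrow> 'm" and M
  assumes e: "e \<in> boundary" and \<gamma>: "\<gamma> \<in> e" and M: "0 \<le> M"
    and bound: "\<forall>g\<in>carrier G. \<forall>x\<in>skel. \<forall>q\<in>h (frag_of (g, x)). dist q (\<phi> g b) \<le> M"
begin

lemma busemann_control:
  assumes "g \<in> carrier G" "x \<in> skel" "q \<in> h (frag_of (g, x))"
  shows "\<bar>busemann \<gamma> q - (busemann \<gamma> b + orbit_height e g)\<bar> \<le> M"
proof -
  have "busemann \<gamma> (\<phi> g b) = busemann \<gamma> b + orbit_height e g"
    unfolding orbit_height_def by (rule busemann_eq_norm[OF cat0 proper e \<gamma>])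
  moreover have "\<bar>busemann \<gamma> q - busemann \<gamma> (\<phi> g b)\<bar> \<le> dist q (\<phi> g b)"
    by (rule busemann_Lipschitz[OF boundary_rays[OF e \<gamma>]])
  moreover have "dist q (\<phi> g b) \<le> M" using bound assms by blast
  ultimately show ?thesis by simp
qed

text \<open>Together with \<open>valuation_lower\<close> this determines the valuation of a nonzero
  chain up to M: it is the least height in its support, plus the constant
  \<open>busemann \<gamma> b\<close>.\<close>

lemma valuation_upper:
  assumes c: "c \<in> fchains G skel" and y: "y \<in> Poly_Mapping.keys c"
  shows "Min (busemann \<gamma> ` h c) \<le> busemann \<gamma> b + orbit_height e (fst y) + M"
proof -
  obtain g x where gx: "y = (g, x)" by (cases y)
  have g: "g \<in> carrier G" "x \<in> skel" using c y gx by (auto simp: fchains_def)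
  then obtain k where k: "x \<in> X k" by (auto simp: skel_def)
  obtain q where q: "q \<in> h (frag_of (g, x))" using h_nonempty[OF k] unfolding h_of[OF g(1) k] by blast
  then have "q \<in> h c" using h_union[OF skel_all[OF c]] y gx by blast
  then have "Min (busemann \<gamma> ` h c) \<le> busemann \<gamma> q"
    by (intro Min_le finite_imageI h_finite skel_all c) simp
  then show ?thesis using busemann_control[OF g q] gx by simp
qed

lemma valuation_lower:
  assumes c: "c \<in> fchains G skel" "c \<noteq> 0" and t: "above (orbit_height e) t (Poly_Mapping.lookup c)"
  shows "busemann \<gamma> b + t - M \<le> Min (busemann \<gamma> ` h c)"
proof (rule Min.boundedI)
  show "finite (busemann \<gamma> ` h c)" by (intro finite_imageI h_finite skel_all c)
  obtain y where y: "y \<in> Poly_Mapping.keys c" using c(2) by (metis keys_eq_empty all_not_in_conv)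
  have yG: "fst y \<in> carrier G" "snd y \<in> skel" using c y by (auto simp: fchains_def)
  then obtain k where k: "snd y \<in> X k" by (auto simp: skel_def)
  have "h (frag_of y) \<noteq> {}" using h_of[OF yG(1) k] h_nonempty[OF k] by simp
  then show "busemann \<gamma> ` h c \<noteq> {}" using h_union[OF skel_all[OF c(1)]] y by auto
  fix r assume "r \<in> busemann \<gamma> ` h c"
  then obtain q z where q: "r = busemann \<gamma> q" "q \<in> h (frag_of z)" "z \<in> Poly_Mapping.keys c"
    using h_union[OF skel_all[OF c(1)]] by blast
  obtain g x where gx: "z = (g, x)" by (cases z)
  have g: "g \<in> carrier G" "x \<in> skel" using c q(3) gx by (auto simp: fchains_def)
  have "t \<le> orbit_height e g" using t q(3) gx unfolding above_def in_keys_iff by fastforce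
  then show "busemann \<gamma> b + t - M \<le> r" using busemann_control[OF g q(2)[unfolded gx]] q(1) by simp
qed

end

text \<open>For \<Phi> one can take the set of all conjugates of the map, evaluated at c. It is
  finite by \<open>fin_map_conj_finite\<close>, contains the value itself for the conjugate by the
  unit, and is equivariant by the substitution of \<open>a \<otimes> g\<close> for a.\<close>

lemma finitary_frag_extend:
  assumes r: "fin_map G skel skel r"
  shows "finitary G (skeleton G X n) (skeleton G X n) (frag_extend r)"
proof -
  define \<Phi> where "\<Phi> c = (\<lambda>a. translate G (inv a) (frag_extend r (translate G a c))) ` carrier G" for c
  have cl: "frag_extend r c \<in> fchains G skel" if "c \<in> fchains G skel" for c by (rule fin_map_chains[OF r that])
  have "frag_extend r \<in> additive_maps (free_module G skel) (free_module G skel)"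
    using cl by (auto simp: additive_maps_def carrier_free_module add_free_module frag_extend_add)
  moreover have "finite (\<Phi> c) \<and> \<Phi> c \<subseteq> fchains G skel \<and> frag_extend r c \<in> \<Phi> c \<and>
      (\<forall>g\<in>carrier G. \<Phi> (translate G g c) = translate G g ` \<Phi> c)" if c: "c \<in> fchains G skel" for c
  proof (intro conjI ballI)
    show "finite (\<Phi> c)" unfolding \<Phi>_def by (rule fin_map_conj_finite[OF r c])
    show "\<Phi> c \<subseteq> fchains G skel" unfolding \<Phi>_def using c by (auto intro!: translate_closed cl)
    have "translate G (inv \<one>) (frag_extend r (translate G \<one> c)) = frag_extend r c"
      using translate_one[OF c] translate_one[OF cl[OF c]] by simp
    then show "frag_extend r c \<in> \<Phi> c" unfolding \<Phi>_def by (intro image_eqI[of _ _ "\<one>"]) simp_all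
    fix g assume g: "g \<in> carrier G"
    have *: "translate G (inv a) (frag_extend r (translate G a (translate G g c))) =
        translate G g (translate G (inv (a \<otimes> g)) (frag_extend r (translate G (a \<otimes> g) c)))" if a: "a \<in> carrier G" for a
    proof -
      have "translate G (a \<otimes> g) c \<in> fchains G skel" using a g c by (intro translate_closed) auto
      from cl[OF this] show ?thesis
        using a g translate_translate[OF a g c] translate_translate[of g "inv (a \<otimes> g)" "frag_extend r (translate G (a \<otimes> g) c)" skel]
        by (simp add: inv_mult_group m_assoc[symmetric])
    qed
    show "\<Phi> (translate G g c) = translate G g ` \<Phi> c"
    proof
      show "\<Phi> (translate G g c) \<subseteq> translate G g ` \<Phi> c"
        unfolding \<Phi>_def using * g by (auto intro!: imageI)
      show "translate G g ` \<Phi> c \<subseteq> \<Phi> (translate G g c)"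
      proof
        fix z assume "z \<in> translate G g ` \<Phi> c"
        then obtain a where a: "a \<in> carrier G" "z = translate G g (translate G (inv a) (frag_extend r (translate G a c)))"
          by (auto simp: \<Phi>_def)
        have "(a \<otimes> inv g) \<otimes> g = a" using a g by (simp add: m_assoc)
        then have "z = translate G (inv (a \<otimes> inv g)) (frag_extend r (translate G (a \<otimes> inv g) (translate G g c)))"
          using *[of "a \<otimes> inv g"] a g by simp
        then show "z \<in> \<Phi> (translate G g c)" unfolding \<Phi>_def using a g by (intro image_eqI[of _ _ "a \<otimes> inv g"]) simp_all
      qed
    qed
  qed
  ultimately show ?thesis
    unfolding finitary_def skeleton_eq carrier_free_module smult_free_module frag_extend_of by blast
qed

lemma dynamical_SigmaI:
  assumes e: "e \<in> boundary" and p: "pushes G (orbit_height e) X D (Suc n) p 1"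
  shows "e \<in> dynamical_Sigma n G X d \<epsilon> h"
proof -
  obtain M where M: "0 \<le> M" "\<forall>g\<in>carrier G. \<forall>x\<in>skel. \<forall>q\<in>h (frag_of (g, x)). dist q (\<phi> g b) \<le> M"
    by (rule control_bound)
  \<comment> \<open>The change between valuations and heights costs M at the source and M at the
    target; a shift of 1 is to remain.\<close>
  define m where "m = nat \<lceil>2 * M + 1\<rceil>"
  have m: "real m \<ge> 2 * M + 1" unfolding m_def by linarith
  define r where "r = iter_map p m"
  have r: "pushes G (orbit_height e) X D (Suc n) r (real m * 1)" unfolding r_def by (rule C.pushes_iter_map[OF p])
  have rk: "fin_map G (X k) (X k) r" "raises G (orbit_height e) (X k) r (real m * 1)" if "k \<le> n" for k
    using C.pushes_fin_map[OF r] C.pushes_raises[OF r] that by auto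
  have rs: "fin_map G skel skel r"
    unfolding fin_map_def
  proof (intro conjI ballI)
    fix g x assume g: "g \<in> carrier G" and x: "x \<in> skel"
    then obtain k where k: "k \<le> n" "x \<in> X k" by (auto simp: skel_def)
    show "r (g, x) \<in> fchains G skel" by (rule chains_mono[OF X_skel[OF k(1)] fin_map_closed[OF rk(1)[OF k(1)] g k(2)]])
  next
    fix x assume x: "x \<in> skel"
    then obtain k where k: "k \<le> n" "x \<in> X k" by (auto simp: skel_def)
    show "finite ((\<lambda>g. translate G (inv g) (r (g, x))) ` carrier G)" using rk(1)[OF k(1)] k(2) by (simp add: fin_map_def)
  qed
  have rr: "raises G (orbit_height e) skel r (real m)" using rk(2) by (auto simp: raises_def skel_def)
  let ?f = "frag_extend r"
  have fin: "finitary G (skeleton G X n) (skeleton G X n) ?f" by (rule finitary_frag_extend[OF rs])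
  have "chain_map_inducing_id G X d \<epsilon> n ?f"
    unfolding chain_map_inducing_id_def carrier_free_module
  proof (intro conjI allI impI ballI)
    show "?f \<in> additive_maps (skeleton G X n) (skeleton G X n)" using fin by (simp add: finitary_def)
    show "?f ` fchains G (X k) \<subseteq> fchains G (X k)" if "k \<le> n" for k using fin_map_chains[OF rk(1)[OF that]] by blast
    show "?f (d c) = d (?f c)" if k: "k < n" and c: "c \<in> fchains G (X (Suc k))" for k c
    proof -
      have "?f c \<in> fchains G (X (Suc k))" by (rule fin_map_chains[OF rk(1) c]) (use k in simp)
      then show ?thesis using C.pushes_D_chains[OF r _ c] k by (simp add: d_eq[OF c] d_eq)
    qed
    show "\<epsilon> (?f c) = \<epsilon> c" if c: "c \<in> fchains G (X 0)" for c
      unfolding \<epsilon>_eq_iff[OF fin_map_chains[OF rk(1)[OF le0] c] c] by (rule C.pushes_id_chains[OF r _ c]) simp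
  qed
  moreover have "1 \<le> gsh G X n h e ?f"
    unfolding gsh_def
  proof (rule Inf_greatest)
    fix z assume "z \<in> {valuation h \<gamma> (?f c) - valuation h \<gamma> c | \<gamma> c. \<gamma> \<in> e \<and> c \<in> carrier (skeleton G X n) \<and> c \<noteq> 0}"
    then obtain \<gamma> c where z: "z = valuation h \<gamma> (?f c) - valuation h \<gamma> c" "\<gamma> \<in> e" "c \<in> fchains G skel" "c \<noteq> 0"
      by (auto simp: skeleton_eq carrier_free_module)
    show "1 \<le> z"
    proof (cases "?f c = 0")
      case True
      then show ?thesis using z by (simp add: valuation_def)
    next
      case False
      let ?v = "Min (busemann \<gamma> ` h c)"
      have "above (orbit_height e) (?v - busemann \<gamma> b - M) (Poly_Mapping.lookup c)"
        unfolding above_def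
      proof (intro allI impI)
        fix y assume "Poly_Mapping.lookup c y \<noteq> 0"
        then have "y \<in> Poly_Mapping.keys c" by (simp add: in_keys_iff)
        from valuation_upper[OF e z(2) M z(3) this] show "?v - busemann \<gamma> b - M \<le> orbit_height e (fst y)" by simp
      qed
      then have "above (orbit_height e) (?v - busemann \<gamma> b - M + real m) (Poly_Mapping.lookup (?f c))"
        by (rule above_lookup_extend[OF rr z(3)])
      from valuation_lower[OF e z(2) M fin_map_chains[OF rs z(3)] False this]
      have "?v + 1 \<le> Min (busemann \<gamma> ` h (?f c))" using m by simp
      then show ?thesis using z False by (simp add: valuation_def one_ereal_def)
    qed
  qed
  then have "0 < gsh G X n h e ?f" by (rule less_le_trans[rotated]) simp
  ultimately show ?thesis using e fin unfolding dynamical_Sigma_def by blast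
qed

text \<open>A single application may lower heights, since its gain \<delta> in the valuation can be
  less than the error \<open>2 * M\<close>. The gains are therefore added up in the valuation, where
  each application is lossless, and the error is paid once at the end.\<close>

lemma dynamical_SigmaD:
  assumes "e \<in> dynamical_Sigma n G X d \<epsilon> h"
  shows "e \<in> boundary" "\<exists>p. pushes G (orbit_height e) X D (Suc n) p 1"
proof -
  obtain f where e: "e \<in> boundary" and f: "finitary G (skeleton G X n) (skeleton G X n) f"
    and ch: "chain_map_inducing_id G X d \<epsilon> n f" and gsh: "0 < gsh G X n h e f"
    using assms unfolding dynamical_Sigma_def by blast
  show "e \<in> boundary" by (rule e)
  obtain M where M: "0 \<le> M" "\<forall>g\<in>carrier G. \<forall>x\<in>skel. \<forall>q\<in>h (frag_of (g, x)). dist q (\<phi> g b) \<le> M"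
    by (rule control_bound)
  define \<gamma> where "\<gamma> = base_ray e b"
  have \<gamma>: "\<gamma> \<in> e" unfolding \<gamma>_def by (rule base_ray(1)[OF cat0 proper e])
  define v where "v c = Min (busemann \<gamma> ` h c)" for c
  have val: "valuation h \<gamma> c = ereal (v c)" if "c \<noteq> 0" for c using that by (simp add: valuation_def v_def)
  \<comment> \<open>A finite bound is needed, as the guaranteed shift may be \<infinity>.\<close>
  obtain \<delta> where \<delta>: "0 < \<delta>" "ereal \<delta> < gsh G X n h e f"
    using ereal_dense2[OF gsh] by auto
  have up: "v c + \<delta> \<le> v (f c)" if c: "c \<in> fchains G skel" "c \<noteq> 0" "f c \<noteq> 0" for c
  proof -
    have "gsh G X n h e f \<le> valuation h \<gamma> (f c) - valuation h \<gamma> c"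
      unfolding gsh_def
      by (rule Inf_lower) (use \<gamma> c in \<open>auto simp: skeleton_eq carrier_free_module\<close>)
    with \<delta>(2) have "ereal \<delta> < valuation h \<gamma> (f c) - valuation h \<gamma> c" by (rule less_le_trans)
    then show ?thesis using c by (simp add: val)
  qed
  have add: "f \<in> additive_maps (free_module G skel) (free_module G skel)"
    using f by (simp add: finitary_def skeleton_eq)
  have fcl: "f c \<in> fchains G skel" if "c \<in> fchains G skel" for c
    using add that by (auto simp: additive_maps_def carrier_free_module)
  define p where "p y = f (frag_of y)" for y
  have fp: "f c = frag_extend p c" if "c \<in> fchains G skel" for c
    using additive_maps_frag_extend[OF add that] by (simp add: p_def[abs_def])
  obtain \<Phi> where \<Phi>: "\<forall>c\<in>fchains G skel. finite (\<Phi> c) \<and> \<Phi> c \<subseteq> fchains G skel \<and> f c \<in> \<Phi> c \<and>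
      (\<forall>g\<in>carrier G. \<Phi> (translate G g c) = translate G g ` \<Phi> c)"
    using f unfolding finitary_def skeleton_eq carrier_free_module smult_free_module frag_extend_of by blast
  have pX: "p (g, x) \<in> fchains G (X k)" if "k \<le> n" "g \<in> carrier G" "x \<in> X k" for k g x
  proof -
    have "f ` fchains G (X k) \<subseteq> fchains G (X k)"
      using ch that(1) unfolding chain_map_inducing_id_def carrier_free_module by simp
    moreover have "frag_of (g, x) \<in> fchains G (X k)" using that by simp
    ultimately show ?thesis unfolding p_def by (metis image_subset_iff)
  qed
  have fm: "fin_map G (X k) (X k) p" if k: "k \<le> n" for k
    unfolding fin_map_def
  proof (intro conjI ballI)
    fix x assume x: "x \<in> X k"
    have bx: "frag_of (\<one>, x) \<in> fchains G skel" using x X_skel[OF k] by auto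
    have "(\<lambda>g. translate G (inv g) (p (g, x))) ` carrier G \<subseteq> \<Phi> (frag_of (\<one>, x))"
    proof (rule image_subsetI)
      fix g assume g: "g \<in> carrier G"
      have gx: "translate G g (frag_of (\<one>, x)) = frag_of (g, x)" using g by simp
      have "frag_of (g, x) \<in> fchains G skel" using g x X_skel[OF k] by auto
      then have "p (g, x) \<in> \<Phi> (translate G g (frag_of (\<one>, x)))" unfolding gx p_def using \<Phi> by blast
      moreover have "\<Phi> (translate G g (frag_of (\<one>, x))) = translate G g ` \<Phi> (frag_of (\<one>, x))" using \<Phi> bx g by blast
      ultimately have "p (g, x) \<in> translate G g ` \<Phi> (frag_of (\<one>, x))" by simp
      then obtain c where c: "c \<in> \<Phi> (frag_of (\<one>, x))" "p (g, x) = translate G g c" by blast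
      then have "c \<in> fchains G skel" using \<Phi> bx by blast
      from translate_inv(1)[OF g this] show "translate G (inv g) (p (g, x)) \<in> \<Phi> (frag_of (\<one>, x))" using c by simp
    qed
    then show "finite ((\<lambda>g. translate G (inv g) (p (g, x))) ` carrier G)"
      by (rule finite_subset) (use \<Phi> bx in blast)
  qed (rule pX[OF k])
  have iter: "iter_map p m y \<in> fchains G skel \<and> (iter_map p m y \<noteq> 0 \<longrightarrow> v (frag_of y) + real m * \<delta> \<le> v (iter_map p m y))"
    if y: "frag_of y \<in> fchains G skel" for m y
  proof (induction m)
    case 0
    then show ?case using y by simp
  next
    case (Suc m)
    let ?c = "iter_map p m y"
    have c: "?c \<in> fchains G skel" using Suc by blast
    have eq: "iter_map p (Suc m) y = f ?c" using fp[OF c] by simp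
    show ?case
    proof (intro conjI impI)
      show "iter_map p (Suc m) y \<in> fchains G skel" unfolding eq by (rule fcl[OF c])
      assume nz: "iter_map p (Suc m) y \<noteq> 0"
      then have c0: "?c \<noteq> 0" by auto
      then have "v ?c + \<delta> \<le> v (f ?c)" using up[OF c] nz eq by simp
      moreover have "v (frag_of y) + real m * \<delta> \<le> v ?c" using Suc c0 by blast
      ultimately show "v (frag_of y) + real (Suc m) * \<delta> \<le> v (iter_map p (Suc m) y)"
        unfolding eq by (simp add: algebra_simps)
    qed
  qed
  have raise: "raises G (orbit_height e) skel (iter_map p m) (real m * \<delta> - 2 * M)" for m
    unfolding raises_def above_def
  proof (intro ballI allI impI)
    fix g x z assume g: "g \<in> carrier G" "x \<in> skel" and z: "Poly_Mapping.lookup (iter_map p m (g, x)) z \<noteq> 0"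
    have y: "frag_of (g, x) \<in> fchains G skel" using g by simp
    have zk: "z \<in> Poly_Mapping.keys (iter_map p m (g, x))" using z by (simp add: in_keys_iff)
    then have nz: "iter_map p m (g, x) \<noteq> 0" by auto
    have "v (iter_map p m (g, x)) \<le> busemann \<gamma> b + orbit_height e (fst z) + M"
      unfolding v_def using valuation_upper[OF e \<gamma> M _ zk] iter[OF y] by blast
    moreover have "busemann \<gamma> b + orbit_height e g - M \<le> v (frag_of (g, x))"
      unfolding v_def by (rule valuation_lower[OF e \<gamma> M y _ above_lookup_of]) simp
    moreover have "v (frag_of (g, x)) + real m * \<delta> \<le> v (iter_map p m (g, x))" using iter[OF y] nz by blast
    ultimately show "orbit_height e g + (real m * \<delta> - 2 * M) \<le> orbit_height e (fst z)" by simp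
  qed
  \<comment> \<open>The shift stated here may be negative. From the iterates of p only finitarity
    and the chain map property are taken; their shift comes from \<open>raise\<close>.\<close>
  have pushes1: "pushes G (orbit_height e) X D (Suc n) p (\<delta> - 2 * M)"
    unfolding pushes_def
  proof (intro conjI allI impI ballI)
    fix k assume "k < Suc n"
    then have k: "k \<le> n" by simp
    show "fin_map G (X k) (X k) p" by (rule fm[OF k])
    have "iter_map p 1 = p" by (simp add: fun_eq_iff)
    then show "raises G (orbit_height e) (X k) p (\<delta> - 2 * M)"
      using raises_subset[OF raise[of 1] X_skel[OF k]] by simp
  next
    fix k g x assume k: "Suc k < Suc n" and gx: "g \<in> carrier G" "x \<in> X (Suc k)"
    have 1: "frag_of (g, x) \<in> fchains G (X (Suc k))" using gx by simp
    have "f (d (frag_of (g, x))) = d (f (frag_of (g, x)))"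
      using ch 1 k unfolding chain_map_inducing_id_def carrier_free_module by simp
    moreover have "d (f (frag_of (g, x))) = frag_extend D (p (g, x))"
      unfolding p_def by (rule d_eq) (use pX[of "Suc k" g x] k gx in \<open>simp add: p_def\<close>)
    moreover have "f (d (frag_of (g, x))) = frag_extend p (D (g, x))"
      unfolding D_def[symmetric] by (rule fp, rule chains_mono[OF X_skel C.D_closed[OF gx]]) (use k in simp)
    ultimately show "frag_extend D (p (g, x)) = frag_extend p (D (g, x))" by simp
  next
    fix g x assume gx: "g \<in> carrier G" "x \<in> X 0"
    have 1: "frag_of (g, x) \<in> fchains G (X 0)" using gx by simp
    have "\<epsilon> (p (g, x)) = \<epsilon> (frag_of (g, x))"
      using ch 1 unfolding chain_map_inducing_id_def carrier_free_module p_def by simp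
    then show "\<exists>c\<in>fchains G (X 1). frag_extend D c = p (g, x) - frag_of (g, x)"
      unfolding \<epsilon>_eq_iff[OF pX[OF le0 gx] 1] .
  qed
  define m where "m = nat \<lceil>(2 * M + 1) / \<delta>\<rceil>"
  have "(2 * M + 1) / \<delta> \<le> real m" unfolding m_def by linarith
  then have m: "1 \<le> real m * \<delta> - 2 * M" using \<delta>(1) by (simp add: field_simps)
  have "pushes G (orbit_height e) X D (Suc n) (iter_map p m) 1"
    using C.pushes_iter_map[OF pushes1, of m] raises_mono[OF raises_subset[OF raise[of m] X_skel] m]
    unfolding pushes_def by simp
  then show "\<exists>p. pushes G (orbit_height e) X D (Suc n) p 1" by blast
qed

end

theorem theorem1p4:
  fixes n :: nat
    and G :: "'g monoid"
    and \<phi> :: "'g \<Rightarrow> 'm::metric_space \<Rightarrow> 'm"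
    and b :: 'm
    and A :: "('g \<Rightarrow>\<^sub>0 int, 'a) module"
    and X :: "nat \<Rightarrow> 'x set"
    and d :: "(('g \<times> 'x) \<Rightarrow>\<^sub>0 int) \<Rightarrow> (('g \<times> 'x) \<Rightarrow>\<^sub>0 int)"
    and \<epsilon> :: "(('g \<times> 'x) \<Rightarrow>\<^sub>0 int) \<Rightarrow> 'a"
    and h :: "(('g \<times> 'x) \<Rightarrow>\<^sub>0 int) \<Rightarrow> 'm set"
    and X' :: "nat \<Rightarrow> 'y set"
    and d' :: "(('g \<times> 'y) \<Rightarrow>\<^sub>0 int) \<Rightarrow> (('g \<times> 'y) \<Rightarrow>\<^sub>0 int)"
    and \<epsilon>' :: "(('g \<times> 'y) \<Rightarrow>\<^sub>0 int) \<Rightarrow> 'a"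
  assumes "CAT0 TYPE('m)" and "proper_space TYPE('m)" and "\<not> compact (UNIV :: 'm set)"
    and "group G" and "isometric_action G \<phi>"
    and "left_module (group_ring G) A"
    and "FP_resolution n G A X d \<epsilon>" and "control_map G \<phi> X h"
    and "based_free_resolution G A X' d' \<epsilon>'"
  shows "dynamical_Sigma n G X d \<epsilon> h =
    {e \<in> boundary.
       \<forall>e' \<in> cone_topology b closure_of orbit G (boundary_action \<phi>) e. \<forall>k\<le>n.
         trivial_group
           (Tor (group_ring G) (novikov_module G \<phi> b e') (\<lambda>i. free_module G (X' i)) d' k)}"
proof -
  have fp: "based_free_resolution G A X d \<epsilon>" "finitely_generated (group_ring G) (skeleton G X n)"
    using assms(7) by (simp_all add: FP_resolution_def)
  interpret S: controlled G A X d \<epsilon> \<phi> b n h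
    using assms fp by (simp add: controlled_def controlled_axioms_def resolution_def resolution_axioms_def
        cat0_action_def cat0_action_axioms_def)
  have RX: "resolution G A X d \<epsilon>" by (rule S.resolution_axioms)
  have RX': "resolution G A X' d' \<epsilon>'"
    using assms by (simp add: resolution_def resolution_axioms_def)
  interpret R': resolution G A X' d' \<epsilon>' by (rule RX')
  \<comment> \<open>Tor is computed by the second resolution and then carried over to the one whose
    skeleton is finitely generated.\<close>
  have tor: "trivial_group (Tor (group_ring G) (novikov_module G \<phi> b e') (\<lambda>i. free_module G (X' i)) d' k)
      \<longleftrightarrow> novikov_exact G (S.orbit_height e') X S.D k" if e': "e' \<in> boundary" for e' k
  proof -
    have ht: "height G (S.orbit_height e')" by (rule S.height_orbit_height[OF e'])
    interpret T: height_tensor G "S.orbit_height e'"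
      using ht assms(4) by (simp add: height_tensor_def height_tensor_axioms_def)
    have "trivial_group (Tor (group_ring G) (novikov_module G \<phi> b e') (\<lambda>i. free_module G (X' i)) d' k)
        \<longleftrightarrow> novikov_exact G (S.orbit_height e') X' R'.D k"
      unfolding S.novikov_module_eq[OF e'] by (rule T.trivial_Tor_iff[OF R'.D_complex R'.d_eq])
    also have "\<dots> \<longleftrightarrow> novikov_exact G (S.orbit_height e') X S.D k"
      using resolution_novikov_exact[OF RX RX' ht] resolution_novikov_exact[OF RX' RX ht] by blast
    finally show ?thesis .
  qed
  have "e \<in> dynamical_Sigma n G X d \<epsilon> h \<longleftrightarrow>
      (\<forall>e' \<in> cone_topology b closure_of orbit G (boundary_action \<phi>) e. \<forall>k\<le>n.
         trivial_group (Tor (group_ring G) (novikov_module G \<phi> b e') (\<lambda>i. free_module G (X' i)) d' k))"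
    if e: "e \<in> boundary" for e
  proof -
    have "e \<in> dynamical_Sigma n G X d \<epsilon> h \<longleftrightarrow> (\<exists>p. pushes G (S.orbit_height e) X S.D (Suc n) p 1)"
      using S.dynamical_SigmaI[OF e] S.dynamical_SigmaD(2) by blast
    also have "\<dots> \<longleftrightarrow> (\<forall>U \<beta>'. limit_height G (S.orbit_height e) U \<beta>' \<longrightarrow> (\<forall>k\<le>n. novikov_exact G \<beta>' X S.D k))"
      by (rule S.C.pushes_iff_novikov_exact[OF S.height_orbit_height[OF e] S.finite_X S.disj])
    also have "\<dots> \<longleftrightarrow> (\<forall>e'\<in>cone_topology b closure_of orbit G (boundary_action \<phi>) e. \<forall>k\<le>n.
        novikov_exact G (S.orbit_height e') X S.D k)"
      by (rule S.limit_heights_iff_closure[OF e])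
    also have "\<dots> \<longleftrightarrow> (\<forall>e' \<in> cone_topology b closure_of orbit G (boundary_action \<phi>) e. \<forall>k\<le>n.
         trivial_group (Tor (group_ring G) (novikov_module G \<phi> b e') (\<lambda>i. free_module G (X' i)) d' k))"
      using tor[OF closure_boundary] by simp
    finally show ?thesis .
  qed
  then show ?thesis using S.dynamical_SigmaD(1) by blast
qed

end
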